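(* Let $n \geq 2$ and $p_n := \max\{1,\,(n-1)(n-2)\}$. Suppose that $u : \mathbb{R}^n \rightarrow \mathbb{R}$ satisfies: (i) $u$ is homogeneous of degree $\alpha$ for some $\alpha \in (0,1)$; (ii) $u \in W^{2,p}_{loc}(\mathbb{R}^n \setminus \{0\})$ for some $p > p_n$; (iii) either $\det D^2u$ or $-\det D^2u$ is locally strictly positive in $\mathbb{R}^n \setminus \{0\}$. Then $u$ does not change sign, i.e. either $u \geq 0$ on all of $\mathbb{R}^n$ or $u \leq 0$ on all of $\mathbb{R}^n$.
   Context: A function $u$ on $\mathbb{R}^n$ is homogeneous of degree $\alpha$ if $u(tx) = t^\alpha u(x)$ for all $t > 0$ and $x \in \mathbb{R}^n$. $D^2u$ is the (weak) Hessian of $u$, defined almost everywhere; $u$ is identified with its continuous representative. A measurable function $h$ is locally strictly positive in an open set if on every compact subset $C$ of that set there is a constant $c_C > 0$ (which may depend on $C$) such that $h \geq c_C$ almost everywhere on $C$. *)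

theory Defs
  imports "HOL-Analysis.Analysis"
begin

definition homogeneous_of_degree :: "real \<Rightarrow> (real^'n \<Rightarrow> real) \<Rightarrow> bool" where
  "homogeneous_of_degree \<alpha> u \<longleftrightarrow> (\<forall>t>0. \<forall>x. u (t *\<^sub>R x) = t powr \<alpha> * u x)"

definition partial_deriv :: "'n \<Rightarrow> (real^'n \<Rightarrow> real) \<Rightarrow> real^'n \<Rightarrow> real" where
  "partial_deriv i f = (\<lambda>x. frechet_derivative f (at x) (axis i 1))"

text \<open>A list of indices plays the role of a multi-index of order the length of the list.\<close>

primrec partial_derivs :: "'n list \<Rightarrow> (real^'n \<Rightarrow> real) \<Rightarrow> real^'n \<Rightarrow> real" where
  "partial_derivs [] f = f"
| "partial_derivs (i # is) f = partial_deriv i (partial_derivs is f)"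

definition smooth :: "(real^'n \<Rightarrow> real) \<Rightarrow> bool" where
  "smooth f \<longleftrightarrow> (\<forall>is x. partial_derivs is f differentiable (at x))"

text \<open>Functions in \<open>C\<^sub>c\<^sup>\<infinity>(\<Omega>)\<close>, extended by zero to the whole space.\<close>

definition test_function_on :: "(real^'n) set \<Rightarrow> (real^'n \<Rightarrow> real) \<Rightarrow> bool" where
  "test_function_on \<Omega> \<phi> \<longleftrightarrow>
     smooth \<phi> \<and> compact (closure {x. \<phi> x \<noteq> 0}) \<and> closure {x. \<phi> x \<noteq> 0} \<subseteq> \<Omega>"

definition Lp_loc :: "real \<Rightarrow> (real^'n) set \<Rightarrow> (real^'n \<Rightarrow> real) \<Rightarrow> bool" where
  "Lp_loc p \<Omega> f \<longleftrightarrow>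
     f \<in> borel_measurable (lebesgue_on \<Omega>) \<and>
     (\<forall>C. compact C \<and> C \<subseteq> \<Omega> \<longrightarrow> set_integrable lebesgue C (\<lambda>x. \<bar>f x\<bar> powr p))"

definition has_weak_deriv ::
    "(real^'n) set \<Rightarrow> 'n list \<Rightarrow> (real^'n \<Rightarrow> real) \<Rightarrow> (real^'n \<Rightarrow> real) \<Rightarrow> bool" where
  "has_weak_deriv \<Omega> is f g \<longleftrightarrow>
     Lp_loc 1 \<Omega> f \<and> Lp_loc 1 \<Omega> g \<and>
     (\<forall>\<phi>. test_function_on \<Omega> \<phi> \<longrightarrow>
        (LINT x:\<Omega>|lebesgue. f x * partial_derivs is \<phi> x) =
        (-1) ^ length is * (LINT x:\<Omega>|lebesgue. g x * \<phi> x))"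

definition Sobolev_loc :: "nat \<Rightarrow> real \<Rightarrow> (real^'n) set \<Rightarrow> (real^'n \<Rightarrow> real) \<Rightarrow> bool" where
  "Sobolev_loc k p \<Omega> f \<longleftrightarrow>
     (\<forall>is. length is \<le> k \<longrightarrow> (\<exists>g. Lp_loc p \<Omega> g \<and> has_weak_deriv \<Omega> is f g))"

text \<open>The weak Hessian is determined only up to null sets, so it is a relation between \<open>f\<close> and a
  representative \<open>H\<close>.\<close>

definition has_weak_hessian ::
    "(real^'n) set \<Rightarrow> (real^'n \<Rightarrow> real) \<Rightarrow> (real^'n \<Rightarrow> real^'n^'n) \<Rightarrow> bool" where
  "has_weak_hessian \<Omega> f H \<longleftrightarrow> (\<forall>i j. has_weak_deriv \<Omega> [i, j] f (\<lambda>x. H x $ i $ j))"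

definition locally_strictly_positive :: "(real^'n) set \<Rightarrow> (real^'n \<Rightarrow> real) \<Rightarrow> bool" where
  "locally_strictly_positive \<Omega> h \<longleftrightarrow>
     h \<in> borel_measurable (lebesgue_on \<Omega>) \<and>
     (\<forall>C. compact C \<and> C \<subseteq> \<Omega> \<longrightarrow> (\<exists>c>0. AE x in lebesgue. x \<in> C \<longrightarrow> c \<le> h x))"

definition sobolev_threshold :: "nat \<Rightarrow> real" where
  "sobolev_threshold n = max 1 ((real n - 1) * (real n - 2))"

end

theory Submission
  imports Defs
begin

text \<open>
  Put \<open>f = max 0 u powr (1 / \<alpha>)\<close>, a 1-homogeneous function. The maximum of \<open>\<partial>\<^sub>\<xi> f\<close> over
  \<open>{u > 0}\<close> can only be attained on the ray through \<open>\<xi>\<close> or \<open>- \<xi>\<close> (strong maximum principle). Hence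
  \<open>\<partial>\<^sub>\<xi> f \<le> f(\<xi>)\<close>, so that \<open>{u \<le> 0}\<close> lies in the half-space \<open>{\<xi>. \<xi> \<bullet> Du x \<le> 0}\<close> for every \<open>x\<close> with
  \<open>u x > 0\<close>. With the same argument for \<open>- u\<close>, a change of sign forces \<open>{u > 0}\<close> to be an open half-space on which
  \<open>Du\<close> is everywhere normal to the boundary; then \<open>u\<close> is constant on parallel hyperplanes, and homogeneity makes it grow like
  \<open>t powr \<alpha>\<close> away from a boundary point, where it is differentiable.

  The maximum principle uses only the integrability of the Hessian. Replacing one row of \<open>D\<^sup>2u\<close> by
  \<open>Du\<close> and another one by the gradient of a compactly supported truncation of \<open>\<partial>\<^sub>\<xi> f - \<phi>\<close> gives a null Lagrangian;
  Euler's relations express it by \<open>det D\<^sup>2u\<close>, which has a sign, and a term linear in the gradient of \<open>\<phi>\<close>. With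
  \<open>\<phi> = (u - u(z))\<^sup>2\<close> the latter vanishes and the maximum set is seen to meet every small sphere around \<open>z\<close>; with small
  paraboloids one gets an upper bound for the measure of \<open>{\<partial>\<^sub>\<xi> f \<ge> max - \<epsilon>}\<close>. The exponent \<open>p > (n - 1) (n - 2)\<close> makes these two facts
  incompatible.
\<close>

subsection \<open>Smooth bump functions\<close>

text \<open>The obstacle is regularity: \<open>q \<xi>\<close>, the directional derivative in
  question, is only Hoelder continuous and the Hessian only p-integrable, so no pointwise
  second-order argument is available at a maximum. Integrals of determinants with n - 1 rows of
  Hessian size still make sense, because p > n - 1. The power 1 / \<alpha> makes the derivative
  0-homogeneous, which reduces its maximum to the unit sphere and lets smallness on a cube spread
  along rays. The exponent comes from a count. The set where \<open>q \<xi>\<close> is within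
  \<epsilon> of its maximum has measure at most of order \<epsilon>^(p / (n - 2)). Maximum points at
  all small distances provide about 1 / r disjoint tubes of measure r^(n - 1); on average their
  energy is of order r, so many lie in that set with \<epsilon> of order r^(1 - (n - 2) / p).
  Letting r tend to 0 gives n - 2 \<ge> p / (n - 2) - 1, that is p \<le> (n - 1) (n - 2). For n = 2
  the comparison with paraboloids is by itself contradictory. Homogeneity saves one dimension in
  each Sobolev-type estimate, so that u is continuously differentiable off the origin even where p
  is below n.\<close>

definition bump_term :: "real poly \<Rightarrow> nat \<Rightarrow> real \<Rightarrow> real" where
  "bump_term p k t = (if \<bar>t\<bar> < 1
     then poly p t * inverse (1 - t\<^sup>2) ^ k * exp (- inverse (1 - t\<^sup>2)) else 0)"

text \<open>With s = 1 / (1 - t^2) one has s' = 2 t s^2. The polynomial is the coefficient of s^(k +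
  2) once s^k and s^(k + 1) are rewritten with powers of 1 - t^2, so differentiation stays within
  the family \<open>bump_term p k\<close>. This closure is the whole reason for smoothness.\<close>

definition bump_term_deriv :: "real poly \<Rightarrow> nat \<Rightarrow> real poly" where
  "bump_term_deriv p k = pderiv p * [:1, 0, -1:]\<^sup>2 + of_nat (2 * k) * [:0, 1:] * p * [:1, 0, -1:]
     - 2 * [:0, 1:] * p"

text \<open>A single term of the exponential series already bounds s^k by fact k times exp
  s.\<close>

lemma power_mult_exp_neg_le:
  fixes s :: real assumes "s \<ge> 0" shows "s ^ k * exp (- s) \<le> fact k"
proof -
  have "s ^ k / fact k \<le> (\<Sum>i. s ^ i /\<^sub>R fact i)"
    using sum_le_suminf[OF summable_exp_generic[of s], of "{k}"] assms
    by (auto simp: divide_inverse mult.commute)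
  then have "s ^ k \<le> fact k * exp s"
    by (simp add: exp_def field_simps)
  then show ?thesis by (simp add: exp_minus field_simps)
qed

lemma power_cancel_reciprocal:
  fixes s a :: real assumes "s * a = 1"
  shows "s ^ k = a\<^sup>2 * s ^ (k + 2)" "s ^ (k + 1) = a * s ^ (k + 2)"
proof -
  have "a\<^sup>2 * s ^ (k + 2) = (s * a)\<^sup>2 * s ^ k" "a * s ^ (k + 2) = (s * a) * s ^ (k + 1)"
    by (simp_all add: power_mult_distrib power_add power2_eq_square mult_ac)
  then show "s ^ k = a\<^sup>2 * s ^ (k + 2)" "s ^ (k + 1) = a * s ^ (k + 2)"
    using assms by simp_all
qed

text \<open>Two spare powers of 1 - t^2 are traded against the exponential. The resulting
  second-order vanishing at t = 1 and t = -1 yields the zero derivative at these two points.\<close>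

lemma bump_term_bound:
  obtains C where "C \<ge> 0" "\<And>t. \<bar>bump_term p k t\<bar> \<le> C * (1 - t\<^sup>2)\<^sup>2"
proof -
  obtain B where B: "\<And>t. t \<in> {-1..1} \<Longrightarrow> \<bar>poly p t\<bar> \<le> B"
  proof -
    have "compact ((\<lambda>t. \<bar>poly p t\<bar>) ` {-1..1})"
      by (intro compact_continuous_image continuous_intros) auto
    then show ?thesis using that
      by (meson bounded_imp_bdd_above bdd_above.E compact_imp_bounded image_eqI)
  qed
  have "\<bar>bump_term p k t\<bar> \<le> (\<bar>B\<bar> * fact (k + 2)) * (1 - t\<^sup>2)\<^sup>2" for t
  proof (cases "\<bar>t\<bar> < 1")
    case True
    define s where "s = inverse (1 - t\<^sup>2)"
    have pos: "1 - t\<^sup>2 > 0" using True by (simp add: abs_square_less_1)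
    then have s: "s > 0" by (simp add: s_def)
    have "\<bar>bump_term p k t\<bar> = \<bar>poly p t\<bar> * (s ^ k * exp (- s))"
      using True s by (simp add: bump_term_def s_def[symmetric] abs_mult)
    also have "s ^ k * exp (-s) = (s ^ (k+2) * exp (-s)) * (1 - t\<^sup>2)\<^sup>2"
      using power_cancel_reciprocal(1)[of s "1 - t\<^sup>2" k] pos by (simp add: s_def mult_ac)
    also have "\<bar>poly p t\<bar> * \<dots> \<le> \<bar>B\<bar> * (fact (k+2) * (1 - t\<^sup>2)\<^sup>2)"
      using B[of t, simplified] True s power_mult_exp_neg_le[of s "k+2"] abs_less_iff[of t 1]
      by (intro mult_mono mult_right_mono) (auto simp del: power_Suc fact_Suc)
    finally show ?thesis by (simp add: mult.assoc)
  qed (simp add: bump_term_def)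
  then show ?thesis using that[of "\<bar>B\<bar> * fact (k + 2)"] by simp
qed

lemma has_real_derivative_bump_term:
  "(bump_term p k has_real_derivative bump_term (bump_term_deriv p k) (k + 2) t) (at t)"
proof -
  consider "\<bar>t\<bar> < 1" | "\<bar>t\<bar> = 1" | "\<bar>t\<bar> > 1" by linarith
  then show ?thesis
  proof cases
    case 1
    then have ne: "1 - t\<^sup>2 \<noteq> 0" by (metis abs_square_eq_1 less_irrefl right_minus_eq)
    define s where "s = (\<lambda>t::real. inverse (1 - t\<^sup>2))"
    have s1: "s t * (1 - t\<^sup>2) = 1" using ne by (simp add: s_def)
    have ds: "(s has_real_derivative 2 * t * (s t)\<^sup>2) (at t)"
      unfolding s_def using ne
      by (auto intro!: derivative_eq_intros simp: power2_eq_square field_simps)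
    have k2: "s t ^ k = (1 - t\<^sup>2)\<^sup>2 * s t ^ (k+2)" "s t ^ (k+1) = (1 - t\<^sup>2) * s t ^ (k+2)"
      using power_cancel_reciprocal[OF s1] by simp_all
    have "((\<lambda>t. poly p t * s t ^ k * exp (- s t)) has_real_derivative
        (poly (pderiv p) t * s t ^ k + poly p t * (of_nat k * s t ^ (k - 1) * (2 * t * (s t)\<^sup>2))
         - poly p t * s t ^ k * (2 * t * (s t)\<^sup>2)) * exp (- s t)) (at t)"
      by (rule derivative_eq_intros refl poly_DERIV ds)+ (simp add: algebra_simps)
    also have "of_nat k * s t ^ (k - 1) * (2 * t * (s t)\<^sup>2) = of_nat k * 2 * t * s t ^ (k + 1)"
      by (cases k) (simp_all add: power_add power2_eq_square)
    also have "(poly (pderiv p) t * s t ^ k + poly p t * (of_nat k * 2 * t * s t ^ (k + 1))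
         - poly p t * s t ^ k * (2 * t * (s t)\<^sup>2)) * exp (- s t) =
       (poly (pderiv p) t * ((1 - t\<^sup>2)\<^sup>2 * s t ^ (k+2))
         + poly p t * (of_nat k * 2 * t * ((1 - t\<^sup>2) * s t ^ (k+2)))
         - poly p t * 2 * t * s t ^ (k+2)) * exp (- s t)"
      unfolding k2[symmetric] by (simp add: power_add power2_eq_square mult_ac)
    also have "\<dots> = poly (bump_term_deriv p k) t * s t ^ (k + 2) * exp (- s t)"
      by (simp add: bump_term_deriv_def algebra_simps power2_eq_square)
    also have "\<dots> = bump_term (bump_term_deriv p k) (k + 2) t"
      using 1 by (simp add: bump_term_def s_def)
    finally have "((\<lambda>t. poly p t * inverse (1 - t\<^sup>2) ^ k * exp (- inverse (1 - t\<^sup>2))) has_real_derivative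
       bump_term (bump_term_deriv p k) (k + 2) t) (at t)"
      by (simp add: s_def)
    moreover have "eventually (\<lambda>t. t \<in> {-1<..<1}) (nhds t)"
      using 1 by (intro eventually_nhds_in_open) auto
    then have "eventually (\<lambda>t. poly p t * inverse (1 - t\<^sup>2) ^ k * exp (- inverse (1 - t\<^sup>2)) = bump_term p k t) (nhds t)"
      by eventually_elim (auto simp: bump_term_def)
    ultimately show ?thesis
      by (subst (asm) DERIV_cong_ev[OF refl _ refl])
  next
    case 2
    then have t0: "bump_term q j t = 0" for q j by (simp add: bump_term_def)
    obtain C where C: "C \<ge> 0" "\<And>t. \<bar>bump_term p k t\<bar> \<le> C * (1 - t\<^sup>2)\<^sup>2"
      using bump_term_bound[of p k] by blast
    have t2: "t\<^sup>2 = 1" using 2 by (simp add: abs_square_eq_1)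
    \<comment> \<open>One of the two factors 1 - y^2 absorbs the denominator y - t, the other one
      tends to 0.\<close>
    have "((\<lambda>y. bump_term p k y / (y - t)) \<longlongrightarrow> 0) (at t)"
    proof (rule tendsto_0_le[where K=1])
      have "((\<lambda>y. C * (- (t + y)) * (1 - y\<^sup>2)) \<longlongrightarrow> C * (- (t+t)) * (1 - t\<^sup>2)) (at t)"
        by (intro tendsto_intros)
      then show "((\<lambda>y. C * (- (t + y)) * (1 - y\<^sup>2)) \<longlongrightarrow> 0) (at t)" using t2 by simp
      show "\<forall>\<^sub>F y in at t. norm (bump_term p k y / (y - t)) \<le> norm (C * (- (t + y)) * (1 - y\<^sup>2)) * 1"
        unfolding eventually_at_filter
      proof (intro always_eventually allI impI)
        fix y assume y: "y \<noteq> t"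
        have e: "1 - y\<^sup>2 = - (t + y) * (y - t)" using t2 by (simp add: algebra_simps power2_eq_square)
        have e': "\<bar>1 - y\<^sup>2\<bar> = \<bar>t + y\<bar> * \<bar>y - t\<bar>"
          unfolding e by (simp only: abs_mult abs_minus_cancel)
        have "(1 - y\<^sup>2)\<^sup>2 = \<bar>1 - y\<^sup>2\<bar> * (\<bar>t + y\<bar> * \<bar>y - t\<bar>)"
          unfolding e'[symmetric] by (simp add: power2_eq_square)
        then have "\<bar>bump_term p k y\<bar> \<le> \<bar>C\<bar> * \<bar>1 - y\<^sup>2\<bar> * (\<bar>t + y\<bar> * \<bar>y - t\<bar>)"
          using C(2)[of y] C(1) by (simp add: mult.assoc)
        then have "\<bar>bump_term p k y\<bar> / \<bar>y - t\<bar> \<le> \<bar>C\<bar> * \<bar>1 - y\<^sup>2\<bar> * \<bar>t + y\<bar>"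
          using y by (simp add: divide_le_eq mult_ac)
        then show "norm (bump_term p k y / (y - t)) \<le> norm (C * (- (t + y)) * (1 - y\<^sup>2)) * 1"
          by (simp only: real_norm_def abs_mult abs_divide abs_minus_cancel mult_1_right mult_ac)
      qed
    qed
    then show ?thesis
      using t0 by (simp add: has_field_derivative_iff)
  next
    case 3
    have "((\<lambda>t. 0) has_real_derivative 0) (at t)" by simp
    moreover have "eventually (\<lambda>t. t \<in> {..<-1} \<union> {1<..}) (nhds t)"
      using 3 by (intro eventually_nhds_in_open) auto
    then have "eventually (\<lambda>t. 0 = bump_term p k t) (nhds t)"
      by eventually_elim (auto simp: bump_term_def)
    ultimately have "(bump_term p k has_real_derivative 0) (at t)"
      by (subst (asm) DERIV_cong_ev[OF refl _ refl])
    then show ?thesis using 3 by (simp add: bump_term_def)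
  qed
qed

section \<open>Gradients in coordinates and products of one-variable bumps\<close>

lemma partial_deriv_eq:
  fixes f :: "real^'n \<Rightarrow> real"
  assumes "(f has_derivative (\<lambda>h. g \<bullet> h)) (at x)"
  shows "partial_deriv i f x = g $ i"
  unfolding partial_deriv_def frechet_derivative_at[OF assms, symmetric] by (simp add: inner_axis)

lemma has_derivative_partial_derivs:
  fixes f :: "real^'n \<Rightarrow> real"
  assumes "f differentiable (at x)"
  shows "(f has_derivative (\<lambda>h. (\<chi> i. partial_deriv i f x) \<bullet> h)) (at x)"
proof -
  obtain D where D: "(f has_derivative D) (at x)" using assms by (auto simp: differentiable_def)
  then have l: "linear D" by (rule has_derivative_linear)
  have "D h = (\<chi> i. partial_deriv i f x) \<bullet> h" for h
  proof -
    have "D h = D (\<Sum>i\<in>UNIV. (h $ i) *\<^sub>R axis i 1)"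
      by (metis basis_expansion scalar_mult_eq_scaleR)
    also have "\<dots> = (\<Sum>i\<in>UNIV. h $ i * D (axis i 1))"
      by (simp add: linear_sum[OF l] linear_scale[OF l])
    also have "\<dots> = (\<chi> i. partial_deriv i f x) \<bullet> h"
      using frechet_derivative_at[OF D]
      by (simp add: inner_vec_def partial_deriv_def mult.commute)
    finally show ?thesis .
  qed
  then have "D = (\<lambda>h. (\<chi> i. partial_deriv i f x) \<bullet> h)" by (rule ext)
  then show ?thesis using D by simp
qed

text \<open>A partial derivative changes the data \<open>P\<close>, \<open>K\<close> of one factor
  only, so the family is closed under all partial derivatives. The support is a cube, the shape used
  in all later integral estimates.\<close>

definition prod_bump :: "('n::finite \<Rightarrow> real poly) \<Rightarrow> ('n \<Rightarrow> nat) \<Rightarrow> real^'n \<Rightarrow> real" where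
  "prod_bump P K x = (\<Prod>i\<in>UNIV. bump_term (P i) (K i) (x $ i))"

lemma has_derivative_prod_bump:
  "(prod_bump P K has_derivative
     (\<lambda>h. (\<chi> i. prod_bump (P(i := bump_term_deriv (P i) (K i))) (K(i := K i + 2)) x) \<bullet> h)) (at x)"
proof -
  have d: "((\<lambda>x. bump_term (P i) (K i) (x $ i)) has_derivative
      (\<lambda>h. bump_term (bump_term_deriv (P i) (K i)) (K i + 2) (x $ i) * h $ i)) (at x)" for i
    using has_derivative_compose[of "\<lambda>x. x $ i" "\<lambda>h. h $ i" x UNIV,
        OF _ has_real_derivative_bump_term[of "P i" "K i" "x $ i", unfolded has_field_derivative_def]]
    by (simp add: bounded_linear_imp_has_derivative bounded_linear_vec_nth)
  have "(prod_bump P K has_derivative (\<lambda>h. \<Sum>i\<in>UNIV.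
      (bump_term (bump_term_deriv (P i) (K i)) (K i + 2) (x $ i) * h $ i) *
      (\<Prod>j\<in>UNIV - {i}. bump_term (P j) (K j) (x $ j)))) (at x)"
    unfolding prod_bump_def[abs_def] by (rule has_derivative_prod) (rule d)
  moreover have "(\<Sum>i\<in>UNIV.
      (bump_term (bump_term_deriv (P i) (K i)) (K i + 2) (x $ i) * h $ i) *
      (\<Prod>j\<in>UNIV - {i}. bump_term (P j) (K j) (x $ j))) =
    (\<chi> i. prod_bump (P(i := bump_term_deriv (P i) (K i))) (K(i := K i + 2)) x) \<bullet> h" for h
    unfolding inner_vec_def prod_bump_def
  proof (intro sum.cong refl)
    fix i
    let ?f = "\<lambda>j. bump_term ((P(i := bump_term_deriv (P i) (K i))) j) ((K(i := K i + 2)) j) (x $ j)"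
    have "(\<Prod>j\<in>UNIV. ?f j) = ?f i * (\<Prod>j\<in>UNIV - {i}. ?f j)" by (rule prod.remove) auto
    also have "(\<Prod>j\<in>UNIV - {i}. ?f j) = (\<Prod>j\<in>UNIV - {i}. bump_term (P j) (K j) (x $ j))"
      by (rule prod.cong) auto
    finally show "(bump_term (bump_term_deriv (P i) (K i)) (K i + 2) (x $ i) * h $ i) *
      (\<Prod>j\<in>UNIV - {i}. bump_term (P j) (K j) (x $ j)) = (\<chi> i. \<Prod>j\<in>UNIV. bump_term ((P(i := bump_term_deriv (P i) (K i))) j) ((K(i := K i + 2)) j) (x $ j)) $ i \<bullet> h $ i"
      by simp
  qed
  ultimately show ?thesis by simp
qed

lemma partial_deriv_prod_bump:
  "partial_deriv i (prod_bump P K) = prod_bump (P(i := bump_term_deriv (P i) (K i))) (K(i := K i + 2))"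
  by (rule ext, subst partial_deriv_eq[OF has_derivative_prod_bump]) simp

lemma partial_derivs_prod_bump: "\<exists>P' K'. partial_derivs is (prod_bump P K) = prod_bump P' K'"
proof (induction "is")
  case Nil
  then show ?case by auto
next
  case (Cons a "is")
  then show ?case by (metis partial_deriv_prod_bump partial_derivs.simps(2))
qed

text \<open>Distinct partial derivatives update different factors; symmetry of mixed derivatives is
  here the commutation of two function updates.\<close>

lemma partial_deriv_prod_bump_commute:
  "partial_deriv i (partial_deriv j (prod_bump P K)) = partial_deriv j (partial_deriv i (prod_bump P K))"
  by (cases "i = j") (auto simp: partial_deriv_prod_bump fun_upd_twist)

lemma smooth_prod_bump: "smooth (prod_bump P K)"
  unfolding smooth_def
proof (intro allI)
  fix "is" x
  obtain P' K' where "partial_derivs is (prod_bump P K) = prod_bump P' K'"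
    using partial_derivs_prod_bump by blast
  then show "partial_derivs is (prod_bump P K) differentiable at x"
    using has_derivative_prod_bump[of P' K' x] by (auto simp: differentiable_def)
qed

lemma prod_bump_eq_0: "\<bar>x $ i\<bar> \<ge> 1 \<Longrightarrow> prod_bump P K x = 0"
  unfolding prod_bump_def by (rule prod_zero) (auto simp: bump_term_def intro!: exI[of _ i])

lemma smooth_differentiable: "smooth f \<Longrightarrow> partial_derivs is f differentiable (at x)"
  by (simp add: smooth_def)

text \<open>The reflected argument x - y is the form in which kernels enter convolutions; each
  derivative in y contributes a factor - a.\<close>

lemma partial_derivs_affine:
  fixes f :: "real^'n \<Rightarrow> real"
  assumes "smooth f"
  shows "partial_derivs is (\<lambda>y. c * f (a *\<^sub>R (x - y))) =
    (\<lambda>y. c * (- a) ^ length is * partial_derivs is f (a *\<^sub>R (x - y)))"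
    and "partial_derivs is (\<lambda>y. c * f (a *\<^sub>R (x - y))) differentiable (at z)"
proof -
  have D: "((\<lambda>y. d * g (a *\<^sub>R (x - y))) has_derivative
      (\<lambda>h. (\<chi> i. d * (- a) * partial_deriv i g (a *\<^sub>R (x - z))) \<bullet> h)) (at z)"
    if "g differentiable (at (a *\<^sub>R (x - z)))" for d :: real and g :: "real^'n \<Rightarrow> real" and z
  proof -
    have 1: "((\<lambda>y. a *\<^sub>R (x - y)) has_derivative (\<lambda>h. - (a *\<^sub>R h))) (at z)"
      by (auto intro!: derivative_eq_intros)
    have "((\<lambda>y. d * g (a *\<^sub>R (x - y))) has_derivative
      (\<lambda>h. d * ((\<chi> i. partial_deriv i g (a *\<^sub>R (x - z))) \<bullet> (- (a *\<^sub>R h))))) (at z)"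
      by (intro has_derivative_mult_right
          has_derivative_compose[OF 1 has_derivative_partial_derivs[OF that]])
    then show ?thesis
      by (rule has_derivative_eq_rhs) (auto simp: inner_vec_def sum_distrib_left mult_ac sum_negf)
  qed
  show 1: "partial_derivs is (\<lambda>y. c * f (a *\<^sub>R (x - y))) =
    (\<lambda>y. c * (- a) ^ length is * partial_derivs is f (a *\<^sub>R (x - y)))" for "is"
  proof (induction "is")
    case (Cons i "is")
    show ?case
      unfolding partial_derivs.simps Cons
      by (rule ext, subst partial_deriv_eq[OF D[OF smooth_differentiable[OF assms]]]) simp
  qed simp
  show "partial_derivs is (\<lambda>y. c * f (a *\<^sub>R (x - y))) differentiable (at z)"
    unfolding 1 using D[OF smooth_differentiable[OF assms]] by (auto simp: differentiable_def)
qed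

lemma smooth_affine:
  fixes f :: "real^'n \<Rightarrow> real"
  assumes "smooth f" shows "smooth (\<lambda>y. c * f (a *\<^sub>R (x - y)))"
  using partial_derivs_affine(2)[OF assms] by (simp add: smooth_def)

subsection \<open>Mollification\<close>

lemma nn_integral_lborel_affine:
  fixes f :: "real^'n \<Rightarrow> ennreal"
  assumes [measurable]: "f \<in> borel_measurable borel" and "c \<noteq> 0"
  shows "(\<integral>\<^sup>+x. f x \<partial>lborel) = ennreal (\<bar>c\<bar> ^ CARD('n)) * (\<integral>\<^sup>+x. f (t + c *\<^sub>R x) \<partial>lborel)"
  by (subst lborel_affine[OF assms(2), of t])
     (simp add: nn_integral_density nn_integral_distr nn_integral_cmult ennreal_power[symmetric])

lemma integrable_lborel_affine_iff:
  fixes f :: "real^'n \<Rightarrow> real"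
  assumes "c \<noteq> 0"
  shows "integrable lborel (\<lambda>x. f (t + c *\<^sub>R x)) \<longleftrightarrow> integrable lborel f"
proof -
  have *: "integrable lborel (\<lambda>x. f (t + c *\<^sub>R x))"
    if i: "integrable lborel f" "c \<noteq> 0" for f :: "real^'n \<Rightarrow> real" and c t
  proof -
    have [measurable]: "f \<in> borel_measurable borel" using i by (auto dest: borel_measurable_integrable)
    have "\<infinity> \<noteq> (\<integral>\<^sup>+x. ennreal (norm (f x)) \<partial>lborel)"
      using i unfolding integrable_iff_bounded by auto
    also have "(\<integral>\<^sup>+x. ennreal (norm (f x)) \<partial>lborel) =
      ennreal (\<bar>c\<bar> ^ CARD('n)) * (\<integral>\<^sup>+x. ennreal (norm (f (t + c *\<^sub>R x))) \<partial>lborel)"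
      using i by (intro nn_integral_lborel_affine) auto
    finally show ?thesis using i
      by (auto simp: integrable_iff_bounded ennreal_mult_eq_top_iff top.not_eq_extremum[symmetric])
  qed
  show ?thesis
    using *[of f c t] *[of "\<lambda>x. f (t + c *\<^sub>R x)" "1/c" "- (1/c) *\<^sub>R t"] assms
    by (auto simp: algebra_simps)
qed

lemma integral_lborel_affine:
  fixes f :: "real^'n \<Rightarrow> real"
  assumes [measurable]: "f \<in> borel_measurable borel" and "c \<noteq> 0"
  shows "(\<integral>x. f x \<partial>lborel) = \<bar>c\<bar> ^ CARD('n) * (\<integral>x. f (t + c *\<^sub>R x) \<partial>lborel)"
  by (subst lborel_affine[OF assms(2), of t])
     (simp add: integral_density integral_distr)

definition cube :: "real^'n \<Rightarrow> real \<Rightarrow> (real^'n) set" where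
  "cube x r = {y. \<forall>i. \<bar>y $ i - x $ i\<bar> \<le> r}"

lemma cube_eq_cbox: "cube x r = cbox (x - vec r) (x + vec r)"
  by (auto simp: cube_def mem_box_cart abs_le_iff algebra_simps)

lemma compact_cube [simp]: "compact (cube x r)"
  and convex_cube [simp]: "convex (cube x r)"
  and cube_borel [measurable, simp]: "cube x r \<in> sets borel"
  by (auto simp: cube_eq_cbox convex_box)

lemma measure_cube: "r \<ge> 0 \<Longrightarrow> measure lborel (cube (x :: real^'n) r) = (2 * r) ^ CARD('n)"
  unfolding cube_eq_cbox by (simp add: content_cbox_cart interval_ne_empty_cart power_mult_distrib mult.commute)

lemma emeasure_cube: "r \<ge> 0 \<Longrightarrow> emeasure lborel (cube (x :: real^'n) r) = ennreal ((2 * r) ^ CARD('n))"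
  by (subst measure_cube[symmetric, of r x]) (use emeasure_lborel_cbox_finite[of "x - vec r" "x + vec r"] in
      \<open>simp_all add: emeasure_eq_ennreal_measure cube_eq_cbox less_top[symmetric]\<close>)

lemma mem_cube_iff: "y \<in> cube x r \<longleftrightarrow> (\<forall>i. \<bar>y $ i - x $ i\<bar> \<le> r)"
  by (simp add: cube_def)

lemma cube_norm_le: "y \<in> cube x r \<Longrightarrow> norm (y - x) \<le> real CARD('n) * r" for x y :: "real^'n" and r :: real
proof -
  assume "y \<in> cube x r"
  then have "(\<Sum>i\<in>UNIV. \<bar>(y - x) $ i\<bar>) \<le> (\<Sum>i\<in>(UNIV::'n set). r)"
    by (intro sum_mono) (auto simp: cube_def)
  then show ?thesis using norm_le_l1_cart[of "y - x"] by simp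
qed

lemma ball_subset_cube: "norm (y - x) \<le> r \<Longrightarrow> y \<in> cube x r"
  unfolding cube_def using component_le_norm_cart[of "y - x"] by (auto intro: order_trans)

lemma integrable_continuous_compact_support:
  fixes f :: "real^'n \<Rightarrow> 'b::{banach, second_countable_topology}"
  assumes "continuous_on UNIV f" "\<And>x. x \<notin> cube z r \<Longrightarrow> f x = 0"
  shows "integrable lborel f"
proof -
  have "set_integrable lborel (cube z r) f"
    unfolding set_integrable_def
    by (rule borel_integrable_compact) (use assms(1) in \<open>auto intro: continuous_on_subset\<close>)
  moreover have "(\<lambda>x. indicator (cube z r) x *\<^sub>R f x) = f"
    using assms(2) by (auto simp: indicator_def)
  ultimately show ?thesis by (simp add: set_integrable_def)
qed

lemma integral_lborel_eq_cube:
  fixes f :: "real^'n \<Rightarrow> 'b::euclidean_space"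
  assumes "continuous_on UNIV f" "\<And>x. x \<notin> cube z r \<Longrightarrow> f x = 0"
  shows "(\<integral>x. f x \<partial>lborel) = integral (cube z r) f"
proof -
  have "(\<integral>x. f x \<partial>lborel) = integral UNIV f"
    by (rule integral_lborel[symmetric, OF integrable_continuous_compact_support[OF assms]])
  also have "\<dots> = integral (cube z r) f"
  proof -
    have "integral UNIV f = integral UNIV (\<lambda>x. if x \<in> cube z r then f x else 0)"
      by (intro Henstock_Kurzweil_Integration.integral_cong) (use assms(2) in auto)
    then show ?thesis by (simp only: integral_restrict_UNIV)
  qed
  finally show ?thesis .
qed

definition conv :: "(real^'n \<Rightarrow> real) \<Rightarrow> (real^'n \<Rightarrow> real) \<Rightarrow> real^'n \<Rightarrow> real" where
  "conv f \<phi> x = (\<integral>y. f y * \<phi> (x - y) \<partial>lborel)"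

text \<open>The derivative falls on the kernel, so continuity of \<open>f\<close> suffices. For
  centres within distance 1 of x all integrands live in one cube of half-width R + 1, where
  Leibniz's rule for boxes applies.\<close>

lemma has_derivative_conv:
  fixes f \<phi> :: "real^'n \<Rightarrow> real" and g :: "real^'n \<Rightarrow> real^'n"
  assumes f: "continuous_on UNIV f"
    and \<phi>: "\<And>x. (\<phi> has_derivative (\<lambda>h. g x \<bullet> h)) (at x)"
    and g: "continuous_on UNIV g"
    and supp: "\<And>x. x \<notin> cube 0 R \<Longrightarrow> \<phi> x = 0" "\<And>x. x \<notin> cube 0 R \<Longrightarrow> g x = 0"
  shows "(conv f \<phi> has_derivative (\<lambda>h. (\<chi> i. conv f (\<lambda>z. g z $ i) x) \<bullet> h)) (at x)"
proof -
  define B where "B = cube x (R + 1)"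
  have cphi: "continuous_on UNIV \<phi>"
    using \<phi> by (auto simp: continuous_on_eq_continuous_within intro: has_derivative_continuous)
  have out: "x' - y \<notin> cube 0 R" if "x' \<in> cube x 1" "y \<notin> B" for x' y
  proof
    assume "x' - y \<in> cube 0 R"
    then have "\<bar>y $ i - x $ i\<bar> \<le> R + 1" for i
      using that(1) unfolding cube_def by (auto simp: abs_le_iff algebra_simps dest!: spec[of _ i])
    then show False using that(2) by (simp add: B_def cube_def)
  qed
  have 1: "conv f \<phi> x' = integral B (\<lambda>y. f y * \<phi> (x' - y))" if "x' \<in> cube x 1" for x'
    unfolding conv_def B_def
    by (rule integral_lborel_eq_cube)
      (use out[OF that, unfolded B_def] supp in \<open>auto intro!: continuous_intros f continuous_on_compose2[OF cphi]\<close>)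
  have "((\<lambda>x'. integral (cbox (x - vec (R+1)) (x + vec (R+1))) (\<lambda>y. f y * \<phi> (x' - y))) has_derivative
     blinfun_apply (integral (cbox (x - vec (R+1)) (x + vec (R+1))) (\<lambda>y. blinfun_inner_right (f y *\<^sub>R g (x - y))))) (at x within UNIV)"
  proof (rule leibniz_rule)
    fix x' t :: "real^'n"
    have "((\<lambda>x'. x' - t) has_derivative (\<lambda>h. h)) (at x')" by (auto intro!: derivative_eq_intros)
    from has_derivative_compose[OF this \<phi>[of "x' - t"]]
    have "((\<lambda>x'. \<phi> (x' - t)) has_derivative (\<lambda>h. g (x' - t) \<bullet> h)) (at x')" .
    then show "((\<lambda>x'. f t * \<phi> (x' - t)) has_derivative blinfun_apply (blinfun_inner_right (f t *\<^sub>R g (x' - t)))) (at x' within UNIV)"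
      by (auto intro!: derivative_eq_intros)
  next
    fix x' show "(\<lambda>y. f y * \<phi> (x' - y)) integrable_on cbox (x - vec (R + 1)) (x + vec (R + 1))"
      by (intro integrable_continuous continuous_intros continuous_on_subset[OF f] continuous_on_compose2[OF cphi]) auto
  next
    show "continuous_on (UNIV \<times> cbox (x - vec (R + 1)) (x + vec (R + 1)))
       (\<lambda>(x, t). blinfun_inner_right (f t *\<^sub>R g (x - t)))"
      unfolding split_beta
      by (intro bounded_linear.continuous_on[OF bounded_linear_blinfun_inner_right] continuous_intros
          continuous_on_compose2[OF f] continuous_on_compose2[OF g]) auto
  qed auto
  moreover have "integral B (\<lambda>y. blinfun_inner_right (f y *\<^sub>R g (x - y))) =
     blinfun_inner_right (integral B (\<lambda>y. f y *\<^sub>R g (x - y)))"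
  proof -
    have "(\<lambda>y. f y *\<^sub>R g (x - y)) integrable_on B"
      unfolding B_def cube_eq_cbox
      by (intro integrable_continuous continuous_intros continuous_on_subset[OF f] continuous_on_compose2[OF g]) auto
    from integral_linear[OF this bounded_linear_blinfun_inner_right] show ?thesis by (simp add: o_def)
  qed
  moreover have "integral B (\<lambda>y. f y *\<^sub>R g (x - y)) = (\<chi> i. conv f (\<lambda>z. g z $ i) x)"
  proof -
    have x: "x \<in> cube x 1" by (simp add: cube_def)
    have "integral B (\<lambda>y. f y *\<^sub>R g (x - y)) = (\<integral>y. f y *\<^sub>R g (x - y) \<partial>lborel)"
      unfolding B_def
      by (rule integral_lborel_eq_cube[symmetric])
         (use out[OF x, unfolded B_def] supp in \<open>auto intro!: continuous_intros f continuous_on_compose2[OF g]\<close>)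
    moreover have "(\<integral>y. f y *\<^sub>R g (x - y) \<partial>lborel) $ i = (\<integral>y. (f y *\<^sub>R g (x - y)) $ i \<partial>lborel)" for i
      by (rule integral_bounded_linear[OF bounded_linear_vec_nth, symmetric],
          rule integrable_continuous_compact_support[of _ x "R+1"])
         (use out[OF x, unfolded B_def] supp in \<open>auto intro!: continuous_intros f continuous_on_compose2[OF g]\<close>)
    ultimately show ?thesis by (simp add: vec_eq_iff conv_def)
  qed
  ultimately have "((\<lambda>x'. integral B (\<lambda>y. f y * \<phi> (x' - y))) has_derivative (\<lambda>h. (\<chi> i. conv f (\<lambda>z. g z $ i) x) \<bullet> h)) (at x)"
    by (simp add: B_def cube_eq_cbox)
  then show ?thesis
  proof (rule has_derivative_transform_within[OF _ zero_less_one])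
    fix x' assume "dist x' x < 1"
    then have "x' \<in> cube x 1" by (intro ball_subset_cube) (simp add: dist_norm)
    then show "integral B (\<lambda>y. f y * \<phi> (x' - y)) = conv f \<phi> x'" using 1 by simp
  qed auto
qed

text \<open>Reflecting the variable moves x into the continuous factor \<open>f\<close> and leaves a
  domain of integration that does not depend on x.\<close>

lemma continuous_on_conv:
  fixes f \<phi> :: "real^'n \<Rightarrow> real"
  assumes f: "continuous_on UNIV f" and \<phi>: "continuous_on UNIV \<phi>"
    and supp: "\<And>x. x \<notin> cube 0 R \<Longrightarrow> \<phi> x = 0"
  shows "continuous_on UNIV (conv f \<phi>)"
proof -
  have eq: "conv f \<phi> x = integral (cube 0 R) (\<lambda>z. f (x - z) * \<phi> z)" for x
  proof -
    have "conv f \<phi> x = (\<integral>z. f (x + (-1) *\<^sub>R z) * \<phi> (x - (x + (-1) *\<^sub>R z)) \<partial>lborel)"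
      unfolding conv_def
      by (subst integral_lborel_affine[where c="-1" and t=x])
         (use f \<phi> in \<open>auto intro!: borel_measurable_continuous_onI continuous_intros continuous_on_compose2[OF \<phi>]\<close>)
    also have "\<dots> = (\<integral>z. f (x - z) * \<phi> z \<partial>lborel)" by simp
    also have "\<dots> = integral (cube 0 R) (\<lambda>z. f (x - z) * \<phi> z)"
      by (rule integral_lborel_eq_cube) (use supp in \<open>auto intro!: continuous_intros \<phi> continuous_on_compose2[OF f]\<close>)
    finally show ?thesis .
  qed
  show ?thesis
    unfolding eq[abs_def] cube_eq_cbox
    by (rule integral_continuous_on_param[where U=UNIV])
       (auto simp: split_beta intro!: continuous_intros continuous_on_compose2[OF f] continuous_on_compose2[OF \<phi>])
qed

definition std_bump :: "real^'n \<Rightarrow> real" where "std_bump = prod_bump (\<lambda>_. 1) (\<lambda>_. 0)"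

text \<open>The normalising integral is never evaluated; its positivity
  (\<open>integral_std_bump_pos\<close>) is enough for total mass 1.\<close>

definition mollifier :: "real \<Rightarrow> real^'n \<Rightarrow> real" where
  "mollifier \<epsilon> x = (inverse \<epsilon> ^ CARD('n) / (\<integral>z. std_bump (z :: real^'n) \<partial>lborel)) * std_bump (inverse \<epsilon> *\<^sub>R (x - 0))"

lemma smooth_continuous:
  assumes "smooth f" shows "continuous_on UNIV (partial_derivs is f)"
proof -
  have "isCont (partial_derivs is f) x" for x
    using assms unfolding smooth_def by (simp add: differentiable_imp_continuous_within)
  then show ?thesis by (simp add: continuous_on_eq_continuous_at)
qed

lemma std_bump_nonneg: "std_bump x \<ge> 0"
  by (auto simp: std_bump_def prod_bump_def bump_term_def intro!: prod_nonneg)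

lemma continuous_on_std_bump: "continuous_on UNIV (std_bump :: real^'n \<Rightarrow> real)"
  using smooth_continuous[OF smooth_prod_bump, of "[]"] by (simp add: std_bump_def)

lemma std_bump_eq_0: "x \<notin> cube 0 1 \<Longrightarrow> std_bump x = 0"
  unfolding std_bump_def cube_def using prod_bump_eq_0 less_imp_le by (fastforce simp: not_le)

lemma integral_std_bump_pos: "(\<integral>z. std_bump (z :: real^'n) \<partial>lborel) > 0"
proof -
  have int: "integrable lborel (std_bump :: real^'n \<Rightarrow> real)"
    by (rule integrable_continuous_compact_support[OF continuous_on_std_bump std_bump_eq_0])
  have pos: "std_bump x > 0" if "x \<in> cube 0 (1/2)" for x :: "real^'n"
    unfolding std_bump_def prod_bump_def
  proof (rule prod_pos)
    fix i :: 'n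
    have "\<bar>x $ i\<bar> \<le> 1/2" using that by (auto simp: cube_def)
    then have "\<bar>x $ i\<bar> < 1" by linarith
    then show "0 < bump_term 1 0 (x $ i)" by (simp add: bump_term_def)
  qed
  have "(\<integral>z. std_bump (z :: real^'n) \<partial>lborel) \<noteq> 0"
  proof
    assume "(\<integral>z. std_bump (z :: real^'n) \<partial>lborel) = 0"
    then have "AE x in lborel. std_bump (x :: real^'n) = 0"
      using integral_nonneg_eq_0_iff_AE[OF int] std_bump_nonneg by auto
    then have "AE x in lborel. x \<notin> cube (0 :: real^'n) (1/2)"
      by eventually_elim (use pos in force)
    then have "emeasure lborel (cube (0 :: real^'n) (1/2)) = 0"
      by (subst (asm) AE_iff_measurable[OF _ refl]) auto
    then show False by (simp add: emeasure_cube)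
  qed
  moreover have "(\<integral>z. std_bump (z :: real^'n) \<partial>lborel) \<ge> 0"
    by (simp add: std_bump_nonneg)
  ultimately show ?thesis by linarith
qed

lemma mollifier_eq_0:
  assumes "\<epsilon> > 0" "x \<notin> cube 0 \<epsilon>" shows "mollifier \<epsilon> x = 0"
proof -
  have "inverse \<epsilon> *\<^sub>R x \<notin> cube 0 1"
    using assms by (auto simp: cube_def abs_mult field_simps)
  then show ?thesis by (simp add: mollifier_def std_bump_eq_0)
qed

lemma smooth_mollifier: "smooth (mollifier \<epsilon> :: real^'n \<Rightarrow> real)"
proof -
  have "smooth (\<lambda>y. (inverse \<epsilon> ^ CARD('n) / (\<integral>z. std_bump (z :: real^'n) \<partial>lborel)) * std_bump ((- inverse \<epsilon>) *\<^sub>R (0 - y)))"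
    unfolding std_bump_def by (rule smooth_affine[OF smooth_prod_bump])
  then show ?thesis unfolding mollifier_def[abs_def] by simp
qed

lemma mollifier_nonneg: "\<epsilon> > 0 \<Longrightarrow> mollifier \<epsilon> (x :: real^'n) \<ge> 0"
  using integral_std_bump_pos[where 'n='n] by (auto simp: mollifier_def intro!: divide_nonneg_pos mult_nonneg_nonneg std_bump_nonneg)

lemma integral_mollifier: "\<epsilon> > 0 \<Longrightarrow> (\<integral>x. mollifier \<epsilon> (x :: real^'n) \<partial>lborel) = 1"
proof -
  assume e: "\<epsilon> > 0"
  have [measurable]: "(mollifier \<epsilon> :: real^'n \<Rightarrow> real) \<in> borel_measurable borel"
    "(std_bump :: real^'n \<Rightarrow> real) \<in> borel_measurable borel"
    using smooth_continuous[OF smooth_mollifier, of "[]"] continuous_on_std_bump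
    by (auto intro!: borel_measurable_continuous_onI)
  show ?thesis
    using integral_std_bump_pos[where 'n='n] e
    by (subst integral_lborel_affine[where c=\<epsilon> and t=0])
       (simp_all add: mollifier_def power_mult_distrib[symmetric] field_simps)
qed

lemma partial_derivs_eq_0_outside:
  fixes f :: "real^'n \<Rightarrow> real"
  assumes "\<And>x. x \<notin> cube 0 r \<Longrightarrow> f x = 0" "x \<notin> cube 0 r"
  shows "partial_derivs is f x = 0"
  using assms(2)
proof (induction "is" arbitrary: x)
  case Nil
  then show ?case using assms by simp
next
  case (Cons i "is")
  have "open (- cube (0::real^'n) r)" by (simp add: cube_eq_cbox closed_cbox open_Compl)
  then have "eventually (\<lambda>y. y \<in> - cube 0 r) (nhds x)"
    using Cons.prems by (intro eventually_nhds_in_open) auto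
  then have ev: "eventually (\<lambda>y. 0 = partial_derivs is f y) (nhds x)"
    by eventually_elim (use Cons.IH in auto)
  have "((\<lambda>y. 0) has_derivative (\<lambda>h. 0 \<bullet> h)) (at x)" by simp
  then have "(partial_derivs is f has_derivative (\<lambda>h. 0 \<bullet> h)) (at x)"
    by (rule has_derivative_transform_eventually) (use ev in \<open>auto simp: eventually_at_filter elim: eventually_mono dest: eventually_nhds_x_imp_x\<close>)
  from partial_deriv_eq[OF this] show ?case by simp
qed

lemma partial_derivs_append: "partial_derivs (is @ js) f = partial_derivs is (partial_derivs js f)"
  by (induction "is") auto

text \<open>Supplies the symmetry of the second and third derivatives of mollified functions, which
  \<open>null_lagrangian\<close> demands of its derivative matrices.\<close>

lemma partial_derivs_swap_mollifier:
  "partial_derivs (is @ i # j # js) (mollifier \<epsilon> :: real^'n \<Rightarrow> real) = partial_derivs (is @ j # i # js) (mollifier \<epsilon>)"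
proof -
  define c where "c = inverse \<epsilon> ^ CARD('n) / (\<integral>z. std_bump (z :: real^'n) \<partial>lborel)"
  have m: "(mollifier \<epsilon> :: real^'n \<Rightarrow> real) = (\<lambda>y. c * prod_bump (\<lambda>_. 1) (\<lambda>_. 0) ((- inverse \<epsilon>) *\<^sub>R (0 - y)))"
    by (auto simp: mollifier_def std_bump_def c_def)
  obtain P K where js: "partial_derivs js (prod_bump (\<lambda>_::'n. 1) (\<lambda>_. 0)) = prod_bump P K"
    using partial_derivs_prod_bump by blast
  have "partial_derivs (is @ i # j # js) (prod_bump (\<lambda>_::'n. 1) (\<lambda>_. 0)) = partial_derivs (is @ j # i # js) (prod_bump (\<lambda>_. 1) (\<lambda>_. 0))"
    by (simp add: partial_derivs_append js partial_deriv_prod_bump_commute[of i j])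
  then show ?thesis
    unfolding m partial_derivs_affine(1)[OF smooth_prod_bump] by simp
qed

lemma has_derivative_conv_mollifier:
  fixes f :: "real^'n \<Rightarrow> real"
  assumes f: "continuous_on UNIV f" and e: "\<epsilon> > 0"
  shows "(conv f (partial_derivs is (mollifier \<epsilon>)) has_derivative
     (\<lambda>h. (\<chi> i. conv f (partial_derivs (i # is) (mollifier \<epsilon>)) x) \<bullet> h)) (at x)"
proof -
  have "(conv f (partial_derivs is (mollifier \<epsilon>)) has_derivative
     (\<lambda>h. (\<chi> i. conv f (\<lambda>z. (\<chi> i. partial_derivs (i # is) (mollifier \<epsilon>) z) $ i) x) \<bullet> h)) (at x)"
  proof (rule has_derivative_conv[OF f, where R=\<epsilon>])
    show "(partial_derivs is (mollifier \<epsilon>) has_derivative (\<lambda>h. (\<chi> i. partial_derivs (i # is) (mollifier \<epsilon>) x) \<bullet> h)) (at x)" for x :: "real^'n"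
      unfolding partial_derivs.simps
      by (rule has_derivative_partial_derivs) (rule smooth_differentiable[OF smooth_mollifier])
    show "continuous_on UNIV (\<lambda>x. \<chi> i. partial_derivs (i # is) (mollifier \<epsilon>) (x::real^'n))"
      by (intro continuous_on_vec_lambda smooth_continuous smooth_mollifier)
  qed (use e in \<open>auto simp: vec_eq_iff simp del: partial_derivs.simps intro!: partial_derivs_eq_0_outside mollifier_eq_0\<close>)
  then show ?thesis by simp
qed

lemma continuous_on_conv_mollifier:
  fixes f :: "real^'n \<Rightarrow> real"
  assumes f: "continuous_on UNIV f" and e: "\<epsilon> > 0"
  shows "continuous_on UNIV (conv f (partial_derivs is (mollifier \<epsilon>)))"
  by (rule continuous_on_conv[OF f smooth_continuous[OF smooth_mollifier], where R=\<epsilon>])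
     (use e in \<open>auto intro!: partial_derivs_eq_0_outside mollifier_eq_0\<close>)

section \<open>Convergence of mollifications in L^p\<close>

lemma powr_tangent_le:
  fixes a b p :: real
  assumes "p \<ge> 1" "a \<ge> 0" "b \<ge> 0"
  shows "b powr p + p * b powr (p - 1) * (a - b) \<le> a powr p"
proof (cases "a = 0 \<or> b = 0")
  case True
  then show ?thesis
  proof
    assume "a = 0"
    moreover have "b powr (p - 1) * b = b powr p" if "b \<noteq> 0"
      using powr_add[of b "p - 1" 1] assms that by simp
    ultimately show ?thesis using assms by (cases "b = 0") (auto simp: mult.assoc)
  qed (use assms in auto)
next
  case False
  then have pos: "a > 0" "b > 0" using assms by auto
  \<comment> \<open>Young's inequality with weights 1 / p and 1 - 1 / p becomes the tangent
    inequality of the convex power after multiplication by p.\<close>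
  have "(a powr p) powr (1/p) * (b powr p) powr (1 - 1/p) \<le> 1/p * a powr p + (1 - 1/p) * b powr p"
    using assms pos by (intro Youngs_inequality_0) auto
  also have "(a powr p) powr (1/p) = a" using assms pos by (simp add: powr_powr)
  also have "(b powr p) powr (1 - 1/p) = b powr (p - 1)" using assms by (simp add: powr_powr algebra_simps)
  finally have "p * (a * b powr (p - 1)) \<le> p * (1/p * a powr p + (1 - 1/p) * b powr p)"
    using assms by (intro mult_left_mono) auto
  also have "\<dots> = a powr p + (p - 1) * b powr p" using assms by (simp add: field_simps)
  finally have "p * (a * b powr (p - 1)) \<le> a powr p + (p - 1) * b powr p" .
  moreover have "b powr (p - 1) * b = b powr p"
    using powr_add[of b "p - 1" 1] pos by simp
  ultimately show ?thesis by (simp add: algebra_simps)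
qed

lemma mollifier_measurable [measurable]: "(mollifier \<epsilon> :: real^'n \<Rightarrow> real) \<in> borel_measurable borel"
  using smooth_continuous[OF smooth_mollifier, of "[]"] by (auto intro!: borel_measurable_continuous_onI)

lemma partial_derivs_mollifier_measurable [measurable]:
  "(partial_derivs is (mollifier \<epsilon>) :: real^'n \<Rightarrow> real) \<in> borel_measurable borel"
  using smooth_continuous[OF smooth_mollifier] by (auto intro!: borel_measurable_continuous_onI)

lemma partial_derivs_mollifier_bounded:
  assumes "\<epsilon> > 0"
  obtains B where "B \<ge> 0" "\<And>x. \<bar>partial_derivs is (mollifier \<epsilon>) (x::real^'n)\<bar> \<le> B"
proof -
  have "compact (partial_derivs is (mollifier \<epsilon>) ` cube (0::real^'n) \<epsilon>)"
    by (intro compact_continuous_image continuous_on_subset[OF smooth_continuous[OF smooth_mollifier]]) auto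
  then have "bounded (partial_derivs is (mollifier \<epsilon>) ` cube (0::real^'n) \<epsilon>)" by (rule compact_imp_bounded)
  then have "\<exists>B. \<forall>x\<in>cube (0::real^'n) \<epsilon>. \<bar>partial_derivs is (mollifier \<epsilon>) x\<bar> \<le> B" by (simp add: bounded_iff)
  then obtain B where B: "\<And>x. x \<in> cube (0::real^'n) \<epsilon> \<Longrightarrow> \<bar>partial_derivs is (mollifier \<epsilon>) x\<bar> \<le> B"
    by blast
  show ?thesis
  proof (rule that[of "\<bar>B\<bar>"])
    show "\<bar>partial_derivs is (mollifier \<epsilon>) x\<bar> \<le> \<bar>B\<bar>" for x :: "real^'n"
    proof (cases "x \<in> cube 0 \<epsilon>")
      case False
      have "partial_derivs is (mollifier \<epsilon>) x = 0"
        by (rule partial_derivs_eq_0_outside[OF _ False]) (rule mollifier_eq_0[OF assms])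
      then show ?thesis by simp
    qed (use B[of x] in auto)
  qed auto
qed

lemma integrable_mult_kernel:
  fixes f :: "real^'n \<Rightarrow> real"
  assumes f: "integrable lborel f" and e: "\<epsilon> > 0"
  shows "integrable lborel (\<lambda>y. f y * partial_derivs is (mollifier \<epsilon>) (x - y))"
proof -
  obtain B where B: "B \<ge> 0" "\<And>x. \<bar>partial_derivs is (mollifier \<epsilon>) (x::real^'n)\<bar> \<le> B"
    using partial_derivs_mollifier_bounded[OF e, of "is"] by blast
  have [measurable]: "f \<in> borel_measurable borel" using f by (auto dest: borel_measurable_integrable)
  show ?thesis
  proof (rule Bochner_Integration.integrable_bound[OF integrable_mult_right[OF f, of B]])
    show "AE y in lborel. norm (f y * partial_derivs is (mollifier \<epsilon>) (x - y)) \<le> norm (B * f y)"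
      using mult_left_mono[OF B(2)] B(1) by (auto simp: abs_mult mult.commute[of B])
  qed measurable
qed

lemma integrable_mollifier_shift:
  "\<epsilon> > 0 \<Longrightarrow> integrable lborel (\<lambda>y. mollifier \<epsilon> (x - y :: real^'n))"
  "\<epsilon> > 0 \<Longrightarrow> (\<integral>y. mollifier \<epsilon> (x - y :: real^'n) \<partial>lborel) = 1"
proof -
  assume e: "\<epsilon> > 0"
  have "integrable lborel (mollifier \<epsilon> :: real^'n \<Rightarrow> real)"
    using integral_mollifier[OF e, where 'n='n] not_integrable_integral_eq by fastforce
  then show "integrable lborel (\<lambda>y. mollifier \<epsilon> (x - y :: real^'n))"
    using integrable_lborel_affine_iff[of "-1" "mollifier \<epsilon>" x] by simp
  show "(\<integral>y. mollifier \<epsilon> (x - y :: real^'n) \<partial>lborel) = 1"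
    using integral_lborel_affine[of "mollifier \<epsilon> :: real^'n \<Rightarrow> real" "-1" x] integral_mollifier[OF e, where 'n='n] by simp
qed

lemma nn_integral_mollifier_shift:
  "\<epsilon> > 0 \<Longrightarrow> (\<integral>\<^sup>+y. ennreal (mollifier \<epsilon> (y - x :: real^'n)) \<partial>lborel) = 1"
proof -
  assume e: "\<epsilon> > 0"
  have "(\<integral>\<^sup>+y. ennreal (mollifier \<epsilon> (y - x :: real^'n)) \<partial>lborel) = (\<integral>\<^sup>+y. ennreal (mollifier \<epsilon> y) \<partial>(lborel :: (real^'n) measure))"
    using nn_integral_lborel_affine[of "\<lambda>y::real^'n. ennreal (mollifier \<epsilon> y)" 1 "-x"] by simp
  also have "\<dots> = ennreal (\<integral>y. mollifier \<epsilon> y \<partial>(lborel :: (real^'n) measure))"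
    using integrable_mollifier_shift(1)[OF e, of 0] integrable_lborel_affine_iff[of "-1" "mollifier \<epsilon>" "0::real^'n"]
    by (intro nn_integral_eq_integral) (auto simp: mollifier_nonneg e)
  finally show ?thesis using integral_mollifier[OF e, where 'n='n] by simp
qed

lemma conv_measurable [measurable]:
  assumes [measurable]: "f \<in> borel_measurable borel" "\<phi> \<in> borel_measurable borel"
  shows "conv f \<phi> \<in> borel_measurable borel"
proof -
  have "(\<lambda>x. \<integral>y. f y * \<phi> (x - y) \<partial>lborel) \<in> borel_measurable borel"
    by (rule lborel.borel_measurable_lebesgue_integral) measurable
  then show ?thesis by (simp add: conv_def[abs_def])
qed

text \<open>Jensen's inequality: the tangent inequality at the mean value \<open>b\<close> is
  averaged against the probability density given by the mollifier.\<close>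

lemma conv_powr_le:
  fixes f :: "real^'n \<Rightarrow> real"
  assumes p: "p \<ge> 1" and e: "\<epsilon> > 0"
    and f: "integrable lborel f" "integrable lborel (\<lambda>x. \<bar>f x\<bar> powr p)"
  shows "\<bar>conv f (mollifier \<epsilon>) x\<bar> powr p \<le> conv (\<lambda>x. \<bar>f x\<bar> powr p) (mollifier \<epsilon>) x"
proof -
  let ?m = "\<lambda>y. mollifier \<epsilon> (x - y)"
  define b where "b = conv (\<lambda>x. \<bar>f x\<bar>) (mollifier \<epsilon>) x"
  have i1: "integrable lborel (\<lambda>y. f y * ?m y)" "integrable lborel (\<lambda>y. \<bar>f y\<bar> * ?m y)"
    "integrable lborel (\<lambda>y. \<bar>f y\<bar> powr p * ?m y)"
    using integrable_mult_kernel[OF f(1) e, of "[]" x] integrable_mult_kernel[OF integrable_abs[OF f(1)] e, of "[]" x]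
      integrable_mult_kernel[OF f(2) e, of "[]" x] by simp_all
  have b: "b \<ge> 0" unfolding b_def conv_def by (simp add: mollifier_nonneg e)
  have "\<bar>conv f (mollifier \<epsilon>) x\<bar> \<le> b"
    unfolding conv_def b_def
    using integral_norm_bound[of lborel "\<lambda>y. f y * ?m y"] by (simp add: abs_mult mollifier_nonneg e)
  then have "\<bar>conv f (mollifier \<epsilon>) x\<bar> powr p \<le> b powr p"
    using p by (intro powr_mono2) auto
  also have "b powr p = b powr p * (\<integral>y. ?m y \<partial>lborel) + p * b powr (p-1) * (b - b * (\<integral>y. ?m y \<partial>lborel))"
    by (simp add: integrable_mollifier_shift(2)[OF e])
  also have "\<dots> = (\<integral>y. (b powr p + p * b powr (p - 1) * (\<bar>f y\<bar> - b)) * ?m y \<partial>lborel)"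
  proof -
    have "(\<integral>y. (b powr p + p * b powr (p - 1) * (\<bar>f y\<bar> - b)) * ?m y \<partial>lborel) =
      (\<integral>y. (b powr p - p * b powr (p-1) * b) * ?m y + (p * b powr (p - 1)) * (\<bar>f y\<bar> * ?m y) \<partial>lborel)"
      by (simp add: algebra_simps)
    also have "\<dots> = (b powr p - p * b powr (p-1) * b) * (\<integral>y. ?m y \<partial>lborel) + (p * b powr (p - 1)) * b"
      using i1 integrable_mollifier_shift(1)[OF e, of x]
      by (subst Bochner_Integration.integral_add) (auto simp: b_def conv_def)
    finally show ?thesis by (simp add: algebra_simps)
  qed
  also have "\<dots> \<le> (\<integral>y. \<bar>f y\<bar> powr p * ?m y \<partial>lborel)"
  proof (rule integral_mono)
    have "(\<lambda>y. (b powr p + p * b powr (p - 1) * (\<bar>f y\<bar> - b)) * ?m y) =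
      (\<lambda>y. (b powr p - p * b powr (p-1) * b) * ?m y + (p * b powr (p - 1)) * (\<bar>f y\<bar> * ?m y))"
      by (auto simp: algebra_simps)
    then show "integrable lborel (\<lambda>y. (b powr p + p * b powr (p - 1) * (\<bar>f y\<bar> - b)) * ?m y)"
      using i1 integrable_mollifier_shift(1)[OF e, of x] by simp
  qed (use i1 in \<open>auto intro!: mult_right_mono powr_tangent_le p b mollifier_nonneg e\<close>)
  finally show ?thesis by (simp add: conv_def)
qed

text \<open>By Tonelli the integral of a mollified function over \<open>S\<close> is an average of
  integrals of translates. A bound common to all translates by vectors of the kernel's support is
  therefore inherited.\<close>

lemma nn_integral_conv_le:
  fixes f :: "real^'n \<Rightarrow> real"
  assumes [measurable]: "f \<in> borel_measurable borel" "S \<in> sets borel"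
    and nn: "\<And>x. f x \<ge> 0" and int: "integrable lborel f" and e: "\<epsilon> > 0"
    and K: "\<And>z. z \<in> cube 0 \<epsilon> \<Longrightarrow> (\<integral>\<^sup>+x. ennreal (f (x - z)) * indicator S x \<partial>lborel) \<le> K"
  shows "(\<integral>\<^sup>+x. ennreal (conv f (mollifier \<epsilon>) x) * indicator S x \<partial>lborel) \<le> K"
proof -
  have 1: "ennreal (conv f (mollifier \<epsilon>) x) = (\<integral>\<^sup>+z. ennreal (f (x - z)) * ennreal (mollifier \<epsilon> z) \<partial>lborel)" for x
  proof -
    have "ennreal (conv f (mollifier \<epsilon>) x) = (\<integral>\<^sup>+y. ennreal (f y * mollifier \<epsilon> (x - y)) \<partial>lborel)"
      unfolding conv_def using integrable_mult_kernel[OF int e, of "[]" x] nn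
      by (intro nn_integral_eq_integral[symmetric]) (auto simp: mollifier_nonneg e)
    also have "\<dots> = (\<integral>\<^sup>+z. ennreal (f (x - z) * mollifier \<epsilon> z) \<partial>lborel)"
      by (subst nn_integral_lborel_affine[where c="-1" and t=x]) auto
    finally show ?thesis using nn by (simp add: ennreal_mult' mollifier_nonneg e)
  qed
  have "(\<integral>\<^sup>+x. ennreal (conv f (mollifier \<epsilon>) x) * indicator S x \<partial>lborel) =
     (\<integral>\<^sup>+x. (\<integral>\<^sup>+z. ennreal (f (x - z)) * indicator S x * ennreal (mollifier \<epsilon> z) \<partial>lborel) \<partial>lborel)"
    unfolding 1 by (subst nn_integral_multc[symmetric]) (auto simp: mult_ac)
  also have "\<dots> = (\<integral>\<^sup>+z. (\<integral>\<^sup>+x. ennreal (f (x - z)) * indicator S x * ennreal (mollifier \<epsilon> z) \<partial>lborel) \<partial>lborel)"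
    by (rule lborel_pair.Fubini') measurable
  also have "\<dots> = (\<integral>\<^sup>+z. (\<integral>\<^sup>+x. ennreal (f (x - z)) * indicator S x \<partial>lborel) * ennreal (mollifier \<epsilon> z) \<partial>lborel)"
    by (subst nn_integral_multc) auto
  also have "\<dots> \<le> (\<integral>\<^sup>+z. K * ennreal (mollifier \<epsilon> (z - 0 :: real^'n)) \<partial>lborel)"
  proof (rule nn_integral_mono)
    fix z :: "real^'n"
    show "(\<integral>\<^sup>+x. ennreal (f (x - z)) * indicator S x \<partial>lborel) * ennreal (mollifier \<epsilon> z) \<le> K * ennreal (mollifier \<epsilon> (z - 0))"
      by (cases "z \<in> cube 0 \<epsilon>") (auto intro: mult_right_mono K simp: mollifier_eq_0[OF e])
  qed
  also have "\<dots> = K" by (subst nn_integral_cmult) (auto simp: nn_integral_mollifier_shift[OF e, of 0, simplified])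
  finally show ?thesis .
qed

lemma conv_uniform:
  fixes h :: "real^'n \<Rightarrow> real"
  assumes h: "continuous_on UNIV h" and "r \<ge> 0" "\<eta> > 0"
  obtains \<epsilon>0 where "\<epsilon>0 > 0" "\<And>\<epsilon> x. \<lbrakk>0 < \<epsilon>; \<epsilon> < \<epsilon>0; x \<in> cube z r\<rbrakk> \<Longrightarrow> \<bar>conv h (mollifier \<epsilon>) x - h x\<bar> \<le> \<eta>"
proof -
  have "uniformly_continuous_on (cube z (r+1)) h"
    by (intro compact_uniformly_continuous continuous_on_subset[OF h]) auto
  then obtain d where d: "d > 0" "\<And>x y. x \<in> cube z (r+1) \<Longrightarrow> y \<in> cube z (r+1) \<Longrightarrow> dist y x < d \<Longrightarrow> dist (h y) (h x) < \<eta>"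
    using \<open>\<eta> > 0\<close> unfolding uniformly_continuous_on_def by metis
  \<comment> \<open>A vector of \<open>cube 0 \<epsilon>\<close> has Euclidean norm at most n
    \<epsilon>, hence the division of d by n + 1.\<close>
  define e0 where "e0 = min 1 (d / (real CARD('n) + 1))"
  show ?thesis
  proof (rule that[of e0])
    show "e0 > 0" using d by (simp add: e0_def)
    fix \<epsilon> x assume e: "0 < \<epsilon>" "\<epsilon> < e0" "x \<in> cube z r"
    have bnd: "\<bar>h y * mollifier \<epsilon> (x - y) - h x * mollifier \<epsilon> (x - y)\<bar> \<le> \<eta> * mollifier \<epsilon> (x - y)" for y
    proof (cases "x - y \<in> cube 0 \<epsilon>")
      case True
      then have y1: "\<bar>x $ i - y $ i\<bar> \<le> 1" for i using e by (auto simp: cube_def e0_def dest!: spec[of _ i])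
      have y2: "\<bar>x $ i - z $ i\<bar> \<le> r" for i using e(3) by (auto simp: cube_def)
      have "\<bar>y $ i - z $ i\<bar> \<le> r + 1" for i using y1[of i] y2[of i] by linarith
      then have y: "y \<in> cube z (r+1)" by (auto simp: cube_def)
      have "norm (x - y) \<le> CARD('n) * \<epsilon>" using cube_norm_le[OF True] by simp
      also have "\<dots> < d"
      proof -
        have "real CARD('n) * \<epsilon> \<le> (real CARD('n) + 1) * \<epsilon>" using e by simp
        also have "\<dots> < (real CARD('n) + 1) * (d / (real CARD('n) + 1))"
          using e unfolding e0_def by (intro mult_strict_left_mono) auto
        also have "\<dots> = d" by simp
        finally show ?thesis .
      qed
      finally have "dist (h y) (h x) < \<eta>"
        using e(3) by (intro d y) (auto simp: dist_norm norm_minus_commute cube_def intro: order_trans)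
      then have "\<bar>h y - h x\<bar> * mollifier \<epsilon> (x - y) \<le> \<eta> * mollifier \<epsilon> (x - y)"
        by (intro mult_right_mono mollifier_nonneg e) (auto simp: dist_real_def)
      then show ?thesis using mollifier_nonneg[OF e(1), of "x - y"] by (simp add: abs_mult left_diff_distrib[symmetric])
    qed (use e in \<open>simp add: mollifier_eq_0\<close>)
    have i1: "integrable lborel (\<lambda>y. h y * mollifier \<epsilon> (x - y))"
    proof (rule integrable_continuous_compact_support[where z=x and r=\<epsilon>])
      show "continuous_on UNIV (\<lambda>y. h y * mollifier \<epsilon> (x - y))"
        by (intro continuous_intros h continuous_on_compose2[OF smooth_continuous[OF smooth_mollifier, of "[]", simplified]]) auto
      fix y assume "y \<notin> cube x \<epsilon>"
      then have "x - y \<notin> cube 0 \<epsilon>" by (auto simp: cube_def abs_minus_commute)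
      then show "h y * mollifier \<epsilon> (x - y) = 0" using e by (simp add: mollifier_eq_0)
    qed
    note i2 = integrable_mollifier_shift(1)[OF e(1), of x]
    have "conv h (mollifier \<epsilon>) x - h x = (\<integral>y. h y * mollifier \<epsilon> (x - y) \<partial>lborel) - (\<integral>y. h x * mollifier \<epsilon> (x - y) \<partial>lborel)"
      by (simp add: conv_def integrable_mollifier_shift(2)[OF e(1)])
    also have "\<dots> = (\<integral>y. h y * mollifier \<epsilon> (x - y) - h x * mollifier \<epsilon> (x - y) \<partial>lborel)"
      using i1 i2 by simp
    also have "\<bar>\<dots>\<bar> \<le> (\<integral>y. \<bar>h y * mollifier \<epsilon> (x - y) - h x * mollifier \<epsilon> (x - y)\<bar> \<partial>lborel)"
      using integral_norm_bound[of lborel "\<lambda>y. h y * mollifier \<epsilon> (x - y) - h x * mollifier \<epsilon> (x - y)"] by simp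
    also have "\<dots> \<le> (\<integral>y. \<eta> * mollifier \<epsilon> (x - y) \<partial>lborel)"
      using i1 i2 bnd by (intro integral_mono) auto
    also have "\<dots> = \<eta>" by (simp add: integrable_mollifier_shift(2)[OF e(1)])
    finally show "\<bar>conv h (mollifier \<epsilon>) x - h x\<bar> \<le> \<eta>" .
  qed
qed

lemma powr_abs_add_le:
  fixes a b c p :: real
  assumes "p > 0"
  shows "\<bar>a + b + c\<bar> powr p \<le> 3 powr p * (\<bar>a\<bar> powr p + \<bar>b\<bar> powr p + \<bar>c\<bar> powr p)"
proof -
  define m where "m = max \<bar>a\<bar> (max \<bar>b\<bar> \<bar>c\<bar>)"
  have "\<bar>a + b + c\<bar> powr p \<le> (3 * m) powr p"
    using assms by (intro powr_mono2) (auto simp: m_def)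
  also have "\<dots> = 3 powr p * m powr p" by (simp add: powr_mult m_def)
  also have "m powr p \<le> \<bar>a\<bar> powr p + \<bar>b\<bar> powr p + \<bar>c\<bar> powr p"
    by (auto simp: m_def max_def)
  finally show ?thesis by simp
qed

lemma le_one_plus_powr: "p \<ge> 1 \<Longrightarrow> x \<ge> 0 \<Longrightarrow> x \<le> 1 + x powr p" for x p :: real
proof (cases "x \<le> 1")
  case False
  moreover assume "p \<ge> 1" "x \<ge> 0"
  ultimately have "x powr 1 \<le> x powr p" by (intro powr_mono) auto
  then show ?thesis using False by simp
qed (auto intro: add_increasing2)

lemma set_integrable_cube_of_powr:
  fixes g :: "real^'n \<Rightarrow> real"
  assumes [measurable]: "g \<in> borel_measurable borel" and p: "p \<ge> 1"
    and g: "set_integrable lborel (cube z r) (\<lambda>x. \<bar>g x\<bar> powr p)"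
  shows "set_integrable lborel (cube z r) g"
  unfolding set_integrable_def
proof (rule Bochner_Integration.integrable_bound)
  have "integrable lborel (\<lambda>x. indicator (cube z r) x *\<^sub>R (1::real))"
    using borel_integrable_compact[of "cube z r" "\<lambda>_. 1 :: real"] by simp
  then show "integrable lborel (\<lambda>x. indicator (cube z r) x *\<^sub>R (1::real) + indicator (cube z r) x *\<^sub>R \<bar>g x\<bar> powr p)"
    using g unfolding set_integrable_def by (rule Bochner_Integration.integrable_add)
  show "AE x in lborel. norm (indicator (cube z r) x *\<^sub>R g x) \<le> norm (indicator (cube z r) x *\<^sub>R (1::real) + indicator (cube z r) x *\<^sub>R \<bar>g x\<bar> powr p)"
    using le_one_plus_powr[of p] p by (auto simp: indicator_def)
qed measurable

text \<open>Truncation makes dominated convergence available twice: for the truncations of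
  \<open>g\<close>, and for the truncated continuous functions \<open>h n\<close> that converge to
  \<open>g\<close> off a negligible set. Each error gets \<eta> / (2 * 3 powr p), where 3 powr p
  comes from \<open>powr_abs_add_le\<close>.\<close>

lemma Lp_approx_continuous:
  fixes g :: "real^'n \<Rightarrow> real"
  assumes [measurable]: "g \<in> borel_measurable borel" and p: "p \<ge> 1"
    and g: "set_integrable lborel (cube z r) (\<lambda>x. \<bar>g x\<bar> powr p)" and \<eta>: "\<eta> > 0"
  obtains h where "continuous_on UNIV h"
    "(\<integral>\<^sup>+x. ennreal (\<bar>g x - h x\<bar> powr p) * indicator (cube z r) x \<partial>lborel) < ennreal \<eta>"
proof -
  let ?S = "cube z r"
  define clip :: "nat \<Rightarrow> real \<Rightarrow> real" where "clip k t = max (- real k) (min (real k) t)" for k t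
  have clip [simp]: "\<bar>clip k t\<bar> \<le> k" for k t by (auto simp: clip_def)
  have clip_cont: "continuous_on UNIV (clip k)" for k unfolding clip_def by (intro continuous_intros)
  then have [measurable]: "clip k \<in> borel_measurable borel" for k by (rule borel_measurable_continuous_onI)
  have gi: "integrable lborel (\<lambda>x. indicator ?S x * \<bar>g x\<bar> powr p)"
    using g by (simp add: set_integrable_def)
  have Si: "integrable lborel (\<lambda>x. indicator ?S x * c)" for c :: real
    using borel_integrable_compact[of "cube z r" "\<lambda>_. c"] by simp
  have e: "\<eta> / (2 * 3 powr p) > 0" using \<eta> by simp
  have "(\<lambda>k. \<integral>x. indicator ?S x * \<bar>g x - clip k (g x)\<bar> powr p \<partial>lborel) \<longlonglongrightarrow> (\<integral>x. 0 \<partial>(lborel :: (real^'n) measure))"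
  proof (rule integral_dominated_convergence[OF _ _ gi])
    have "(\<lambda>k. indicator ?S x * \<bar>g x - clip k (g x)\<bar> powr p) \<longlonglongrightarrow> 0" for x
    proof (rule tendsto_eventually)
      obtain k0 :: nat where "\<bar>g x\<bar> \<le> k0" using real_arch_simple by blast
      then have "clip k (g x) = g x" if "k \<ge> k0" for k using that by (auto simp: clip_def)
      then show "\<forall>\<^sub>F k in sequentially. indicator ?S x * \<bar>g x - clip k (g x)\<bar> powr p = 0"
        unfolding eventually_sequentially by (intro exI[of _ k0]) auto
    qed
    then show "AE x in lborel. (\<lambda>k. indicator ?S x * \<bar>g x - clip k (g x)\<bar> powr p) \<longlonglongrightarrow> 0" by simp
    show "AE x in lborel. norm (indicator ?S x * \<bar>g x - clip k (g x)\<bar> powr p) \<le> indicator ?S x * \<bar>g x\<bar> powr p" for k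
    proof (rule AE_I2)
      fix x
      have "\<bar>g x - clip k (g x)\<bar> \<le> \<bar>g x\<bar>" by (auto simp: clip_def)
      then have "\<bar>g x - clip k (g x)\<bar> powr p \<le> \<bar>g x\<bar> powr p" using p by (intro powr_mono2) auto
      then show "norm (indicator ?S x * \<bar>g x - clip k (g x)\<bar> powr p) \<le> indicator ?S x * \<bar>g x\<bar> powr p"
        by (auto simp: indicator_def)
    qed
  qed measurable
  then have "\<forall>\<^sub>F k in sequentially. (\<integral>x. indicator ?S x * \<bar>g x - clip k (g x)\<bar> powr p \<partial>lborel) < \<eta> / (2 * 3 powr p)"
    using e by (intro order_tendstoD(2)) auto
  then obtain k where k: "(\<integral>x. indicator ?S x * \<bar>g x - clip k (g x)\<bar> powr p \<partial>lborel) < \<eta> / (2 * 3 powr p)"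
    by (auto simp: eventually_sequentially)
  have "g measurable_on ?S"
    by (intro lebesgue_measurable_imp_measurable_on measurable_completion) auto
  then obtain N h where N: "negligible N" and h: "\<And>n. continuous_on UNIV (h n)"
    and lim: "\<And>x. x \<notin> N \<Longrightarrow> (\<lambda>n. h n x) \<longlonglongrightarrow> (if x \<in> ?S then g x else 0)"
    unfolding measurable_on_def by blast
  have [measurable]: "h n \<in> borel_measurable borel" for n using h by (rule borel_measurable_continuous_onI)
  have AEN: "AE x in lborel. x \<notin> N"
    using AE_not_in[of N lebesgue] N by (simp add: negligible_iff_null_sets AE_completion_iff)
  have "(\<lambda>n. \<integral>x. indicator ?S x * \<bar>clip k (g x) - clip k (h n x)\<bar> powr p \<partial>lborel) \<longlonglongrightarrow> (\<integral>x. 0 \<partial>(lborel :: (real^'n) measure))"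
  proof (rule integral_dominated_convergence[OF _ _ Si[of "(2 * real k) powr p"]])
    show "AE x in lborel. (\<lambda>n. indicator ?S x * \<bar>clip k (g x) - clip k (h n x)\<bar> powr p) \<longlonglongrightarrow> 0"
      using AEN
    proof eventually_elim
      fix x assume x: "x \<notin> N"
      show "(\<lambda>n. indicator ?S x * \<bar>clip k (g x) - clip k (h n x)\<bar> powr p) \<longlonglongrightarrow> 0"
      proof (cases "x \<in> ?S")
        case True
        then have "(\<lambda>n. h n x) \<longlonglongrightarrow> g x" using lim[OF x] by simp
        then have "(\<lambda>n. clip k (h n x)) \<longlonglongrightarrow> clip k (g x)"
          unfolding clip_def by (intro tendsto_intros)
        then have "(\<lambda>n. \<bar>clip k (g x) - clip k (h n x)\<bar>) \<longlonglongrightarrow> \<bar>clip k (g x) - clip k (g x)\<bar>"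
          by (intro tendsto_intros)
        then have "(\<lambda>n. \<bar>clip k (g x) - clip k (h n x)\<bar> powr p) \<longlonglongrightarrow> 0 powr p"
          using p by (intro tendsto_powr2) auto
        then show ?thesis using True by simp
      qed simp
    qed
    show "AE x in lborel. norm (indicator ?S x * \<bar>clip k (g x) - clip k (h n x)\<bar> powr p) \<le> indicator ?S x * (2 * real k) powr p" for n
    proof (rule AE_I2)
      fix x
      have "\<bar>clip k (g x) - clip k (h n x)\<bar> \<le> 2 * real k"
        using clip[of k "g x"] clip[of k "h n x"] by linarith
      then have "\<bar>clip k (g x) - clip k (h n x)\<bar> powr p \<le> (2 * real k) powr p" using p by (intro powr_mono2) auto
      then show "norm (indicator ?S x * \<bar>clip k (g x) - clip k (h n x)\<bar> powr p) \<le> indicator ?S x * (2 * real k) powr p"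
        by (auto simp: indicator_def)
    qed
  qed measurable
  then have "\<forall>\<^sub>F n in sequentially. (\<integral>x. indicator ?S x * \<bar>clip k (g x) - clip k (h n x)\<bar> powr p \<partial>lborel) < \<eta> / (2 * 3 powr p)"
    using e by (intro order_tendstoD(2)) auto
  then obtain n where n: "(\<integral>x. indicator ?S x * \<bar>clip k (g x) - clip k (h n x)\<bar> powr p \<partial>lborel) < \<eta> / (2 * 3 powr p)"
    by (auto simp: eventually_sequentially)
  let ?h = "\<lambda>x. clip k (h n x)"
  have i1: "integrable lborel (\<lambda>x. indicator ?S x * \<bar>g x - clip k (g x)\<bar> powr p)"
    by (rule Bochner_Integration.integrable_bound[OF gi])
       (use p in \<open>auto simp: indicator_def clip_def intro!: powr_mono2\<close>)
  have i2: "integrable lborel (\<lambda>x. indicator ?S x * \<bar>clip k (g x) - ?h x\<bar> powr p)"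
  proof (rule Bochner_Integration.integrable_bound[OF Si[of "(2 * real k) powr p"]])
    show "AE x in lborel. norm (indicator ?S x * \<bar>clip k (g x) - ?h x\<bar> powr p) \<le> norm (indicator ?S x * (2 * real k) powr p)"
    proof (rule AE_I2)
      fix x
      have "\<bar>clip k (g x) - clip k (h n x)\<bar> \<le> 2 * real k"
        using clip[of k "g x"] clip[of k "h n x"] by linarith
      then have "\<bar>clip k (g x) - clip k (h n x)\<bar> powr p \<le> (2 * real k) powr p" using p by (intro powr_mono2) auto
      then show "norm (indicator ?S x * \<bar>clip k (g x) - ?h x\<bar> powr p) \<le> norm (indicator ?S x * (2 * real k) powr p)"
        by (auto simp: indicator_def)
    qed
  qed measurable
  show ?thesis
  proof (rule that[of ?h])
    show "continuous_on UNIV ?h" using continuous_on_compose2[OF clip_cont h] by simp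
    have "(\<integral>\<^sup>+x. ennreal (\<bar>g x - ?h x\<bar> powr p) * indicator ?S x \<partial>lborel) \<le>
      (\<integral>\<^sup>+x. ennreal (3 powr p * (indicator ?S x * \<bar>g x - clip k (g x)\<bar> powr p + indicator ?S x * \<bar>clip k (g x) - ?h x\<bar> powr p)) \<partial>lborel)"
    proof (rule nn_integral_mono)
      fix x
      show "ennreal (\<bar>g x - ?h x\<bar> powr p) * indicator ?S x \<le> ennreal (3 powr p * (indicator ?S x * \<bar>g x - clip k (g x)\<bar> powr p + indicator ?S x * \<bar>clip k (g x) - ?h x\<bar> powr p))"
        using powr_abs_add_le[of p "g x - clip k (g x)" "clip k (g x) - ?h x" 0] p by (auto simp: indicator_def)
    qed
    also have "\<dots> = ennreal (\<integral>x. 3 powr p * (indicator ?S x * \<bar>g x - clip k (g x)\<bar> powr p + indicator ?S x * \<bar>clip k (g x) - ?h x\<bar> powr p) \<partial>lborel)"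
      using i1 i2 by (intro nn_integral_eq_integral) auto
    also have "\<dots> < ennreal \<eta>"
    proof (rule ennreal_lessI[OF \<eta>])
      show "(\<integral>x. 3 powr p * (indicator ?S x * \<bar>g x - clip k (g x)\<bar> powr p + indicator ?S x * \<bar>clip k (g x) - ?h x\<bar> powr p) \<partial>lborel) < \<eta>"
        unfolding integral_mult_right_zero Bochner_Integration.integral_add[OF i1 i2]
        using k n by (simp add: field_simps)
    qed
    finally show "(\<integral>\<^sup>+x. ennreal (\<bar>g x - ?h x\<bar> powr p) * indicator ?S x \<partial>lborel) < ennreal \<eta>" .
  qed
qed

lemma cube_sub_cube:
  assumes "x \<in> cube z r" "x - y \<in> cube 0 \<epsilon>" shows "y \<in> cube z (r + \<epsilon>)"
proof -
  have "\<bar>y $ i - z $ i\<bar> \<le> r + \<epsilon>" for i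
    using assms by (auto simp: cube_def dest!: spec[of _ i])
  then show ?thesis by (simp add: cube_def)
qed

lemma cube_mono: "r \<le> s \<Longrightarrow> cube x r \<subseteq> cube x s"
  by (auto simp: cube_def intro: order_trans)

lemma cube_subset_cube: "x \<in> cube z r \<Longrightarrow> r + \<rho> \<le> R \<Longrightarrow> cube x \<rho> \<subseteq> cube z R" for z :: "real^'n"
proof
  fix y assume a: "x \<in> cube z r" "r + \<rho> \<le> R" "y \<in> cube x \<rho>"
  have "\<bar>y $ i - z $ i\<bar> \<le> R" for i
    using a by (auto simp: cube_def dest!: spec[of _ i])
  then show "y \<in> cube z R" by (simp add: cube_def)
qed

text \<open>The kernel sees only values near x, so a function that is integrable merely near x may
  be replaced by a globally integrable one.\<close>

lemma conv_indicator:
  assumes e: "\<epsilon> > 0" and x: "\<And>y. x - y \<in> cube 0 \<epsilon> \<Longrightarrow> y \<in> S"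
  shows "conv (\<lambda>y. indicator S y * f y) (partial_derivs js (mollifier \<epsilon>)) x = conv f (partial_derivs js (mollifier \<epsilon>)) x"
  unfolding conv_def
proof (rule Bochner_Integration.integral_cong[OF refl])
  fix y
  show "indicator S y * f y * partial_derivs js (mollifier \<epsilon>) (x - y) = f y * partial_derivs js (mollifier \<epsilon>) (x - y)"
  proof (cases "x - y \<in> cube 0 \<epsilon>")
    case False
    then have "partial_derivs js (mollifier \<epsilon>) (x - y) = 0"
      by (rule partial_derivs_eq_0_outside[rotated]) (rule mollifier_eq_0[OF e])
    then show ?thesis by simp
  qed (use x in auto)
qed

text \<open>\<open>g\<close> is split into a continuous function \<open>h\<close> and a remainder
  \<open>G\<close> that is small in L^p on the larger cube. Mollification of \<open>h\<close>
  converges uniformly, and Jensen's inequality bounds the mollified \<open>G\<close> by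
  \<open>G\<close> itself. The margin \<open>d\<close> keeps every value that the kernel reaches
  inside the region of integrability.\<close>

lemma conv_Lp_convergence:
  fixes g :: "real^'n \<Rightarrow> real"
  assumes [measurable]: "g \<in> borel_measurable borel" and p: "p \<ge> 1" and r: "r \<ge> 0" and d: "d > 0"
    and g: "set_integrable lborel (cube z (r + d)) (\<lambda>x. \<bar>g x\<bar> powr p)" and \<eta>: "\<eta> > 0"
  obtains \<epsilon>0 where "\<epsilon>0 > 0" "\<epsilon>0 \<le> d"
    "\<And>\<epsilon>. \<lbrakk>0 < \<epsilon>; \<epsilon> < \<epsilon>0\<rbrakk> \<Longrightarrow>
       (\<integral>\<^sup>+x. ennreal (\<bar>conv g (mollifier \<epsilon>) x - g x\<bar> powr p) * indicator (cube z r) x \<partial>lborel) \<le> ennreal \<eta>"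
proof -
  let ?C = "cube z r" and ?C' = "cube z (r + d)"
  define \<eta>' where "\<eta>' = \<eta> / (3 * 3 powr p)"
  have \<eta>': "\<eta>' > 0" using \<eta> by (simp add: \<eta>'_def)
  obtain h where h: "continuous_on UNIV h"
    and hg: "(\<integral>\<^sup>+x. ennreal (\<bar>g x - h x\<bar> powr p) * indicator ?C' x \<partial>lborel) < ennreal \<eta>'"
    using Lp_approx_continuous[OF _ p g \<eta>'] by auto
  have [measurable]: "h \<in> borel_measurable borel" using h by (rule borel_measurable_continuous_onI)
  define V where "V = (2 * r) ^ CARD('n)"
  have V: "V \<ge> 0" using r by (simp add: V_def)
  \<comment> \<open>The p-th power of this uniform error, integrated over a cube of volume
    \<open>V\<close>, stays below \<open>\<eta>'\<close>; 1 + V avoids a division by zero when r =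
    0.\<close>
  define \<delta> where "\<delta> = (\<eta>' / (1 + V)) powr (1/p)"
  have \<delta>: "\<delta> > 0" "\<delta> powr p = \<eta>' / (1 + V)" using \<eta>' V p by (auto simp: \<delta>_def powr_powr)
  obtain e1 where e1: "e1 > 0" "\<And>\<epsilon> x. \<lbrakk>0 < \<epsilon>; \<epsilon> < e1; x \<in> ?C\<rbrakk> \<Longrightarrow> \<bar>conv h (mollifier \<epsilon>) x - h x\<bar> \<le> \<delta>"
    using conv_uniform[OF h r \<delta>(1), of z] by blast
  define G where "G = (\<lambda>y. indicator ?C' y * (g y - h y))"
  have Gm [measurable]: "G \<in> borel_measurable borel" unfolding G_def by measurable
  have Gp: "(\<integral>\<^sup>+x. ennreal (\<bar>G x\<bar> powr p) \<partial>lborel) < ennreal \<eta>'"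
  proof -
    have "ennreal (\<bar>G x\<bar> powr p) = ennreal (\<bar>g x - h x\<bar> powr p) * indicator ?C' x" for x
      by (auto simp: G_def indicator_def)
    then show ?thesis using hg by simp
  qed
  have iGp: "integrable lborel (\<lambda>x. \<bar>G x\<bar> powr p)"
    unfolding integrable_iff_bounded using Gp by (auto intro: less_trans)
  have iG: "integrable lborel G"
  proof -
    have "set_integrable lborel ?C' (\<lambda>x. \<bar>G x\<bar> powr p)"
      unfolding set_integrable_def by (rule integrable_mult_indicator[OF _ iGp]) simp
    then have "set_integrable lborel ?C' G" by (rule set_integrable_cube_of_powr[OF Gm p])
    moreover have "(\<lambda>x. indicator ?C' x *\<^sub>R G x) = G" by (auto simp: G_def indicator_def)
    ultimately show ?thesis by (simp add: set_integrable_def)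
  qed
  show ?thesis
  proof (rule that[of "min d e1"])
    fix \<epsilon> assume e: "0 < \<epsilon>" "\<epsilon> < min d e1"
    have Gc: "(\<integral>\<^sup>+x. ennreal (\<bar>conv G (mollifier \<epsilon>) x\<bar> powr p) \<partial>lborel) \<le> ennreal \<eta>'"
    proof -
      have "(\<integral>\<^sup>+x. ennreal (\<bar>conv G (mollifier \<epsilon>) x\<bar> powr p) \<partial>lborel) \<le> (\<integral>\<^sup>+x. ennreal (conv (\<lambda>x. \<bar>G x\<bar> powr p) (mollifier \<epsilon>) x) * indicator UNIV x \<partial>lborel)"
        using conv_powr_le[OF p e(1) iG iGp] by (intro nn_integral_mono) (auto intro: ennreal_leI)
      also have "\<dots> \<le> ennreal \<eta>'"
      proof (rule nn_integral_conv_le[OF _ _ _ iGp e(1)])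
        fix a :: "real^'n"
        have "(\<integral>\<^sup>+x. ennreal (\<bar>G (x - a)\<bar> powr p) \<partial>lborel) = (\<integral>\<^sup>+x. ennreal (\<bar>G x\<bar> powr p) \<partial>lborel)"
          using nn_integral_lborel_affine[of "\<lambda>x. ennreal (\<bar>G x\<bar> powr p)" 1 "-a"] by simp
        then show "(\<integral>\<^sup>+x. ennreal (\<bar>G (x - a)\<bar> powr p) * indicator UNIV x \<partial>lborel) \<le> ennreal \<eta>'"
          using Gp by simp
      qed auto
      finally show ?thesis .
    qed
    have split: "conv g (mollifier \<epsilon>) x - g x = conv G (mollifier \<epsilon>) x + (conv h (mollifier \<epsilon>) x - h x) + - G x" if x: "x \<in> ?C" for x
    proof -
      have x': "x \<in> ?C'" using x cube_mono[of r "r + d" z] d by auto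
      have y: "y \<in> ?C'" if "x - y \<in> cube 0 \<epsilon>" for y
        using cube_sub_cube[OF x that] cube_mono[of "r + \<epsilon>" "r + d" z] e by auto
      have "conv G (mollifier \<epsilon>) x = conv (\<lambda>y. g y - h y) (mollifier \<epsilon>) x"
        unfolding G_def using conv_indicator[OF e(1), where x=x and S="?C'" and js="[]"] y by simp
      moreover have "conv (\<lambda>y. indicator ?C' y * g y) (mollifier \<epsilon>) x = conv g (mollifier \<epsilon>) x"
        using conv_indicator[OF e(1), where x=x and S="?C'" and js="[]"] y by simp
      moreover have "conv (\<lambda>y. indicator ?C' y * g y) (mollifier \<epsilon>) x = conv (\<lambda>y. G y + indicator ?C' y * h y) (mollifier \<epsilon>) x"
        unfolding G_def by (simp add: algebra_simps)
      moreover have "conv (\<lambda>y. G y + indicator ?C' y * h y) (mollifier \<epsilon>) x = conv G (mollifier \<epsilon>) x + conv (\<lambda>y. indicator ?C' y * h y) (mollifier \<epsilon>) x"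
      proof -
        have "integrable lborel (\<lambda>y. indicator ?C' y * h y)"
          using borel_integrable_compact[of ?C' h] continuous_on_subset[OF h] by auto
        then have "integrable lborel (\<lambda>y. (indicator ?C' y * h y) * mollifier \<epsilon> (x - y))"
          using integrable_mult_kernel[OF _ e(1), of _ "[]" x] by auto
        moreover have "integrable lborel (\<lambda>y. G y * mollifier \<epsilon> (x - y))"
          using integrable_mult_kernel[OF iG e(1), of "[]" x] by auto
        ultimately show ?thesis unfolding conv_def
          by (subst Bochner_Integration.integral_add[symmetric]) (auto simp: algebra_simps)
      qed
      moreover have "conv (\<lambda>y. indicator ?C' y * h y) (mollifier \<epsilon>) x = conv h (mollifier \<epsilon>) x"
        using conv_indicator[OF e(1), where x=x and S="?C'" and js="[]"] y by simp
      ultimately show ?thesis using x' by (simp add: G_def)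
    qed
    have "(\<integral>\<^sup>+x. ennreal (\<bar>conv g (mollifier \<epsilon>) x - g x\<bar> powr p) * indicator ?C x \<partial>lborel) \<le>
      (\<integral>\<^sup>+x. ennreal (3 powr p) * (ennreal (\<bar>conv G (mollifier \<epsilon>) x\<bar> powr p) + ennreal (\<eta>' / (1 + V)) * indicator ?C x + ennreal (\<bar>G x\<bar> powr p)) \<partial>lborel)"
    proof (rule nn_integral_mono)
      fix x
      show "ennreal (\<bar>conv g (mollifier \<epsilon>) x - g x\<bar> powr p) * indicator ?C x \<le>
        ennreal (3 powr p) * (ennreal (\<bar>conv G (mollifier \<epsilon>) x\<bar> powr p) + ennreal (\<eta>' / (1 + V)) * indicator ?C x + ennreal (\<bar>G x\<bar> powr p))"
      proof (cases "x \<in> ?C")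
        case True
        have "\<bar>conv h (mollifier \<epsilon>) x - h x\<bar> powr p \<le> \<eta>' / (1 + V)"
          unfolding \<delta>(2)[symmetric] using e p True by (intro powr_mono2 e1) auto
        then have "\<bar>conv g (mollifier \<epsilon>) x - g x\<bar> powr p \<le> 3 powr p * (\<bar>conv G (mollifier \<epsilon>) x\<bar> powr p + \<eta>' / (1 + V) + \<bar>G x\<bar> powr p)"
          unfolding split[OF True] using p
          by (intro order_trans[OF powr_abs_add_le] mult_left_mono) auto
        then show ?thesis using True \<eta>' V
          by (simp add: ennreal_mult'[symmetric] ennreal_plus[symmetric] del: ennreal_plus)
      qed simp
    qed
    also have "\<dots> = ennreal (3 powr p) * ((\<integral>\<^sup>+x. ennreal (\<bar>conv G (mollifier \<epsilon>) x\<bar> powr p) \<partial>lborel) + ennreal (\<eta>' / (1 + V)) * ennreal V + (\<integral>\<^sup>+x. ennreal (\<bar>G x\<bar> powr p) \<partial>lborel))"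
      by (simp add: nn_integral_cmult nn_integral_add nn_integral_cmult_indicator emeasure_cube[OF r] V_def)
    also have "\<dots> \<le> ennreal (3 powr p) * (ennreal \<eta>' + ennreal \<eta>' + ennreal \<eta>')"
    proof (intro mult_left_mono add_mono Gc less_imp_le[OF Gp])
      have "\<eta>' / (1 + V) * V \<le> \<eta>'" using \<eta>' V by (simp add: field_simps)
      then show "ennreal (\<eta>' / (1 + V)) * ennreal V \<le> ennreal \<eta>'"
        using \<eta>' V by (simp add: ennreal_mult'[symmetric])
    qed auto
    also have "\<dots> = ennreal \<eta>"
      using \<eta>' \<eta> by (simp add: ennreal_mult'[symmetric] ennreal_plus[symmetric] \<eta>'_def field_simps del: ennreal_plus)
    finally show "(\<integral>\<^sup>+x. ennreal (\<bar>conv g (mollifier \<epsilon>) x - g x\<bar> powr p) * indicator ?C x \<partial>lborel) \<le> ennreal \<eta>" .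
  qed (use e1 d in auto)
qed

subsection \<open>Morrey's estimate\<close>

text \<open>Both B - f and B + f are nondecreasing. A majorant function instead of a constant allows
  derivative bounds that blow up at an endpoint, such as t^(\<gamma> - 1) with \<gamma> < 1.\<close>

lemma DERIV_abs_le_imp_abs_diff_le:
  fixes f B :: "real \<Rightarrow> real"
  assumes "a \<le> b" "continuous_on {a..b} f" "continuous_on {a..b} B"
    and f: "\<And>t. a < t \<Longrightarrow> t < b \<Longrightarrow> (f has_real_derivative f' t) (at t)"
    and B: "\<And>t. a < t \<Longrightarrow> t < b \<Longrightarrow> (B has_real_derivative B' t) (at t)"
    and le: "\<And>t. a < t \<Longrightarrow> t < b \<Longrightarrow> \<bar>f' t\<bar> \<le> B' t"
  shows "\<bar>f b - f a\<bar> \<le> B b - B a"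
proof -
  have "(\<lambda>t. B t - f t) a \<le> (\<lambda>t. B t - f t) b"
  proof (rule DERIV_nonneg_imp_increasing_open[OF \<open>a \<le> b\<close>])
    fix t assume t: "a < t" "t < b"
    have "((\<lambda>t. B t - f t) has_real_derivative B' t - f' t) (at t)"
      by (intro DERIV_diff f B t)
    then show "\<exists>y. ((\<lambda>t. B t - f t) has_real_derivative y) (at t) \<and> 0 \<le> y"
      using le[OF t] by (intro exI[of _ "B' t - f' t"]) linarith
  qed (intro continuous_intros assms)
  moreover have "(\<lambda>t. B t + f t) a \<le> (\<lambda>t. B t + f t) b"
  proof (rule DERIV_nonneg_imp_increasing_open[OF \<open>a \<le> b\<close>])
    fix t assume t: "a < t" "t < b"
    have "((\<lambda>t. B t + f t) has_real_derivative B' t + f' t) (at t)"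
      by (intro DERIV_add f B t)
    then show "\<exists>y. ((\<lambda>t. B t + f t) has_real_derivative y) (at t) \<and> 0 \<le> y"
      using le[OF t] by (intro exI[of _ "B' t + f' t"]) linarith
  qed (intro continuous_intros assms)
  ultimately show ?thesis by linarith
qed

lemma integral_cube_eq_lborel:
  fixes f :: "real^'n \<Rightarrow> real"
  assumes "continuous_on UNIV f"
  shows "set_integrable lborel (cube x r) f"
    and "integral (cube x r) f = (\<integral>y. indicator (cube x r) y * f y \<partial>lborel)"
    and "f integrable_on cube x r"
proof -
  show 1: "set_integrable lborel (cube x r) f"
    unfolding set_integrable_def
    by (rule borel_integrable_compact) (use assms in \<open>auto intro: continuous_on_subset\<close>)
  show "integral (cube x r) f = (\<integral>y. indicator (cube x r) y * f y \<partial>lborel)"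
    using set_borel_integral_eq_integral(2)[OF 1] by (simp add: set_lebesgue_integral_def)
  show "f integrable_on cube x r" by (rule set_borel_integral_eq_integral(1)[OF 1])
qed

lemma integral_cube_affine:
  fixes f :: "real^'n \<Rightarrow> real"
  assumes f: "continuous_on UNIV f" and t: "t > 0"
  shows "integral (cube x (t * r)) f = t ^ CARD('n) * integral (cube 0 r) (\<lambda>w. f (x + t *\<^sub>R w))"
proof -
  have [measurable]: "f \<in> borel_measurable borel" using f by (rule borel_measurable_continuous_onI)
  have mem: "x + t *\<^sub>R w \<in> cube x (t * r) \<longleftrightarrow> w \<in> cube 0 r" for w
    using t by (simp add: cube_def abs_mult)
  have "integral (cube x (t * r)) f = (\<integral>y. indicator (cube x (t * r)) y * f y \<partial>lborel)"
    by (rule integral_cube_eq_lborel[OF f])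
  also have "\<dots> = \<bar>t\<bar> ^ CARD('n) * (\<integral>w. indicator (cube x (t * r)) (x + t *\<^sub>R w) * f (x + t *\<^sub>R w) \<partial>lborel)"
    using t by (intro integral_lborel_affine) auto
  also have "\<dots> = t ^ CARD('n) * (\<integral>w. indicator (cube 0 r) w * f (x + t *\<^sub>R w) \<partial>lborel)"
    using t by (simp add: indicator_def mem)
  also have "(\<integral>w. indicator (cube 0 r) w * f (x + t *\<^sub>R w) \<partial>lborel) = integral (cube 0 r) (\<lambda>w. f (x + t *\<^sub>R w))"
    by (rule integral_cube_eq_lborel(2)[symmetric])
       (intro continuous_on_compose2[OF f] continuous_intros, auto)
  finally show ?thesis .
qed

lemma inner_le_sum_abs:
  fixes G w :: "real^'n"
  assumes "\<And>i. \<bar>w $ i\<bar> \<le> c"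
  shows "\<bar>G \<bullet> w\<bar> \<le> c * (\<Sum>i\<in>UNIV. \<bar>G $ i\<bar>)"
proof -
  have "\<bar>G \<bullet> w\<bar> \<le> (\<Sum>i\<in>UNIV. \<bar>G $ i * w $ i\<bar>)" by (simp add: inner_vec_def)
  also have "\<dots> \<le> (\<Sum>i\<in>UNIV. c * \<bar>G $ i\<bar>)"
    using assms by (intro sum_mono) (auto simp: abs_mult mult.commute[of c] intro!: mult_left_mono)
  finally show ?thesis by (simp add: sum_distrib_left)
qed

text \<open>The averages of \<open>g\<close> over \<open>cube x t\<close> are differentiated in \<open>t\<close> and in the centre, which avoids
  Fubini's theorem.\<close>

lemma morrey:
  fixes g :: "real^'n \<Rightarrow> real" and G :: "real^'n \<Rightarrow> real^'n" and L r \<gamma> :: real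
  assumes g: "\<And>x. (g has_derivative (\<lambda>h. G x \<bullet> h)) (at x)" and G: "continuous_on UNIV G"
    and S: "convex S" and r: "r > 0" and \<gamma>: "\<gamma> > 0"
    and L: "\<And>x \<rho>. x \<in> S \<Longrightarrow> 0 < \<rho> \<Longrightarrow> \<rho> \<le> r \<Longrightarrow>
      integral (cube x \<rho>) (\<lambda>z. \<Sum>i\<in>UNIV. \<bar>G z $ i\<bar>) \<le> L * \<rho> powr (real CARD('n) - 1 + \<gamma>)"
    and x: "x \<in> S" and y: "y \<in> S" "y \<in> cube x r"
  shows "\<bar>g x - g y\<bar> \<le> (2 / \<gamma> + 1) * L * r powr \<gamma>"
proof -
  let ?n = "CARD('n)"
  define N where "N z = (\<Sum>i\<in>UNIV. \<bar>G z $ i\<bar>)" for z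
  have cg: "continuous_on UNIV g"
    using g by (auto simp: continuous_on_eq_continuous_within intro: has_derivative_continuous)
  have cN: "continuous_on UNIV N" unfolding N_def by (intro continuous_intros G)
  \<comment> \<open>\<open>A t\<close> is the integral of \<open>g\<close> over
    \<open>cube z t\<close> divided by t^n, so its value at 0 is 2^n times \<open>g z\<close>. Its
    derivative is bounded through the hypothesis at radius t, and the bound t^(\<gamma> - 1)
    integrates to t^\<gamma> / \<gamma>.\<close>
  have avg: "\<bar>integral (cube z r) g / r ^ ?n - 2 ^ ?n * g z\<bar> \<le> L / \<gamma> * r powr \<gamma>" if z: "z \<in> S" for z
  proof -
    define A where "A t = integral (cube 0 1) (\<lambda>w. g (z + t *\<^sub>R w))" for t
    define A' where "A' t = integral (cube 0 1) (\<lambda>w. G (z + t *\<^sub>R w) \<bullet> w)" for t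
    have dA: "(A has_real_derivative A' t) (at t)" for t
      unfolding A_def[abs_def] A'_def cube_eq_cbox
    proof (rule leibniz_rule_field_derivative[where U=UNIV])
      fix t w
      have "((\<lambda>t. z + t *\<^sub>R w) has_derivative (\<lambda>h. h *\<^sub>R w)) (at t)" by (auto intro!: derivative_eq_intros)
      from has_derivative_compose[OF this g]
      show "((\<lambda>t. g (z + t *\<^sub>R w)) has_real_derivative G (z + t *\<^sub>R w) \<bullet> w) (at t within UNIV)"
        by (simp add: has_field_derivative_def mult_commute_abs)
    next
      fix t show "(\<lambda>w. g (z + t *\<^sub>R w)) integrable_on cbox (0 - vec 1) (0 + vec 1)"
        by (intro integrable_continuous continuous_on_compose2[OF cg] continuous_intros) auto
    next
      show "continuous_on (UNIV \<times> cbox (0 - vec 1) (0 + vec 1)) (\<lambda>(t, w). G (z + t *\<^sub>R w) \<bullet> w)"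
        unfolding split_beta by (intro continuous_intros continuous_on_compose2[OF G]) auto
    qed auto
    have bA: "\<bar>A' t\<bar> \<le> L * t powr (\<gamma> - 1)" if t: "0 < t" "t < r" for t
    proof -
      have "\<bar>A' t\<bar> \<le> integral (cube 0 1) (\<lambda>w. N (z + t *\<^sub>R w))"
        unfolding A'_def real_norm_def[symmetric]
      proof (rule integral_norm_bound_integral)
        show "(\<lambda>w. G (z + t *\<^sub>R w) \<bullet> w) integrable_on cube 0 1"
          by (intro integral_cube_eq_lborel(3) continuous_intros continuous_on_compose2[OF G]) auto
        show "(\<lambda>w. N (z + t *\<^sub>R w)) integrable_on cube 0 1"
          by (intro integral_cube_eq_lborel(3) continuous_on_compose2[OF cN] continuous_intros) auto
        show "norm (G (z + t *\<^sub>R w) \<bullet> w) \<le> N (z + t *\<^sub>R w)" if "w \<in> cube 0 1" for w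
          using inner_le_sum_abs[of w 1 "G (z + t *\<^sub>R w)"] that by (simp add: cube_def N_def)
      qed
      also have "\<dots> = integral (cube z t) N / t ^ ?n"
        using integral_cube_affine[OF cN t(1), of z 1] t by simp
      also have "\<dots> \<le> L * t powr (real ?n - 1 + \<gamma>) / t ^ ?n"
        using L[OF z t(1)] t unfolding N_def by (intro divide_right_mono) auto
      also have "\<dots> = L * t powr (\<gamma> - 1)"
      proof -
        have "t powr (real ?n - 1 + \<gamma>) = t powr (\<gamma> - 1) * t powr ?n"
          by (subst powr_add[symmetric]) (simp add: algebra_simps)
        also have "t powr ?n = t ^ ?n" using t by (intro powr_realpow) auto
        finally show ?thesis using t by simp
      qed
      finally show ?thesis .
    qed
    have "\<bar>A r - A 0\<bar> \<le> L / \<gamma> * r powr \<gamma> - L / \<gamma> * 0 powr \<gamma>"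
    proof (rule DERIV_abs_le_imp_abs_diff_le)
      show "continuous_on {0..r} A"
        by (intro continuous_at_imp_continuous_on ballI DERIV_isCont[OF dA])
      show "continuous_on {0..r} (\<lambda>t. L / \<gamma> * t powr \<gamma>)"
        using \<gamma> by (intro continuous_intros continuous_on_powr') auto
      show "((\<lambda>t. L / \<gamma> * t powr \<gamma>) has_real_derivative L * t powr (\<gamma> - 1)) (at t)" if "0 < t" for t
        using that \<gamma> by (auto intro!: derivative_eq_intros)
    qed (use r dA bA in auto)
    moreover have "A 0 = 2 ^ ?n * g z"
      using measure_cube[of 1 "0::real^'n"] by (simp add: A_def cube_eq_cbox)
    moreover have "A r = integral (cube z r) g / r ^ ?n"
      using integral_cube_affine[OF cg r, of z 1] r by (simp add: A_def)
    ultimately show ?thesis using \<gamma> by simp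
  qed
  \<comment> \<open>The cube slides along the segment from x to y. Convexity of \<open>S\<close>
    keeps its centre where the hypothesis holds.\<close>
  have move: "\<bar>integral (cube x r) g - integral (cube y r) g\<bar> \<le> r * (L * r powr (real ?n - 1 + \<gamma>))"
  proof -
    define M where "M s = integral (cube 0 r) (\<lambda>w. g (x + s *\<^sub>R (y - x) + w))" for s
    define M' where "M' s = integral (cube 0 r) (\<lambda>w. G (x + s *\<^sub>R (y - x) + w) \<bullet> (y - x))" for s
    have dM: "(M has_real_derivative M' t) (at t)" for t
      unfolding M_def[abs_def] M'_def cube_eq_cbox
    proof (rule leibniz_rule_field_derivative[where U=UNIV])
      fix t w
      have "((\<lambda>t. x + t *\<^sub>R (y - x) + w) has_derivative (\<lambda>h. h *\<^sub>R (y - x))) (at t)" by (auto intro!: derivative_eq_intros)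
      from has_derivative_compose[OF this g]
      show "((\<lambda>t. g (x + t *\<^sub>R (y - x) + w)) has_real_derivative G (x + t *\<^sub>R (y - x) + w) \<bullet> (y - x)) (at t within UNIV)"
        by (simp add: has_field_derivative_def mult_commute_abs)
    next
      fix t show "(\<lambda>w. g (x + t *\<^sub>R (y - x) + w)) integrable_on cbox (0 - vec r) (0 + vec r)"
        by (intro integrable_continuous continuous_on_compose2[OF cg] continuous_intros) auto
    next
      show "continuous_on (UNIV \<times> cbox (0 - vec r) (0 + vec r)) (\<lambda>(t, w). G (x + t *\<^sub>R (y - x) + w) \<bullet> (y - x))"
        unfolding split_beta by (intro continuous_intros continuous_on_compose2[OF G]) auto
    qed auto
    have shift: "integral (cube 0 r) (\<lambda>w. f (z + w)) = integral (cube z r) f" if "continuous_on UNIV f"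
      for f :: "real^'n \<Rightarrow> real" and z
      using integral_cube_affine[OF that, of 1 z r] by simp
    have bM: "\<bar>M' s\<bar> \<le> r * (L * r powr (real ?n - 1 + \<gamma>))" if s: "0 < s" "s < 1" for s
    proof -
      define z where "z = x + s *\<^sub>R (y - x)"
      have "z = (1 - s) *\<^sub>R x + s *\<^sub>R y" by (simp add: z_def algebra_simps)
      then have z: "z \<in> S" using S x y s by (simp add: convex_alt)
      have "\<bar>M' s\<bar> \<le> integral (cube 0 r) (\<lambda>w. r * N (z + w))"
        unfolding M'_def real_norm_def[symmetric]
      proof (rule integral_norm_bound_integral)
        show "(\<lambda>w. G (x + s *\<^sub>R (y - x) + w) \<bullet> (y - x)) integrable_on cube 0 r"
          by (intro integral_cube_eq_lborel(3) continuous_intros continuous_on_compose2[OF G]) auto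
        show "(\<lambda>w. r * N (z + w)) integrable_on cube 0 r"
          by (intro integral_cube_eq_lborel(3) continuous_intros continuous_on_compose2[OF cN]) auto
        show "norm (G (x + s *\<^sub>R (y - x) + w) \<bullet> (y - x)) \<le> r * N (z + w)" for w
          using inner_le_sum_abs[of "y - x" r "G (z + w)"] y(2) by (simp add: cube_def N_def z_def)
      qed
      also have "\<dots> = r * integral (cube z r) N" using shift[OF cN, of z] by simp
      also have "\<dots> \<le> r * (L * r powr (real ?n - 1 + \<gamma>))"
        using L[OF z r] r unfolding N_def by (intro mult_left_mono) auto
      finally show ?thesis .
    qed
    have "\<bar>M 1 - M 0\<bar> \<le> r * (L * r powr (real ?n - 1 + \<gamma>)) * 1 - r * (L * r powr (real ?n - 1 + \<gamma>)) * 0"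
    proof (rule DERIV_abs_le_imp_abs_diff_le)
      show "continuous_on {0..1} M"
        by (intro continuous_at_imp_continuous_on ballI DERIV_isCont[OF dM])
      show "((\<lambda>s. r * (L * r powr (real ?n - 1 + \<gamma>)) * s) has_real_derivative r * (L * r powr (real ?n - 1 + \<gamma>))) (at s)" for s
        by (auto intro!: derivative_eq_intros)
    qed (use dM bM in \<open>auto intro!: continuous_intros\<close>)
    moreover have "M 0 = integral (cube x r) g" "M 1 = integral (cube y r) g"
      using shift[OF cg, of x] shift[OF cg, of y] by (simp_all add: M_def)
    ultimately show ?thesis by (simp add: abs_minus_commute)
  qed
  have "r * (L * r powr (real ?n - 1 + \<gamma>)) / r ^ ?n = L * r powr \<gamma>"
  proof -
    have "r powr (real ?n - 1 + \<gamma>) * r powr 1 = r powr \<gamma> * r powr ?n"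
      unfolding powr_add[symmetric] by (simp add: algebra_simps)
    then have "r powr (real ?n - 1 + \<gamma>) * r = r powr \<gamma> * r ^ ?n" using r by (simp add: powr_realpow)
    then have e: "r * (L * r powr (real ?n - 1 + \<gamma>)) = (L * r powr \<gamma>) * r ^ ?n" by (simp add: mult_ac)
    show ?thesis unfolding e using r by simp
  qed
  moreover have "\<bar>integral (cube x r) g / r ^ ?n - integral (cube y r) g / r ^ ?n\<bar> \<le> r * (L * r powr (real ?n - 1 + \<gamma>)) / r ^ ?n"
    using divide_right_mono[OF move, of "r ^ ?n"] r unfolding diff_divide_distrib[symmetric] abs_divide by simp
  ultimately have "\<bar>2 ^ ?n * g x - 2 ^ ?n * g y\<bar> \<le> L / \<gamma> * r powr \<gamma> + L * r powr \<gamma> + L / \<gamma> * r powr \<gamma>"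
    using avg[OF x] avg[OF y(1)] by linarith
  then have "2 ^ ?n * \<bar>g x - g y\<bar> \<le> (2 / \<gamma> + 1) * L * r powr \<gamma>"
  proof -
    have "\<bar>2 ^ ?n * g x - 2 ^ ?n * g y\<bar> = 2 ^ ?n * \<bar>g x - g y\<bar>"
      unfolding right_diff_distrib[symmetric] abs_mult by simp
    moreover assume "\<bar>2 ^ ?n * g x - 2 ^ ?n * g y\<bar> \<le> L / \<gamma> * r powr \<gamma> + L * r powr \<gamma> + L / \<gamma> * r powr \<gamma>"
    moreover have "L / \<gamma> * r powr \<gamma> + L * r powr \<gamma> + L / \<gamma> * r powr \<gamma> = (2 / \<gamma> + 1) * L * r powr \<gamma>"
      by (simp add: algebra_simps)
    ultimately show ?thesis by simp
  qed
  moreover have "1 * \<bar>g x - g y\<bar> \<le> 2 ^ ?n * \<bar>g x - g y\<bar>" by (intro mult_right_mono) auto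
  ultimately show ?thesis by simp
qed

subsection \<open>Determinants of gradients\<close>

lemma linear_det_row:
  fixes R :: "'n::finite \<Rightarrow> real^'n"
  shows "linear (\<lambda>v. det (\<chi> i. if i = j then v else R i))"
proof (rule linearI)
  show "det (\<chi> i. if i = j then v + w else R i) = det (\<chi> i. if i = j then v else R i) + det (\<chi> i. if i = j then w else R i)" for v w
    using det_row_add[of j "\<lambda>_. v" "\<lambda>_. w" R] by simp
  show "det (\<chi> i. if i = j then c *\<^sub>R v else R i) = c *\<^sub>R det (\<chi> i. if i = j then v else R i)" for c v
  proof -
    have "c *\<^sub>R v = c *s v" by (simp add: vec_eq_iff)
    then show ?thesis using det_row_mul[of j c "\<lambda>_. v" R] by (simp only: real_scaleR_def)
  qed
qed

definition det2 :: "'n \<Rightarrow> 'n \<Rightarrow> real^'n \<Rightarrow> real^'n \<Rightarrow> ('n \<Rightarrow> real^'n) \<Rightarrow> real" where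
  "det2 j k v w R = det (\<chi> i. if i = j then v else if i = k then w else R i)"

lemma linear_det2_left: "linear (\<lambda>v. det2 j k v w R)"
  unfolding det2_def by (rule linear_det_row)

lemma linear_det2_right:
  assumes "j \<noteq> k" shows "linear (\<lambda>w. det2 j k v w R)"
proof -
  have "(\<lambda>w. det2 j k v w R) = (\<lambda>w. det (\<chi> i. if i = k then w else if i = j then v else R i))"
    unfolding det2_def using assms by (intro ext arg_cong[where f=det]) (auto simp: vec_eq_iff)
  then show ?thesis using linear_det_row by simp
qed

lemma det2_same:
  assumes "j \<noteq> k" shows "det2 j k v v R = 0"
  unfolding det2_def by (rule det_identical_rows[OF assms]) (auto simp: row_def)

lemma det2_eq_row:
  assumes "j \<noteq> k" "l \<noteq> j" "l \<noteq> k"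
  shows "det2 j k (R l) w R = 0" "det2 j k v (R l) R = 0"
  unfolding det2_def
  by (rule det_identical_rows[of j l], use assms in \<open>auto simp: row_def\<close>)
     (rule det_identical_rows[of k l], use assms in \<open>auto simp: row_def\<close>)

lemma det2_swap:
  assumes "j \<noteq> k" shows "det2 j k w v R = - det2 j k v w R"
proof -
  have "0 = det2 j k (v + w) (v + w) R" using det2_same[OF assms] by simp
  also have "\<dots> = det2 j k v v R + det2 j k v w R + (det2 j k w v R + det2 j k w w R)"
    by (simp add: linear_add[OF linear_det2_left] linear_add[OF linear_det2_right[OF assms]])
  finally show ?thesis using det2_same[OF assms] by simp
qed

text \<open>The algebra behind the comparison. In the application \<open>R\<close> are the rows of
  the Hessian, \<open>P\<close> is the gradient, a combination of them by Euler's relation, and row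
  j is the gradient of \<open>q \<xi>\<close>. The multiple of \<open>P\<close> in row j is killed
  by row k, and antisymmetry leaves only a 2 x 2 minor of the coefficients.\<close>

lemma det2_combination:
  fixes R :: "'n::finite \<Rightarrow> real^'n"
  assumes jk: "j \<noteq> k" and P: "P = (\<Sum>l\<in>UNIV. x l *\<^sub>R R l)"
  shows "det2 j k (s *\<^sub>R (\<Sum>l\<in>UNIV. e l *\<^sub>R R l) + t *\<^sub>R P) P R = s * (e j * x k - e k * x j) * det (\<chi> i. R i)"
proof -
  note left = linear_det2_left[of j k _ R] and right = linear_det2_right[OF jk, of _ R]
  have 1: "det2 j k (R l) (R m) R = (if l = j \<and> m = k then det (\<chi> i. R i) else if l = k \<and> m = j then - det (\<chi> i. R i) else 0)" for l m
  proof -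
    have d: "det2 j k (R j) (R k) R = det (\<chi> i. R i)"
      unfolding det2_def by (intro arg_cong[where f=det]) (auto simp: vec_eq_iff)
    consider "l \<noteq> j" "l \<noteq> k" | "m \<noteq> j" "m \<noteq> k" | "l = j" "m = j" | "l = k" "m = k" | "l = j" "m = k" | "l = k" "m = j" by blast
    then show ?thesis
      by cases (use jk d det2_swap[OF jk, of "R j" "R k" R] in \<open>auto simp: det2_eq_row[OF jk] det2_same[OF jk]\<close>)
  qed
  have 2: "det2 j k (R l) P R = (if l = j then x k * det (\<chi> i. R i) else if l = k then - x j * det (\<chi> i. R i) else 0)" for l
  proof -
    have "det2 j k (R l) P R = (\<Sum>m\<in>UNIV. x m * det2 j k (R l) (R m) R)"
      unfolding P by (simp add: linear_sum[OF right] linear_scale[OF right])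
    also have "\<dots> = (\<Sum>m\<in>UNIV. if m = (if l = j then k else j) then x m * (if l = j then det (\<chi> i. R i) else if l = k then - det (\<chi> i. R i) else 0) else 0)"
      unfolding 1 using jk by (intro sum.cong) auto
    finally show ?thesis using jk by auto
  qed
  have "det2 j k (s *\<^sub>R (\<Sum>l\<in>UNIV. e l *\<^sub>R R l) + t *\<^sub>R P) P R = s * (\<Sum>l\<in>UNIV. e l * det2 j k (R l) P R)"
    by (simp add: linear_add[OF left] linear_sum[OF left] linear_scale[OF left] det2_same[OF jk])
  also have "(\<Sum>l\<in>UNIV. e l * det2 j k (R l) P R) = (\<Sum>l\<in>UNIV. (if l = j then e j * x k * det (\<chi> i. R i) else 0) + (if l = k then - e k * x j * det (\<chi> i. R i) else 0))"
    unfolding 2 using jk by (intro sum.cong) auto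
  also have "\<dots> = (e j * x k - e k * x j) * det (\<chi> i. R i)"
    by (simp add: sum.distrib algebra_simps)
  finally show ?thesis by (simp add: mult_ac)
qed

lemma has_derivative_det:
  fixes R :: "'n::finite \<Rightarrow> 'a::real_normed_vector \<Rightarrow> real^'n"
  assumes "\<And>i. (R i has_derivative R' i) (at x)"
  shows "((\<lambda>x. det (\<chi> i. R i x)) has_derivative
    (\<lambda>h. \<Sum>i\<in>UNIV. det (\<chi> l. if l = i then R' i h else R l x))) (at x)"
proof -
  have d: "((\<lambda>x. R i x $ l) has_derivative (\<lambda>h. R' i h $ l)) (at x)" for i l
    using bounded_linear.has_derivative[OF bounded_linear_vec_nth assms] .
  have "((\<lambda>x. det (\<chi> i. R i x)) has_derivative
    (\<lambda>h. \<Sum>p\<in>{p. p permutes UNIV}. of_int (sign p) * (\<Sum>i\<in>UNIV. R' i h $ p i * (\<Prod>l\<in>UNIV - {i}. R l x $ p l)))) (at x)"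
    unfolding det_def vec_lambda_beta by (intro has_derivative_sum has_derivative_mult_right has_derivative_prod d)
  moreover have "(\<Sum>p\<in>{p. p permutes UNIV}. of_int (sign p) * (\<Sum>i\<in>UNIV. R' i h $ p i * (\<Prod>l\<in>UNIV - {i}. R l x $ p l))) =
    (\<Sum>i\<in>UNIV. det (\<chi> l. if l = i then R' i h else R l x))" for h
  proof -
    have "(\<Prod>l\<in>UNIV. (if l = i then R' i h else R l x) $ p l) = R' i h $ p i * (\<Prod>l\<in>UNIV - {i}. R l x $ p l)" for i p
      by (subst prod.remove[of UNIV i]) auto
    then show ?thesis
      unfolding det_def vec_lambda_beta by (simp add: sum_distrib_left sum.swap[of _ UNIV])
  qed
  ultimately show ?thesis by simp
qed

text \<open>A symmetric matrix is contracted with a determinant that is antisymmetric in the same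
  two indices.\<close>

lemma piola:
  fixes R :: "'n::finite \<Rightarrow> real^'n"
  assumes ij: "i \<noteq> j" and sym: "\<And>a b. S a $ b = S b $ a"
  shows "(\<Sum>a\<in>UNIV. det (\<chi> l. if l = i then S a else if l = j then axis a 1 else R l)) = 0"
proof -
  let ?D = "\<lambda>a b. det2 i j (axis a 1) (axis b 1) R"
  note left = linear_det2_left[of i j _ R]
  have eq: "det2 i j (S a) w R = (\<Sum>b\<in>UNIV. S a $ b * det2 i j (axis b 1) w R)" for a w
  proof -
    have "S a = (\<Sum>b\<in>UNIV. (S a $ b) *\<^sub>R axis b 1)"
      by (metis basis_expansion scalar_mult_eq_scaleR)
    then have "det2 i j (S a) w R = det2 i j (\<Sum>b\<in>UNIV. (S a $ b) *\<^sub>R axis b 1) w R" by simp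
    then show ?thesis by (simp add: linear_sum[OF left] linear_scale[OF left])
  qed
  define T where "T = (\<Sum>a\<in>UNIV. \<Sum>b\<in>UNIV. S a $ b * ?D b a)"
  have "T = (\<Sum>a\<in>UNIV. \<Sum>b\<in>UNIV. S b $ a * ?D a b)"
    unfolding T_def by (rule sum.swap)
  also have "\<dots> = - T"
    unfolding T_def sum_negf[symmetric] using det2_swap[OF ij] sym
    by (intro sum.cong refl) (metis mult_minus_right)
  finally have "T = 0" by simp
  then show ?thesis unfolding T_def eq[symmetric] by (simp add: det2_def)
qed

lemma gradient_eq_0_outside:
  fixes f :: "real^'n \<Rightarrow> real"
  assumes g: "\<And>x. (f has_derivative (\<lambda>h. g x \<bullet> h)) (at x)"
    and f: "\<And>x. x \<notin> cube z r \<Longrightarrow> f x = 0" and x: "x \<notin> cube z r"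
  shows "g x = 0"
proof -
  have "open (- cube z r)" by (simp add: cube_eq_cbox closed_cbox open_Compl)
  then have "eventually (\<lambda>y. y \<in> - cube z r) (nhds x)"
    using x by (intro eventually_nhds_in_open) auto
  then have ev: "eventually (\<lambda>y. f y = 0) (nhds x)"
    by eventually_elim (use f in auto)
  have "((\<lambda>y. 0) has_derivative (\<lambda>h. g x \<bullet> h)) (at x)"
    by (rule has_derivative_transform_eventually[OF g]) (use ev f x in \<open>auto simp: eventually_at_filter elim: eventually_mono\<close>)
  then have "(\<lambda>h. g x \<bullet> h) = (\<lambda>h. 0)"
    using has_derivative_unique has_derivative_const by blast
  then have "g x \<bullet> g x = 0" by metis
  then show ?thesis by simp
qed

text \<open>Convolution with the constant 1 is the constant function whose value is the integral of
  \<open>f\<close>. Its derivative vanishes, and by \<open>has_derivative_conv\<close> it is also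
  the integral of the partial derivatives. This gives the divergence theorem for compact
  support.\<close>

lemma integral_partial_eq_0:
  fixes f :: "real^'n \<Rightarrow> real"
  assumes g: "\<And>x. (f has_derivative (\<lambda>h. g x \<bullet> h)) (at x)" and cg: "continuous_on UNIV g"
    and f: "\<And>x. x \<notin> cube z r \<Longrightarrow> f x = 0"
  shows "(\<integral>x. g x $ i \<partial>lborel) = 0"
proof -
  define R where "R = \<bar>r\<bar> + norm z"
  have sub: "cube z r \<subseteq> cube 0 R"
  proof
    fix y assume y: "y \<in> cube z r"
    have "\<bar>y $ i\<bar> \<le> R" for i
      using y component_le_norm_cart[of z i] by (auto simp: cube_def R_def dest!: spec[of _ i])
    then show "y \<in> cube 0 R" by (simp add: cube_def)
  qed
  have g0: "g x = 0" if "x \<notin> cube z r" for x by (rule gradient_eq_0_outside[OF g f that])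
  have cf: "continuous_on UNIV f"
    using g by (auto simp: continuous_on_eq_continuous_within intro: has_derivative_continuous)
  have mf [measurable]: "f \<in> borel_measurable borel" "\<And>i. (\<lambda>x. g x $ i) \<in> borel_measurable borel"
    using cf cg by (auto intro!: borel_measurable_continuous_onI continuous_intros)
  have c1: "conv (\<lambda>_. 1) \<phi> x = (\<integral>y. \<phi> y \<partial>lborel)" if [measurable]: "\<phi> \<in> borel_measurable borel" for \<phi> :: "real^'n \<Rightarrow> real" and x
    unfolding conv_def using integral_lborel_affine[OF that, of "-1" x] by simp
  have "(conv (\<lambda>_. 1) f has_derivative (\<lambda>h. (\<chi> i. conv (\<lambda>_. 1) (\<lambda>z. g z $ i) 0) \<bullet> h)) (at 0)"
    by (rule has_derivative_conv[OF _ g cg, where R=R]) (use sub f g0 in auto)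
  moreover have "conv (\<lambda>_. 1) f = (\<lambda>x. \<integral>y. f y \<partial>lborel)" using c1[OF mf(1)] by auto
  ultimately have "(\<lambda>h. (\<chi> i. conv (\<lambda>_. 1) (\<lambda>z. g z $ i) (0::real^'n)) \<bullet> h) = (\<lambda>h. 0)"
    using has_derivative_unique has_derivative_const by metis
  then have "(\<chi> i. conv (\<lambda>_. 1) (\<lambda>z. g z $ i) (0::real^'n)) \<bullet> axis i 1 = 0" by metis
  then show ?thesis using c1[OF mf(2)] by (simp add: inner_axis)
qed

text \<open>By \<open>piola\<close> the cofactors \<open>C a\<close> of row \<open>j\<close> form a divergence-free field as soon as all other rows are
  gradients, so the integrand is a divergence.\<close>

lemma null_lagrangian:
  fixes \<zeta> :: "real^'n \<Rightarrow> real" and Z :: "real^'n \<Rightarrow> real^'n"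
    and R :: "'n \<Rightarrow> real^'n \<Rightarrow> real^'n" and S :: "'n \<Rightarrow> real^'n \<Rightarrow> real^'n^'n"
  assumes \<zeta>: "\<And>x. (\<zeta> has_derivative (\<lambda>h. Z x \<bullet> h)) (at x)" and Z: "continuous_on UNIV Z"
    and supp: "\<And>x. x \<notin> cube z r \<Longrightarrow> \<zeta> x = 0"
    and R: "\<And>i x. i \<noteq> j \<Longrightarrow> (R i has_derivative (\<lambda>h. S i x *v h)) (at x)"
    and S: "\<And>i. i \<noteq> j \<Longrightarrow> continuous_on UNIV (S i)" and sym: "\<And>i x a b. i \<noteq> j \<Longrightarrow> S i x $ a $ b = S i x $ b $ a"
  shows "(\<integral>x. det (\<chi> i. if i = j then Z x else R i x) \<partial>lborel) = 0"
proof -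
  define C where "C a x = det (\<chi> i. if i = j then axis a 1 else R i x)" for a :: 'n and x
  define C' where "C' a x = (\<chi> b. \<Sum>i\<in>UNIV - {j}. det (\<chi> l. if l = i then S i x *v axis b 1 else if l = j then axis a 1 else R l x))" for a :: 'n and x
  have cR: "continuous_on UNIV (R i)" if "i \<noteq> j" for i
    using R[OF that] by (auto simp: continuous_on_eq_continuous_within intro: has_derivative_continuous)
  have dC: "(C a has_derivative (\<lambda>h. C' a x \<bullet> h)) (at x)" for a x
  proof -
    have "((\<lambda>x. det (\<chi> i. (\<lambda>i x. if i = j then axis a 1 else R i x) i x)) has_derivative
      (\<lambda>h. \<Sum>i\<in>UNIV. det (\<chi> l. if l = i then (if i = j then 0 else S i x *v h) else (\<lambda>i x. if i = j then axis a 1 else R i x) l x))) (at x)"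
    proof (rule has_derivative_det)
      show "((\<lambda>x. if i = j then axis a 1 else R i x) has_derivative (\<lambda>h. if i = j then 0 else S i x *v h)) (at x)" for i
        using R[of i x] by (cases "i = j") auto
    qed
    moreover have "(\<Sum>i\<in>UNIV. det (\<chi> l. if l = i then (if i = j then 0 else S i x *v h) else if l = j then axis a 1 else R l x)) = C' a x \<bullet> h" for h
    proof -
      have "det (\<chi> l. if l = j then 0 else R' l) = 0" for R' :: "'n \<Rightarrow> real^'n"
        using linear_0[OF linear_det_row[of j R']] .
      then have 0: "det (\<chi> l. if l = j then (if j = j then 0 else S j x *v h) else if l = j then axis a 1 else R l x) = 0" by simp
      have "(\<Sum>i\<in>UNIV. det (\<chi> l. if l = i then (if i = j then 0 else S i x *v h) else if l = j then axis a 1 else R l x)) =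
        (\<Sum>i\<in>UNIV - {j}. det (\<chi> l. if l = i then S i x *v h else if l = j then axis a 1 else R l x))"
      proof -
        have "(\<Sum>i\<in>UNIV - {j}. det (\<chi> l. if l = i then (if i = j then 0 else S i x *v h) else if l = j then axis a 1 else R l x)) =
          (\<Sum>i\<in>UNIV - {j}. det (\<chi> l. if l = i then S i x *v h else if l = j then axis a 1 else R l x))"
        proof (rule sum.cong[OF refl])
          fix i assume "i \<in> UNIV - {j}"
          then have "i \<noteq> j" by simp
          then show "det (\<chi> l. if l = i then (if i = j then 0 else S i x *v h) else if l = j then axis a 1 else R l x) =
            det (\<chi> l. if l = i then S i x *v h else if l = j then axis a 1 else R l x)"
            by (simp only: if_False)
        qed
        then show ?thesis by (subst sum.remove[of UNIV j]) (simp_all only: finite UNIV_I 0 add_0_left)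
      qed
      also have "\<dots> = (\<Sum>i\<in>UNIV - {j}. \<Sum>b\<in>UNIV. h $ b * det (\<chi> l. if l = i then S i x *v axis b 1 else if l = j then axis a 1 else R l x))"
      proof (intro sum.cong refl)
        fix i
        note lin = linear_compose[OF matrix_vector_mul_linear[of "S i x"] linear_det_row[of i "\<lambda>l. if l = j then axis a 1 else R l x"], unfolded o_def]
        have "h = (\<Sum>b\<in>UNIV. (h $ b) *\<^sub>R axis b 1)" by (metis basis_expansion scalar_mult_eq_scaleR)
        then have "det (\<chi> l. if l = i then S i x *v h else if l = j then axis a 1 else R l x) =
          det (\<chi> l. if l = i then S i x *v (\<Sum>b\<in>UNIV. (h $ b) *\<^sub>R axis b 1) else if l = j then axis a 1 else R l x)"
          by (rule arg_cong[where f="\<lambda>h. det (\<chi> l. if l = i then S i x *v h else if l = j then axis a 1 else R l x)"])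
        also have "\<dots> = (\<Sum>b\<in>UNIV. h $ b * det (\<chi> l. if l = i then S i x *v axis b 1 else if l = j then axis a 1 else R l x))"
          by (simp add: linear_sum[OF lin] linear_scale[OF lin])
        finally show "det (\<chi> l. if l = i then S i x *v h else if l = j then axis a 1 else R l x) = \<dots>" .
      qed
      also have "\<dots> = C' a x \<bullet> h"
        unfolding C'_def inner_vec_def by (subst sum.swap) (simp add: sum_distrib_left mult.commute)
      finally show ?thesis .
    qed
    ultimately show ?thesis by (simp add: C_def[abs_def])
  qed
  have det_cont: "continuous_on UNIV (\<lambda>x. det (\<chi> l. f l x))" if "\<And>l. continuous_on UNIV (f l)" for f :: "'n \<Rightarrow> real^'n \<Rightarrow> real^'n"
    unfolding det_def vec_lambda_beta by (intro continuous_intros that)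
  have cC': "continuous_on UNIV (C' a)" for a
    unfolding C'_def
  proof (intro continuous_on_vec_lambda continuous_on_sum det_cont)
    fix b i l assume "i \<in> UNIV - {j}"
    then show "continuous_on UNIV (\<lambda>x. if l = i then S i x *v axis b 1 else if l = j then axis a 1 else R l x)"
      using cR[of l] S[of i]
      by (cases "l = i"; cases "l = j")
         (auto simp: matrix_vector_mult_def intro!: continuous_intros continuous_on_vec_lambda)
  qed
  have cC: "continuous_on UNIV (C a)" for a
    using dC by (auto simp: continuous_on_eq_continuous_within intro: has_derivative_continuous)
  have c\<zeta>: "continuous_on UNIV \<zeta>"
    using \<zeta> by (auto simp: continuous_on_eq_continuous_within intro: has_derivative_continuous)
  have Z0: "Z x = 0" if "x \<notin> cube z r" for x by (rule gradient_eq_0_outside[OF \<zeta> supp that])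
  have i1: "integrable lborel (\<lambda>x. Z x $ a * C a x)" for a
    by (rule integrable_continuous_compact_support[where z=z and r=r]) (use Z0 in \<open>auto intro!: continuous_intros Z cC\<close>)
  have i2: "integrable lborel (\<lambda>x. \<zeta> x * C' a x $ a)" for a
    by (rule integrable_continuous_compact_support[where z=z and r=r]) (use supp in \<open>auto intro!: continuous_intros c\<zeta> cC'\<close>)
  \<comment> \<open>Integration by parts in the direction a: the partial derivative of
    \<open>\<zeta>\<close> times the cofactor integrates to 0.\<close>
  have part: "(\<integral>x. Z x $ a * C a x \<partial>lborel) = - (\<integral>x. \<zeta> x * C' a x $ a \<partial>lborel)" for a
  proof -
    have "(\<integral>x. (C a x *\<^sub>R Z x + \<zeta> x *\<^sub>R C' a x) $ a \<partial>lborel) = 0"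
    proof (rule integral_partial_eq_0)
      show "((\<lambda>x. \<zeta> x * C a x) has_derivative (\<lambda>h. (C a x *\<^sub>R Z x + \<zeta> x *\<^sub>R C' a x) \<bullet> h)) (at x)" for x
        by (rule has_derivative_eq_rhs[OF has_derivative_mult[OF \<zeta> dC]]) (auto simp: inner_add_left algebra_simps)
    qed (use supp in \<open>auto intro!: continuous_intros Z c\<zeta> cC cC'\<close>)
    then show ?thesis using i1[of a] i2[of a] by (simp add: mult.commute)
  qed
  have "(\<integral>x. det (\<chi> i. if i = j then Z x else R i x) \<partial>lborel) = (\<integral>x. (\<Sum>a\<in>UNIV. Z x $ a * C a x) \<partial>lborel)"
  proof (rule Bochner_Integration.integral_cong[OF refl])
    fix x
    note lin = linear_det_row[of j "\<lambda>i. R i x"]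
    have "Z x = (\<Sum>a\<in>UNIV. (Z x $ a) *\<^sub>R axis a 1)" by (metis basis_expansion scalar_mult_eq_scaleR)
    then have "det (\<chi> i. if i = j then Z x else R i x) = det (\<chi> i. if i = j then (\<Sum>a\<in>UNIV. (Z x $ a) *\<^sub>R axis a 1) else R i x)"
      by (rule arg_cong[where f="\<lambda>h. det (\<chi> i. if i = j then h else R i x)"])
    also have "\<dots> = (\<Sum>a\<in>UNIV. Z x $ a * C a x)"
      by (simp add: linear_sum[OF lin] linear_scale[OF lin] C_def)
    finally show "det (\<chi> i. if i = j then Z x else R i x) = \<dots>" .
  qed
  also have "\<dots> = (\<Sum>a\<in>UNIV. \<integral>x. Z x $ a * C a x \<partial>lborel)" using i1 by simp
  also have "\<dots> = - (\<Sum>a\<in>UNIV. \<integral>x. \<zeta> x * C' a x $ a \<partial>lborel)" by (simp add: part sum_negf)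
  also have "(\<Sum>a\<in>UNIV. \<integral>x. \<zeta> x * C' a x $ a \<partial>lborel) = (\<integral>x. \<zeta> x * (\<Sum>a\<in>UNIV. C' a x $ a) \<partial>lborel)"
    using i2 by (simp add: sum_distrib_left)
  \<comment> \<open>The divergence of the cofactor field is a sum over the differentiated rows i;
    each summand vanishes by \<open>piola\<close>.\<close>
  also have "(\<lambda>x. \<zeta> x * (\<Sum>a\<in>UNIV. C' a x $ a)) = (\<lambda>x. 0)"
  proof
    fix x
    have "(\<Sum>a\<in>UNIV. C' a x $ a) = (\<Sum>i\<in>UNIV - {j}. \<Sum>a\<in>UNIV. det (\<chi> l. if l = i then S i x *v axis a 1 else if l = j then axis a 1 else R l x))"
      unfolding C'_def vec_lambda_beta by (rule sum.swap)
    also have "\<dots> = 0"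
    proof (rule sum.neutral, rule ballI)
      fix i assume "i \<in> UNIV - {j}"
      then show "(\<Sum>a\<in>UNIV. det (\<chi> l. if l = i then S i x *v axis a 1 else if l = j then axis a 1 else R l x)) = 0"
        by (intro piola) (auto simp: matrix_vector_mult_basis column_def sym)
    qed
    finally show "\<zeta> x * (\<Sum>a\<in>UNIV. C' a x $ a) = 0" by simp
  qed
  finally show ?thesis by simp
qed

lemma abs_det_le:
  fixes M :: "real^'n^'n"
  assumes "\<And>i l. \<bar>M $ i $ l\<bar> \<le> c i"
  shows "\<bar>det M\<bar> \<le> fact CARD('n) * (\<Prod>i\<in>UNIV. c i)"
proof -
  have "\<bar>det M\<bar> \<le> (\<Sum>p\<in>{p. p permutes (UNIV :: 'n set)}. \<bar>of_int (sign p) * (\<Prod>i\<in>UNIV. M $ i $ p i)\<bar>)"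
    unfolding det_def by (rule sum_abs)
  also have "\<dots> \<le> (\<Sum>p\<in>{p. p permutes (UNIV :: 'n set)}. (\<Prod>i\<in>UNIV. c i))"
  proof (rule sum_mono)
    fix p :: "'n \<Rightarrow> 'n"
    have "\<bar>of_int (sign p) * (\<Prod>i\<in>UNIV. M $ i $ p i)\<bar> = (\<Prod>i\<in>UNIV. \<bar>M $ i $ p i\<bar>)"
      by (simp add: abs_mult sign_def abs_prod)
    also have "\<dots> \<le> (\<Prod>i\<in>UNIV. c i)" by (intro prod_mono) (use assms in auto)
    finally show "\<bar>of_int (sign p) * (\<Prod>i\<in>UNIV. M $ i $ p i)\<bar> \<le> (\<Prod>i\<in>UNIV. c i)" .
  qed
  also have "\<dots> = fact CARD('n) * (\<Prod>i\<in>UNIV. c i)"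
    by (simp add: card_permutations[of UNIV "CARD('n)"])
  finally show ?thesis .
qed

text \<open>Only n - 2 rows have the size of the Hessian. This power of \<open>h\<close> determines
  the exponents in the level set estimate.\<close>

lemma abs_det2_le:
  fixes R :: "'n::finite \<Rightarrow> real^'n"
  assumes jk: "j \<noteq> k" and "norm v \<le> V" "norm w \<le> W" and "\<And>i l. \<bar>R i $ l\<bar> \<le> h"
  shows "\<bar>det2 j k v w R\<bar> \<le> fact CARD('n) * (V * W * h ^ (CARD('n) - 2))"
proof -
  define c where "c i = (if i = j then V else if i = k then W else h)" for i
  have "\<bar>det2 j k v w R\<bar> \<le> fact CARD('n) * (\<Prod>i\<in>UNIV. c i)"
    unfolding det2_def
  proof (rule abs_det_le)
    show "\<bar>(\<chi> i. if i = j then v else if i = k then w else R i) $ i $ l\<bar> \<le> c i" for i l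
      using assms component_le_norm_cart[of v l] component_le_norm_cart[of w l] by (auto simp: c_def)
  qed
  also have "(\<Prod>i\<in>UNIV. c i) = c j * (c k * (\<Prod>i\<in>UNIV - {j} - {k}. c i))"
    using jk by (subst prod.remove[of UNIV j], simp, simp, subst prod.remove[of "UNIV - {j}" k]) auto
  also have "(\<Prod>i\<in>UNIV - {j} - {k}. c i) = (\<Prod>i\<in>UNIV - {j} - {k}. h)"
    by (rule prod.cong) (auto simp: c_def)
  also have "\<dots> = h ^ (CARD('n) - 2)"
    using jk by (simp add: card_Diff_singleton numeral_2_eq_2)
  finally show ?thesis using jk by (simp add: c_def mult.assoc)
qed

subsection \<open>The weak Hessian and its homogeneity\<close>

lemma nn_integral_le_all_imp_AE_0:
  fixes f :: "'a \<Rightarrow> ennreal"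
  assumes [measurable]: "f \<in> borel_measurable M" and "\<And>\<eta>. \<eta> > 0 \<Longrightarrow> (\<integral>\<^sup>+x. f x \<partial>M) \<le> ennreal \<eta>"
  shows "AE x in M. f x = 0"
proof -
  have "(\<integral>\<^sup>+x. f x \<partial>M) \<le> 0 + ennreal e" if "e > 0" for e using assms(2)[OF that] by simp
  then have "(\<integral>\<^sup>+x. f x \<partial>M) \<le> 0" by (rule ennreal_le_epsilon)
  then show ?thesis by (simp add: nn_integral_0_iff_AE)
qed

lemma mollifier_scale:
  assumes "s > 0" "\<epsilon> > 0"
  shows "mollifier (s * \<epsilon>) = (\<lambda>x :: real^'n. (inverse s) ^ CARD('n) * mollifier \<epsilon> ((- inverse s) *\<^sub>R (0 - x)))"
  by (rule ext) (simp add: mollifier_def power_mult_distrib mult_ac)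

text \<open>Homogeneity converts a dilation of the argument into a dilation of the mollification
  radius; every derivative lowers the degree by one.\<close>

lemma conv_scale:
  fixes u :: "real^'n \<Rightarrow> real"
  assumes hom: "\<And>t x. t > 0 \<Longrightarrow> u (t *\<^sub>R x) = t powr \<alpha> * u x" and u: "continuous_on UNIV u"
    and s: "s > 0" and e: "\<epsilon> > 0"
  shows "conv u (partial_derivs js (mollifier (s * \<epsilon>))) (s *\<^sub>R x) =
    s powr (\<alpha> - length js) * conv u (partial_derivs js (mollifier \<epsilon>)) x"
proof -
  have [measurable]: "u \<in> borel_measurable borel" using u by (rule borel_measurable_continuous_onI)
  have "conv u (partial_derivs js (mollifier (s * \<epsilon>))) (s *\<^sub>R x) =
    \<bar>s\<bar> ^ CARD('n) * (\<integral>y. u (0 + s *\<^sub>R y) * partial_derivs js (mollifier (s * \<epsilon>)) (s *\<^sub>R x - (0 + s *\<^sub>R y)) \<partial>lborel)"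
    unfolding conv_def using s by (intro integral_lborel_affine) auto
  also have "\<dots> = s ^ CARD('n) * (\<integral>y. (s powr \<alpha> * inverse s ^ CARD('n) * inverse s ^ length js) * (u y * partial_derivs js (mollifier \<epsilon>) (x - y)) \<partial>lborel)"
    unfolding mollifier_scale[OF s e] partial_derivs_affine(1)[OF smooth_mollifier]
    using s by (simp add: hom scaleR_diff_right[symmetric] mult_ac)
  also have "\<dots> = s powr (\<alpha> - length js) * conv u (partial_derivs js (mollifier \<epsilon>)) x"
    using s unfolding integral_mult_right_zero conv_def by (simp add: powr_diff powr_realpow field_simps power_inverse)
  finally show ?thesis .
qed

lemma test_function_mollifier:
  fixes x :: "real^'n"
  assumes e: "\<epsilon> > 0" and x: "0 \<notin> cube x \<epsilon>"
  shows "test_function_on (UNIV - {0}) (\<lambda>y. mollifier \<epsilon> (x - y))"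
proof -
  let ?\<phi> = "\<lambda>y. mollifier \<epsilon> (x - y)"
  have sub: "closure {y. ?\<phi> y \<noteq> 0} \<subseteq> cube x \<epsilon>"
  proof (rule closure_minimal)
    show "{y. ?\<phi> y \<noteq> 0} \<subseteq> cube x \<epsilon>"
    proof
      fix y assume "y \<in> {y. ?\<phi> y \<noteq> 0}"
      then have "x - y \<in> cube 0 \<epsilon>" using mollifier_eq_0[OF e] by auto
      then show "y \<in> cube x \<epsilon>" by (auto simp: cube_def abs_minus_commute)
    qed
  qed (simp add: compact_imp_closed)
  have "compact (closure {y. ?\<phi> y \<noteq> 0})"
    using compact_Int_closed[OF compact_cube[of x \<epsilon>] closed_closure[of "{y. ?\<phi> y \<noteq> 0}"]] sub by (simp add: inf.absorb2)
  then show ?thesis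
    using sub x smooth_affine[OF smooth_mollifier, of 1 \<epsilon> 1 x] unfolding test_function_on_def by auto
qed

text \<open>\<open>H\<close> consists of Borel representatives of the weak second derivatives, and \<open>\<sigma>\<close> carries the
  sign of the Hessian determinant.\<close>

locale hessian_setup =
  fixes u :: "real^'n \<Rightarrow> real" and H :: "'n \<Rightarrow> 'n \<Rightarrow> real^'n \<Rightarrow> real" and \<alpha> p \<sigma> :: real
  assumes n2: "CARD('n) \<ge> 2" and \<alpha>: "0 < \<alpha>" "\<alpha> < 1"
    and hom: "\<And>t x. t > 0 \<Longrightarrow> u (t *\<^sub>R x) = t powr \<alpha> * u x"
    and cont: "continuous_on UNIV u"
    and p1: "p > 1" and pn: "p > (real CARD('n) - 1) * (real CARD('n) - 2)"
    and Hm [measurable]: "\<And>i j. H i j \<in> borel_measurable borel"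
    and Hp: "\<And>C i j. compact C \<Longrightarrow> 0 \<notin> C \<Longrightarrow> set_integrable lborel C (\<lambda>x. \<bar>H i j x\<bar> powr p)"
    and weak: "\<And>\<phi> i j. test_function_on (UNIV - {0}) \<phi> \<Longrightarrow>
      (\<integral>x. u x * partial_derivs [j, i] \<phi> x \<partial>lborel) = (\<integral>x. H i j x * \<phi> x \<partial>lborel)"
    and pos: "\<And>C. compact C \<Longrightarrow> 0 \<notin> C \<Longrightarrow>
      \<exists>c>0. AE x in lborel. x \<in> C \<longrightarrow> c \<le> \<sigma> * det (\<chi> i j. H i j x)"
begin

text \<open>Mollification with its first and second partial derivatives. The derivatives sit on the
  kernel, so all three are smooth on the whole space, even near the origin, where the weak Hessian
  is not controlled.\<close>

definition "ul \<epsilon> = conv u (mollifier \<epsilon>)"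
definition "Pl \<epsilon> i = conv u (partial_derivs [i] (mollifier \<epsilon>))"
definition "Al \<epsilon> i j = conv u (partial_derivs [j, i] (mollifier \<epsilon>))"

lemma u_measurable [measurable]: "u \<in> borel_measurable borel"
  using cont by (rule borel_measurable_continuous_onI)

text \<open>For n = 2 this is p > 1, and for n \<ge> 3 the factor n - 2 is at least 1. Hoelder
  continuity of the gradient and integrability of the determinants rest on this bound; the larger
  threshold decides the comparison of exponents in \<open>no_transversal_max\<close>.\<close>

lemma p_gt_n1: "p > real CARD('n) - 1"
proof (cases "CARD('n) = 2")
  case True then show ?thesis using p1 by simp
next
  case False
  then have "real CARD('n) \<ge> 3" using n2 by linarith
  then have "(real CARD('n) - 1) * 1 \<le> (real CARD('n) - 1) * (real CARD('n) - 2)" by (intro mult_left_mono) auto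
  then show ?thesis using pn by simp
qed

lemma has_derivative_ul: "\<epsilon> > 0 \<Longrightarrow> (ul \<epsilon> has_derivative (\<lambda>h. (\<chi> i. Pl \<epsilon> i x) \<bullet> h)) (at x)"
  using has_derivative_conv_mollifier[OF cont, of \<epsilon> "[]" x] by (simp add: ul_def[abs_def] Pl_def)

lemma has_derivative_Pl: "\<epsilon> > 0 \<Longrightarrow> (Pl \<epsilon> i has_derivative (\<lambda>h. (\<chi> j. Al \<epsilon> i j x) \<bullet> h)) (at x)"
  using has_derivative_conv_mollifier[OF cont, of \<epsilon> "[i]" x] by (simp add: Pl_def[abs_def] Al_def)

lemma has_derivative_Al: "\<epsilon> > 0 \<Longrightarrow> (Al \<epsilon> i j has_derivative (\<lambda>h. (\<chi> k. conv u (partial_derivs [k, j, i] (mollifier \<epsilon>)) x) \<bullet> h)) (at x)"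
  using has_derivative_conv_mollifier[OF cont, of \<epsilon> "[j, i]" x] by (simp add: Al_def[abs_def])

lemma continuous_on_ul: "\<epsilon> > 0 \<Longrightarrow> continuous_on UNIV (ul \<epsilon>)"
  and continuous_on_Pl: "\<epsilon> > 0 \<Longrightarrow> continuous_on UNIV (Pl \<epsilon> i)"
  and continuous_on_Al: "\<epsilon> > 0 \<Longrightarrow> continuous_on UNIV (Al \<epsilon> i j)"
  using continuous_on_conv_mollifier[OF cont, of \<epsilon> "[]"] continuous_on_conv_mollifier[OF cont, of \<epsilon> "[i]"]
    continuous_on_conv_mollifier[OF cont, of \<epsilon> "[j, i]"]
  by (simp_all add: ul_def Pl_def Al_def)

text \<open>The reflected mollifier around x is a test function as long as its support avoids the
  origin.\<close>

lemma Al_eq_conv: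
  assumes e: "\<epsilon> > 0" and x: "0 \<notin> cube x \<epsilon>"
  shows "Al \<epsilon> i j x = conv (H i j) (mollifier \<epsilon>) x"
proof -
  note w = weak[OF test_function_mollifier[OF e x], of j i]
  have "partial_derivs [j, i] (\<lambda>y. mollifier \<epsilon> (x - y)) = (\<lambda>y. partial_derivs [j, i] (mollifier \<epsilon>) (x - y))"
    using partial_derivs_affine(1)[OF smooth_mollifier, of "[j, i]" 1 \<epsilon> 1 x] by (simp del: partial_derivs.simps)
  then show ?thesis using w unfolding Al_def conv_def by simp
qed

lemma H_Lp_conv:
  assumes r: "r \<ge> 0" and d: "d > 0" and z: "0 \<notin> cube z (r + d)" and \<eta>: "\<eta> > 0"
  obtains \<epsilon>0 where "\<epsilon>0 > 0" "\<epsilon>0 \<le> d"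
    "\<And>\<epsilon>. \<lbrakk>0 < \<epsilon>; \<epsilon> < \<epsilon>0\<rbrakk> \<Longrightarrow>
       (\<integral>\<^sup>+x. ennreal (\<bar>Al \<epsilon> i j x - H i j x\<bar> powr p) * indicator (cube z r) x \<partial>lborel) \<le> ennreal \<eta>"
proof -
  obtain e0 where e0: "e0 > 0" "e0 \<le> d" "\<And>\<epsilon>. \<lbrakk>0 < \<epsilon>; \<epsilon> < e0\<rbrakk> \<Longrightarrow>
       (\<integral>\<^sup>+x. ennreal (\<bar>conv (H i j) (mollifier \<epsilon>) x - H i j x\<bar> powr p) * indicator (cube z r) x \<partial>lborel) \<le> ennreal \<eta>"
    using conv_Lp_convergence[OF Hm[of i j] less_imp_le[OF p1] r d Hp[OF compact_cube z, of i j] \<eta>] by blast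
  show ?thesis
  proof (rule that[OF e0(1,2)])
    fix \<epsilon> assume e: "0 < \<epsilon>" "\<epsilon> < e0"
    have "Al \<epsilon> i j x = conv (H i j) (mollifier \<epsilon>) x" if "x \<in> cube z r" for x
    proof (rule Al_eq_conv[OF e(1)])
      show "0 \<notin> cube x \<epsilon>"
      proof
        assume "0 \<in> cube x \<epsilon>"
        then have "x - 0 \<in> cube 0 \<epsilon>" by (simp add: cube_def)
        from cube_sub_cube[OF that this] have "0 \<in> cube z (r + d)"
          using cube_mono[of "r + \<epsilon>" "r + d" z] e e0 by auto
        then show False using z by simp
      qed
    qed
    then have "(\<integral>\<^sup>+x. ennreal (\<bar>Al \<epsilon> i j x - H i j x\<bar> powr p) * indicator (cube z r) x \<partial>lborel) =
      (\<integral>\<^sup>+x. ennreal (\<bar>conv (H i j) (mollifier \<epsilon>) x - H i j x\<bar> powr p) * indicator (cube z r) x \<partial>lborel)"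
      by (intro nn_integral_cong) (auto simp: indicator_def)
    then show "(\<integral>\<^sup>+x. ennreal (\<bar>Al \<epsilon> i j x - H i j x\<bar> powr p) * indicator (cube z r) x \<partial>lborel) \<le> ennreal \<eta>"
      using e0(3)[OF e] by simp
  qed
qed

lemma Al_measurable [measurable]: "Al \<epsilon> i j \<in> borel_measurable borel"
  unfolding Al_def by measurable

text \<open>The mollified second derivatives scale exactly if the radius is scaled as well, and the
  identity passes to the L^p limit. The exceptional null set depends on \<open>s\<close>, which is
  therefore fixed in advance.\<close>

lemma H_hom_AE:
  assumes s: "s > 0" and r: "r \<ge> 0" and d: "d > 0" and z: "0 \<notin> cube z (r + d)"
  shows "AE x in lborel. x \<in> cube z r \<longrightarrow> H i j (s *\<^sub>R x) = s powr (\<alpha> - 2) * H i j x"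
proof -
  let ?D = "\<lambda>x. H i j (s *\<^sub>R x) - s powr (\<alpha> - 2) * H i j x"
  have mem: "s *\<^sub>R x \<in> cube (s *\<^sub>R z) (s * \<rho>) \<longleftrightarrow> x \<in> cube z \<rho>" for x \<rho>
    using s by (simp add: cube_def right_diff_distrib[symmetric] abs_mult)
  have z': "0 \<notin> cube (s *\<^sub>R z) (s * r + s * d)"
    using z mem[of 0 "r + d"] by (simp add: distrib_left)
  have sr: "s * r \<ge> 0" and sd: "s * d > 0" using s r d by auto
  \<comment> \<open>Dominates both the Jacobian of the dilation and the p-th power of the
    homogeneity factor.\<close>
  define B where "B = max 1 (max (inverse s ^ CARD('n)) ((s powr (\<alpha> - 2)) powr p))"
  have B: "B \<ge> 1" "inverse s ^ CARD('n) \<le> B" "(s powr (\<alpha> - 2)) powr p \<le> B" by (auto simp: B_def)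
  have "AE x in lborel. ennreal (\<bar>?D x\<bar> powr p) * indicator (cube z r) x = 0"
  proof (rule nn_integral_le_all_imp_AE_0)
    fix \<eta> :: real assume \<eta>: "\<eta> > 0"
    define \<eta>' where "\<eta>' = \<eta> / (2 * 3 powr p * B)"
    have \<eta>': "\<eta>' > 0" using \<eta> B by (simp add: \<eta>'_def)
    obtain e1 where e1: "e1 > 0" "\<And>\<epsilon>. \<lbrakk>0 < \<epsilon>; \<epsilon> < e1\<rbrakk> \<Longrightarrow>
       (\<integral>\<^sup>+x. ennreal (\<bar>Al \<epsilon> i j x - H i j x\<bar> powr p) * indicator (cube z r) x \<partial>lborel) \<le> ennreal \<eta>'"
      using H_Lp_conv[OF r d z \<eta>', of i j] by blast
    obtain e2 where e2: "e2 > 0" "\<And>\<epsilon>. \<lbrakk>0 < \<epsilon>; \<epsilon> < e2\<rbrakk> \<Longrightarrow>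
       (\<integral>\<^sup>+x. ennreal (\<bar>Al \<epsilon> i j x - H i j x\<bar> powr p) * indicator (cube (s *\<^sub>R z) (s * r)) x \<partial>lborel) \<le> ennreal \<eta>'"
      using H_Lp_conv[OF sr sd z' \<eta>', of i j] by blast
    define \<epsilon> where "\<epsilon> = min (e1 / 2) (e2 / (2 * s))"
    have e: "\<epsilon> > 0" "\<epsilon> < e1" "s * \<epsilon> < e2" "s * \<epsilon> > 0"
    proof -
      show "\<epsilon> > 0" "\<epsilon> < e1" using e1 e2 s by (auto simp: \<epsilon>_def)
      then show "s * \<epsilon> > 0" using s by simp
      have "s * \<epsilon> \<le> s * (e2 / (2 * s))" using s by (intro mult_left_mono) (auto simp: \<epsilon>_def)
      then show "s * \<epsilon> < e2" using s e2(1) by simp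
    qed
    have sc: "Al (s * \<epsilon>) i j (s *\<^sub>R x) = s powr (\<alpha> - 2) * Al \<epsilon> i j x" for x
      using conv_scale[OF hom cont s e(1), of "[j, i]" x] by (simp add: Al_def)
    have "(\<integral>\<^sup>+x. ennreal (\<bar>?D x\<bar> powr p) * indicator (cube z r) x \<partial>lborel) \<le>
      (\<integral>\<^sup>+x. ennreal (3 powr p) * (ennreal (\<bar>Al (s * \<epsilon>) i j (s *\<^sub>R x) - H i j (s *\<^sub>R x)\<bar> powr p) * indicator (cube (s *\<^sub>R z) (s * r)) (s *\<^sub>R x)
        + ennreal B * (ennreal (\<bar>Al \<epsilon> i j x - H i j x\<bar> powr p) * indicator (cube z r) x)) \<partial>lborel)"
    proof (rule nn_integral_mono)
      fix x
      have "\<bar>?D x\<bar> powr p = \<bar>- (Al (s * \<epsilon>) i j (s *\<^sub>R x) - H i j (s *\<^sub>R x)) + s powr (\<alpha> - 2) * (Al \<epsilon> i j x - H i j x) + 0\<bar> powr p"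
        unfolding sc by (simp add: algebra_simps)
      also have "\<dots> \<le> 3 powr p * (\<bar>- (Al (s * \<epsilon>) i j (s *\<^sub>R x) - H i j (s *\<^sub>R x))\<bar> powr p + \<bar>s powr (\<alpha> - 2) * (Al \<epsilon> i j x - H i j x)\<bar> powr p + \<bar>0\<bar> powr p)"
        using p1 by (intro powr_abs_add_le) auto
      also have "\<dots> = 3 powr p * (\<bar>Al (s * \<epsilon>) i j (s *\<^sub>R x) - H i j (s *\<^sub>R x)\<bar> powr p + (s powr (\<alpha> - 2)) powr p * \<bar>Al \<epsilon> i j x - H i j x\<bar> powr p)"
        by (simp add: abs_mult powr_mult abs_minus_commute)
      also have "\<dots> \<le> 3 powr p * (\<bar>Al (s * \<epsilon>) i j (s *\<^sub>R x) - H i j (s *\<^sub>R x)\<bar> powr p + B * \<bar>Al \<epsilon> i j x - H i j x\<bar> powr p)"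
        using B by (intro mult_left_mono add_left_mono mult_right_mono) auto
      finally have "ennreal (\<bar>?D x\<bar> powr p) \<le> ennreal (3 powr p) * (ennreal (\<bar>Al (s * \<epsilon>) i j (s *\<^sub>R x) - H i j (s *\<^sub>R x)\<bar> powr p) + ennreal B * ennreal (\<bar>Al \<epsilon> i j x - H i j x\<bar> powr p))"
        using B by (simp add: ennreal_mult'[symmetric] ennreal_plus[symmetric] del: ennreal_plus)
      then show "ennreal (\<bar>?D x\<bar> powr p) * indicator (cube z r) x \<le> ennreal (3 powr p) * (ennreal (\<bar>Al (s * \<epsilon>) i j (s *\<^sub>R x) - H i j (s *\<^sub>R x)\<bar> powr p) * indicator (cube (s *\<^sub>R z) (s * r)) (s *\<^sub>R x)
        + ennreal B * (ennreal (\<bar>Al \<epsilon> i j x - H i j x\<bar> powr p) * indicator (cube z r) x))"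
        by (auto simp: indicator_def mem)
    qed
    also have "\<dots> = ennreal (3 powr p) * ((\<integral>\<^sup>+x. ennreal (\<bar>Al (s * \<epsilon>) i j (s *\<^sub>R x) - H i j (s *\<^sub>R x)\<bar> powr p) * indicator (cube (s *\<^sub>R z) (s * r)) (s *\<^sub>R x) \<partial>lborel)
        + ennreal B * (\<integral>\<^sup>+x. ennreal (\<bar>Al \<epsilon> i j x - H i j x\<bar> powr p) * indicator (cube z r) x \<partial>lborel))"
      by (simp add: nn_integral_cmult nn_integral_add)
    also have "(\<integral>\<^sup>+x. ennreal (\<bar>Al (s * \<epsilon>) i j (s *\<^sub>R x) - H i j (s *\<^sub>R x)\<bar> powr p) * indicator (cube (s *\<^sub>R z) (s * r)) (s *\<^sub>R x) \<partial>lborel) =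
       ennreal (\<bar>inverse s\<bar> ^ CARD('n)) * (\<integral>\<^sup>+x. ennreal (\<bar>Al (s * \<epsilon>) i j x - H i j x\<bar> powr p) * indicator (cube (s *\<^sub>R z) (s * r)) x \<partial>lborel)"
      using s by (subst nn_integral_lborel_affine[where c="inverse s" and t=0]) auto
    also have "ennreal (3 powr p) * (ennreal (\<bar>inverse s\<bar> ^ CARD('n)) * (\<integral>\<^sup>+x. ennreal (\<bar>Al (s * \<epsilon>) i j x - H i j x\<bar> powr p) * indicator (cube (s *\<^sub>R z) (s * r)) x \<partial>lborel)
        + ennreal B * (\<integral>\<^sup>+x. ennreal (\<bar>Al \<epsilon> i j x - H i j x\<bar> powr p) * indicator (cube z r) x \<partial>lborel)) \<le>
       ennreal (3 powr p) * (ennreal B * ennreal \<eta>' + ennreal B * ennreal \<eta>')"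
      using s B by (intro mult_left_mono add_mono mult_mono e1(2) e2(2) e) (auto intro: ennreal_leI)
    also have "\<dots> = ennreal \<eta>"
    proof -
      have "3 powr p * (B * \<eta>' + B * \<eta>') = \<eta>" using B by (simp add: \<eta>'_def)
      moreover have "ennreal (3 powr p * (B * \<eta>' + B * \<eta>')) = ennreal (3 powr p) * (ennreal B * ennreal \<eta>' + ennreal B * ennreal \<eta>')"
        using B \<eta>' by (subst ennreal_mult', simp, subst ennreal_plus) (simp_all add: ennreal_mult')
      ultimately show ?thesis by simp
    qed
    finally show "(\<integral>\<^sup>+x. ennreal (\<bar>?D x\<bar> powr p) * indicator (cube z r) x \<partial>lborel) \<le> ennreal \<eta>" .
  qed measurable
  then show ?thesis by eventually_elim (use p1 in \<open>auto simp: indicator_def split: if_splits\<close>)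
qed

end

section \<open>Tubes over cubes and the gain of one dimension\<close>

definition tube :: "real \<Rightarrow> real^'n \<Rightarrow> real \<Rightarrow> (real^'n) set" where
  "tube c x \<rho> = {s *\<^sub>R y |s y. s \<in> {1..1 + c} \<and> y \<in> cube x \<rho>}"

lemma compact_tube: "compact (tube c x \<rho>)"
proof -
  have "tube c x \<rho> = (\<lambda>(s, y). s *\<^sub>R y) ` ({1..1 + c} \<times> cube x \<rho>)" by (force simp: tube_def)
  then show ?thesis
    by (auto intro!: compact_continuous_image compact_Times continuous_intros simp: split_beta)
qed

lemma tube_borel [measurable]: "tube c x \<rho> \<in> sets borel"
  using compact_tube by (rule borel_compact)

lemma tube_mono: "cube x \<rho> \<subseteq> cube y r \<Longrightarrow> tube c x \<rho> \<subseteq> tube c y r"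
  by (auto simp: tube_def)

text \<open>About \<open>c / \<rho>\<close> dilates of the cube are disjoint and contained in the tube, and homogeneity makes
  the integral over each of them comparable to the integral over the cube.\<close>

lemma packing:
  fixes f :: "real^'n \<Rightarrow> ennreal" and x :: "real^'n" and c \<rho> \<eta> \<kappa> :: real
  assumes [measurable]: "f \<in> borel_measurable borel"
    and c: "0 < c" "c \<le> 1" and \<rho>: "0 < \<rho>" and \<eta>: "\<eta> > 0" "\<And>y. y \<in> cube x \<rho> \<Longrightarrow> norm y \<ge> \<eta>"
    and hom: "\<And>s. s \<in> {1..1 + c} \<Longrightarrow> AE y in lborel. y \<in> cube x \<rho> \<longrightarrow> f (s *\<^sub>R y) = ennreal (s powr \<kappa>) * f y"
  shows "(\<integral>\<^sup>+y. f y * indicator (cube x \<rho>) y \<partial>lborel) \<le>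
    ennreal (5 * real CARD('n) / (\<eta> * c) * 2 powr \<bar>real CARD('n) + \<kappa>\<bar> * \<rho>) * (\<integral>\<^sup>+y. f y * indicator (tube c x \<rho>) y \<partial>lborel)"
proof -
  let ?n = "real CARD('n)"
  \<comment> \<open>Norms vary by at most 2 n \<rho> on the cube and dilation factors are at most 2.
    Two overlapping dilates would thus have factors differing by at most 4 n \<rho> / \<eta>, less
    than the spacing \<Lambda> \<rho>.\<close>
  define \<Lambda> where "\<Lambda> = 5 * ?n / \<eta>"
  have \<Lambda>: "\<Lambda> > 0" using \<eta> by (simp add: \<Lambda>_def)
  define N where "N = nat \<lfloor>c / (\<Lambda> * \<rho>)\<rfloor>"
  have N: "real N \<le> c / (\<Lambda> * \<rho>)" "real (Suc N) \<ge> c / (\<Lambda> * \<rho>)"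
  proof -
    have "c / (\<Lambda> * \<rho>) \<ge> 0" using c \<Lambda> \<rho> by simp
    then show "real N \<le> c / (\<Lambda> * \<rho>)" "real (Suc N) \<ge> c / (\<Lambda> * \<rho>)" unfolding N_def by linarith+
  qed
  define s where "s a = 1 + real a * (\<Lambda> * \<rho>)" for a :: nat
  have s: "s a \<in> {1..1 + c}" if "a \<le> N" for a
  proof -
    have "real a * (\<Lambda> * \<rho>) \<le> real N * (\<Lambda> * \<rho>)" using that \<Lambda> \<rho> by (intro mult_right_mono) auto
    also have "\<dots> \<le> c" using N(1) \<Lambda> \<rho> by (simp add: field_simps)
    finally show ?thesis using \<Lambda> \<rho> by (simp add: s_def)
  qed
  define Q where "Q a = (\<lambda>y. s a *\<^sub>R y) ` cube x \<rho>" for a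
  define I where "I = (\<integral>\<^sup>+y. f y * indicator (cube x \<rho>) y \<partial>lborel)"
  \<comment> \<open>A lower bound for s^(n + \<kappa>) on the interval from 1 to 2, whatever the
    sign of the exponent. It combines the Jacobian s^n with the homogeneity factor of
    \<open>f\<close>.\<close>
  define m where "m = 2 powr - \<bar>?n + \<kappa>\<bar>"
  have Qm [measurable]: "Q a \<in> sets borel" for a
    unfolding Q_def by (intro borel_compact compact_continuous_image continuous_intros) auto
  have QI: "ennreal m * I \<le> (\<integral>\<^sup>+y. f y * indicator (Q a) y \<partial>lborel)" if a: "a \<le> N" for a
  proof -
    have sp: "s a > 0" "s a \<le> 2" "s a \<ge> 1" using s[OF a] c by auto
    have mem: "s a *\<^sub>R y \<in> Q a \<longleftrightarrow> y \<in> cube x \<rho>" for y using sp by (auto simp: Q_def)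
    have "(\<integral>\<^sup>+y. f y * indicator (Q a) y \<partial>lborel) =
      ennreal (\<bar>s a\<bar> ^ CARD('n)) * (\<integral>\<^sup>+y. f (0 + s a *\<^sub>R y) * indicator (Q a) (0 + s a *\<^sub>R y) \<partial>lborel)"
      using sp by (intro nn_integral_lborel_affine) auto
    also have "(\<integral>\<^sup>+y. f (0 + s a *\<^sub>R y) * indicator (Q a) (0 + s a *\<^sub>R y) \<partial>lborel) = (\<integral>\<^sup>+y. ennreal (s a powr \<kappa>) * (f y * indicator (cube x \<rho>) y) \<partial>lborel)"
      using hom[OF s[OF a]] by (intro nn_integral_cong_AE, eventually_elim) (auto simp: indicator_def mem mult_ac)
    also have "\<dots> = ennreal (s a powr \<kappa>) * I" unfolding I_def by (rule nn_integral_cmult) measurable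
    finally have e: "(\<integral>\<^sup>+y. f y * indicator (Q a) y \<partial>lborel) = ennreal (s a ^ CARD('n) * s a powr \<kappa>) * I"
      using sp by (simp add: ennreal_mult' mult.assoc)
    have "m \<le> s a powr (- \<bar>?n + \<kappa>\<bar>)" unfolding m_def using sp by (intro powr_mono2') auto
    also have "\<dots> \<le> s a powr (?n + \<kappa>)" using sp by (intro powr_mono) auto
    also have "\<dots> = s a ^ CARD('n) * s a powr \<kappa>" using sp by (simp add: powr_add powr_realpow)
    finally show ?thesis unfolding e by (intro mult_right_mono ennreal_leI) auto
  qed
  have norm_diff: "norm y - norm y' \<le> 2 * ?n * \<rho>" if "y \<in> cube x \<rho>" "y' \<in> cube x \<rho>" for y y'
    using cube_norm_le[OF that(1)] cube_norm_le[OF that(2)] norm_triangle_ineq2[of y x] norm_triangle_ineq2[of x y']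
    by (simp add: norm_minus_commute)
  have disj: "Q a \<inter> Q b = {}" if ab: "b < a" "a \<le> N" for a b
  proof (rule ccontr)
    assume "Q a \<inter> Q b \<noteq> {}"
    then obtain y y' where y: "y \<in> cube x \<rho>" "y' \<in> cube x \<rho>" "s a *\<^sub>R y = s b *\<^sub>R y'" by (auto simp: Q_def)
    have sb: "s b \<in> {1..1 + c}" "s a \<in> {1..1+c}" using s ab by auto
    have "s a * norm y = s b * norm y'"
      using arg_cong[OF y(3), of norm] sb by simp
    then have "(s a - s b) * norm y = s b * (norm y' - norm y)" by (simp add: algebra_simps)
    also have "\<dots> \<le> 2 * (2 * ?n * \<rho>)"
    proof -
      have "s b * (norm y' - norm y) \<le> s b * (2 * ?n * \<rho>)" using norm_diff[OF y(2,1)] sb by (intro mult_left_mono) auto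
      also have "\<dots> \<le> 2 * (2 * ?n * \<rho>)" using sb c \<rho> by (intro mult_right_mono) auto
      finally show ?thesis .
    qed
    also have "\<dots> < 5 * ?n * \<rho>" using \<rho> by simp
    also have "5 * ?n * \<rho> = (\<Lambda> * \<rho>) * \<eta>" using \<eta> by (simp add: \<Lambda>_def)
    also have "\<dots> \<le> (s a - s b) * norm y"
    proof (rule mult_mono)
      have "real b + 1 \<le> real a" using ab by linarith
      then have "(real b + 1) * (\<Lambda> * \<rho>) \<le> real a * (\<Lambda> * \<rho>)" using \<Lambda> \<rho> by (intro mult_right_mono) auto
      then show "\<Lambda> * \<rho> \<le> s a - s b" by (simp add: s_def algebra_simps)
      moreover have "0 < \<Lambda> * \<rho>" using \<Lambda> \<rho> by simp
      ultimately show "0 \<le> s a - s b" by linarith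
    qed (use \<eta> y in auto)
    finally show False by simp
  qed
  have "of_nat (Suc N) * (ennreal m * I) = (\<Sum>a\<le>N. ennreal m * I)" by simp
  also have "\<dots> \<le> (\<Sum>a\<le>N. (\<integral>\<^sup>+y. f y * indicator (Q a) y \<partial>lborel))" by (intro sum_mono QI) auto
  also have "\<dots> = (\<integral>\<^sup>+y. (\<Sum>a\<le>N. f y * indicator (Q a) y) \<partial>lborel)" by (rule nn_integral_sum[symmetric]) measurable
  also have "\<dots> \<le> (\<integral>\<^sup>+y. f y * indicator (tube c x \<rho>) y \<partial>lborel)"
  proof (rule nn_integral_mono)
    fix y
    show "(\<Sum>a\<le>N. f y * indicator (Q a) y) \<le> f y * indicator (tube c x \<rho>) y"
    proof (cases "\<exists>a\<le>N. y \<in> Q a")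
      case True
      then obtain a where a: "a \<le> N" "y \<in> Q a" by blast
      have "y \<in> tube c x \<rho>" using a s[OF a(1)] by (auto simp: Q_def tube_def)
      moreover have "(\<Sum>b\<le>N. f y * indicator (Q b) y) = (\<Sum>b\<in>{a}. f y * indicator (Q b) y)"
      proof (rule sum.mono_neutral_right)
        show "\<forall>i\<in>{..N} - {a}. f y * indicator (Q i) y = 0"
        proof
          fix b assume "b \<in> {..N} - {a}"
          then have "b \<le> N" "b < a \<or> a < b" by auto
          then have "y \<notin> Q b" using disj[of b a] disj[of a b] a by blast
          then show "f y * indicator (Q b) y = 0" by simp
        qed
      qed (use a in auto)
      ultimately show ?thesis using a by simp
    qed (simp add: indicator_def)
  qed
  finally have main: "of_nat (Suc N) * (ennreal m * I) \<le> (\<integral>\<^sup>+y. f y * indicator (tube c x \<rho>) y \<partial>lborel)" .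
  have m: "m > 0" by (simp add: m_def)
  have "c \<le> real (Suc N) * (\<Lambda> * \<rho>)" using N(2) \<Lambda> \<rho> by (simp only: divide_le_eq mult_pos_pos if_True)
  moreover have "\<Lambda> * \<rho> / (c * m) * (real (Suc N) * m) = real (Suc N) * (\<Lambda> * \<rho>) / c" using m by simp
  ultimately have "1 \<le> \<Lambda> * \<rho> / (c * m) * (real (Suc N) * m)" using c by simp
  then have "ennreal 1 \<le> ennreal (\<Lambda> * \<rho> / (c * m) * (real (Suc N) * m))" by (rule ennreal_leI)
  then have "ennreal 1 * I \<le> ennreal (\<Lambda> * \<rho> / (c * m) * (real (Suc N) * m)) * I"
    by (rule mult_right_mono) simp
  also have "ennreal (\<Lambda> * \<rho> / (c * m) * (real (Suc N) * m)) = ennreal (\<Lambda> * \<rho> / (c * m)) * (of_nat (Suc N) * ennreal m)"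
  proof -
    have "ennreal (real (Suc N) * m) = of_nat (Suc N) * ennreal m"
      by (subst ennreal_mult') (simp_all only: of_nat_0_le_iff ennreal_of_nat_eq_real_of_nat)
    moreover have "0 \<le> \<Lambda> * \<rho> / (c * m)" using \<Lambda> \<rho> c m by simp
    ultimately show ?thesis by (simp only: ennreal_mult')
  qed
  also have "\<dots> * I = ennreal (\<Lambda> * \<rho> / (c * m)) * (of_nat (Suc N) * (ennreal m * I))"
    by (simp only: mult.assoc)
  also have "\<dots> \<le> ennreal (\<Lambda> * \<rho> / (c * m)) * (\<integral>\<^sup>+y. f y * indicator (tube c x \<rho>) y \<partial>lborel)"
    by (intro mult_left_mono main) auto
  also have "\<Lambda> * \<rho> / (c * m) = 5 * ?n / (\<eta> * c) * 2 powr \<bar>?n + \<kappa>\<bar> * \<rho>"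
    by (simp add: \<Lambda>_def m_def powr_minus_divide)
  finally show ?thesis by (simp add: I_def)
qed

lemma not_in_cube_margin:
  assumes "0 \<notin> cube (x :: real^'n) \<rho>"
  obtains d where "d > 0" "0 \<notin> cube x (\<rho> + d)"
proof -
  obtain i where i: "\<bar>x $ i\<bar> > \<rho>" using assms by (auto simp: cube_def not_le)
  show ?thesis
  proof (rule that[of "(\<bar>x $ i\<bar> - \<rho>) / 2"])
    show "0 \<notin> cube x (\<rho> + (\<bar>x $ i\<bar> - \<rho>) / 2)"
      using i by (auto simp: cube_def field_simps intro!: exI[of _ i])
  qed (use i in auto)
qed

text \<open>Either h \<le> \<mu>, or h / \<mu> is at most its own p-th power. The level \<mu> is
  free: it balances the two terms in \<open>nn_integral_cube_young\<close> and makes the first one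
  absorbable in \<open>level_estimate\<close>.\<close>

lemma le_young_split:
  fixes h \<mu> p :: real
  assumes "h \<ge> 0" "\<mu> > 0" "p \<ge> 1"
  shows "h \<le> \<mu> + \<mu> powr (1 - p) * h powr p"
proof -
  have "h / \<mu> \<le> 1 + (h / \<mu>) powr p" using assms by (intro le_one_plus_powr) auto
  then have "\<mu> * (h / \<mu>) \<le> \<mu> * (1 + (h / \<mu>) powr p)" using assms by (intro mult_left_mono) auto
  also have "\<dots> = \<mu> + \<mu> powr (1 - p) * h powr p"
    using assms by (simp add: powr_divide powr_diff distrib_left)
  finally show ?thesis using assms by simp
qed

text \<open>Hoelder's inequality on a cube, up to the constant. The factor \<rho> in the energy
  hypothesis is the gain from \<open>packing\<close>; it raises the exponent from n - n / p to n -
  (n - 1) / p.\<close>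

lemma nn_integral_cube_young:
  fixes h :: "real^'n \<Rightarrow> real"
  assumes [measurable]: "h \<in> borel_measurable borel" and h0: "\<And>y. h y \<ge> 0" and p: "p \<ge> 1" and \<rho>: "\<rho> > 0" and E: "E > 0"
    and le: "(\<integral>\<^sup>+y. ennreal (h y powr p) * indicator (cube x \<rho>) y \<partial>lborel) \<le> ennreal (E * \<rho>)"
  shows "(\<integral>\<^sup>+y. ennreal (h y) * indicator (cube x \<rho>) y \<partial>lborel) \<le>
    ennreal ((2 ^ CARD('n) + 1) * E powr (1 / p) * \<rho> powr (real CARD('n) - 1 + (1 - (real CARD('n) - 1) / p)))"
proof -
  let ?n = "real CARD('n)"
  \<comment> \<open>The level at which the constant term and the energy term have the same order in
    \<rho>.\<close>
  define \<mu> where "\<mu> = (E / \<rho> powr (?n - 1)) powr (1 / p)"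
  have \<mu>: "\<mu> > 0" using E \<rho> by (simp add: \<mu>_def)
  have "(\<integral>\<^sup>+y. ennreal (h y) * indicator (cube x \<rho>) y \<partial>lborel) \<le>
    (\<integral>\<^sup>+y. ennreal \<mu> * indicator (cube x \<rho>) y + ennreal (\<mu> powr (1 - p)) * (ennreal (h y powr p) * indicator (cube x \<rho>) y) \<partial>lborel)"
  proof (rule nn_integral_mono)
    fix y
    have "ennreal (h y) \<le> ennreal \<mu> + ennreal (\<mu> powr (1 - p)) * ennreal (h y powr p)"
      using le_young_split[OF h0[of y] \<mu> p] \<mu>
      by (simp add: ennreal_mult'[symmetric] ennreal_plus[symmetric] del: ennreal_plus)
    then show "ennreal (h y) * indicator (cube x \<rho>) y \<le> ennreal \<mu> * indicator (cube x \<rho>) y + ennreal (\<mu> powr (1 - p)) * (ennreal (h y powr p) * indicator (cube x \<rho>) y)"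
      by (auto simp: indicator_def)
  qed
  also have "\<dots> = ennreal \<mu> * ennreal ((2 * \<rho>) ^ CARD('n)) + ennreal (\<mu> powr (1 - p)) * (\<integral>\<^sup>+y. ennreal (h y powr p) * indicator (cube x \<rho>) y \<partial>lborel)"
    using \<rho> by (simp add: nn_integral_add nn_integral_cmult nn_integral_cmult_indicator emeasure_cube)
  also have "\<dots> \<le> ennreal \<mu> * ennreal ((2 * \<rho>) ^ CARD('n)) + ennreal (\<mu> powr (1 - p)) * ennreal (E * \<rho>)"
    by (intro add_left_mono mult_left_mono le) auto
  also have "\<dots> = ennreal (\<mu> * (2 * \<rho>) ^ CARD('n) + \<mu> powr (1 - p) * (E * \<rho>))"
    using \<mu> E \<rho> by (simp add: ennreal_mult power_mult_distrib)
  also have "\<mu> * (2 * \<rho>) ^ CARD('n) + \<mu> powr (1 - p) * (E * \<rho>) = (2 ^ CARD('n) + 1) * (\<mu> * \<rho> powr ?n)"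
  proof -
    have "\<mu> powr p = E / \<rho> powr (?n - 1)" using E \<rho> p by (simp add: \<mu>_def powr_powr)
    then have "\<mu> powr (1 - p) * (E * \<rho>) = \<mu> * (\<rho> powr (?n - 1) * \<rho>)"
      using \<mu> E \<rho> by (simp add: powr_diff)
    also have "\<rho> powr (?n - 1) * \<rho> = \<rho> powr ?n" using \<rho> by (simp add: powr_diff)
    finally show ?thesis using \<rho> by (simp add: power_mult_distrib powr_realpow algebra_simps)
  qed
  also have "\<mu> * \<rho> powr ?n = E powr (1/p) * \<rho> powr (?n - 1 + (1 - (?n - 1) / p))"
  proof -
    have "\<mu> = E powr (1/p) * \<rho> powr (- ((?n - 1) / p))"
      using E \<rho> unfolding \<mu>_def by (simp add: powr_divide powr_powr powr_minus_divide)
    then have "\<mu> * \<rho> powr ?n = E powr (1/p) * (\<rho> powr (- ((?n - 1) / p)) * \<rho> powr ?n)" by simp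
    also have "\<rho> powr (- ((?n - 1) / p)) * \<rho> powr ?n = \<rho> powr (?n - 1 + (1 - (?n - 1) / p))"
      unfolding powr_add[symmetric] by (simp add: algebra_simps)
    finally show ?thesis .
  qed
  finally show ?thesis by (simp add: mult.assoc)
qed

section \<open>Hoelder continuity of the gradient\<close>

context hessian_setup
begin

text \<open>Homogeneity improves the Sobolev exponent: the tube estimate saves one dimension, so the gradient is
  Hoelder continuous already for \<open>p > n - 1\<close>.\<close>

definition "\<gamma> = 1 - (real CARD('n) - 1) / p"

lemma \<gamma>: "0 < \<gamma>" "\<gamma> < 1"
  using p_gt_n1 p1 n2 by (auto simp: \<gamma>_def field_simps)

text \<open>The constant of \<open>packing\<close> for the p-th power of a Hessian entry, which is
  homogeneous of degree p (\<alpha> - 2).\<close>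

definition "packC \<eta> c = 5 * real CARD('n) / (\<eta> * c) * 2 powr \<bar>real CARD('n) + p * (\<alpha> - 2)\<bar>"

lemma packC_pos: "\<eta> > 0 \<Longrightarrow> c > 0 \<Longrightarrow> packC \<eta> c > 0"
  by (simp add: packC_def)

lemma norm_ge_not_0: "\<eta> > 0 \<Longrightarrow> (\<And>y. y \<in> S \<Longrightarrow> norm y \<ge> \<eta>) \<Longrightarrow> 0 \<notin> S"
  by force

lemma H_cube_p:
  assumes c: "0 < c" "c \<le> 1" and \<rho>: "0 < \<rho>" and \<eta>: "\<eta> > 0" "\<And>y. y \<in> cube x \<rho> \<Longrightarrow> norm y \<ge> \<eta>"
  shows "(\<integral>\<^sup>+y. ennreal (\<bar>H i j y\<bar> powr p) * indicator (cube x \<rho>) y \<partial>lborel) \<le>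
    ennreal (packC \<eta> c * \<rho>) * (\<integral>\<^sup>+y. ennreal (\<bar>H i j y\<bar> powr p) * indicator (tube c x \<rho>) y \<partial>lborel)"
  unfolding packC_def
proof (rule packing[OF _ c \<rho> \<eta>])
  fix s assume s: "s \<in> {1..1 + c}"
  obtain d where d: "d > 0" "0 \<notin> cube x (\<rho> + d)" using not_in_cube_margin norm_ge_not_0[OF \<eta>] by blast
  have "AE y in lborel. y \<in> cube x \<rho> \<longrightarrow> H i j (s *\<^sub>R y) = s powr (\<alpha> - 2) * H i j y"
    using H_hom_AE[OF _ _ d] s \<rho> by simp
  then show "AE y in lborel. y \<in> cube x \<rho> \<longrightarrow> ennreal (\<bar>H i j (s *\<^sub>R y)\<bar> powr p) = ennreal (s powr (p * (\<alpha> - 2))) * ennreal (\<bar>H i j y\<bar> powr p)"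
  proof eventually_elim
    fix y assume y: "y \<in> cube x \<rho> \<longrightarrow> H i j (s *\<^sub>R y) = s powr (\<alpha> - 2) * H i j y"
    show "y \<in> cube x \<rho> \<longrightarrow> ennreal (\<bar>H i j (s *\<^sub>R y)\<bar> powr p) = ennreal (s powr (p * (\<alpha> - 2))) * ennreal (\<bar>H i j y\<bar> powr p)"
    proof
      assume "y \<in> cube x \<rho>"
      then have "\<bar>H i j (s *\<^sub>R y)\<bar> powr p = s powr (p * (\<alpha> - 2)) * \<bar>H i j y\<bar> powr p"
        using y by (simp add: abs_mult powr_mult powr_powr mult.commute)
      then show "ennreal (\<bar>H i j (s *\<^sub>R y)\<bar> powr p) = ennreal (s powr (p * (\<alpha> - 2))) * ennreal (\<bar>H i j y\<bar> powr p)"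
        by (simp add: ennreal_mult')
    qed
  qed
qed measurable

lemma H_cube_1:
  assumes c: "0 < c" "c \<le> 1" and \<rho>: "0 < \<rho>" and \<eta>: "\<eta> > 0" "\<And>y. y \<in> cube x \<rho> \<Longrightarrow> norm y \<ge> \<eta>"
    and E: "E > 0" "(\<integral>\<^sup>+y. ennreal (\<bar>H i j y\<bar> powr p) * indicator (tube c x \<rho>) y \<partial>lborel) \<le> ennreal E"
  shows "(\<integral>\<^sup>+y. ennreal \<bar>H i j y\<bar> * indicator (cube x \<rho>) y \<partial>lborel) \<le>
    ennreal ((2 ^ CARD('n) + 1) * (packC \<eta> c * E) powr (1 / p) * \<rho> powr (real CARD('n) - 1 + \<gamma>))"
  unfolding \<gamma>_def
proof (rule nn_integral_cube_young)
  have "(\<integral>\<^sup>+y. ennreal (\<bar>H i j y\<bar> powr p) * indicator (cube x \<rho>) y \<partial>lborel) \<le>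
    ennreal (packC \<eta> c * \<rho>) * (\<integral>\<^sup>+y. ennreal (\<bar>H i j y\<bar> powr p) * indicator (tube c x \<rho>) y \<partial>lborel)"
    by (rule H_cube_p[OF c \<rho> \<eta>])
  also have "\<dots> \<le> ennreal (packC \<eta> c * \<rho>) * ennreal E" by (intro mult_left_mono E) auto
  also have "\<dots> = ennreal (packC \<eta> c * E * \<rho>)"
    using packC_pos[OF \<eta>(1) c(1)] \<rho> E by (simp add: ennreal_mult'[symmetric] mult_ac)
  finally show "(\<integral>\<^sup>+y. ennreal (\<bar>H i j y\<bar> powr p) * indicator (cube x \<rho>) y \<partial>lborel) \<le> ennreal (packC \<eta> c * E * \<rho>)" .
qed (use p1 \<rho> E packC_pos[OF \<eta>(1) c(1)] in auto)

text \<open>Collects the constant of \<open>morrey\<close>, the n entries of a Hessian row with the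
  factor of \<open>nn_integral_cube_young\<close>, and the doubled radius in
  \<open>Pl_osc\<close>.\<close>

definition "holdC = (2 / \<gamma> + 1) * (real CARD('n) * (2 ^ CARD('n) + 1)) * 2 powr \<gamma>"

lemma holdC_pos: "holdC > 0"
  using \<gamma> by (simp add: holdC_def add_pos_pos)

text \<open>The bound is uniform in \<epsilon> and keeps the factor E powr (1 / p), so that tubes of
  small energy later yield a better modulus of continuity. The radius 4 r is made up of r for the
  centres, 2 r for the cubes in \<open>morrey\<close> and r for the mollification.\<close>

lemma Pl_osc:
  assumes c: "0 < c" "c \<le> 1" and r: "0 < r" and \<eta>: "\<eta> > 0" "\<And>y. y \<in> cube z (4 * r) \<Longrightarrow> norm y \<ge> \<eta>"
    and E: "E > 0" "\<And>i j. (\<integral>\<^sup>+y. ennreal (\<bar>H i j y\<bar> powr p) * indicator (tube c z (4 * r)) y \<partial>lborel) \<le> ennreal E"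
    and e: "0 < \<epsilon>" "\<epsilon> \<le> r" and x: "x \<in> cube z r" and y: "y \<in> cube z r"
  shows "\<bar>Pl \<epsilon> i x - Pl \<epsilon> i y\<bar> \<le> holdC * (packC \<eta> c * E) powr (1 / p) * r powr \<gamma>"
proof -
  let ?n = "real CARD('n)"
  define M where "M = (2 ^ CARD('n) + 1) * (packC \<eta> c * E) powr (1 / p)"
  have M: "M \<ge> 0" by (simp add: M_def)
  have z0: "0 \<notin> cube z (4 * r)" by (rule norm_ge_not_0[OF \<eta>])
  have L: "integral (cube x' \<rho>) (\<lambda>y. \<bar>Al \<epsilon> i j y\<bar>) \<le> M * \<rho> powr (?n - 1 + \<gamma>)"
    if x': "x' \<in> cube z r" and \<rho>: "0 < \<rho>" "\<rho> \<le> 2 * r" for x' \<rho> j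
  proof -
    define f where "f = (\<lambda>y. indicator (cube z (4 * r)) y * \<bar>H i j y\<bar>)"
    have [measurable]: "f \<in> borel_measurable borel" unfolding f_def by measurable
    have fi: "integrable lborel f"
    proof -
      have "set_integrable lborel (cube z (4 * r)) (H i j)"
        by (rule set_integrable_cube_of_powr[OF Hm less_imp_le[OF p1] Hp[OF compact_cube z0]])
      then have "set_integrable lborel (cube z (4 * r)) (\<lambda>y. \<bar>H i j y\<bar>)" by (rule set_integrable_abs)
      then show ?thesis by (simp add: set_integrable_def f_def)
    qed
    have le: "\<bar>Al \<epsilon> i j w\<bar> \<le> conv f (mollifier \<epsilon>) w" if w: "w \<in> cube x' \<rho>" for w
    proof -
      have w': "w \<in> cube z (3 * r)" using w cube_subset_cube[OF x', of \<rho> "3 * r"] \<rho> by auto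
      have sub: "cube w \<epsilon> \<subseteq> cube z (4 * r)" using e by (intro cube_subset_cube[OF w']) auto
      have "Al \<epsilon> i j w = conv (H i j) (mollifier \<epsilon>) w" using sub z0 e by (intro Al_eq_conv) auto
      also have "\<dots> = conv (\<lambda>y. indicator (cube z (4 * r)) y * H i j y) (mollifier \<epsilon>) w"
      proof -
        have "y \<in> cube z (4 * r)" if "w - y \<in> cube 0 \<epsilon>" for y
        proof -
          have "y \<in> cube w \<epsilon>" using that by (simp add: cube_def abs_minus_commute)
          then show ?thesis using sub by auto
        qed
        then show ?thesis using conv_indicator[OF e(1), where x=w and S="cube z (4 * r)" and js="[]"] by simp
      qed
      also have "\<bar>\<dots>\<bar> \<le> conv f (mollifier \<epsilon>) w"
        unfolding conv_def f_def
        using integral_norm_bound[of lborel "\<lambda>y. indicator (cube z (4 * r)) y * H i j y * mollifier \<epsilon> (w - y)"]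
        by (simp add: abs_mult mollifier_nonneg e)
      finally show ?thesis .
    qed
    have "(\<integral>\<^sup>+w. ennreal \<bar>Al \<epsilon> i j w\<bar> * indicator (cube x' \<rho>) w \<partial>lborel) \<le> (\<integral>\<^sup>+w. ennreal (conv f (mollifier \<epsilon>) w) * indicator (cube x' \<rho>) w \<partial>lborel)"
      by (rule nn_integral_mono) (auto simp: indicator_def intro!: ennreal_leI le)
    also have "\<dots> \<le> ennreal (M * \<rho> powr (?n - 1 + \<gamma>))"
    proof (rule nn_integral_conv_le[OF _ _ _ fi e(1)])
      fix a :: "real^'n" assume a: "a \<in> cube 0 \<epsilon>"
      have xa: "x' - a \<in> cube z (2 * r)"
      proof -
        have "x' - a \<in> cube x' \<epsilon>" using a by (simp add: cube_def)
        then show ?thesis using cube_subset_cube[OF x', of \<epsilon> "2 * r"] e by auto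
      qed
      have sub: "cube (x' - a) \<rho> \<subseteq> cube z (4 * r)" using \<rho> by (intro cube_subset_cube[OF xa]) auto
      have mem: "w - a \<in> cube (x' - a) \<rho> \<longleftrightarrow> w \<in> cube x' \<rho>" for w by (simp add: cube_def)
      have "(\<integral>\<^sup>+w. ennreal (f (w - a)) * indicator (cube x' \<rho>) w \<partial>lborel) \<le> (\<integral>\<^sup>+w. ennreal \<bar>H i j (w - a)\<bar> * indicator (cube (x' - a) \<rho>) (w - a) \<partial>lborel)"
        by (rule nn_integral_mono) (auto simp: f_def indicator_def mem)
      also have "\<dots> = (\<integral>\<^sup>+w. ennreal \<bar>H i j w\<bar> * indicator (cube (x' - a) \<rho>) w \<partial>lborel)"
        using nn_integral_lborel_affine[of "\<lambda>w. ennreal \<bar>H i j w\<bar> * indicator (cube (x' - a) \<rho>) w" 1 "-a"] by simp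
      also have "\<dots> \<le> ennreal ((2 ^ CARD('n) + 1) * (packC \<eta> c * E) powr (1 / p) * \<rho> powr (?n - 1 + \<gamma>))"
      proof (rule H_cube_1[OF c \<rho>(1) \<eta>(1) _ E(1)])
        show "\<eta> \<le> norm y" if "y \<in> cube (x' - a) \<rho>" for y using that sub \<eta>(2) by auto
        have "(\<integral>\<^sup>+y. ennreal (\<bar>H i j y\<bar> powr p) * indicator (tube c (x' - a) \<rho>) y \<partial>lborel) \<le> (\<integral>\<^sup>+y. ennreal (\<bar>H i j y\<bar> powr p) * indicator (tube c z (4 * r)) y \<partial>lborel)"
          using tube_mono[OF sub, of c] by (intro nn_integral_mono mult_left_mono) (auto simp: indicator_def)
        also note E(2)
        finally show "(\<integral>\<^sup>+y. ennreal (\<bar>H i j y\<bar> powr p) * indicator (tube c (x' - a) \<rho>) y \<partial>lborel) \<le> ennreal E" .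
      qed
      finally show "(\<integral>\<^sup>+w. ennreal (f (w - a)) * indicator (cube x' \<rho>) w \<partial>lborel) \<le> ennreal (M * \<rho> powr (?n - 1 + \<gamma>))"
        by (simp add: M_def)
    qed (auto simp: f_def)
    finally have nn: "(\<integral>\<^sup>+w. ennreal \<bar>Al \<epsilon> i j w\<bar> * indicator (cube x' \<rho>) w \<partial>lborel) \<le> ennreal (M * \<rho> powr (?n - 1 + \<gamma>))" .
    have ca: "continuous_on UNIV (\<lambda>y. \<bar>Al \<epsilon> i j y\<bar>)" by (intro continuous_intros continuous_on_Al e)
    have "ennreal (integral (cube x' \<rho>) (\<lambda>y. \<bar>Al \<epsilon> i j y\<bar>)) = (\<integral>\<^sup>+w. ennreal (indicator (cube x' \<rho>) w * \<bar>Al \<epsilon> i j w\<bar>) \<partial>lborel)"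
      unfolding integral_cube_eq_lborel(2)[OF ca]
      using integral_cube_eq_lborel(1)[OF ca, of x' \<rho>] unfolding set_integrable_def
      by (intro nn_integral_eq_integral[symmetric]) auto
    also have "\<dots> = (\<integral>\<^sup>+w. ennreal \<bar>Al \<epsilon> i j w\<bar> * indicator (cube x' \<rho>) w \<partial>lborel)"
      by (rule nn_integral_cong) (auto simp: indicator_def)
    also note nn
    finally show ?thesis using M by (subst (asm) ennreal_le_iff) auto
  qed
  have "\<bar>Pl \<epsilon> i x - Pl \<epsilon> i y\<bar> \<le> (2 / \<gamma> + 1) * (?n * M) * (2 * r) powr \<gamma>"
  proof (rule morrey[OF has_derivative_Pl[OF e(1)] _ _ _ \<gamma>(1) _ x y])
    show "continuous_on UNIV (\<lambda>x. \<chi> j. Al \<epsilon> i j x)" by (intro continuous_on_vec_lambda continuous_on_Al e)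
    fix x' \<rho> assume x': "x' \<in> cube z r" and \<rho>: "0 < \<rho>" "\<rho> \<le> 2 * r"
    have "integral (cube x' \<rho>) (\<lambda>w. \<Sum>j\<in>UNIV. \<bar>(\<chi> j. Al \<epsilon> i j w) $ j\<bar>) = (\<Sum>j\<in>UNIV. integral (cube x' \<rho>) (\<lambda>w. \<bar>Al \<epsilon> i j w\<bar>))"
      by (simp, rule Henstock_Kurzweil_Integration.integral_sum) (auto intro!: integral_cube_eq_lborel(3) continuous_intros continuous_on_Al e)
    also have "\<dots> \<le> (\<Sum>j\<in>(UNIV::'n set). M * \<rho> powr (?n - 1 + \<gamma>))" by (intro sum_mono L x' \<rho>)
    finally show "integral (cube x' \<rho>) (\<lambda>w. \<Sum>j\<in>UNIV. \<bar>(\<chi> j. Al \<epsilon> i j w) $ j\<bar>) \<le> ?n * M * \<rho> powr (?n - 1 + \<gamma>)" by simp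
  next
    show "y \<in> cube x (2 * r)"
    proof -
      have "\<bar>y $ k - x $ k\<bar> \<le> 2 * r" for k using x y by (auto simp: cube_def dest!: spec[of _ k])
      then show ?thesis by (simp add: cube_def)
    qed
  qed (use r in auto)
  then show ?thesis using r by (simp add: holdC_def M_def powr_mult mult_ac)
qed

lemma tube_norm_ge:
  fixes z :: "real^'n"
  assumes "\<And>y. y \<in> cube z r \<Longrightarrow> norm y \<ge> \<eta>" "w \<in> tube c z r" shows "norm w \<ge> \<eta>"
proof -
  obtain s y where sy: "s \<in> {1..1 + c}" "y \<in> cube z r" "w = s *\<^sub>R y" using assms(2) by (auto simp: tube_def)
  have "1 * norm y \<le> s * norm y" using sy by (intro mult_right_mono) auto
  then show ?thesis using assms(1)[OF sy(2)] sy by simp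
qed

lemma energy_finite:
  assumes "compact T" "0 \<notin> T"
  obtains E where "E > 0" "\<And>i j. (\<integral>\<^sup>+y. ennreal (\<bar>H i j y\<bar> powr p) * indicator T y \<partial>lborel) \<le> ennreal E"
proof -
  have Tm [measurable]: "T \<in> sets borel" using assms by (simp add: borel_compact)
  define I where "I i j = (\<integral>y. indicator T y * \<bar>H i j y\<bar> powr p \<partial>lborel)" for i j
  have I: "(\<integral>\<^sup>+y. ennreal (\<bar>H i j y\<bar> powr p) * indicator T y \<partial>lborel) = ennreal (I i j)" for i j
  proof -
    have "(\<integral>\<^sup>+y. ennreal (\<bar>H i j y\<bar> powr p) * indicator T y \<partial>lborel) = (\<integral>\<^sup>+y. ennreal (indicator T y * \<bar>H i j y\<bar> powr p) \<partial>lborel)"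
      by (rule nn_integral_cong) (auto simp: indicator_def)
    also have "\<dots> = ennreal (I i j)"
      unfolding I_def using Hp[OF assms, of i j] unfolding set_integrable_def
      by (intro nn_integral_eq_integral) auto
    finally show ?thesis .
  qed
  have I0: "I i j \<ge> 0" for i j unfolding I_def by simp
  show ?thesis
  proof (rule that[of "1 + (\<Sum>i\<in>UNIV. \<Sum>j\<in>UNIV. I i j)"])
    show "0 < 1 + (\<Sum>i\<in>UNIV. \<Sum>j\<in>UNIV. I i j)" by (intro add_pos_nonneg sum_nonneg I0) auto
    fix i j
    have "I i j \<le> (\<Sum>j\<in>UNIV. I i j)" by (rule member_le_sum) (auto simp: I0)
    also have "\<dots> \<le> (\<Sum>i\<in>UNIV. \<Sum>j\<in>UNIV. I i j)" by (rule member_le_sum[where f="\<lambda>i. \<Sum>j\<in>UNIV. I i j"]) (auto simp: I0 intro!: sum_nonneg)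
    finally show "(\<integral>\<^sup>+y. ennreal (\<bar>H i j y\<bar> powr p) * indicator T y \<partial>lborel) \<le> ennreal (1 + (\<Sum>i\<in>UNIV. \<Sum>j\<in>UNIV. I i j))"
      unfolding I by (intro ennreal_leI) simp
  qed
qed

lemma good_cube:
  assumes "z \<noteq> (0 :: real^'n)"
  obtains r \<eta> where "r > 0" "\<eta> > 0" "\<And>y. y \<in> cube z r \<Longrightarrow> norm y \<ge> \<eta>"
proof (rule that[of "norm z / (2 * real CARD('n))" "norm z / 2"])
  fix y assume "y \<in> cube z (norm z / (2 * real CARD('n)))"
  from cube_norm_le[OF this] have "norm (y - z) \<le> norm z / 2" by simp
  then show "norm z / 2 \<le> norm y" using norm_triangle_ineq2[of z "z - y"] by (simp add: norm_minus_commute)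
qed (use assms in auto)

text \<open>By equicontinuity a partial derivative is close to a difference quotient of step
  \<open>h\<close>, uniformly in the mollification radius. The difference quotients converge because
  the mollifications converge uniformly.\<close>

lemma Pl_cauchy:
  assumes z: "z \<noteq> 0"
  obtains r where "r > 0" "\<And>\<delta>. \<delta> > 0 \<Longrightarrow> \<exists>e0>0. \<forall>\<epsilon> \<epsilon>' i. \<forall>x\<in>cube z r. 0 < \<epsilon> \<and> \<epsilon> < e0 \<and> 0 < \<epsilon>' \<and> \<epsilon>' < e0 \<longrightarrow> \<bar>Pl \<epsilon> i x - Pl \<epsilon>' i x\<bar> \<le> \<delta>"
proof -
  obtain R \<eta> where R: "R > 0" and \<eta>: "\<eta> > 0" "\<And>y. y \<in> cube z R \<Longrightarrow> norm y \<ge> \<eta>" using good_cube[OF z] by blast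
  have t0: "0 \<notin> tube 1 z R"
  proof
    assume "0 \<in> tube 1 z R"
    from tube_norm_ge[OF \<eta>(2) this] \<eta>(1) show False by simp
  qed
  obtain E where E: "E > 0" "\<And>i j. (\<integral>\<^sup>+y. ennreal (\<bar>H i j y\<bar> powr p) * indicator (tube 1 z R) y \<partial>lborel) \<le> ennreal E"
    using energy_finite[OF compact_tube t0] by blast
  define C where "C = holdC * (packC \<eta> 1 * E) powr (1 / p)"
  have C: "C > 0" using holdC_pos packC_pos[OF \<eta>(1), of 1] E by (simp add: C_def)
  have osc: "\<bar>Pl \<epsilon> i x - Pl \<epsilon> i y\<bar> \<le> C * h powr \<gamma>"
    if "x \<in> cube z (R / 2)" "y \<in> cube x h" "0 < h" "4 * h \<le> R / 2" "0 < \<epsilon>" "\<epsilon> \<le> h" for x y h \<epsilon> i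
  proof -
    have sub: "cube x (4 * h) \<subseteq> cube z R" using that by (intro cube_subset_cube[OF that(1)]) auto
    have "(\<integral>\<^sup>+y. ennreal (\<bar>H i j y\<bar> powr p) * indicator (tube 1 x (4 * h)) y \<partial>lborel) \<le> ennreal E" for i j
    proof -
      have "(\<integral>\<^sup>+y. ennreal (\<bar>H i j y\<bar> powr p) * indicator (tube 1 x (4 * h)) y \<partial>lborel) \<le> (\<integral>\<^sup>+y. ennreal (\<bar>H i j y\<bar> powr p) * indicator (tube 1 z R) y \<partial>lborel)"
        using tube_mono[OF sub, of 1] by (intro nn_integral_mono mult_left_mono) (auto simp: indicator_def)
      also note E(2)
      finally show ?thesis .
    qed
    moreover have "x \<in> cube x h" using that by (simp add: cube_def)
    ultimately show ?thesis
      unfolding C_def using that sub \<eta> E(1)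
      by (intro Pl_osc[where z=x]) auto
  qed
  show ?thesis
  proof (rule that[of "R / 2"])
    fix \<delta> :: real assume \<delta>: "\<delta> > 0"
    \<comment> \<open>The first entry leaves room for the cubes of \<open>Pl_osc\<close>, the second
      brings the oscillation on the scale of the step below \<delta> / 4.\<close>
    define h where "h = min (R / 8) ((\<delta> / (4 * C)) powr (1 / \<gamma>))"
    have h: "h > 0" "4 * h \<le> R / 2" using R C \<delta> by (auto simp: h_def)
    have hg: "C * h powr \<gamma> \<le> \<delta> / 4"
    proof -
      have "h powr \<gamma> \<le> ((\<delta> / (4 * C)) powr (1 / \<gamma>)) powr \<gamma>" using h \<gamma> by (intro powr_mono2) (auto simp: h_def)
      also have "\<dots> = \<delta> / (4 * C)" using \<gamma> C \<delta> by (simp add: powr_powr)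
      finally show ?thesis using C by (simp add: field_simps)
    qed
    obtain e1 where e1: "e1 > 0" "\<And>\<epsilon> x. \<lbrakk>0 < \<epsilon>; \<epsilon> < e1; x \<in> cube z R\<rbrakk> \<Longrightarrow> \<bar>ul \<epsilon> x - u x\<bar> \<le> \<delta> * h / 8"
    proof -
      have "R \<ge> 0" "\<delta> * h / 8 > 0" using R \<delta> h by auto
      from conv_uniform[OF cont this, of z] show ?thesis using that unfolding ul_def by blast
    qed
    show "\<exists>e0>0. \<forall>\<epsilon> \<epsilon>' i. \<forall>x\<in>cube z (R / 2). 0 < \<epsilon> \<and> \<epsilon> < e0 \<and> 0 < \<epsilon>' \<and> \<epsilon>' < e0 \<longrightarrow> \<bar>Pl \<epsilon> i x - Pl \<epsilon>' i x\<bar> \<le> \<delta>"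
    proof (intro exI[of _ "min e1 h"] conjI allI ballI impI)
      fix \<epsilon> \<epsilon>' i x assume x: "x \<in> cube z (R / 2)" and e: "0 < \<epsilon> \<and> \<epsilon> < min e1 h \<and> 0 < \<epsilon>' \<and> \<epsilon>' < min e1 h"
      define y where "y = x + h *\<^sub>R axis i 1"
      have seg: "x + t *\<^sub>R axis i 1 \<in> cube x h" if "0 \<le> t" "t \<le> h" for t
        using that by (auto simp: cube_def axis_def)
      have sub: "cube x h \<subseteq> cube z R" using h R by (intro cube_subset_cube[OF x]) auto
      \<comment> \<open>The difference quotient is a value of the partial derivative on the segment,
        by the mean value theorem. The radius e stays below the step h, as \<open>Pl_osc\<close>
        requires.\<close>
      have mvt: "\<bar>Pl e i x - (ul e y - ul e x) / h\<bar> \<le> \<delta> / 4" if e: "0 < e" "e < h" for e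
      proof -
        have d: "((\<lambda>t. ul e (x + t *\<^sub>R axis i 1)) has_real_derivative Pl e i (x + t *\<^sub>R axis i 1)) (at t)" for t
        proof -
          have "((\<lambda>t. x + t *\<^sub>R axis i 1) has_derivative (\<lambda>h. h *\<^sub>R axis i 1)) (at t)" by (auto intro!: derivative_eq_intros)
          from has_derivative_compose[OF this has_derivative_ul[OF e(1), of "x + t *\<^sub>R axis i 1"]]
          show ?thesis by (simp add: has_field_derivative_def inner_axis mult_commute_abs)
        qed
        obtain t where t: "0 < t" "t < h" "ul e (x + h *\<^sub>R axis i 1) - ul e (x + 0 *\<^sub>R axis i 1) = (h - 0) * Pl e i (x + t *\<^sub>R axis i 1)"
          using MVT2[OF h(1), of "\<lambda>t. ul e (x + t *\<^sub>R axis i 1)" "\<lambda>t. Pl e i (x + t *\<^sub>R axis i 1)"] d by blast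
        have "(ul e y - ul e x) / h = Pl e i (x + t *\<^sub>R axis i 1)" using t h by (simp add: y_def)
        then show ?thesis using osc[OF x seg[of t] h, of e i] t e hg by auto
      qed
      have xy: "x \<in> cube z R" "y \<in> cube z R" using seg[of 0] seg[of h] sub h by (auto simp: y_def)
      have "\<bar>ul \<epsilon> y - u y\<bar> \<le> \<delta> * h / 8" "\<bar>ul \<epsilon>' y - u y\<bar> \<le> \<delta> * h / 8"
        "\<bar>ul \<epsilon> x - u x\<bar> \<le> \<delta> * h / 8" "\<bar>ul \<epsilon>' x - u x\<bar> \<le> \<delta> * h / 8"
        using e1(2)[OF _ _ xy(2), of \<epsilon>] e1(2)[OF _ _ xy(2), of \<epsilon>'] e1(2)[OF _ _ xy(1), of \<epsilon>] e1(2)[OF _ _ xy(1), of \<epsilon>'] e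
        by simp_all
      then have "\<bar>(ul \<epsilon> y - ul \<epsilon> x) - (ul \<epsilon>' y - ul \<epsilon>' x)\<bar> \<le> \<delta> * h / 2" by linarith
      then have "\<bar>(ul \<epsilon> y - ul \<epsilon> x) - (ul \<epsilon>' y - ul \<epsilon>' x)\<bar> / h \<le> \<delta> / 2" using h by (simp add: field_simps)
      then have "\<bar>(ul \<epsilon> y - ul \<epsilon> x) / h - (ul \<epsilon>' y - ul \<epsilon>' x) / h\<bar> \<le> \<delta> / 2"
        using h unfolding diff_divide_distrib[symmetric] abs_divide by simp
      moreover have "\<bar>Pl \<epsilon> i x - (ul \<epsilon> y - ul \<epsilon> x) / h\<bar> \<le> \<delta> / 4" using e by (intro mvt) auto
      moreover have "\<bar>Pl \<epsilon>' i x - (ul \<epsilon>' y - ul \<epsilon>' x) / h\<bar> \<le> \<delta> / 4" using e by (intro mvt) auto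
      ultimately show "\<bar>Pl \<epsilon> i x - Pl \<epsilon>' i x\<bar> \<le> \<delta>" by linarith
    qed (use e1 h in auto)
  qed (use R in auto)
qed

text \<open>A total function, defined also at the origin, where nothing is claimed about
  convergence. As a limit of continuous functions along one fixed sequence it is Borel on the whole
  space.\<close>

definition "P i x = lim (\<lambda>l. Pl (inverse (real (Suc l))) i x)"

lemma P_uniform:
  assumes z: "z \<noteq> 0"
  obtains r where "r > 0" "\<And>\<delta>. \<delta> > 0 \<Longrightarrow> \<exists>e0>0. \<forall>\<epsilon> i. \<forall>x\<in>cube z r. 0 < \<epsilon> \<and> \<epsilon> < e0 \<longrightarrow> \<bar>Pl \<epsilon> i x - P i x\<bar> \<le> \<delta>"
proof -
  obtain r where r: "r > 0" and cau: "\<And>\<delta>. \<delta> > 0 \<Longrightarrow> \<exists>e0>0. \<forall>\<epsilon> \<epsilon>' i. \<forall>x\<in>cube z r. 0 < \<epsilon> \<and> \<epsilon> < e0 \<and> 0 < \<epsilon>' \<and> \<epsilon>' < e0 \<longrightarrow> \<bar>Pl \<epsilon> i x - Pl \<epsilon>' i x\<bar> \<le> \<delta>"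
    using Pl_cauchy[OF z] by blast
  have lt: "\<exists>N. \<forall>l\<ge>N. inverse (real (Suc l)) < e0" if "e0 > 0" for e0 :: real
    using order_tendstoD(2)[OF LIMSEQ_inverse_real_of_nat that] by (simp add: eventually_sequentially)
  have lim: "(\<lambda>l. Pl (inverse (real (Suc l))) i x) \<longlonglongrightarrow> P i x" if x: "x \<in> cube z r" for i x
  proof -
    have "Cauchy (\<lambda>l. Pl (inverse (real (Suc l))) i x)"
      unfolding Cauchy_def
    proof (intro allI impI)
      fix e :: real assume e: "e > 0"
      obtain e0 where e0: "e0 > 0" "\<And>\<epsilon> \<epsilon>' i x. x \<in> cube z r \<Longrightarrow> 0 < \<epsilon> \<and> \<epsilon> < e0 \<and> 0 < \<epsilon>' \<and> \<epsilon>' < e0 \<Longrightarrow> \<bar>Pl \<epsilon> i x - Pl \<epsilon>' i x\<bar> \<le> e / 2"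
        using cau[of "e / 2"] e by auto
      obtain N where N: "\<And>l. l \<ge> N \<Longrightarrow> inverse (real (Suc l)) < e0" using lt[OF e0(1)] by blast
      show "\<exists>M. \<forall>m\<ge>M. \<forall>n\<ge>M. dist (Pl (inverse (real (Suc m))) i x) (Pl (inverse (real (Suc n))) i x) < e"
      proof (intro exI[of _ N] allI impI)
        fix m n assume "m \<ge> N" "n \<ge> N"
        then have "\<bar>Pl (inverse (real (Suc m))) i x - Pl (inverse (real (Suc n))) i x\<bar> \<le> e / 2"
          by (intro e0(2) x conjI N) (simp_all del: of_nat_Suc)
        then show "dist (Pl (inverse (real (Suc m))) i x) (Pl (inverse (real (Suc n))) i x) < e"
          using e by (simp add: dist_real_def del: of_nat_Suc)
      qed
    qed
    then show ?thesis unfolding P_def by (simp add: Cauchy_convergent_iff convergent_LIMSEQ_iff)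
  qed
  show ?thesis
  proof (rule that[OF r])
    fix \<delta> :: real assume \<delta>: "\<delta> > 0"
    obtain e0 where e0: "e0 > 0" "\<And>\<epsilon> \<epsilon>' i x. x \<in> cube z r \<Longrightarrow> 0 < \<epsilon> \<and> \<epsilon> < e0 \<and> 0 < \<epsilon>' \<and> \<epsilon>' < e0 \<Longrightarrow> \<bar>Pl \<epsilon> i x - Pl \<epsilon>' i x\<bar> \<le> \<delta>"
      using cau[OF \<delta>] by auto
    obtain N where N: "\<And>l. l \<ge> N \<Longrightarrow> inverse (real (Suc l)) < e0" using lt[OF e0(1)] by blast
    show "\<exists>e0>0. \<forall>\<epsilon> i. \<forall>x\<in>cube z r. 0 < \<epsilon> \<and> \<epsilon> < e0 \<longrightarrow> \<bar>Pl \<epsilon> i x - P i x\<bar> \<le> \<delta>"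
    proof (intro exI[of _ e0] conjI allI ballI impI e0(1))
      fix \<epsilon> i x assume x: "x \<in> cube z r" and e: "0 < \<epsilon> \<and> \<epsilon> < e0"
      have "(\<lambda>l. \<bar>Pl \<epsilon> i x - Pl (inverse (real (Suc l))) i x\<bar>) \<longlonglongrightarrow> \<bar>Pl \<epsilon> i x - P i x\<bar>"
        by (intro tendsto_intros lim x)
      then show "\<bar>Pl \<epsilon> i x - P i x\<bar> \<le> \<delta>"
      proof (rule LIMSEQ_le_const2)
        show "\<exists>N. \<forall>l\<ge>N. \<bar>Pl \<epsilon> i x - Pl (inverse (real (Suc l))) i x\<bar> \<le> \<delta>"
        proof (intro exI[of _ N] allI impI)
          fix l assume "l \<ge> N"
          then show "\<bar>Pl \<epsilon> i x - Pl (inverse (real (Suc l))) i x\<bar> \<le> \<delta>"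
            using e N[of l] by (intro e0(2) x conjI) (simp_all del: of_nat_Suc)
        qed
      qed
    qed
  qed
qed

lemma P_tendsto:
  assumes "x \<noteq> 0" "\<And>l. e l > 0" "e \<longlonglongrightarrow> 0"
  shows "(\<lambda>l. Pl (e l) i x) \<longlonglongrightarrow> P i x"
proof -
  obtain r where r: "r > 0" "\<And>\<delta>. \<delta> > 0 \<Longrightarrow> \<exists>e0>0. \<forall>\<epsilon> i. \<forall>y\<in>cube x r. 0 < \<epsilon> \<and> \<epsilon> < e0 \<longrightarrow> \<bar>Pl \<epsilon> i y - P i y\<bar> \<le> \<delta>"
    using P_uniform[OF assms(1)] by blast
  have x: "x \<in> cube x r" using r by (simp add: cube_def)
  show ?thesis
  proof (rule LIMSEQ_I)
    fix d :: real assume d: "d > 0"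
    obtain e0 where e0: "e0 > 0" "\<And>\<epsilon>. 0 < \<epsilon> \<and> \<epsilon> < e0 \<Longrightarrow> \<bar>Pl \<epsilon> i x - P i x\<bar> \<le> d / 2"
      using r(2)[of "d / 2"] d x by auto
    have "\<exists>N. \<forall>l\<ge>N. e l < e0" using order_tendstoD(2)[OF assms(3) e0(1)] by (simp add: eventually_sequentially)
    then obtain N where N: "\<And>l. l \<ge> N \<Longrightarrow> e l < e0" by blast
    show "\<exists>no. \<forall>n\<ge>no. norm (Pl (e n) i x - P i x) < d"
    proof (intro exI[of _ N] allI impI)
      fix n assume "n \<ge> N"
      then have "\<bar>Pl (e n) i x - P i x\<bar> \<le> d / 2" using N assms(2) by (intro e0(2)) auto
      then show "norm (Pl (e n) i x - P i x) < d" using d by simp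
    qed
  qed
qed

lemma continuous_P: "continuous_on (UNIV - {0}) (P i)"
proof -
  have "isCont (P i) z" if z: "z \<noteq> 0" for z
  proof -
    obtain r where r: "r > 0" and un: "\<And>\<delta>. \<delta> > 0 \<Longrightarrow> \<exists>e0>0. \<forall>\<epsilon> i. \<forall>x\<in>cube z r. 0 < \<epsilon> \<and> \<epsilon> < e0 \<longrightarrow> \<bar>Pl \<epsilon> i x - P i x\<bar> \<le> \<delta>"
      using P_uniform[OF z] by blast
    have "continuous_on (ball z r) (P i)"
    proof (rule uniform_limit_theorem)
      show "uniform_limit (ball z r) (\<lambda>l. Pl (inverse (real (Suc l))) i) (P i) sequentially"
      proof (rule uniform_limitI)
        fix d :: real assume d: "d > 0"
        obtain e0 where e0: "e0 > 0" "\<And>\<epsilon> x. x \<in> cube z r \<Longrightarrow> 0 < \<epsilon> \<and> \<epsilon> < e0 \<Longrightarrow> \<bar>Pl \<epsilon> i x - P i x\<bar> \<le> d / 2"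
          using un[of "d / 2"] d by auto
        have sub: "x \<in> cube z r" if "x \<in> ball z r" for x using that by (intro ball_subset_cube) (simp add: dist_norm norm_minus_commute)
        show "\<forall>\<^sub>F l in sequentially. \<forall>x\<in>ball z r. dist (Pl (inverse (real (Suc l))) i x) (P i x) < d"
          using order_tendstoD(2)[OF LIMSEQ_inverse_real_of_nat e0(1)]
        proof eventually_elim
          case (elim l)
          show ?case
          proof
            fix x assume "x \<in> ball z r"
            then have "\<bar>Pl (inverse (real (Suc l))) i x - P i x\<bar> \<le> d / 2"
              using elim by (intro e0(2) sub) (simp_all del: of_nat_Suc)
            then show "dist (Pl (inverse (real (Suc l))) i x) (P i x) < d" using d by (simp add: dist_real_def del: of_nat_Suc)
          qed
        qed
      qed
      show "\<forall>\<^sub>F l in sequentially. continuous_on (ball z r) (Pl (inverse (real (Suc l))) i)"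
        by (intro always_eventually allI continuous_on_subset[OF continuous_on_Pl]) (auto simp del: of_nat_Suc)
    qed simp
    then show ?thesis using r by (simp add: continuous_on_eq_continuous_at)
  qed
  then show ?thesis by (simp add: continuous_on_eq_continuous_at open_delete)
qed

definition "Du x = (\<chi> i. P i x)"

text \<open>Locally uniform convergence of the gradients turns the pointwise limit of the
  mollifications into a differentiable function; together with \<open>continuous_P\<close> the
  function u is continuously differentiable off the origin.\<close>

lemma has_derivative_u:
  assumes z: "z \<noteq> 0" shows "(u has_derivative (\<lambda>h. Du z \<bullet> h)) (at z)"
proof -
  obtain r where r: "r > 0" and un: "\<And>\<delta>. \<delta> > 0 \<Longrightarrow> \<exists>e0>0. \<forall>\<epsilon> i. \<forall>x\<in>cube z r. 0 < \<epsilon> \<and> \<epsilon> < e0 \<longrightarrow> \<bar>Pl \<epsilon> i x - P i x\<bar> \<le> \<delta>"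
    using P_uniform[OF z] by blast
  have sub: "x \<in> cube z r" if "x \<in> ball z r" for x using that by (intro ball_subset_cube) (simp add: dist_norm norm_minus_commute)
  let ?e = "\<lambda>l. inverse (real (Suc l))"
  have lim: "(\<lambda>l. ul (?e l) x) \<longlonglongrightarrow> u x" for x
  proof (rule LIMSEQ_I)
    fix d :: real assume d: "d > 0"
    obtain e0 where e0: "e0 > 0" "\<And>\<epsilon> y. 0 < \<epsilon> \<Longrightarrow> \<epsilon> < e0 \<Longrightarrow> y \<in> cube x 0 \<Longrightarrow> \<bar>ul \<epsilon> y - u y\<bar> \<le> d / 2"
      using conv_uniform[OF cont, of 0 "d / 2" x] d unfolding ul_def by auto
    have "\<exists>N. \<forall>l\<ge>N. ?e l < e0"
      using order_tendstoD(2)[OF LIMSEQ_inverse_real_of_nat e0(1)] by (simp add: eventually_sequentially)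
    then obtain N where N: "\<And>l. l \<ge> N \<Longrightarrow> ?e l < e0" by blast
    show "\<exists>no. \<forall>n\<ge>no. norm (ul (?e n) x - u x) < d"
    proof (intro exI[of _ N] allI impI)
      fix n assume "n \<ge> N"
      then have "\<bar>ul (?e n) x - u x\<bar> \<le> d / 2" by (intro e0(2) N) (auto simp: cube_def)
      then show "norm (ul (?e n) x - u x) < d" using d by (simp del: of_nat_Suc)
    qed
  qed
  have "\<exists>g. \<forall>x\<in>ball z r. (\<lambda>l. ul (?e l) x) \<longlonglongrightarrow> g x \<and> (g has_derivative (\<lambda>h. Du x \<bullet> h)) (at x within ball z r)"
  proof (rule has_derivative_sequence)
    show "(ul (?e l) has_derivative (\<lambda>h. (\<chi> i. Pl (?e l) i x) \<bullet> h)) (at x within ball z r)" for l x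
      by (rule has_derivative_at_withinI[OF has_derivative_ul]) (simp del: of_nat_Suc)
    fix e :: real assume e: "e > 0"
    define d where "d = e / real CARD('n)"
    have d: "d > 0" using e by (simp add: d_def)
    obtain e0 where e0: "e0 > 0" "\<And>\<epsilon> i x. x \<in> cube z r \<Longrightarrow> 0 < \<epsilon> \<and> \<epsilon> < e0 \<Longrightarrow> \<bar>Pl \<epsilon> i x - P i x\<bar> \<le> d"
      using un[OF d] by auto
    show "\<forall>\<^sub>F l in sequentially. \<forall>x\<in>ball z r. \<forall>h. norm ((\<chi> i. Pl (?e l) i x) \<bullet> h - Du x \<bullet> h) \<le> e * norm h"
      using order_tendstoD(2)[OF LIMSEQ_inverse_real_of_nat e0(1)]
    proof eventually_elim
      case (elim l)
      show ?case
      proof (intro ballI allI)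
        fix x h :: "real^'n" assume x: "x \<in> ball z r"
        have "(\<chi> i. Pl (?e l) i x) - Du x \<in> cube 0 d"
          using elim by (auto simp: cube_def Du_def intro!: e0(2) sub x simp del: of_nat_Suc)
        from cube_norm_le[OF this] have "norm ((\<chi> i. Pl (?e l) i x) - Du x) \<le> e" by (simp add: d_def)
        then have "norm ((\<chi> i. Pl (?e l) i x) - Du x) * norm h \<le> e * norm h" by (intro mult_right_mono) auto
        then show "norm ((\<chi> i. Pl (?e l) i x) \<bullet> h - Du x \<bullet> h) \<le> e * norm h"
          using Cauchy_Schwarz_ineq2[of "(\<chi> i. Pl (?e l) i x) - Du x" h] by (simp add: inner_diff_left)
      qed
    qed
  qed (use r lim[of z] in auto)
  then obtain g where g: "\<And>x. x \<in> ball z r \<Longrightarrow> (\<lambda>l. ul (?e l) x) \<longlonglongrightarrow> g x" "\<And>x. x \<in> ball z r \<Longrightarrow> (g has_derivative (\<lambda>h. Du x \<bullet> h)) (at x within ball z r)"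
    by blast
  have gu: "g x = u x" if "x \<in> ball z r" for x using LIMSEQ_unique[OF g(1)[OF that] lim] .
  have "(u has_derivative (\<lambda>h. Du z \<bullet> h)) (at z within ball z r)"
  proof (rule has_derivative_transform)
    show zb: "z \<in> ball z r" using r by simp
    show "(g has_derivative (\<lambda>h. Du z \<bullet> h)) (at z within ball z r)" by (rule g(2)[OF zb])
    show "u x = g x" if "x \<in> ball z r" for x using gu[OF that] by (rule sym)
  qed
  moreover have "at z within ball z r = at z" using r by (intro at_within_open) auto
  ultimately show ?thesis by simp
qed

lemma continuous_Du: "continuous_on (UNIV - {0}) Du"
  unfolding Du_def[abs_def] by (intro continuous_on_vec_lambda continuous_P)

lemma P_osc:
  assumes c: "0 < c" "c \<le> 1" and r: "0 < r" and \<eta>: "\<eta> > 0" "\<And>y. y \<in> cube z (4 * r) \<Longrightarrow> norm y \<ge> \<eta>"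
    and E: "E > 0" "\<And>i j. (\<integral>\<^sup>+y. ennreal (\<bar>H i j y\<bar> powr p) * indicator (tube c z (4 * r)) y \<partial>lborel) \<le> ennreal E"
    and x: "x \<in> cube z r" and y: "y \<in> cube z r"
  shows "\<bar>P i x - P i y\<bar> \<le> holdC * (packC \<eta> c * E) powr (1 / p) * r powr \<gamma>"
proof -
  have "cube z r \<subseteq> cube z (4 * r)" using r by (intro cube_mono) auto
  then have xy: "x \<noteq> 0" "y \<noteq> 0" using x y \<eta> by force+
  \<comment> \<open>These radii respect the restriction \<epsilon> \<le> r of \<open>Pl_osc\<close>
    for every l.\<close>
  let ?e = "\<lambda>l. r * inverse (real (Suc l))"
  have e: "?e l > 0" "?e l \<le> r" for l using r by (auto simp: field_simps)
  have e0: "?e \<longlonglongrightarrow> 0" using tendsto_mult_right_zero[OF LIMSEQ_inverse_real_of_nat, of r] by simp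
  have "(\<lambda>l. \<bar>Pl (?e l) i x - Pl (?e l) i y\<bar>) \<longlonglongrightarrow> \<bar>P i x - P i y\<bar>"
    using e(1) e0 xy by (intro tendsto_intros P_tendsto) auto
  then show ?thesis
  proof (rule LIMSEQ_le_const2)
    show "\<exists>N. \<forall>l\<ge>N. \<bar>Pl (?e l) i x - Pl (?e l) i y\<bar> \<le> holdC * (packC \<eta> c * E) powr (1 / p) * r powr \<gamma>"
      using Pl_osc[OF c r \<eta> E e x y] by blast
  qed
qed

end

section \<open>Homogeneous gradients and dominated approximation of the Hessian\<close>

lemma powr_abs_sum_le:
  fixes a :: "'i \<Rightarrow> real"
  assumes "finite A" "p > 0"
  shows "\<bar>\<Sum>i\<in>A. a i\<bar> powr p \<le> real (card A) powr p * (\<Sum>i\<in>A. \<bar>a i\<bar> powr p)"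
proof (cases "A = {}")
  case False
  define m where "m = Max ((\<lambda>i. \<bar>a i\<bar>) ` A)"
  have m: "m \<in> (\<lambda>i. \<bar>a i\<bar>) ` A" unfolding m_def using assms False by (intro Max_in) auto
  then obtain i where i: "i \<in> A" "m = \<bar>a i\<bar>" by auto
  have "\<bar>\<Sum>i\<in>A. a i\<bar> \<le> (\<Sum>i\<in>A. \<bar>a i\<bar>)" by (rule sum_abs)
  also have "\<dots> \<le> (\<Sum>i\<in>A. m)" using assms by (intro sum_mono) (auto simp: m_def)
  finally have "\<bar>\<Sum>i\<in>A. a i\<bar> powr p \<le> (real (card A) * m) powr p" using assms by (intro powr_mono2) auto
  also have "\<dots> = real (card A) powr p * \<bar>a i\<bar> powr p" using i by (simp add: powr_mult)
  also have "\<dots> \<le> real (card A) powr p * (\<Sum>i\<in>A. \<bar>a i\<bar> powr p)"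
    using i assms by (intro mult_left_mono member_le_sum) auto
  finally show ?thesis .
qed (use assms in simp)

context hessian_setup
begin

lemma P_hom:
  assumes "t > 0" "x \<noteq> 0" shows "Du (t *\<^sub>R x) = t powr (\<alpha> - 1) *\<^sub>R Du x"
proof -
  have tx: "t *\<^sub>R x \<noteq> 0" using assms by simp
  have "((\<lambda>y. t *\<^sub>R y) has_derivative (\<lambda>h. t *\<^sub>R h)) (at x)" by (auto intro!: derivative_eq_intros)
  from has_derivative_compose[OF this has_derivative_u[OF tx]]
  have "((\<lambda>y. t powr \<alpha> * u y) has_derivative (\<lambda>h. Du (t *\<^sub>R x) \<bullet> (t *\<^sub>R h))) (at x)"
    using hom[OF assms(1)] by simp
  moreover have "((\<lambda>y. t powr \<alpha> * u y) has_derivative (\<lambda>h. t powr \<alpha> * (Du x \<bullet> h))) (at x)"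
    by (intro has_derivative_mult_right has_derivative_u assms)
  ultimately have "(\<lambda>h. Du (t *\<^sub>R x) \<bullet> (t *\<^sub>R h)) = (\<lambda>h. t powr \<alpha> * (Du x \<bullet> h))"
    by (rule has_derivative_unique)
  then have e: "t * (Du (t *\<^sub>R x) \<bullet> h) = t powr \<alpha> * (Du x \<bullet> h)" for h
    using fun_cong[OF \<open>(\<lambda>h. Du (t *\<^sub>R x) \<bullet> (t *\<^sub>R h)) = (\<lambda>h. t powr \<alpha> * (Du x \<bullet> h))\<close>, of h] by simp
  show ?thesis
  proof (rule vector_eq_ldot[THEN iffD1], rule allI)
    fix h
    have "h \<bullet> Du (t *\<^sub>R x) = t powr \<alpha> / t * (h \<bullet> Du x)" using e[of h] assms(1) by (simp add: inner_commute field_simps)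
    then show "h \<bullet> Du (t *\<^sub>R x) = h \<bullet> t powr (\<alpha> - 1) *\<^sub>R Du x" using assms(1) by (simp add: powr_diff)
  qed
qed

lemma euler_u:
  assumes "x \<noteq> 0" shows "x \<bullet> Du x = \<alpha> * u x"
proof -
  have "((\<lambda>t. t *\<^sub>R x) has_derivative (\<lambda>h. h *\<^sub>R x)) (at 1)" by (auto intro!: derivative_eq_intros)
  from has_derivative_compose[OF this, of u "\<lambda>h. Du x \<bullet> h"] has_derivative_u[OF assms]
  have "((\<lambda>t. u (t *\<^sub>R x)) has_derivative (\<lambda>h. h * (Du x \<bullet> x))) (at 1)" by simp
  then have 1: "((\<lambda>t. u (t *\<^sub>R x)) has_real_derivative Du x \<bullet> x) (at 1)"
    by (simp add: has_field_derivative_def mult_commute_abs)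
  have 2: "((\<lambda>t. t powr \<alpha> * u x) has_real_derivative \<alpha> * u x) (at 1)"
    by (auto intro!: derivative_eq_intros)
  have "((\<lambda>t. u (t *\<^sub>R x)) has_real_derivative \<alpha> * u x) (at 1)"
  proof (rule has_field_derivative_transform_within[OF 2, of 1])
    fix t :: real assume "dist t 1 < 1"
    then have "t > 0" by (simp add: dist_real_def)
    then show "t powr \<alpha> * u x = u (t *\<^sub>R x)" using hom by simp
  qed auto
  from DERIV_unique[OF 1 this] show ?thesis by (simp add: inner_commute)
qed

lemma P_measurable [measurable]: "P i \<in> borel_measurable borel"
proof -
  have "Pl (inverse (real (Suc l))) i \<in> borel_measurable borel" for l
    unfolding Pl_def by measurable
  then show ?thesis unfolding P_def[abs_def] by (intro borel_measurable_lim_metric)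
qed

text \<open>Along radii with L^p errors at most 2^-l the errors are summable, so their sum is finite
  almost everywhere. This gives pointwise convergence and one integrable majorant \<open>G\<close>
  for the p-th powers, with a single sequence for all n^2 entries.\<close>

lemma approx_sequence:
  assumes r: "r \<ge> 0" and d: "d > 0" and z: "0 \<notin> cube z (r + d)"
  obtains e :: "nat \<Rightarrow> real" and G :: "real^'n \<Rightarrow> real"
  where "\<And>l. e l > 0" "e \<longlonglongrightarrow> 0" "set_integrable lborel (cube z r) G"
    "AE x in lborel. x \<in> cube z r \<longrightarrow> (\<forall>i j. (\<lambda>l. Al (e l) i j x) \<longlonglongrightarrow> H i j x) \<and> (\<forall>l i j. \<bar>Al (e l) i j x\<bar> powr p \<le> G x)"
proof -
  define W where "W l \<epsilon> i j \<longleftrightarrow> (\<integral>\<^sup>+x. ennreal (\<bar>Al \<epsilon> i j x - H i j x\<bar> powr p) * indicator (cube z r) x \<partial>lborel) \<le> ennreal ((1/2) ^ l)" for l :: nat and \<epsilon> i j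
  have "\<exists>\<epsilon>. 0 < \<epsilon> \<and> \<epsilon> < inverse (real (Suc l)) \<and> (\<forall>i j. W l \<epsilon> i j)" for l
  proof -
    have "\<forall>i j. \<exists>e0>0. \<forall>\<epsilon>. 0 < \<epsilon> \<and> \<epsilon> < e0 \<longrightarrow> W l \<epsilon> i j"
    proof (intro allI)
      fix i j
      have "(1/2) ^ l > (0::real)" by simp
      then show "\<exists>e0>0. \<forall>\<epsilon>. 0 < \<epsilon> \<and> \<epsilon> < e0 \<longrightarrow> W l \<epsilon> i j"
      proof (rule H_Lp_conv[OF r d z, where i=i and j=j])
        fix e0 assume e0: "0 < e0" and a: "\<And>\<epsilon>. 0 < \<epsilon> \<Longrightarrow> \<epsilon> < e0 \<Longrightarrow> (\<integral>\<^sup>+x. ennreal (\<bar>Al \<epsilon> i j x - H i j x\<bar> powr p) * indicator (cube z r) x \<partial>lborel) \<le> ennreal ((1/2) ^ l)"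
        show "\<exists>e0>0. \<forall>\<epsilon>. 0 < \<epsilon> \<and> \<epsilon> < e0 \<longrightarrow> W l \<epsilon> i j"
          unfolding W_def using e0 by (intro exI[of _ e0] conjI allI impI a) auto
      qed
    qed
    then obtain e0 where e0: "\<And>i j. e0 i j > 0" "\<And>i j \<epsilon>. 0 < \<epsilon> \<Longrightarrow> \<epsilon> < e0 i j \<Longrightarrow> W l \<epsilon> i j"
      by metis
    define m where "m = Min (range (\<lambda>(i, j). e0 i j))"
    have m: "m > 0" unfolding m_def using e0(1) by (subst Min_gr_iff) auto
    have mle: "m \<le> e0 i j" for i j unfolding m_def by (intro Min_le) (auto intro: rev_image_eqI[of "(i, j)"])
    show ?thesis
    proof (intro exI[of _ "min m (inverse (real (Suc l))) / 2"] conjI allI)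
      show "min m (inverse (real (Suc l))) / 2 > 0" using m by simp
      have "inverse (real (Suc l)) > 0" by simp
      then show "min m (inverse (real (Suc l))) / 2 < inverse (real (Suc l))" by linarith
      fix i j
      have "min m (inverse (real (Suc l))) / 2 < e0 i j" using mle[of i j] m by linarith
      then show "W l (min m (inverse (real (Suc l))) / 2) i j"
        using m by (intro e0(2)) auto
    qed
  qed
  then obtain e where e: "\<And>l. 0 < e l" "\<And>l. e l < inverse (real (Suc l))"
    "\<And>l i j. W l (e l) i j"
    by metis
  have eI: "(\<integral>\<^sup>+x. ennreal (\<bar>Al (e l) i j x - H i j x\<bar> powr p) * indicator (cube z r) x \<partial>lborel) \<le> ennreal ((1/2) ^ l)" for l i j
    using e(3)[of l i j] by (simp add: W_def)
  define dd where "dd l x = (\<Sum>i\<in>UNIV. \<Sum>j\<in>UNIV. \<bar>Al (e l) i j x - H i j x\<bar> powr p) * indicator (cube z r) x" for l x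
  have dd0: "dd l x \<ge> 0" for l x unfolding dd_def by (intro mult_nonneg_nonneg sum_nonneg) auto
  have [measurable]: "dd l \<in> borel_measurable borel" for l unfolding dd_def[abs_def] by measurable
  have ddI: "(\<integral>\<^sup>+x. ennreal (dd l x) \<partial>lborel) \<le> ennreal (real (CARD('n) * CARD('n)) * (1/2) ^ l)" for l
  proof -
    have "(\<integral>\<^sup>+x. ennreal (dd l x) \<partial>lborel) = (\<integral>\<^sup>+x. (\<Sum>i\<in>UNIV. \<Sum>j\<in>UNIV. ennreal (\<bar>Al (e l) i j x - H i j x\<bar> powr p) * indicator (cube z r) x) \<partial>lborel)"
      unfolding dd_def by (rule nn_integral_cong) (auto simp: indicator_def sum_nonneg)
    also have "\<dots> = (\<Sum>i\<in>UNIV. \<Sum>j\<in>UNIV. \<integral>\<^sup>+x. ennreal (\<bar>Al (e l) i j x - H i j x\<bar> powr p) * indicator (cube z r) x \<partial>lborel)"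
    proof -
      have "(\<integral>\<^sup>+x. (\<Sum>i\<in>UNIV. \<Sum>j\<in>UNIV. ennreal (\<bar>Al (e l) i j x - H i j x\<bar> powr p) * indicator (cube z r) x) \<partial>lborel) =
        (\<Sum>i\<in>UNIV. \<integral>\<^sup>+x. (\<Sum>j\<in>UNIV. ennreal (\<bar>Al (e l) i j x - H i j x\<bar> powr p) * indicator (cube z r) x) \<partial>lborel)"
        by (rule nn_integral_sum) measurable
      also have "\<dots> = (\<Sum>i\<in>UNIV. \<Sum>j\<in>UNIV. \<integral>\<^sup>+x. ennreal (\<bar>Al (e l) i j x - H i j x\<bar> powr p) * indicator (cube z r) x \<partial>lborel)"
        by (intro sum.cong refl nn_integral_sum) measurable
      finally show ?thesis .
    qed
    also have "\<dots> \<le> (\<Sum>i\<in>(UNIV::'n set). \<Sum>j\<in>(UNIV::'n set). ennreal ((1/2) ^ l))" by (intro sum_mono eI)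
    also have "\<dots> = ennreal (\<Sum>i\<in>(UNIV::'n set). \<Sum>j\<in>(UNIV::'n set). (1/2) ^ l)" by (simp only: sum_ennreal sum_nonneg zero_le_power zero_le_divide_1_iff zero_le_numeral)
    finally show ?thesis by (simp add: mult.assoc)
  qed
  define D where "D x = (\<Sum>l. ennreal (dd l x))" for x
  have [measurable]: "D \<in> borel_measurable borel" unfolding D_def[abs_def] by measurable
  have DI: "(\<integral>\<^sup>+x. D x \<partial>lborel) < \<infinity>"
  proof -
    have "(\<integral>\<^sup>+x. D x \<partial>lborel) = (\<Sum>l. \<integral>\<^sup>+x. ennreal (dd l x) \<partial>lborel)" unfolding D_def by (rule nn_integral_suminf) measurable
    also have "\<dots> \<le> (\<Sum>l. ennreal (real (CARD('n) * CARD('n)) * (1/2) ^ l))" by (intro suminf_le ddI) auto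
    also have "\<dots> = ennreal (\<Sum>l. real (CARD('n) * CARD('n)) * (1/2) ^ l)"
      by (intro suminf_ennreal2 summable_mult summable_geometric) auto
    finally show ?thesis by (simp add: le_less_trans)
  qed
  then have Dfin: "AE x in lborel. D x \<noteq> \<infinity>" by (intro nn_integral_PInf_AE) auto
  define D' where "D' x = enn2real (D x)" for x
  have [measurable]: "D' \<in> borel_measurable borel" unfolding D'_def[abs_def] by measurable
  have D'i: "integrable lborel D'"
  proof -
    have "(\<integral>\<^sup>+x. ennreal (norm (D' x)) \<partial>lborel) = (\<integral>\<^sup>+x. D x \<partial>lborel)"
      using Dfin by (intro nn_integral_cong_AE, eventually_elim) (auto simp: D'_def ennreal_enn2real_if)
    then show ?thesis using DI unfolding integrable_iff_bounded by simp
  qed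
  define G where "G x = 3 powr p * (D' x + (\<Sum>i\<in>UNIV. \<Sum>j\<in>UNIV. \<bar>H i j x\<bar> powr p))" for x
  have z0: "0 \<notin> cube z r" using z cube_mono[of r "r + d" z] d by auto
  show ?thesis
  proof (rule that[of e G])
    show "e l > 0" for l by (rule e)
    show "e \<longlonglongrightarrow> 0"
      by (rule tendsto_sandwich[OF _ _ tendsto_const LIMSEQ_inverse_real_of_nat])
         (auto intro!: always_eventually less_imp_le e simp del: of_nat_Suc)
    have "set_integrable lborel (cube z r) D'"
      unfolding set_integrable_def by (rule integrable_mult_indicator[OF _ D'i]) simp
    moreover have "set_integrable lborel (cube z r) (\<lambda>x. \<Sum>i\<in>UNIV. \<Sum>j\<in>UNIV. \<bar>H i j x\<bar> powr p)"
      using Hp[OF compact_cube z0] unfolding set_integrable_def scaleR_sum_right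
      by (intro Bochner_Integration.integrable_sum) auto
    ultimately show "set_integrable lborel (cube z r) G"
      unfolding G_def by (intro set_integrable_mult_right set_integral_add(1))
    show "AE x in lborel. x \<in> cube z r \<longrightarrow> (\<forall>i j. (\<lambda>l. Al (e l) i j x) \<longlonglongrightarrow> H i j x) \<and> (\<forall>l i j. \<bar>Al (e l) i j x\<bar> powr p \<le> G x)"
      using Dfin
    proof eventually_elim
      fix x assume fin: "D x \<noteq> \<infinity>"
      show "x \<in> cube z r \<longrightarrow> (\<forall>i j. (\<lambda>l. Al (e l) i j x) \<longlonglongrightarrow> H i j x) \<and> (\<forall>l i j. \<bar>Al (e l) i j x\<bar> powr p \<le> G x)"
      proof (intro impI conjI allI)
        assume x: "x \<in> cube z r"
        have sm: "summable (\<lambda>l. dd l x)"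
          by (rule summable_suminf_not_top) (use dd0 fin in \<open>auto simp: D_def\<close>)
        have D'eq: "D' x = (\<Sum>l. dd l x)"
          unfolding D'_def D_def using suminf_ennreal2[OF dd0 sm] by (simp add: suminf_nonneg[OF sm dd0])
        have le: "\<bar>Al (e l) i j x - H i j x\<bar> powr p \<le> dd l x" for l i j
        proof -
          have "\<bar>Al (e l) i j x - H i j x\<bar> powr p \<le> (\<Sum>j\<in>UNIV. \<bar>Al (e l) i j x - H i j x\<bar> powr p)" by (rule member_le_sum) auto
          also have "\<dots> \<le> (\<Sum>i\<in>UNIV. \<Sum>j\<in>UNIV. \<bar>Al (e l) i j x - H i j x\<bar> powr p)"
            by (rule member_le_sum[where f="\<lambda>i. \<Sum>j\<in>UNIV. \<bar>Al (e l) i j x - H i j x\<bar> powr p"]) (auto intro!: sum_nonneg)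
          finally show ?thesis using x by (simp add: dd_def)
        qed
        fix i j
        have "(\<lambda>l. \<bar>Al (e l) i j x - H i j x\<bar> powr p) \<longlonglongrightarrow> 0"
          by (rule tendsto_sandwich[OF _ _ tendsto_const summable_LIMSEQ_zero[OF sm]]) (auto intro!: always_eventually le)
        then have "(\<lambda>l. (\<bar>Al (e l) i j x - H i j x\<bar> powr p) powr (1/p)) \<longlonglongrightarrow> 0 powr (1/p)"
          using p1 by (intro tendsto_powr2) auto
        then have "(\<lambda>l. \<bar>Al (e l) i j x - H i j x\<bar>) \<longlonglongrightarrow> 0" using p1 by (simp add: powr_powr)
        then show "(\<lambda>l. Al (e l) i j x) \<longlonglongrightarrow> H i j x"
          by (simp add: tendsto_rabs_zero_iff LIM_zero_iff)
        fix l
        have "\<bar>Al (e l) i j x\<bar> powr p = \<bar>(Al (e l) i j x - H i j x) + H i j x + 0\<bar> powr p" by simp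
        also have "\<dots> \<le> 3 powr p * (\<bar>Al (e l) i j x - H i j x\<bar> powr p + \<bar>H i j x\<bar> powr p + \<bar>0\<bar> powr p)"
          using p1 by (intro powr_abs_add_le) auto
        also have "\<dots> \<le> G x"
          unfolding G_def
        proof (intro mult_left_mono)
          have "\<bar>Al (e l) i j x - H i j x\<bar> powr p \<le> D' x"
            using le[of l i j] sum_le_suminf[OF sm, of "{l}"] dd0 by (simp add: D'eq)
          moreover have "\<bar>H i j x\<bar> powr p \<le> (\<Sum>j\<in>UNIV. \<bar>H i j x\<bar> powr p)" by (rule member_le_sum) auto
          moreover have "(\<Sum>j\<in>UNIV. \<bar>H i j x\<bar> powr p) \<le> (\<Sum>i\<in>UNIV. \<Sum>j\<in>UNIV. \<bar>H i j x\<bar> powr p)"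
            by (rule member_le_sum[where f="\<lambda>i. \<Sum>j\<in>UNIV. \<bar>H i j x\<bar> powr p"]) (auto intro!: sum_nonneg)
          ultimately show "\<bar>Al (e l) i j x - H i j x\<bar> powr p + \<bar>H i j x\<bar> powr p + \<bar>0\<bar> powr p \<le> D' x + (\<Sum>i\<in>UNIV. \<Sum>j\<in>UNIV. \<bar>H i j x\<bar> powr p)"
            by simp
        qed simp
        finally show "\<bar>Al (e l) i j x\<bar> powr p \<le> G x" .
      qed
    qed
  qed
qed

end

subsection \<open>Euler's relation for the Hessian\<close>

context hessian_setup
begin

lemma ul_uniform:
  assumes r: "r \<ge> 0" and \<delta>: "\<delta> > 0"
  shows "\<exists>e0>0. \<forall>\<epsilon>. \<forall>x\<in>cube z r. 0 < \<epsilon> \<and> \<epsilon> < e0 \<longrightarrow> \<bar>ul \<epsilon> x - u x\<bar> \<le> \<delta>"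
proof (rule conv_uniform[OF cont r \<delta>, of z])
  fix e0 assume "0 < e0" "\<And>\<epsilon> x. 0 < \<epsilon> \<Longrightarrow> \<epsilon> < e0 \<Longrightarrow> x \<in> cube z r \<Longrightarrow> \<bar>conv u (mollifier \<epsilon>) x - u x\<bar> \<le> \<delta>"
  then show ?thesis unfolding ul_def by (intro exI[of _ e0]) auto
qed

text \<open>Collects, on one cube, what the later limit passages need. The bounds hold for every l,
  not merely eventually, because an initial segment of the sequence is dropped after which all
  deviations are at most 1.\<close>

lemma local_approximation:
  assumes z: "z \<noteq> 0"
  obtains \<rho> :: real and e :: "nat \<Rightarrow> real" and G :: "real^'n \<Rightarrow> real" and B :: real
  where "\<rho> > 0" "0 \<notin> cube z \<rho>" "\<And>l. e l > 0" "set_integrable lborel (cube z \<rho>) G"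
    "AE x in lborel. x \<in> cube z \<rho> \<longrightarrow> (\<forall>i j. (\<lambda>l. Al (e l) i j x) \<longlonglongrightarrow> H i j x) \<and> (\<forall>l i j. \<bar>Al (e l) i j x\<bar> powr p \<le> G x)"
    "\<And>l i x. x \<in> cube z \<rho> \<Longrightarrow> \<bar>Pl (e l) i x\<bar> \<le> B" "\<And>i x. x \<in> cube z \<rho> \<Longrightarrow> \<bar>P i x\<bar> \<le> B"
    "\<And>l x. x \<in> cube z \<rho> \<Longrightarrow> \<bar>ul (e l) x\<bar> \<le> B" "\<And>x. x \<in> cube z \<rho> \<Longrightarrow> \<bar>u x\<bar> \<le> B"
    "\<And>\<delta>. \<delta> > 0 \<Longrightarrow> \<exists>N. \<forall>l\<ge>N. \<forall>x\<in>cube z \<rho>. \<bar>ul (e l) x - u x\<bar> \<le> \<delta> \<and> (\<forall>i. \<bar>Pl (e l) i x - P i x\<bar> \<le> \<delta>)"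
proof -
  obtain r0 \<eta> where r0: "r0 > 0" "\<eta> > 0" "\<And>y. y \<in> cube z r0 \<Longrightarrow> norm y \<ge> \<eta>" using good_cube[OF z] by blast
  obtain r1 where r1: "r1 > 0" and un: "\<And>\<delta>. \<delta> > 0 \<Longrightarrow> \<exists>e0>0. \<forall>\<epsilon> i. \<forall>x\<in>cube z r1. 0 < \<epsilon> \<and> \<epsilon> < e0 \<longrightarrow> \<bar>Pl \<epsilon> i x - P i x\<bar> \<le> \<delta>"
    using P_uniform[OF z] by blast
  define \<rho> where "\<rho> = min r0 r1 / 2"
  have \<rho>: "\<rho> > 0" "\<rho> + \<rho> \<le> r0" "\<rho> \<le> r1" using r0 r1 by (auto simp: \<rho>_def)
  have z2: "0 \<notin> cube z (\<rho> + \<rho>)"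
  proof
    assume "0 \<in> cube z (\<rho> + \<rho>)"
    then have "0 \<in> cube z r0" using cube_mono[OF \<rho>(2)] by auto
    from r0(3)[OF this] r0(2) show False by simp
  qed
  have z1: "0 \<notin> cube z \<rho>" using z2 cube_mono[of \<rho> "\<rho> + \<rho>" z] \<rho> by auto
  have sub1: "cube z \<rho> \<subseteq> cube z r1" using \<rho> by (intro cube_mono) auto
  have cP: "continuous_on (cube z \<rho>) (P i)" for i by (rule continuous_on_subset[OF continuous_P]) (use z1 in auto)
  have "\<exists>B. \<forall>x\<in>cube z \<rho>. \<bar>P i x\<bar> \<le> B" for i
    using compact_imp_bounded[OF compact_continuous_image[OF cP compact_cube]] by (simp add: bounded_iff)
  then obtain BP where BP: "\<And>i x. x \<in> cube z \<rho> \<Longrightarrow> \<bar>P i x\<bar> \<le> BP i" by metis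
  have "\<exists>B. \<forall>x\<in>cube z \<rho>. \<bar>u x\<bar> \<le> B"
    using compact_imp_bounded[OF compact_continuous_image[OF continuous_on_subset[OF cont subset_UNIV] compact_cube]] by (simp add: bounded_iff)
  then obtain Bu where Bu: "\<And>x. x \<in> cube z \<rho> \<Longrightarrow> \<bar>u x\<bar> \<le> Bu" by blast
  define B where "B = 1 + \<bar>Bu\<bar> + (\<Sum>i\<in>UNIV. \<bar>BP i\<bar>)"
  have B1: "\<bar>P i x\<bar> + 1 \<le> B" if "x \<in> cube z \<rho>" for i x
  proof -
    have "\<bar>BP i\<bar> \<le> (\<Sum>i\<in>UNIV. \<bar>BP i\<bar>)" by (rule member_le_sum) auto
    then show ?thesis using BP[OF that, of i] unfolding B_def by linarith
  qed
  have B2: "\<bar>u x\<bar> + 1 \<le> B" if "x \<in> cube z \<rho>" for x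
  proof -
    have "0 \<le> (\<Sum>i\<in>UNIV. \<bar>BP i\<bar>)" by (rule sum_nonneg) auto
    then show ?thesis using Bu[OF that] unfolding B_def by linarith
  qed
  show ?thesis
  proof (rule approx_sequence[OF less_imp_le[OF \<rho>(1)] \<rho>(1) z2])
    fix e :: "nat \<Rightarrow> real" and G
    assume e: "\<And>l. 0 < e l" "e \<longlonglongrightarrow> 0" and G: "set_integrable lborel (cube z \<rho>) G"
      and ae: "AE x in lborel. x \<in> cube z \<rho> \<longrightarrow> (\<forall>i j. (\<lambda>l. Al (e l) i j x) \<longlonglongrightarrow> H i j x) \<and> (\<forall>l i j. \<bar>Al (e l) i j x\<bar> powr p \<le> G x)"
    have conv: "\<exists>N. \<forall>l\<ge>N. \<forall>x\<in>cube z \<rho>. \<bar>ul (e l) x - u x\<bar> \<le> \<delta> \<and> (\<forall>i. \<bar>Pl (e l) i x - P i x\<bar> \<le> \<delta>)" if \<delta>: "\<delta> > 0" for \<delta>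
    proof -
      obtain e1 where e1: "e1 > 0" "\<And>\<epsilon> i x. x \<in> cube z r1 \<Longrightarrow> 0 < \<epsilon> \<and> \<epsilon> < e1 \<Longrightarrow> \<bar>Pl \<epsilon> i x - P i x\<bar> \<le> \<delta>" using un[OF \<delta>] by blast
      obtain e2 where e2: "e2 > 0" "\<And>\<epsilon> x. x \<in> cube z \<rho> \<Longrightarrow> 0 < \<epsilon> \<and> \<epsilon> < e2 \<Longrightarrow> \<bar>ul \<epsilon> x - u x\<bar> \<le> \<delta>" using ul_uniform[OF less_imp_le[OF \<rho>(1)] \<delta>, of z] by blast
      have "\<forall>\<^sub>F l in sequentially. e l < min e1 e2" using e1 e2 by (intro order_tendstoD(2)[OF e(2)]) auto
      then obtain N where N: "\<And>l. l \<ge> N \<Longrightarrow> e l < min e1 e2" by (auto simp: eventually_sequentially)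
      show ?thesis
      proof (intro exI[of _ N] allI impI ballI conjI)
        fix l x assume l: "N \<le> l" and x: "x \<in> cube z \<rho>"
        show "\<bar>ul (e l) x - u x\<bar> \<le> \<delta>" using N[OF l] e(1)[of l] by (intro e2(2)[OF x]) auto
        show "\<bar>Pl (e l) i x - P i x\<bar> \<le> \<delta>" for i using N[OF l] e(1)[of l] x sub1 by (intro e1(2)) auto
      qed
    qed
    obtain N where N: "\<And>l x i. l \<ge> N \<Longrightarrow> x \<in> cube z \<rho> \<Longrightarrow> \<bar>ul (e l) x - u x\<bar> \<le> 1 \<and> \<bar>Pl (e l) i x - P i x\<bar> \<le> 1"
      using conv[OF zero_less_one] by blast
    show thesis
    proof (rule that[of \<rho> "\<lambda>l. e (l + N)" G B])
      show "AE x in lborel. x \<in> cube z \<rho> \<longrightarrow> (\<forall>i j. (\<lambda>l. Al (e (l + N)) i j x) \<longlonglongrightarrow> H i j x) \<and> (\<forall>l i j. \<bar>Al (e (l + N)) i j x\<bar> powr p \<le> G x)"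
        using ae by eventually_elim (auto intro: LIMSEQ_ignore_initial_segment)
      show "\<bar>Pl (e (l + N)) i x\<bar> \<le> B" if "x \<in> cube z \<rho>" for l i x
        using N[OF le_add2 that, of l i] B1[OF that, of i] by linarith
      show "\<bar>ul (e (l + N)) x\<bar> \<le> B" if "x \<in> cube z \<rho>" for l x
        using N[OF le_add2 that, THEN conjunct1, of l] B2[OF that] by linarith
      show "\<bar>P i x\<bar> \<le> B" if "x \<in> cube z \<rho>" for i x using B1[OF that, of i] by linarith
      show "\<bar>u x\<bar> \<le> B" if "x \<in> cube z \<rho>" for x using B2[OF that] by linarith
      show "\<exists>M. \<forall>l\<ge>M. \<forall>x\<in>cube z \<rho>. \<bar>ul (e (l + N)) x - u x\<bar> \<le> \<delta> \<and> (\<forall>i. \<bar>Pl (e (l + N)) i x - P i x\<bar> \<le> \<delta>)" if d: "\<delta> > 0" for \<delta>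
      proof -
        obtain M where "\<forall>l\<ge>M. \<forall>x\<in>cube z \<rho>. \<bar>ul (e l) x - u x\<bar> \<le> \<delta> \<and> (\<forall>i. \<bar>Pl (e l) i x - P i x\<bar> \<le> \<delta>)" using conv[OF d] by blast
        then show ?thesis by (intro exI[of _ M]) (simp add: trans_le_add1)
      qed
    qed (use \<rho> z1 e G in auto)
  qed
qed

text \<open>The residual of Euler's relation for the gradient: component j of the formal gradient of
  x \<bullet> Du x - \<alpha> * u x.\<close>

definition "RR x j = (\<Sum>i\<in>UNIV. x $ i * H i j x) + (1 - \<alpha>) * P j x"

text \<open>The function x \<bullet> Du x - \<alpha> * u x vanishes off the origin, hence so does
  its weak gradient. The smooth approximants are integrated by parts against a mollifier; in the
  limit every mollification of the residual is 0, and so is the residual itself.\<close>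

lemma euler_H:
  assumes z: "z \<noteq> 0"
  obtains r where "r > 0" "0 \<notin> cube z r" "AE x in lborel. x \<in> cube z r \<longrightarrow> (\<forall>j. RR x j = 0)"
proof (rule local_approximation[OF z])
  fix \<rho> :: real and e :: "nat \<Rightarrow> real" and G :: "real^'n \<Rightarrow> real" and B :: real
  assume \<rho>: "\<rho> > 0" and z0: "0 \<notin> cube z \<rho>" and e: "\<And>l. e l > 0" and G: "set_integrable lborel (cube z \<rho>) G"
    and ae: "AE x in lborel. x \<in> cube z \<rho> \<longrightarrow> (\<forall>i j. (\<lambda>l. Al (e l) i j x) \<longlonglongrightarrow> H i j x) \<and> (\<forall>l i j. \<bar>Al (e l) i j x\<bar> powr p \<le> G x)"
    and B1: "\<And>l i x. x \<in> cube z \<rho> \<Longrightarrow> \<bar>Pl (e l) i x\<bar> \<le> B" and B2: "\<And>i x. x \<in> cube z \<rho> \<Longrightarrow> \<bar>P i x\<bar> \<le> B"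
    and B3: "\<And>l x. x \<in> cube z \<rho> \<Longrightarrow> \<bar>ul (e l) x\<bar> \<le> B" and B4: "\<And>x. x \<in> cube z \<rho> \<Longrightarrow> \<bar>u x\<bar> \<le> B"
    and un: "\<And>\<delta>. \<delta> > 0 \<Longrightarrow> \<exists>N. \<forall>l\<ge>N. \<forall>x\<in>cube z \<rho>. \<bar>ul (e l) x - u x\<bar> \<le> \<delta> \<and> (\<forall>i. \<bar>Pl (e l) i x - P i x\<bar> \<le> \<delta>)"
  have B0: "B \<ge> 0" using B2[of z undefined] \<rho> by (force simp: cube_def)
  define X where "X = norm z + real CARD('n) * \<rho>"
  have X: "\<bar>x $ i\<bar> \<le> X" if "x \<in> cube z \<rho>" for x i
    using cube_norm_le[OF that] component_le_norm_cart[of x i] norm_triangle_ineq2[of x z] by (simp add: X_def)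
  have X0: "X \<ge> 0" using \<rho> by (simp add: X_def)
  have Pconv: "(\<lambda>l. Pl (e l) i x) \<longlonglongrightarrow> P i x" "(\<lambda>l. ul (e l) x) \<longlonglongrightarrow> u x" if x: "x \<in> cube z \<rho>" for i x
  proof -
    have *: "\<exists>N. \<forall>l\<ge>N. \<bar>ul (e l) x - u x\<bar> < d \<and> \<bar>Pl (e l) i x - P i x\<bar> < d" if d: "d > 0" for d
    proof -
      obtain N where "\<forall>l\<ge>N. \<forall>x\<in>cube z \<rho>. \<bar>ul (e l) x - u x\<bar> \<le> d / 2 \<and> (\<forall>i. \<bar>Pl (e l) i x - P i x\<bar> \<le> d / 2)"
        using un[of "d / 2"] d by auto
      then have "\<forall>l\<ge>N. \<bar>ul (e l) x - u x\<bar> \<le> d / 2 \<and> \<bar>Pl (e l) i x - P i x\<bar> \<le> d / 2" using x by blast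
      then show ?thesis using d by (intro exI[of _ N]) force
    qed
    show "(\<lambda>l. Pl (e l) i x) \<longlonglongrightarrow> P i x" "(\<lambda>l. ul (e l) x) \<longlonglongrightarrow> u x"
      unfolding LIMSEQ_iff using * by (auto; meson)+
  qed
  have RRm [measurable]: "(\<lambda>x. RR x j) \<in> borel_measurable borel" for j unfolding RR_def by measurable
  have zero: "conv (\<lambda>x. RR x j) (mollifier \<delta>) x = 0" if x: "x \<in> cube z (\<rho> / 2)" and \<delta>: "0 < \<delta>" "\<delta> < \<rho> / 2" for x \<delta> j
  proof -
    define \<psi> where "\<psi> = (\<lambda>y. 1 * mollifier \<delta> (1 *\<^sub>R (x - y)))"
    define \<psi>' where "\<psi>' y = (\<chi> i. partial_derivs [i] \<psi> y)" for y
    have sm: "smooth \<psi>" unfolding \<psi>_def by (rule smooth_affine[OF smooth_mollifier])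
    have d\<psi>: "(\<psi> has_derivative (\<lambda>h. \<psi>' y \<bullet> h)) (at y)" for y
      unfolding \<psi>'_def using has_derivative_partial_derivs[of \<psi> y] smooth_differentiable[OF sm, of "[]" y] by simp
    have c\<psi>': "continuous_on UNIV \<psi>'" unfolding \<psi>'_def by (intro continuous_on_vec_lambda smooth_continuous sm)
    have c\<psi>: "continuous_on UNIV \<psi>" using smooth_continuous[OF sm, of "[]"] by simp
    have sub: "cube x \<delta> \<subseteq> cube z \<rho>" using \<delta> by (intro cube_subset_cube[OF x]) auto
    have supp: "\<psi> y = 0" if "y \<notin> cube x \<delta>" for y
    proof -
      have "x - y \<notin> cube 0 \<delta>" using that by (auto simp: cube_def abs_minus_commute)
      then show ?thesis using mollifier_eq_0[OF \<delta>(1)] by (simp add: \<psi>_def)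
    qed
    have supp': "\<psi>' y = 0" if "y \<notin> cube x \<delta>" for y by (rule gradient_eq_0_outside[OF d\<psi> supp that])
    have "\<exists>M. \<forall>y\<in>cube x \<delta>. \<bar>\<psi> y\<bar> \<le> M" "\<exists>M. \<forall>y\<in>cube x \<delta>. norm (\<psi>' y) \<le> M"
      using compact_imp_bounded[OF compact_continuous_image[OF continuous_on_subset[OF c\<psi> subset_UNIV] compact_cube]]
        compact_imp_bounded[OF compact_continuous_image[OF continuous_on_subset[OF c\<psi>' subset_UNIV] compact_cube]]
      by (simp_all add: bounded_iff)
    then obtain M1 M2 where M1: "\<And>y. y \<in> cube x \<delta> \<Longrightarrow> \<bar>\<psi> y\<bar> \<le> M1" and M2: "\<And>y. y \<in> cube x \<delta> \<Longrightarrow> norm (\<psi>' y) \<le> M2" by blast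
    define rr where "rr l y = (\<Sum>i\<in>UNIV. y $ i * Pl (e l) i y) - \<alpha> * ul (e l) y" for l y
    define Q where "Q l y = (\<chi> j. (\<Sum>i\<in>UNIV. y $ i * Al (e l) i j y) + (1 - \<alpha>) * Pl (e l) j y)" for l y
    have drr: "(rr l has_derivative (\<lambda>h. Q l y \<bullet> h)) (at y)" for l y
    proof -
      have dn: "((\<lambda>y. y $ i) has_derivative (\<lambda>h. h $ i)) (at y)" for i
        by (simp add: bounded_linear_imp_has_derivative bounded_linear_vec_nth)
      have "(rr l has_derivative (\<lambda>h. (\<Sum>i\<in>UNIV. y $ i * ((\<chi> j. Al (e l) i j y) \<bullet> h) + h $ i * Pl (e l) i y) - \<alpha> * ((\<chi> i. Pl (e l) i y) \<bullet> h))) (at y)"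
        unfolding rr_def[abs_def]
        by (intro has_derivative_diff has_derivative_sum has_derivative_mult dn has_derivative_Pl has_derivative_ul e has_derivative_mult_right)
      moreover have "(\<Sum>i\<in>UNIV. y $ i * ((\<chi> j. Al (e l) i j y) \<bullet> h) + h $ i * Pl (e l) i y) - \<alpha> * ((\<chi> i. Pl (e l) i y) \<bullet> h) = Q l y \<bullet> h" for h
      proof -
        have "(\<Sum>i\<in>UNIV. y $ i * ((\<chi> j. Al (e l) i j y) \<bullet> h)) = (\<Sum>i\<in>UNIV. \<Sum>j\<in>UNIV. y $ i * (Al (e l) i j y * h $ j))"
          by (simp add: inner_vec_def sum_distrib_left)
        also have "\<dots> = (\<Sum>j\<in>UNIV. (\<Sum>i\<in>UNIV. y $ i * Al (e l) i j y) * h $ j)"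
          by (subst sum.swap) (simp add: sum_distrib_right mult.assoc)
        finally show ?thesis
          by (simp add: sum.distrib Q_def inner_vec_def algebra_simps sum_subtractf sum_distrib_left)
      qed
      ultimately show ?thesis by simp
    qed
    have cQ: "continuous_on UNIV (Q l)" for l
      unfolding Q_def by (intro continuous_on_vec_lambda continuous_intros continuous_on_Al continuous_on_Pl e)
    have crr: "continuous_on UNIV (rr l)" for l
      unfolding rr_def by (intro continuous_intros continuous_on_ul continuous_on_Pl e)
    have parts: "(\<integral>y. \<psi> y * Q l y $ j \<partial>lborel) + (\<integral>y. rr l y * \<psi>' y $ j \<partial>lborel) = 0" for l
    proof -
      have "(\<integral>y. (\<psi> y *\<^sub>R Q l y + rr l y *\<^sub>R \<psi>' y) $ j \<partial>lborel) = 0"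
      proof (rule integral_partial_eq_0)
        show "((\<lambda>y. rr l y * \<psi> y) has_derivative (\<lambda>h. (\<psi> y *\<^sub>R Q l y + rr l y *\<^sub>R \<psi>' y) \<bullet> h)) (at y)" for y
          by (rule has_derivative_eq_rhs[OF has_derivative_mult[OF drr d\<psi>]]) (auto simp: inner_add_left)
        show "continuous_on UNIV (\<lambda>y. \<psi> y *\<^sub>R Q l y + rr l y *\<^sub>R \<psi>' y)" by (intro continuous_intros c\<psi> c\<psi>' cQ crr)
        show "rr l y * \<psi> y = 0" if "y \<notin> cube x \<delta>" for y using supp[OF that] by simp
      qed
      moreover have "integrable lborel (\<lambda>y. \<psi> y * Q l y $ j)"
        by (rule integrable_continuous_compact_support[where z=x and r=\<delta>]) (use supp in \<open>auto intro!: continuous_intros c\<psi> cQ\<close>)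
      moreover have "integrable lborel (\<lambda>y. rr l y * \<psi>' y $ j)"
        by (rule integrable_continuous_compact_support[where z=x and r=\<delta>]) (use supp' in \<open>auto intro!: continuous_intros c\<psi>' crr\<close>)
      ultimately show ?thesis by simp
    qed
    have [measurable]: "\<psi> \<in> borel_measurable borel" "(\<lambda>y. \<psi>' y $ j) \<in> borel_measurable borel" "rr l \<in> borel_measurable borel" "(\<lambda>y. Q l y $ j) \<in> borel_measurable borel" for l
      using c\<psi> c\<psi>' crr[of l] cQ[of l] by (auto intro!: borel_measurable_continuous_onI continuous_intros)
    have Gi: "integrable lborel (\<lambda>y. indicator (cube z \<rho>) y * G y)" using G by (simp add: set_integrable_def)
    have Ci: "integrable lborel (\<lambda>y. indicator (cube z \<rho>) y * c)" for c :: real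
      using borel_integrable_compact[of "cube z \<rho>" "\<lambda>_. c"] by simp
    \<comment> \<open>Domination rests on the pointwise bound of a second derivative by 1 plus its
      p-th power, hence by 1 + G.\<close>
    have lim1: "(\<lambda>l. \<integral>y. \<psi> y * Q l y $ j \<partial>lborel) \<longlonglongrightarrow> (\<integral>y. \<psi> y * RR y j \<partial>lborel)"
    proof (rule integral_dominated_convergence)
      show "integrable lborel (\<lambda>y. \<bar>M1\<bar> * (indicator (cube z \<rho>) y * (real CARD('n) * X + B) + (real CARD('n) * X) * (indicator (cube z \<rho>) y * G y)))"
        by (intro integrable_mult_right Bochner_Integration.integrable_add Ci Gi)
      show "AE y in lborel. (\<lambda>l. \<psi> y * Q l y $ j) \<longlonglongrightarrow> \<psi> y * RR y j"
        using ae
      proof eventually_elim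
        fix y assume a: "y \<in> cube z \<rho> \<longrightarrow> (\<forall>i j. (\<lambda>l. Al (e l) i j y) \<longlonglongrightarrow> H i j y) \<and> (\<forall>l i j. \<bar>Al (e l) i j y\<bar> powr p \<le> G y)"
        show "(\<lambda>l. \<psi> y * Q l y $ j) \<longlonglongrightarrow> \<psi> y * RR y j"
        proof (cases "y \<in> cube x \<delta>")
          case True
          then have y: "y \<in> cube z \<rho>" using sub by auto
          then have "(\<lambda>l. Al (e l) i j y) \<longlonglongrightarrow> H i j y" for i using a by blast
          then show ?thesis unfolding Q_def RR_def vec_lambda_beta
            by (intro tendsto_intros Pconv(1)[OF y])
        qed (simp add: supp)
      qed
      show "AE y in lborel. norm (\<psi> y * Q l y $ j) \<le> \<bar>M1\<bar> * (indicator (cube z \<rho>) y * (real CARD('n) * X + B) + (real CARD('n) * X) * (indicator (cube z \<rho>) y * G y))" for l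
        using ae
      proof eventually_elim
        fix y assume a: "y \<in> cube z \<rho> \<longrightarrow> (\<forall>i j. (\<lambda>l. Al (e l) i j y) \<longlonglongrightarrow> H i j y) \<and> (\<forall>l i j. \<bar>Al (e l) i j y\<bar> powr p \<le> G y)"
        show "norm (\<psi> y * Q l y $ j) \<le> \<bar>M1\<bar> * (indicator (cube z \<rho>) y * (real CARD('n) * X + B) + (real CARD('n) * X) * (indicator (cube z \<rho>) y * G y))"
        proof (cases "y \<in> cube x \<delta>")
          case True
          then have y: "y \<in> cube z \<rho>" using sub by auto
          have "\<bar>y $ i * Al (e l) i j y\<bar> \<le> X * (1 + G y)" for i
            unfolding abs_mult
          proof (intro mult_mono X y)
            have "\<bar>Al (e l) i j y\<bar> \<le> 1 + \<bar>Al (e l) i j y\<bar> powr p" using p1 by (intro le_one_plus_powr) auto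
            also have "\<dots> \<le> 1 + G y" using a y by auto
            finally show "\<bar>Al (e l) i j y\<bar> \<le> 1 + G y" .
          qed (use X0 in auto)
          then have "\<bar>\<Sum>i\<in>UNIV. y $ i * Al (e l) i j y\<bar> \<le> (\<Sum>i\<in>(UNIV::'n set). X * (1 + G y))"
            by (intro order_trans[OF sum_abs] sum_mono)
          moreover have "\<bar>(1 - \<alpha>) * Pl (e l) j y\<bar> \<le> 1 * B" unfolding abs_mult using \<alpha> B1[OF y] by (intro mult_mono) auto
          ultimately have "\<bar>Q l y $ j\<bar> \<le> real CARD('n) * X * (1 + G y) + B" unfolding Q_def vec_lambda_beta by simp
          then have "\<bar>\<psi> y\<bar> * \<bar>Q l y $ j\<bar> \<le> \<bar>M1\<bar> * (real CARD('n) * X * (1 + G y) + B)"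
            using M1[OF True] by (intro mult_mono) auto
          then show ?thesis using y by (simp add: abs_mult algebra_simps)
        next
          case False
          have "0 \<le> indicator (cube z \<rho>) y * G y"
          proof (cases "y \<in> cube z \<rho>")
            case True
            then have "\<bar>Al (e 0) j j y\<bar> powr p \<le> G y" using a by blast
            then have "0 \<le> G y" by (meson order_trans powr_ge_zero)
            then show ?thesis using True by simp
          qed simp
          then show ?thesis using False supp B0 X0 by simp
        qed
      qed
    qed measurable
    \<comment> \<open>The integrands tend to 0 because their limit contains the factor that vanishes
      by \<open>euler_u\<close>.\<close>
    have lim2: "(\<lambda>l. \<integral>y. rr l y * \<psi>' y $ j \<partial>lborel) \<longlonglongrightarrow> (\<integral>y. 0 \<partial>(lborel :: (real^'n) measure))"
    proof (rule integral_dominated_convergence)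
      show "integrable lborel (\<lambda>y. indicator (cube z \<rho>) y * ((real CARD('n) * (X * B) + B) * \<bar>M2\<bar>))" by (rule Ci)
      show "AE y in lborel. (\<lambda>l. rr l y * \<psi>' y $ j) \<longlonglongrightarrow> 0"
      proof (rule AE_I2)
        fix y
        show "(\<lambda>l. rr l y * \<psi>' y $ j) \<longlonglongrightarrow> 0"
        proof (cases "y \<in> cube x \<delta>")
          case True
          then have y: "y \<in> cube z \<rho>" using sub by auto
          then have y0: "y \<noteq> 0" using z0 by auto
          have "(\<lambda>l. rr l y * \<psi>' y $ j) \<longlonglongrightarrow> ((\<Sum>i\<in>UNIV. y $ i * P i y) - \<alpha> * u y) * \<psi>' y $ j"
            unfolding rr_def by (intro tendsto_intros Pconv y)
          moreover have "(\<Sum>i\<in>UNIV. y $ i * P i y) = \<alpha> * u y"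
            using euler_u[OF y0] by (simp add: inner_vec_def Du_def)
          ultimately show ?thesis by simp
        qed (simp add: supp')
      qed
      show "AE y in lborel. norm (rr l y * \<psi>' y $ j) \<le> indicator (cube z \<rho>) y * ((real CARD('n) * (X * B) + B) * \<bar>M2\<bar>)" for l
      proof (rule AE_I2)
        fix y
        show "norm (rr l y * \<psi>' y $ j) \<le> indicator (cube z \<rho>) y * ((real CARD('n) * (X * B) + B) * \<bar>M2\<bar>)"
        proof (cases "y \<in> cube x \<delta>")
          case True
          then have y: "y \<in> cube z \<rho>" using sub by auto
          have "\<bar>y $ i * Pl (e l) i y\<bar> \<le> X * B" for i unfolding abs_mult using X[OF y] B1[OF y] X0 by (intro mult_mono) auto
          then have "\<bar>\<Sum>i\<in>UNIV. y $ i * Pl (e l) i y\<bar> \<le> (\<Sum>i\<in>(UNIV::'n set). X * B)"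
            by (intro order_trans[OF sum_abs] sum_mono)
          moreover have "\<bar>\<alpha> * ul (e l) y\<bar> \<le> 1 * B" unfolding abs_mult using \<alpha> B3[OF y] by (intro mult_mono) auto
          ultimately have "\<bar>rr l y\<bar> \<le> real CARD('n) * (X * B) + B" unfolding rr_def by simp
          moreover have "\<bar>\<psi>' y $ j\<bar> \<le> \<bar>M2\<bar>" using M2[OF True] component_le_norm_cart[of "\<psi>' y" j] by linarith
          ultimately have "\<bar>rr l y\<bar> * \<bar>\<psi>' y $ j\<bar> \<le> (real CARD('n) * (X * B) + B) * \<bar>M2\<bar>" by (intro mult_mono) auto
          then show ?thesis using y by (simp add: abs_mult)
        next
          case False
          then show ?thesis using supp' B0 X0 by (simp add: indicator_def)
        qed
      qed
    qed measurable
    have "(\<integral>y. \<psi> y * RR y j \<partial>lborel) + 0 = 0"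
      using tendsto_add[OF lim1 lim2] parts by (simp add: LIMSEQ_const_iff)
    then show ?thesis by (simp add: conv_def \<psi>_def mult.commute)
  qed
  \<comment> \<open>Integrability of the p-th power is what recovers the residual from its
    mollifications through \<open>conv_Lp_convergence\<close>.\<close>
  have RRp: "set_integrable lborel (cube z \<rho>) (\<lambda>x. \<bar>RR x j\<bar> powr p)" for j
    unfolding set_integrable_def
  proof (rule Bochner_Integration.integrable_bound)
    have "integrable lborel (\<lambda>x. indicator (cube z \<rho>) x * \<bar>H i j x\<bar> powr p)" for i
      using Hp[OF compact_cube z0, of i j] by (simp add: set_integrable_def)
    then show "integrable lborel (\<lambda>x. 3 powr p * (real CARD('n) powr p * (\<Sum>i\<in>UNIV. X powr p * (indicator (cube z \<rho>) x * \<bar>H i j x\<bar> powr p)) + indicator (cube z \<rho>) x * B powr p))"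
      using borel_integrable_compact[of "cube z \<rho>" "\<lambda>_. B powr p"]
      by (intro integrable_mult_right Bochner_Integration.integrable_add Bochner_Integration.integrable_sum) auto
    show "AE x in lborel. norm (indicator (cube z \<rho>) x *\<^sub>R \<bar>RR x j\<bar> powr p) \<le>
      norm (3 powr p * (real CARD('n) powr p * (\<Sum>i\<in>UNIV. X powr p * (indicator (cube z \<rho>) x * \<bar>H i j x\<bar> powr p)) + indicator (cube z \<rho>) x * B powr p))"
    proof (rule AE_I2)
      fix x
      show "norm (indicator (cube z \<rho>) x *\<^sub>R \<bar>RR x j\<bar> powr p) \<le>
        norm (3 powr p * (real CARD('n) powr p * (\<Sum>i\<in>UNIV. X powr p * (indicator (cube z \<rho>) x * \<bar>H i j x\<bar> powr p)) + indicator (cube z \<rho>) x * B powr p))"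
      proof (cases "x \<in> cube z \<rho>")
        case True
        have "\<bar>RR x j\<bar> powr p \<le> 3 powr p * (\<bar>\<Sum>i\<in>UNIV. x $ i * H i j x\<bar> powr p + \<bar>(1 - \<alpha>) * P j x\<bar> powr p + \<bar>0\<bar> powr p)"
          using powr_abs_add_le[of p "\<Sum>i\<in>UNIV. x $ i * H i j x" "(1 - \<alpha>) * P j x" 0] p1 by (simp add: RR_def)
        also have "\<dots> \<le> 3 powr p * (real CARD('n) powr p * (\<Sum>i\<in>UNIV. X powr p * \<bar>H i j x\<bar> powr p) + B powr p + \<bar>0\<bar> powr p)"
        proof (intro mult_left_mono add_mono)
          have "\<bar>\<Sum>i\<in>UNIV. x $ i * H i j x\<bar> powr p \<le> real CARD('n) powr p * (\<Sum>i\<in>UNIV. \<bar>x $ i * H i j x\<bar> powr p)"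
            using p1 by (intro powr_abs_sum_le) auto
          also have "\<dots> \<le> real CARD('n) powr p * (\<Sum>i\<in>UNIV. X powr p * \<bar>H i j x\<bar> powr p)"
          proof (intro mult_left_mono sum_mono)
            fix i
            have "\<bar>x $ i * H i j x\<bar> powr p = \<bar>x $ i\<bar> powr p * \<bar>H i j x\<bar> powr p" by (simp add: abs_mult powr_mult)
            also have "\<dots> \<le> X powr p * \<bar>H i j x\<bar> powr p" using X[OF True, of i] p1 by (intro mult_right_mono powr_mono2) auto
            finally show "\<bar>x $ i * H i j x\<bar> powr p \<le> X powr p * \<bar>H i j x\<bar> powr p" .
          qed auto
          finally show "\<bar>\<Sum>i\<in>UNIV. x $ i * H i j x\<bar> powr p \<le> real CARD('n) powr p * (\<Sum>i\<in>UNIV. X powr p * \<bar>H i j x\<bar> powr p)" .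
          have "\<bar>(1 - \<alpha>) * P j x\<bar> \<le> 1 * B" unfolding abs_mult using \<alpha> B2[OF True] by (intro mult_mono) auto
          then show "\<bar>(1 - \<alpha>) * P j x\<bar> powr p \<le> B powr p" using p1 by (intro powr_mono2) auto
        qed auto
        finally show ?thesis using True p1 by (auto intro: order_trans[OF _ abs_ge_self])
      qed simp
    qed
  qed measurable
  have AEj: "AE x in lborel. x \<in> cube z (\<rho> / 2) \<longrightarrow> RR x j = 0" for j
  proof -
    have "AE x in lborel. ennreal (\<bar>RR x j\<bar> powr p) * indicator (cube z (\<rho> / 2)) x = 0"
    proof (rule nn_integral_le_all_imp_AE_0)
      fix \<eta> :: real assume \<eta>: "\<eta> > 0"
      have "\<rho> / 2 \<ge> 0" "\<rho> / 2 > 0" using \<rho> by auto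
      moreover have "set_integrable lborel (cube z (\<rho> / 2 + \<rho> / 2)) (\<lambda>x. \<bar>RR x j\<bar> powr p)" using RRp by simp
      ultimately show "(\<integral>\<^sup>+x. ennreal (\<bar>RR x j\<bar> powr p) * indicator (cube z (\<rho> / 2)) x \<partial>lborel) \<le> ennreal \<eta>"
      proof (rule conv_Lp_convergence[OF RRm less_imp_le[OF p1] _ _ _ \<eta>])
        fix e0 assume e0: "0 < e0" "e0 \<le> \<rho> / 2"
          and le: "\<And>\<epsilon>. 0 < \<epsilon> \<Longrightarrow> \<epsilon> < e0 \<Longrightarrow> (\<integral>\<^sup>+x. ennreal (\<bar>conv (\<lambda>x. RR x j) (mollifier \<epsilon>) x - RR x j\<bar> powr p) * indicator (cube z (\<rho> / 2)) x \<partial>lborel) \<le> ennreal \<eta>"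
        have "(\<integral>\<^sup>+x. ennreal (\<bar>RR x j\<bar> powr p) * indicator (cube z (\<rho> / 2)) x \<partial>lborel) =
          (\<integral>\<^sup>+x. ennreal (\<bar>conv (\<lambda>x. RR x j) (mollifier (e0 / 2)) x - RR x j\<bar> powr p) * indicator (cube z (\<rho> / 2)) x \<partial>lborel)"
          using e0 by (intro nn_integral_cong) (auto simp: indicator_def zero)
        also have "\<dots> \<le> ennreal \<eta>" using e0 by (intro le) auto
        finally show ?thesis .
      qed
    qed measurable
    then show ?thesis by eventually_elim (use p1 in \<open>auto simp: indicator_def split: if_splits\<close>)
  qed
  show thesis
  proof (rule that[of "\<rho> / 2"])
    show "0 \<notin> cube z (\<rho> / 2)" using z0 cube_mono[of "\<rho> / 2" \<rho> z] \<rho> by auto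
    have "AE x in lborel. \<forall>j\<in>UNIV. x \<in> cube z (\<rho> / 2) \<longrightarrow> RR x j = 0" by (rule AE_finite_allI) (auto intro: AEj)
    then show "AE x in lborel. x \<in> cube z (\<rho> / 2) \<longrightarrow> (\<forall>j. RR x j = 0)" by eventually_elim auto
  qed (use \<rho> in auto)
qed

end

subsection \<open>The comparison identity\<close>

lemma has_real_derivative_pos_part_sq:
  "((\<lambda>t::real. (max 0 t)\<^sup>2) has_real_derivative 2 * max 0 t) (at t)"
proof -
  consider "t < 0" | "t = 0" | "t > 0" by linarith
  then show ?thesis
  proof cases
    case 1
    have "((\<lambda>t::real. 0) has_real_derivative 0) (at t)" by simp
    then show ?thesis
      by (rule has_field_derivative_transform_within_open[of _ _ _ "{..<0}", THEN DERIV_cong])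
         (use 1 in auto)
  next
    case 2
    have "((\<lambda>h::real. max 0 h) \<longlongrightarrow> max 0 0) (at 0)" by (intro tendsto_intros)
    moreover have "eventually (\<lambda>h::real. max 0 h = ((max 0 h)\<^sup>2 - (max 0 0)\<^sup>2) / (h - 0)) (at 0)"
      unfolding eventually_at_filter by (intro always_eventually allI impI) (auto simp: max_def power2_eq_square)
    ultimately have "((\<lambda>h::real. ((max 0 h)\<^sup>2 - (max 0 0)\<^sup>2) / (h - 0)) \<longlongrightarrow> max 0 0) (at 0)"
      by (rule Lim_transform_eventually)
    then show ?thesis using 2 by (simp add: has_field_derivative_iff)
  next
    case 3
    have "((\<lambda>t::real. t\<^sup>2) has_real_derivative 2 * t) (at t)" by (auto intro!: derivative_eq_intros)
    then show ?thesis
      by (rule has_field_derivative_transform_within_open[of _ _ _ "{0<..}", THEN DERIV_cong])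
         (use 3 in auto)
  qed
qed

text \<open>As h is negative on the sphere, its positive part vanishes nearby and can be extended by
  0. Squaring makes the extension continuously differentiable, which is the regularity that
  \<open>null_lagrangian\<close> asks of its compactly supported function.\<close>

lemma cutoff_pos_part_sq:
  fixes h :: "real^'n \<Rightarrow> real" and gh :: "real^'n \<Rightarrow> real^'n"
  assumes h: "\<And>x. x \<in> cball x0 t \<Longrightarrow> (h has_derivative (\<lambda>v. gh x \<bullet> v)) (at x)"
    and gh: "\<And>x. x \<in> cball x0 t \<Longrightarrow> isCont gh x" and neg: "\<And>x. x \<in> sphere x0 t \<Longrightarrow> h x < 0"
  shows "((\<lambda>x. if x \<in> ball x0 t then (max 0 (h x))\<^sup>2 else 0) has_derivative
      (\<lambda>v. (if x \<in> ball x0 t then (2 * max 0 (h x)) *\<^sub>R gh x else 0) \<bullet> v)) (at x)" (is ?A)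
    and "isCont (\<lambda>x. if x \<in> ball x0 t then (2 * max 0 (h x)) *\<^sub>R gh x else 0) x" (is ?B)
proof -
  let ?z = "\<lambda>x. if x \<in> ball x0 t then (max 0 (h x))\<^sup>2 else 0"
  let ?g = "\<lambda>x. if x \<in> ball x0 t then (2 * max 0 (h x)) *\<^sub>R gh x else 0"
  show ?A ?B
  proof (atomize (full), cases "x \<in> ball x0 t")
    case True
    then have xc: "x \<in> cball x0 t" by auto
    have ev: "eventually (\<lambda>y. y \<in> ball x0 t) (nhds x)" using True by (intro eventually_nhds_in_open) auto
    have "((\<lambda>x. (max 0 (h x))\<^sup>2) has_derivative (\<lambda>v. 2 * max 0 (h x) * (gh x \<bullet> v))) (at x)"
      using has_derivative_compose[OF h[OF xc] has_real_derivative_pos_part_sq[of "h x", unfolded has_field_derivative_def]]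
      by simp
    then have "(?z has_derivative (\<lambda>v. 2 * max 0 (h x) * (gh x \<bullet> v))) (at x)"
      by (rule has_derivative_transform_eventually) (use ev True in \<open>auto simp: eventually_at_filter elim: eventually_mono\<close>)
    moreover have "isCont ?g x"
    proof -
      have "isCont h x" using h[OF xc] by (rule has_derivative_continuous)
      then have "isCont (\<lambda>x. (2 * max 0 (h x)) *\<^sub>R gh x) x" by (intro continuous_intros gh[OF xc])
      moreover have "eventually (\<lambda>y. (2 * max 0 (h y)) *\<^sub>R gh y = ?g y) (nhds x)" using ev by eventually_elim simp
      ultimately show ?thesis by (subst (asm) isCont_cong)
    qed
    ultimately show "(?z has_derivative (\<lambda>v. ?g x \<bullet> v)) (at x) \<and> isCont ?g x" using True by simp
  next
    case False
    have ev: "eventually (\<lambda>y. y \<in> ball x0 t \<longrightarrow> h y < 0) (nhds x)"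
    proof (cases "x \<in> sphere x0 t")
      case True
      then have "isCont h x" using h[of x] by (intro has_derivative_continuous) auto
      then have "(h \<longlongrightarrow> h x) (nhds x)" by (simp add: isCont_def tendsto_at_iff_tendsto_nhds)
      from order_tendstoD(2)[OF this neg[OF True]] show ?thesis by eventually_elim simp
    next
      case F2: False
      then have "x \<in> - cball x0 t" using False by auto
      then have "eventually (\<lambda>y. y \<in> - cball x0 t) (nhds x)" by (intro eventually_nhds_in_open) (auto simp: open_Compl)
      then show ?thesis by eventually_elim auto
    qed
    have z0: "eventually (\<lambda>y. 0 = ?z y) (nhds x)" and g0: "eventually (\<lambda>y. 0 = ?g y) (nhds x)"
      using ev by (eventually_elim, auto simp: max_def)+
    have "((\<lambda>y. 0) has_derivative (\<lambda>v. 0 \<bullet> v)) (at x)" by simp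
    then have "(?z has_derivative (\<lambda>v. 0 \<bullet> v)) (at x)"
      by (rule has_derivative_transform_eventually) (use z0 False in \<open>auto simp: eventually_at_filter elim: eventually_mono\<close>)
    moreover have "isCont ?g x"
      using isCont_cong[OF g0] by simp
    ultimately show "(?z has_derivative (\<lambda>v. ?g x \<bullet> v)) (at x) \<and> isCont ?g x" using False by simp
  qed
qed

lemma tendsto_det2:
  fixes R :: "nat \<Rightarrow> 'n::finite \<Rightarrow> real^'n"
  assumes "v \<longlonglongrightarrow> v0" "w \<longlonglongrightarrow> w0" "\<And>i. (\<lambda>l. R l i) \<longlonglongrightarrow> R0 i"
  shows "(\<lambda>l. det2 j k (v l) (w l) (R l)) \<longlonglongrightarrow> det2 j k v0 w0 R0"
proof -
  have a: "(\<lambda>l. (\<chi> i. if i = j then v l else if i = k then w l else R l i) $ a $ b) \<longlonglongrightarrow> (\<chi> i. if i = j then v0 else if i = k then w0 else R0 i) $ a $ b" for a b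
    using assms by (auto intro: tendsto_vec_nth)
  show ?thesis unfolding det2_def det_def by (intro tendsto_sum tendsto_mult tendsto_const tendsto_prod a)
qed

lemma det2_measurable:
  fixes R :: "'n::finite \<Rightarrow> 'a \<Rightarrow> real^'n"
  assumes "\<And>a. (\<lambda>x. v x $ a) \<in> borel_measurable M" "\<And>a. (\<lambda>x. w x $ a) \<in> borel_measurable M"
    "\<And>i a. (\<lambda>x. R i x $ a) \<in> borel_measurable M"
  shows "(\<lambda>x. det2 j k (v x) (w x) (\<lambda>i. R i x)) \<in> borel_measurable M"
proof -
  have "(\<lambda>x. (\<chi> i. if i = j then v x else if i = k then w x else R i x) $ a $ b) \<in> borel_measurable M" for a b
    using assms by (cases "a = j"; cases "a = k") auto
  then show ?thesis unfolding det2_def det_def by (intro borel_measurable_sum borel_measurable_times borel_measurable_prod) auto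
qed

context hessian_setup
begin

text \<open>The exponent left over when the power 1 / \<alpha> is differentiated; it is positive
  because \<alpha> < 1.\<close>

definition "\<beta> = 1 / \<alpha> - 1"

lemma \<beta>: "\<beta> > 0" using \<alpha> by (simp add: \<beta>_def)

definition "Pv \<epsilon> x = (\<chi> i. Pl \<epsilon> i x)"
definition "Av \<epsilon> x i = (\<chi> j. Al \<epsilon> i j x)"
definition "Hv x i = (\<chi> j. H i j x)"
definition "ql \<xi> \<epsilon> x = ul \<epsilon> x powr \<beta> * (\<xi> \<bullet> Pv \<epsilon> x)"
definition "gql \<xi> \<epsilon> x = (ul \<epsilon> x powr \<beta>) *\<^sub>R (\<Sum>i\<in>UNIV. (\<xi> $ i) *\<^sub>R Av \<epsilon> x i) + (\<beta> * ul \<epsilon> x powr (\<beta> - 1) * (\<xi> \<bullet> Pv \<epsilon> x)) *\<^sub>R Pv \<epsilon> x"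
text \<open>Up to the factor \<open>\<alpha>\<close>, \<open>q \<xi>\<close> is the derivative of the 1-homogeneous function \<open>u powr (1 / \<alpha>)\<close> in
  direction \<open>\<xi>\<close>; hence it is 0-homogeneous.\<close>

definition "q \<xi> x = u x powr \<beta> * (\<xi> \<bullet> Du x)"
text \<open>What the product rule would give for the gradient of \<open>q \<xi>\<close>, with
  \<open>H\<close> in place of second derivatives. It is used only as the almost everywhere limit of
  the genuine gradients \<open>gql \<xi> \<epsilon>\<close>.\<close>

definition "gq \<xi> x = (u x powr \<beta>) *\<^sub>R (\<Sum>i\<in>UNIV. (\<xi> $ i) *\<^sub>R Hv x i) + (\<beta> * u x powr (\<beta> - 1) * (\<xi> \<bullet> Du x)) *\<^sub>R Du x"

lemma has_derivative_ql:
  assumes e: "\<epsilon> > 0" and pos: "ul \<epsilon> x > 0"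
  shows "(ql \<xi> \<epsilon> has_derivative (\<lambda>h. gql \<xi> \<epsilon> x \<bullet> h)) (at x)"
proof -
  have 1: "((\<lambda>x. ul \<epsilon> x powr \<beta>) has_derivative (\<lambda>h. \<beta> * ul \<epsilon> x powr (\<beta> - 1) * (Pv \<epsilon> x \<bullet> h))) (at x)"
  proof -
    have "((\<lambda>t. t powr \<beta>) has_real_derivative \<beta> * ul \<epsilon> x powr (\<beta> - 1)) (at (ul \<epsilon> x))"
      using pos by (auto intro!: derivative_eq_intros)
    from has_derivative_compose[OF has_derivative_ul[OF e] this[unfolded has_field_derivative_def]]
    show ?thesis by (simp add: Pv_def)
  qed
  have 2: "((\<lambda>x. \<xi> \<bullet> Pv \<epsilon> x) has_derivative (\<lambda>h. (\<Sum>i\<in>UNIV. (\<xi> $ i) *\<^sub>R Av \<epsilon> x i) \<bullet> h)) (at x)"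
  proof -
    have "((\<lambda>x. \<Sum>i\<in>UNIV. \<xi> $ i * Pl \<epsilon> i x) has_derivative (\<lambda>h. \<Sum>i\<in>UNIV. \<xi> $ i * (Av \<epsilon> x i \<bullet> h))) (at x)"
      unfolding Av_def by (intro has_derivative_sum has_derivative_mult_right has_derivative_Pl e)
    moreover have "(\<Sum>i\<in>UNIV. \<xi> $ i * (Av \<epsilon> x i \<bullet> h)) = (\<Sum>i\<in>UNIV. (\<xi> $ i) *\<^sub>R Av \<epsilon> x i) \<bullet> h" for h
      by (simp add: inner_sum_left)
    ultimately show ?thesis by (simp add: inner_vec_def[of \<xi>] Pv_def)
  qed
  show ?thesis unfolding ql_def[abs_def]
    by (rule has_derivative_eq_rhs[OF has_derivative_mult[OF 1 2]]) (auto simp: gql_def inner_add_left algebra_simps)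
qed

lemma continuous_on_Pv: "\<epsilon> > 0 \<Longrightarrow> continuous_on UNIV (Pv \<epsilon>)"
  and continuous_on_Av: "\<epsilon> > 0 \<Longrightarrow> continuous_on UNIV (\<lambda>x. Av \<epsilon> x i)"
  unfolding Pv_def Av_def by (intro continuous_on_vec_lambda continuous_on_Pl continuous_on_Al; simp)+

lemma isCont_gql:
  assumes e: "\<epsilon> > 0" and pos: "ul \<epsilon> x > 0" shows "isCont (gql \<xi> \<epsilon>) x"
proof -
  have "isCont (ul \<epsilon>) x" "isCont (Pv \<epsilon>) x" "isCont (\<lambda>x. Av \<epsilon> x i) x" for i
    using continuous_on_ul[OF e] continuous_on_Pv[OF e] continuous_on_Av[OF e] by (simp_all add: continuous_on_eq_continuous_at)
  then show ?thesis unfolding gql_def[abs_def]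
    using pos by (intro continuous_intros) auto
qed

text \<open>\<open>null_lagrangian\<close> with the gradient of the truncated square in row j, the
  gradient of \<open>ul \<epsilon>\<close> in row k and the gradients of its partial derivatives
  elsewhere. Differentiating the square produces the weight max 0 and a factor 2, which is
  dropped.\<close>

lemma approx_identity:
  assumes e: "\<epsilon> > 0" and pos: "\<And>x. x \<in> cball x0 t \<Longrightarrow> ul \<epsilon> x > 0"
    and \<phi>: "\<And>x. x \<in> cball x0 t \<Longrightarrow> (\<phi> has_derivative (\<lambda>h. g\<phi> x \<bullet> h)) (at x)" "\<And>x. x \<in> cball x0 t \<Longrightarrow> isCont g\<phi> x"
    and neg: "\<And>x. x \<in> sphere x0 t \<Longrightarrow> ql \<xi> \<epsilon> x - \<phi> x < \<tau>"
  shows "(\<integral>x. indicator (ball x0 t) x * (max 0 (ql \<xi> \<epsilon> x - \<phi> x - \<tau>) * det2 j k (gql \<xi> \<epsilon> x - g\<phi> x) (Pv \<epsilon> x) (Av \<epsilon> x)) \<partial>lborel) = 0"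
proof -
  define h where "h x = ql \<xi> \<epsilon> x - \<phi> x - \<tau>" for x
  define gh where "gh x = gql \<xi> \<epsilon> x - g\<phi> x" for x
  define \<zeta> where "\<zeta> x = (if x \<in> ball x0 t then (max 0 (h x))\<^sup>2 else 0)" for x
  define Z where "Z x = (if x \<in> ball x0 t then (2 * max 0 (h x)) *\<^sub>R gh x else 0)" for x
  define R where "R i = (if i = k then Pv \<epsilon> else (\<lambda>x. Av \<epsilon> x i))" for i
  define S where "S i x = (if i = k then (\<chi> a b. Al \<epsilon> a b x) else (\<chi> a b. conv u (partial_derivs [b, a, i] (mollifier \<epsilon>)) x))" for i x
  have dh: "(h has_derivative (\<lambda>v. gh x \<bullet> v)) (at x)" if x: "x \<in> cball x0 t" for x
    unfolding h_def[abs_def] gh_def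
    by (rule has_derivative_eq_rhs[OF has_derivative_diff[OF has_derivative_diff[OF has_derivative_ql[OF e pos[OF x]] \<phi>(1)[OF x]] has_derivative_const]])
       (auto simp: inner_diff_left)
  have cgh: "isCont gh x" if x: "x \<in> cball x0 t" for x
    unfolding gh_def[abs_def] by (intro continuous_intros isCont_gql e pos x \<phi>)
  have neg': "h x < 0" if "x \<in> sphere x0 t" for x using neg[OF that] by (simp add: h_def)
  note cut = cutoff_pos_part_sq[where ?x0.0=x0 and t=t, OF dh cgh neg']
  have d\<zeta>: "(\<zeta> has_derivative (\<lambda>v. Z x \<bullet> v)) (at x)" for x
    using cut(1)[of x] unfolding \<zeta>_def[abs_def] Z_def .
  have cZ: "continuous_on UNIV Z"
    unfolding continuous_on_eq_continuous_at[OF open_UNIV] using cut(2) unfolding Z_def[abs_def] by blast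
  have "(\<integral>x. det (\<chi> i. if i = j then Z x else R i x) \<partial>lborel) = 0"
  proof (rule null_lagrangian[OF d\<zeta> cZ])
    show "\<zeta> x = 0" if "x \<notin> cube x0 t" for x
    proof -
      have "x \<notin> ball x0 t" using that ball_subset_cube[of x x0 t] by (auto simp: dist_norm norm_minus_commute)
      then show ?thesis by (simp add: \<zeta>_def)
    qed
    fix i x assume "i \<noteq> j"
    show "(R i has_derivative (\<lambda>h. S i x *v h)) (at x)"
    proof (rule has_derivative_componentwise_within[THEN iffD2], rule ballI)
      fix b :: "real^'n" assume "b \<in> Basis"
      then obtain a where b: "b = axis a 1" by (auto simp: Basis_vec_def)
      show "((\<lambda>x. R i x \<bullet> b) has_derivative (\<lambda>h. (S i x *v h) \<bullet> b)) (at x)"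
      proof (cases "i = k")
        case True
        have "(Pl \<epsilon> a has_derivative (\<lambda>h. (\<chi> j. Al \<epsilon> a j x) \<bullet> h)) (at x)" by (rule has_derivative_Pl[OF e])
        moreover have "(\<lambda>x. R i x \<bullet> b) = Pl \<epsilon> a" using True by (auto simp: R_def b inner_axis Pv_def)
        moreover have "(S i x *v h) \<bullet> b = (\<chi> j. Al \<epsilon> a j x) \<bullet> h" for h
          using True unfolding b inner_axis by (simp add: S_def matrix_vector_mult_def inner_vec_def)
        ultimately show ?thesis by simp
      next
        case False
        have "(Al \<epsilon> i a has_derivative (\<lambda>h. (\<chi> b. conv u (partial_derivs [b, a, i] (mollifier \<epsilon>)) x) \<bullet> h)) (at x)"
          by (rule has_derivative_Al[OF e])
        moreover have "(\<lambda>x. R i x \<bullet> b) = Al \<epsilon> i a" using False by (auto simp: R_def b inner_axis Av_def)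
        moreover have "(S i x *v h) \<bullet> b = (\<chi> b. conv u (partial_derivs [b, a, i] (mollifier \<epsilon>)) x) \<bullet> h" for h
          using False unfolding b inner_axis by (simp add: S_def matrix_vector_mult_def inner_vec_def del: partial_derivs.simps)
        ultimately show ?thesis by simp
      qed
    qed
    show "S i x $ a $ b = S i x $ b $ a" for a b
      using partial_derivs_swap_mollifier[of "[]" b a "[]" \<epsilon>] partial_derivs_swap_mollifier[of "[]" b a "[i]" \<epsilon>]
      by (simp add: S_def Al_def del: partial_derivs.simps)
  next
    fix i
    have "continuous_on UNIV (conv u (partial_derivs [b, a, i] (mollifier \<epsilon>)))" for a b
      by (rule continuous_on_conv_mollifier[OF cont e])
    then show "continuous_on UNIV (S i)"
      unfolding S_def[abs_def] by (cases "i = k") (auto intro!: continuous_on_vec_lambda continuous_on_Al e simp del: partial_derivs.simps)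
  qed
  moreover have "det (\<chi> i. if i = j then Z x else R i x) = 2 * (indicator (ball x0 t) x * (max 0 (ql \<xi> \<epsilon> x - \<phi> x - \<tau>) * det2 j k (gql \<xi> \<epsilon> x - g\<phi> x) (Pv \<epsilon> x) (Av \<epsilon> x)))" for x
  proof -
    have 1: "det (\<chi> i. if i = j then Z x else R i x) = det2 j k (Z x) (Pv \<epsilon> x) (Av \<epsilon> x)"
      unfolding det2_def by (intro arg_cong[where f=det]) (auto simp: vec_eq_iff R_def)
    have 2: "Z x = (2 * (indicator (ball x0 t) x * max 0 (h x))) *\<^sub>R gh x" by (simp add: Z_def)
    have 3: "det2 j k (c *\<^sub>R v) w Q = c * det2 j k v w Q" for c v w and Q :: "'n \<Rightarrow> real^'n"
      by (simp only: linear_scale[OF linear_det2_left] real_scaleR_def)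
    show ?thesis unfolding 1 unfolding 2 3 h_def gh_def by simp
  qed
  ultimately show ?thesis by simp
qed

end

text \<open>The sum of both endpoint values covers either sign of the exponent; it is applied to
  \<beta> - 1, whose sign depends on \<alpha>.\<close>

lemma powr_le_endpoints:
  fixes a l b c :: real
  assumes "0 < l" "l \<le> a" "a \<le> b" shows "a powr c \<le> l powr c + b powr c"
proof (cases "c \<ge> 0")
  case True
  then have "a powr c \<le> b powr c" using assms by (intro powr_mono2) auto
  then show ?thesis by (simp add: add_increasing)
next
  case False
  then have "a powr c \<le> l powr c" using assms by (intro powr_mono2') auto
  then show ?thesis by (simp add: add_increasing2)
qed

lemma compact_sup_less:
  fixes f :: "'a::topological_space \<Rightarrow> real"
  assumes "compact S" "continuous_on S f" "\<And>x. x \<in> S \<Longrightarrow> f x < c"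
  obtains \<kappa> where "\<kappa> > 0" "\<And>x. x \<in> S \<Longrightarrow> f x \<le> c - \<kappa>"
proof (cases "S = {}")
  case True then show ?thesis using that[of 1] by simp
next
  case False
  then obtain y where y: "y \<in> S" "\<And>x. x \<in> S \<Longrightarrow> f x \<le> f y"
    using continuous_attains_sup[OF assms(1) False assms(2)] by blast
  show ?thesis using that[of "c - f y"] y assms(3)[OF y(1)] by simp
qed

context hessian_setup
begin

lemma continuous_on_q:
  assumes "\<And>x. x \<in> S \<Longrightarrow> x \<noteq> 0 \<and> u x > 0" shows "continuous_on S (q \<xi>)"
  unfolding q_def using assms
  by (intro continuous_intros continuous_on_subset[OF cont] continuous_on_subset[OF continuous_Du]) force+

lemma q_measurable [measurable]: "q \<xi> \<in> borel_measurable borel"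
proof -
  have "(\<lambda>x. \<Sum>i\<in>UNIV. \<xi> $ i * P i x) \<in> borel_measurable borel" by measurable
  then show ?thesis unfolding q_def[abs_def] Du_def inner_vec_def by simp
qed

text \<open>The division by \<alpha> - 1 shows the role of \<alpha> \<noteq> 1: in degree one the
  same relation would make the rows of the Hessian linearly dependent.\<close>

lemma Du_Hv:
  assumes "\<forall>j. RR x j = 0" shows "Du x = (\<Sum>l\<in>UNIV. (x $ l / (\<alpha> - 1)) *\<^sub>R Hv x l)"
proof -
  have "P j x = (\<Sum>l\<in>UNIV. x $ l / (\<alpha> - 1) * H l j x)" for j
  proof -
    have "(\<Sum>i\<in>UNIV. x $ i * H i j x) = (\<alpha> - 1) * P j x" using assms by (simp add: RR_def algebra_simps)
    then have "P j x = (\<Sum>i\<in>UNIV. x $ i * H i j x) / (\<alpha> - 1)" using \<alpha> by simp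
    then show ?thesis by (simp add: sum_divide_distrib)
  qed
  then show ?thesis by (simp add: vec_eq_iff Du_def Hv_def)
qed

text \<open>The factor in front of the Hessian determinant contains a 2 x 2 minor of \<xi> and x.
  For x \<noteq> 0 it is nonzero for some pair j, k unless \<xi> is a multiple of x.\<close>

lemma det2_gq:
  assumes jk: "j \<noteq> k" and R: "\<forall>j. RR x j = 0"
  shows "det2 j k (gq \<xi> x - v) (Du x) (Hv x) =
    u x powr \<beta> * (\<xi> $ j * x $ k - \<xi> $ k * x $ j) / (\<alpha> - 1) * det (\<chi> i. Hv x i) - det2 j k v (Du x) (Hv x)"
proof -
  have "det2 j k (gq \<xi> x - v) (Du x) (Hv x) = det2 j k (gq \<xi> x) (Du x) (Hv x) - det2 j k v (Du x) (Hv x)"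
    by (rule linear_diff[OF linear_det2_left])
  also have "det2 j k (gq \<xi> x) (Du x) (Hv x) = u x powr \<beta> * (\<xi> $ j * (x $ k / (\<alpha> - 1)) - \<xi> $ k * (x $ j / (\<alpha> - 1))) * det (\<chi> i. Hv x i)"
    unfolding gq_def by (rule det2_combination[OF jk Du_Hv[OF R]])
  finally show ?thesis by (simp add: diff_divide_distrib right_diff_distrib)
qed

text \<open>Euler's relations (\<open>Du_Hv\<close>) turn the determinant with first row \<open>gq \<xi> x\<close> into a multiple of the
  Hessian determinant; the function \<open>q \<xi>\<close> itself is only Hoelder continuous, so the identity
  passes through the mollifications.\<close>

lemma comparison_identity:
  assumes z: "z \<noteq> 0" and uz: "u z > 0"
  obtains \<rho> where "\<rho> > 0" "0 \<notin> cube z \<rho>" "\<And>x. x \<in> cube z \<rho> \<Longrightarrow> u x > 0"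
   "\<And>\<xi> j k t \<phi> g\<phi> \<tau>. \<lbrakk>j \<noteq> k; 0 < t; t \<le> \<rho>; \<And>x. x \<noteq> 0 \<Longrightarrow> (\<phi> has_derivative (\<lambda>h. g\<phi> x \<bullet> h)) (at x);
      \<And>x. x \<noteq> 0 \<Longrightarrow> isCont g\<phi> x; \<And>x. x \<in> sphere z t \<Longrightarrow> q \<xi> x - \<phi> x < \<tau>\<rbrakk> \<Longrightarrow>
      integrable lborel (\<lambda>x. indicator (ball z t) x * max 0 (q \<xi> x - \<phi> x - \<tau>) *
          (u x powr \<beta> * (\<xi> $ j * x $ k - \<xi> $ k * x $ j) / (\<alpha> - 1) * det (\<chi> i. Hv x i))) \<and>
      integrable lborel (\<lambda>x. indicator (ball z t) x * max 0 (q \<xi> x - \<phi> x - \<tau>) * det2 j k (g\<phi> x) (Du x) (Hv x)) \<and>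
      (\<integral>x. indicator (ball z t) x * max 0 (q \<xi> x - \<phi> x - \<tau>) *
          (u x powr \<beta> * (\<xi> $ j * x $ k - \<xi> $ k * x $ j) / (\<alpha> - 1) * det (\<chi> i. Hv x i)) \<partial>lborel) =
      (\<integral>x. indicator (ball z t) x * max 0 (q \<xi> x - \<phi> x - \<tau>) * det2 j k (g\<phi> x) (Du x) (Hv x) \<partial>lborel)"
proof (rule local_approximation[OF z])
  fix \<rho>1 :: real and e :: "nat \<Rightarrow> real" and G :: "real^'n \<Rightarrow> real" and B :: real
  assume \<rho>1: "\<rho>1 > 0" and z0: "0 \<notin> cube z \<rho>1" and e: "\<And>l. e l > 0" and G1: "set_integrable lborel (cube z \<rho>1) G"
    and ae1: "AE x in lborel. x \<in> cube z \<rho>1 \<longrightarrow> (\<forall>i j. (\<lambda>l. Al (e l) i j x) \<longlonglongrightarrow> H i j x) \<and> (\<forall>l i j. \<bar>Al (e l) i j x\<bar> powr p \<le> G x)"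
    and B1': "\<And>l i x. x \<in> cube z \<rho>1 \<Longrightarrow> \<bar>Pl (e l) i x\<bar> \<le> B" and B2': "\<And>i x. x \<in> cube z \<rho>1 \<Longrightarrow> \<bar>P i x\<bar> \<le> B"
    and B3': "\<And>l x. x \<in> cube z \<rho>1 \<Longrightarrow> \<bar>ul (e l) x\<bar> \<le> B" and B4': "\<And>x. x \<in> cube z \<rho>1 \<Longrightarrow> \<bar>u x\<bar> \<le> B"
    and un': "\<And>\<delta>. \<delta> > 0 \<Longrightarrow> \<exists>N. \<forall>l\<ge>N. \<forall>x\<in>cube z \<rho>1. \<bar>ul (e l) x - u x\<bar> \<le> \<delta> \<and> (\<forall>i. \<bar>Pl (e l) i x - P i x\<bar> \<le> \<delta>)"
  obtain r2 where r2: "r2 > 0" "AE x in lborel. x \<in> cube z r2 \<longrightarrow> (\<forall>j. RR x j = 0)" using euler_H[OF z] by blast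
  obtain r3 where r3: "r3 > 0" "\<And>x. x \<in> cube z r3 \<Longrightarrow> u x > 0"
  proof -
    have "isCont u z" using cont by (simp add: continuous_on_eq_continuous_at)
    then obtain d where d: "d > 0" "\<And>x. dist x z < d \<Longrightarrow> dist (u x) (u z) < u z"
      using uz unfolding continuous_at_eps_delta by (metis dist_commute)
    show ?thesis
    proof (rule that[of "d / (2 * real CARD('n))"])
      fix x assume "x \<in> cube z (d / (2 * real CARD('n)))"
      from cube_norm_le[OF this] have "norm (x - z) \<le> d / 2" by simp
      then have "dist (u x) (u z) < u z" using d(1) by (intro d(2)) (simp add: dist_norm)
      then show "u x > 0" by (auto simp: dist_real_def)
    qed (use d in auto)
  qed
  define \<rho> where "\<rho> = min \<rho>1 (min r2 r3)"
  have \<rho>: "\<rho> > 0" using \<rho>1 r2 r3 by (simp add: \<rho>_def)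
  have sub1: "cube z \<rho> \<subseteq> cube z \<rho>1" "cube z \<rho> \<subseteq> cube z r2" "cube z \<rho> \<subseteq> cube z r3"
    unfolding \<rho>_def by (intro cube_mono; simp)+
  have z0: "0 \<notin> cube z \<rho>" using z0 sub1 by auto
  have upos: "u x > 0" if "x \<in> cube z \<rho>" for x using r3(2) sub1 that by auto
  have ae: "AE x in lborel. x \<in> cube z \<rho> \<longrightarrow> (\<forall>i j. (\<lambda>l. Al (e l) i j x) \<longlonglongrightarrow> H i j x) \<and> (\<forall>l i j. \<bar>Al (e l) i j x\<bar> powr p \<le> G x) \<and> (\<forall>j. RR x j = 0)"
    using ae1 r2(2) by eventually_elim (use sub1 in auto)
  have B1: "\<bar>Pl (e l) i x\<bar> \<le> B" and B2: "\<bar>P i x\<bar> \<le> B" and B3: "\<bar>ul (e l) x\<bar> \<le> B" and B4: "\<bar>u x\<bar> \<le> B" if "x \<in> cube z \<rho>" for l i x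
    using that sub1 by (auto intro: B1' B2' B3' B4')
  have un: "\<exists>N. \<forall>l\<ge>N. \<forall>x\<in>cube z \<rho>. \<bar>ul (e l) x - u x\<bar> \<le> \<delta> \<and> (\<forall>i. \<bar>Pl (e l) i x - P i x\<bar> \<le> \<delta>)" if "\<delta> > 0" for \<delta>
    using un'[OF that] sub1(1) by blast
  have G: "integrable lborel (\<lambda>x. indicator (cube z \<rho>) x * G x)"
  proof -
    have "set_integrable lborel (cube z \<rho>) G" by (rule set_integrable_subset[OF G1]) (use sub1 in auto)
    then show ?thesis by (simp add: set_integrable_def)
  qed
  \<comment> \<open>The positive lower bound keeps powers of the mollified u with exponent \<beta> -
    1 bounded.\<close>
  obtain m where m: "m > 0" "\<And>x. x \<in> cube z \<rho> \<Longrightarrow> u x \<ge> m"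
  proof -
    have "continuous_on (cube z \<rho>) (\<lambda>x. - u x)" by (intro continuous_intros continuous_on_subset[OF cont]) auto
    then obtain \<kappa> where "\<kappa> > 0" "\<And>x. x \<in> cube z \<rho> \<Longrightarrow> - u x \<le> 0 - \<kappa>"
      using compact_sup_less[OF compact_cube, of z \<rho> "\<lambda>x. - u x" 0] upos by auto
    then show ?thesis using that[of \<kappa>] by force
  qed
  have zc: "z \<in> cube z \<rho>" using \<rho> by (simp add: cube_def)
  have Bpos: "B > 0" using B4[OF zc] m(2)[OF zc] m(1) by linarith
  let ?n = "real CARD('n)"
  have normP: "norm (Pv (e l) x) \<le> ?n * B" and normD: "norm (Du x) \<le> ?n * B" if x: "x \<in> cube z \<rho>" for l x
  proof -
    have "Pv (e l) x \<in> cube 0 B" "Du x \<in> cube 0 B" using B1[OF x] B2[OF x] by (auto simp: cube_def Pv_def Du_def)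
    from this[THEN cube_norm_le] show "norm (Pv (e l) x) \<le> ?n * B" "norm (Du x) \<le> ?n * B" by simp_all
  qed
  have Pconv: "(\<lambda>l. Pv (e l) x) \<longlonglongrightarrow> Du x" "(\<lambda>l. ul (e l) x) \<longlonglongrightarrow> u x" if x: "x \<in> cube z \<rho>" for x
  proof -
    have *: "\<exists>N. \<forall>l\<ge>N. \<bar>ul (e l) x - u x\<bar> < d \<and> \<bar>Pl (e l) i x - P i x\<bar> < d" if d: "d > 0" for d i
    proof -
      obtain N where "\<forall>l\<ge>N. \<forall>x\<in>cube z \<rho>. \<bar>ul (e l) x - u x\<bar> \<le> d / 2 \<and> (\<forall>i. \<bar>Pl (e l) i x - P i x\<bar> \<le> d / 2)"
        using un[of "d / 2"] d by auto
      then have "\<forall>l\<ge>N. \<bar>ul (e l) x - u x\<bar> \<le> d / 2 \<and> \<bar>Pl (e l) i x - P i x\<bar> \<le> d / 2" using x by blast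
      then show ?thesis using d by (intro exI[of _ N]) force
    qed
    have "(\<lambda>l. Pl (e l) i x) \<longlonglongrightarrow> P i x" for i
      unfolding LIMSEQ_iff using * by (auto; meson)
    then show "(\<lambda>l. Pv (e l) x) \<longlonglongrightarrow> Du x" unfolding Pv_def Du_def by (intro vec_tendstoI) simp
    show "(\<lambda>l. ul (e l) x) \<longlonglongrightarrow> u x"
      unfolding LIMSEQ_iff using * by (auto; meson)
  qed
  show thesis
  proof (rule that[OF \<rho> z0 upos])
    fix \<xi> :: "real^'n" and j k :: 'n and t :: real and \<phi> :: "real^'n \<Rightarrow> real" and g\<phi> :: "real^'n \<Rightarrow> real^'n" and \<tau> :: real
    assume jk: "j \<noteq> k" and t: "0 < t" "t \<le> \<rho>" and d\<phi>: "\<And>x. x \<noteq> 0 \<Longrightarrow> (\<phi> has_derivative (\<lambda>h. g\<phi> x \<bullet> h)) (at x)"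
      and cg\<phi>: "\<And>x. x \<noteq> 0 \<Longrightarrow> isCont g\<phi> x" and sph: "\<And>x. x \<in> sphere z t \<Longrightarrow> q \<xi> x - \<phi> x < \<tau>"
    have cb: "cball z t \<subseteq> cube z \<rho>"
      using t by (auto simp: dist_norm norm_minus_commute intro!: ball_subset_cube intro: order_trans)
    have c\<phi>: "continuous_on (- {0}) \<phi>" "continuous_on (- {0}) g\<phi>"
      by (auto intro!: continuous_at_imp_continuous_on has_derivative_continuous[OF d\<phi>] cg\<phi>)
    have [measurable]: "\<phi> \<in> borel_measurable borel" "g\<phi> \<in> borel_measurable borel"
      using c\<phi> by (auto intro!: borel_measurable_continuous_countable_exceptions[of "{0}"])
    have c\<phi>': "continuous_on (cube z \<rho>) \<phi>" "continuous_on (cube z \<rho>) g\<phi>"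
      using z0 by (auto intro: continuous_on_subset[OF c\<phi>(1)] continuous_on_subset[OF c\<phi>(2)])
    have "\<exists>M. \<forall>y\<in>cube z \<rho>. \<bar>\<phi> y\<bar> \<le> M" "\<exists>M. \<forall>y\<in>cube z \<rho>. norm (g\<phi> y) \<le> M"
      using compact_imp_bounded[OF compact_continuous_image[OF c\<phi>'(1) compact_cube]]
        compact_imp_bounded[OF compact_continuous_image[OF c\<phi>'(2) compact_cube]] by (simp_all add: bounded_iff)
    then obtain M1 M2 where M1: "\<And>y. y \<in> cube z \<rho> \<Longrightarrow> \<bar>\<phi> y\<bar> \<le> M1" and M2: "\<And>y. y \<in> cube z \<rho> \<Longrightarrow> norm (g\<phi> y) \<le> M2" by blast
    have M0: "M1 \<ge> 0" "M2 \<ge> 0" using M1[OF zc] M2[OF zc] norm_ge_zero[of "g\<phi> z"] by linarith+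
    have "continuous_on (sphere z t) (\<lambda>x. q \<xi> x - \<phi> x)"
    proof (intro continuous_intros)
      show "continuous_on (sphere z t) (q \<xi>)"
      proof (rule continuous_on_q)
        fix x assume "x \<in> sphere z t"
        then have "x \<in> cube z \<rho>" using cb by auto
        then show "x \<noteq> 0 \<and> u x > 0" using upos z0 by auto
      qed
      show "continuous_on (sphere z t) \<phi>" by (rule continuous_on_subset[OF c\<phi>'(1)]) (use cb in auto)
    qed
    \<comment> \<open>Compactness turns the strict inequality on the sphere into a gap, which
      survives the replacement of \<open>q \<xi>\<close> by its approximants.\<close>
    then obtain \<kappa> where \<kappa>: "\<kappa> > 0" "\<And>x. x \<in> sphere z t \<Longrightarrow> q \<xi> x - \<phi> x \<le> \<tau> - \<kappa>"
      using compact_sup_less[of "sphere z t" "\<lambda>x. q \<xi> x - \<phi> x" \<tau>] sph by auto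
    \<comment> \<open>\<open>q \<xi>\<close> and \<open>ql \<xi>\<close> are the same expression in
      (u, Du) and in its mollified counterpart. Uniform continuity of \<open>F\<close> on a compact
      set therefore gives uniform closeness.\<close>
    define F where "F w = fst w powr \<beta> * (\<xi> \<bullet> snd w)" for w :: "real \<times> (real^'n)"
    have "uniformly_continuous_on ({m / 2..B} \<times> cube 0 B) F"
      unfolding F_def using m by (intro compact_uniformly_continuous compact_Times continuous_intros) auto
    then obtain \<delta> where \<delta>: "\<delta> > 0" "\<And>w w'. w \<in> {m / 2..B} \<times> cube 0 B \<Longrightarrow> w' \<in> {m / 2..B} \<times> cube 0 B \<Longrightarrow> dist w' w < \<delta> \<Longrightarrow> dist (F w') (F w) < \<kappa>"
      using \<kappa>(1) unfolding uniformly_continuous_on_def by metis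
    define \<delta>' where "\<delta>' = min (m / 2) (\<delta> / (4 * ?n))"
    have \<delta>': "\<delta>' > 0" using m \<delta> by (simp add: \<delta>'_def)
    obtain N where N: "\<And>l x i. l \<ge> N \<Longrightarrow> x \<in> cube z \<rho> \<Longrightarrow> \<bar>ul (e l) x - u x\<bar> \<le> \<delta>' \<and> (\<forall>i. \<bar>Pl (e l) i x - P i x\<bar> \<le> \<delta>')"
      using un[OF \<delta>'] by blast
    have ulm: "ul (e l) x \<ge> m / 2" if "l \<ge> N" "x \<in> cube z \<rho>" for l x
    proof -
      have "\<delta>' \<le> m / 2" by (simp add: \<delta>'_def)
      moreover have "\<bar>ul (e l) x - u x\<bar> \<le> \<delta>'" using N[OF that] by blast
      ultimately show ?thesis using m(2)[OF that(2)] by linarith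
    qed
    have ql_close: "\<bar>ql \<xi> (e l) x - q \<xi> x\<bar> < \<kappa>" if l: "l \<ge> N" and x: "x \<in> cube z \<rho>" for l x
    proof -
      have "dist (F (ul (e l) x, Pv (e l) x)) (F (u x, Du x)) < \<kappa>"
      proof (rule \<delta>(2))
        show "(ul (e l) x, Pv (e l) x) \<in> {m / 2..B} \<times> cube 0 B" "(u x, Du x) \<in> {m / 2..B} \<times> cube 0 B"
          using ulm[OF l x] B3[OF x, of l] B4[OF x] m(1) m(2)[OF x] B1[OF x] B2[OF x]
          by (auto simp: cube_def Pv_def Du_def)
        have "Pv (e l) x - Du x \<in> cube 0 \<delta>'" using N[OF l x] by (auto simp: cube_def Pv_def Du_def)
        from cube_norm_le[OF this] have 1: "norm (Pv (e l) x - Du x) \<le> ?n * \<delta>'" by simp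
        have 2: "?n * \<delta>' \<le> \<delta> / 4"
        proof -
          have "?n * \<delta>' \<le> ?n * (\<delta> / (4 * ?n))" unfolding \<delta>'_def by (intro mult_left_mono) auto
          then show ?thesis by simp
        qed
        have "1 * \<delta>' \<le> ?n * \<delta>'" using \<delta>' n2 by (intro mult_right_mono) auto
        then have 3: "\<bar>ul (e l) x - u x\<bar> \<le> \<delta> / 4" using N[OF l x] 2 by linarith
        have "dist (ul (e l) x, Pv (e l) x) (u x, Du x) \<le> dist (ul (e l) x) (u x) + dist (Pv (e l) x) (Du x)"
          unfolding dist_Pair_Pair by (rule sqrt_sum_squares_le_sum) auto
        also have "\<dots> = \<bar>ul (e l) x - u x\<bar> + norm (Pv (e l) x - Du x)" by (simp add: dist_norm)
        finally have "dist (ul (e l) x, Pv (e l) x) (u x, Du x) \<le> \<bar>ul (e l) x - u x\<bar> + norm (Pv (e l) x - Du x)" .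
        then show "dist (ul (e l) x, Pv (e l) x) (u x, Du x) < \<delta>" using 1 2 3 \<delta>(1) by linarith
      qed
      then show ?thesis by (simp add: F_def ql_def q_def dist_real_def)
    qed
    have ballm [measurable]: "ball z t \<in> sets borel" by simp
    define f where "f l x = indicator (ball z t) x * (max 0 (ql \<xi> (e (l + N)) x - \<phi> x - \<tau>) * det2 j k (gql \<xi> (e (l + N)) x - g\<phi> x) (Pv (e (l + N)) x) (Av (e (l + N)) x))" for l x
    define f0 where "f0 x = indicator (ball z t) x * (max 0 (q \<xi> x - \<phi> x - \<tau>) * det2 j k (gq \<xi> x - g\<phi> x) (Du x) (Hv x))" for x
    have fint: "(\<integral>x. f l x \<partial>lborel) = 0" for l
      unfolding f_def
    proof (rule approx_identity[OF e])
      fix x assume x: "x \<in> cball z t"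
      then have xc: "x \<in> cube z \<rho>" using cb by auto
      then show "ul (e (l + N)) x > 0" using ulm[of "l + N" x] m by auto
      have "x \<noteq> 0" using xc z0 by auto
      then show "(\<phi> has_derivative (\<lambda>h. g\<phi> x \<bullet> h)) (at x)" "isCont g\<phi> x" by (auto intro: d\<phi> cg\<phi>)
    next
      fix x assume x: "x \<in> sphere z t"
      then have xc: "x \<in> cube z \<rho>" using cb by auto
      show "ql \<xi> (e (l + N)) x - \<phi> x < \<tau>" using ql_close[of "l + N" x] xc \<kappa>(2)[OF x] by auto
    qed
    \<comment> \<open>A common majorant of all Hessian entries with p-th power 1 + G. The 1 ensures
      h \<ge> 1, so that p > n - 1 keeps h^(n - 1) below the integrable function 1 + G.\<close>
    define h where "h x = (1 + G x) powr (1 / p)" for x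
    have hfacts: "h x \<ge> 1 \<and> h x ^ (CARD('n) - 1) \<le> 1 + G x \<and> h x ^ (CARD('n) - 2) \<le> 1 + G x \<and> (\<forall>l i j. \<bar>Al (e l) i j x\<bar> \<le> h x) \<and> (\<forall>i j. \<bar>H i j x\<bar> \<le> h x)"
      if a: "(\<forall>i j. (\<lambda>l. Al (e l) i j x) \<longlonglongrightarrow> H i j x) \<and> (\<forall>l i j. \<bar>Al (e l) i j x\<bar> powr p \<le> G x)" for x
    proof -
      have "\<bar>Al (e 0) j j x\<bar> powr p \<le> G x" using a by blast
      then have G0: "G x \<ge> 0" by (meson order_trans powr_ge_zero)
      then have h1: "h x \<ge> 1" using p1 by (simp add: h_def ge_one_powr_ge_zero)
      have hp: "h x powr p = 1 + G x" using G0 p1 by (simp add: h_def powr_powr)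
      have pw: "h x ^ r \<le> 1 + G x" if "real r \<le> p" for r
      proof -
        have "h x ^ r = h x powr real r" using h1 by (simp add: powr_realpow)
        also have "\<dots> \<le> h x powr p" using h1 that by (intro powr_mono) auto
        finally show ?thesis using hp by simp
      qed
      have n1: "real (CARD('n) - 1) \<le> p" "real (CARD('n) - 2) \<le> p" using p_gt_n1 n2 by (auto simp: of_nat_diff)
      have Alh: "\<bar>Al (e l) i j x\<bar> \<le> h x" for l i j
      proof -
        have "\<bar>Al (e l) i j x\<bar> = (\<bar>Al (e l) i j x\<bar> powr p) powr (1 / p)" using p1 by (simp add: powr_powr)
        also have "\<dots> \<le> (1 + G x) powr (1 / p)" using a p1 by (intro powr_mono2) (auto intro: add_increasing)
        finally show ?thesis by (simp add: h_def)
      qed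
      have "\<bar>H i j x\<bar> \<le> h x" for i j
      proof -
        have "(\<lambda>l. \<bar>Al (e l) i j x\<bar>) \<longlonglongrightarrow> \<bar>H i j x\<bar>" using a by (intro tendsto_intros) blast
        then show ?thesis by (rule LIMSEQ_le_const2) (use Alh in blast)
      qed
      then show ?thesis using h1 pw n1 Alh by blast
    qed
    have Ci: "integrable lborel (\<lambda>x. C * (indicator (cube z \<rho>) x * 1 + indicator (cube z \<rho>) x * G x))" for C :: real
      using borel_integrable_compact[of "cube z \<rho>" "\<lambda>_. 1 :: real"] G
      by (intro integrable_mult_right Bochner_Integration.integrable_add) auto
    define S where "S = B powr \<beta> * (norm \<xi> * (?n * B)) + M1 + \<bar>\<tau>\<bar>"
    have S0: "S \<ge> 0" using M0 Bpos by (simp add: S_def)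
    define V where "V = B powr \<beta> * (\<Sum>i\<in>UNIV. \<bar>\<xi> $ i\<bar> * ?n) + \<beta> * ((m / 2) powr (\<beta> - 1) + B powr (\<beta> - 1)) * (norm \<xi> * (?n * B)) * (?n * B) + M2"
    have V0: "V \<ge> 0" unfolding V_def using M0 Bpos \<beta> m by (intro add_nonneg_nonneg mult_nonneg_nonneg sum_nonneg) auto
    have Sbound: "max 0 (ql \<xi> (e l) x - \<phi> x - \<tau>) \<le> S" if "l \<ge> N" and x: "x \<in> cube z \<rho>" for l x
    proof -
      have "\<bar>ql \<xi> (e l) x\<bar> \<le> B powr \<beta> * (norm \<xi> * (?n * B))"
        unfolding ql_def abs_mult
      proof (intro mult_mono)
        show "\<bar>ul (e l) x powr \<beta>\<bar> \<le> B powr \<beta>" using ulm[OF that] B3[OF x, of l] m \<beta> by (auto intro!: powr_mono2)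
        show "\<bar>\<xi> \<bullet> Pv (e l) x\<bar> \<le> norm \<xi> * (?n * B)"
          using Cauchy_Schwarz_ineq2[of \<xi> "Pv (e l) x"] mult_left_mono[OF normP[OF x, of l], of "norm \<xi>"] by simp
      qed auto
      then show ?thesis using M1[OF x] S0 unfolding S_def by (auto simp: max_def abs_le_iff)
    qed
    have Vbound: "norm (gql \<xi> (e l) x - g\<phi> x) \<le> V * h x"
      if "l \<ge> N" and x: "x \<in> cube z \<rho>" and hx: "h x \<ge> 1" "\<forall>l i j. \<bar>Al (e l) i j x\<bar> \<le> h x" for l x
    proof -
      have ub: "m / 2 \<le> ul (e l) x" "ul (e l) x \<le> B" using ulm[OF that(1,2)] B3[OF x, of l] by auto
      have A: "norm (\<Sum>i\<in>UNIV. (\<xi> $ i) *\<^sub>R Av (e l) x i) \<le> (\<Sum>i\<in>UNIV. \<bar>\<xi> $ i\<bar> * ?n) * h x"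
      proof -
        have "norm (\<Sum>i\<in>UNIV. (\<xi> $ i) *\<^sub>R Av (e l) x i) \<le> (\<Sum>i\<in>UNIV. norm ((\<xi> $ i) *\<^sub>R Av (e l) x i))" by (rule norm_sum)
        also have "\<dots> \<le> (\<Sum>i\<in>UNIV. \<bar>\<xi> $ i\<bar> * (?n * h x))"
        proof (rule sum_mono)
          fix i
          have "Av (e l) x i \<in> cube 0 (h x)" using hx by (auto simp: cube_def Av_def)
          from cube_norm_le[OF this] show "norm ((\<xi> $ i) *\<^sub>R Av (e l) x i) \<le> \<bar>\<xi> $ i\<bar> * (?n * h x)"
            by (simp add: mult_left_mono)
        qed
        finally show ?thesis by (simp add: sum_distrib_right mult.assoc)
      qed
      have a1: "norm ((ul (e l) x powr \<beta>) *\<^sub>R (\<Sum>i\<in>UNIV. (\<xi> $ i) *\<^sub>R Av (e l) x i)) \<le> B powr \<beta> * ((\<Sum>i\<in>UNIV. \<bar>\<xi> $ i\<bar> * ?n) * h x)"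
        unfolding norm_scaleR using A ub m \<beta> by (intro mult_mono) (auto intro: powr_mono2)
      have a2: "norm ((\<beta> * ul (e l) x powr (\<beta> - 1) * (\<xi> \<bullet> Pv (e l) x)) *\<^sub>R Pv (e l) x) \<le> \<beta> * ((m / 2) powr (\<beta> - 1) + B powr (\<beta> - 1)) * (norm \<xi> * (?n * B)) * (?n * B)"
        unfolding norm_scaleR abs_mult
      proof (intro mult_mono normP[OF x])
        show "\<bar>\<beta>\<bar> \<le> \<beta>" using \<beta> by simp
        show "\<bar>ul (e l) x powr (\<beta> - 1)\<bar> \<le> (m / 2) powr (\<beta> - 1) + B powr (\<beta> - 1)"
          using powr_le_endpoints[of "m / 2" "ul (e l) x" B "\<beta> - 1"] ub m by simp
        show "\<bar>\<xi> \<bullet> Pv (e l) x\<bar> \<le> norm \<xi> * (?n * B)"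
          using Cauchy_Schwarz_ineq2[of \<xi> "Pv (e l) x"] mult_left_mono[OF normP[OF x, of l], of "norm \<xi>"] by simp
      qed (use \<beta> Bpos in auto)
      have "norm (gql \<xi> (e l) x - g\<phi> x) \<le> B powr \<beta> * ((\<Sum>i\<in>UNIV. \<bar>\<xi> $ i\<bar> * ?n) * h x) + \<beta> * ((m / 2) powr (\<beta> - 1) + B powr (\<beta> - 1)) * (norm \<xi> * (?n * B)) * (?n * B) + M2"
        unfolding gql_def
        by (rule order_trans[OF norm_triangle_ineq4]) (intro add_mono order_trans[OF norm_triangle_ineq] a1 a2 M2[OF x])
      also have "\<dots> \<le> V * h x"
      proof -
        have "c \<le> c * h x" if "c \<ge> 0" for c using mult_left_mono[OF hx(1) that] by simp
        from this[of "\<beta> * ((m / 2) powr (\<beta> - 1) + B powr (\<beta> - 1)) * (norm \<xi> * (?n * B)) * (?n * B)"] this[OF M0(2)]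
        show ?thesis unfolding V_def using \<beta> Bpos by (simp add: algebra_simps)
      qed
      finally show ?thesis .
    qed
    define C where "C = S * (fact CARD('n) * (V * (?n * B)))"
    \<comment> \<open>Besides the n - 2 Hessian rows, the gradient in row j contributes one more
      factor h.\<close>
    have npow: "h x * h x ^ (CARD('n) - 2) = h x ^ (CARD('n) - 1)" for x
      using n2 by (simp add: power_Suc[symmetric] Suc_diff_Suc numeral_2_eq_2 del: power_Suc)
    have conv: "f0 \<in> borel_measurable lborel" "(\<lambda>l. \<integral>x. f l x \<partial>lborel) \<longlonglongrightarrow> (\<integral>x. f0 x \<partial>lborel)" "integrable lborel f0"
    proof -
      have Hc: "(\<lambda>x. Hv x i $ a) \<in> borel_measurable borel" "(\<lambda>x. Du x $ a) \<in> borel_measurable borel" for i a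
        by (simp_all add: Hv_def Du_def)
      have g\<phi>c: "(\<lambda>x. g\<phi> x $ a) \<in> borel_measurable borel" for a
        by (rule borel_measurable_continuous_countable_exceptions[of "{0}"]) (auto intro!: continuous_intros c\<phi>(2))
      have gqc: "(\<lambda>x. (gq \<xi> x - g\<phi> x) $ a) \<in> borel_measurable borel" for a
      proof -
        have [measurable]: "(\<lambda>x. g\<phi> x $ a) \<in> borel_measurable borel" by (rule g\<phi>c)
        have "(\<lambda>x. (u x powr \<beta>) * (\<Sum>i\<in>UNIV. (\<xi> $ i) * H i a x) + (\<beta> * u x powr (\<beta> - 1) * (\<Sum>i\<in>UNIV. \<xi> $ i * P i x)) * P a x - g\<phi> x $ a) \<in> borel_measurable borel"
          by measurable
        then show ?thesis by (simp add: gq_def Hv_def Du_def inner_vec_def)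
      qed
      have f0m: "f0 \<in> borel_measurable borel"
      proof -
        have [measurable]: "(\<lambda>x. det2 j k (gq \<xi> x - g\<phi> x) (Du x) (\<lambda>i. Hv x i)) \<in> borel_measurable borel"
          by (rule det2_measurable[OF gqc Hc(2) Hc(1)])
        show ?thesis unfolding f0_def[abs_def] by (intro borel_measurable_times borel_measurable_indicator borel_measurable_max borel_measurable_diff) auto
      qed
      have fm: "f l \<in> borel_measurable borel" for l
      proof -
        have Pc: "(\<lambda>x. Pv (e (l + N)) x $ a) \<in> borel_measurable borel" "(\<lambda>x. Av (e (l + N)) x i $ a) \<in> borel_measurable borel" for a i
          unfolding Pv_def Av_def by (auto intro!: borel_measurable_continuous_onI continuous_on_Pl continuous_on_Al e)
        have [measurable]: "ul (e (l + N)) \<in> borel_measurable borel" "Pl (e (l + N)) i \<in> borel_measurable borel" for i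
          by (auto intro!: borel_measurable_continuous_onI continuous_on_ul continuous_on_Pl e)
        have [measurable]: "(\<lambda>x. g\<phi> x $ a) \<in> borel_measurable borel" for a by (rule g\<phi>c)
        have [measurable]: "ql \<xi> (e (l + N)) \<in> borel_measurable borel"
          unfolding ql_def[abs_def] Pv_def inner_vec_def by simp
        have "(\<lambda>x. (ul (e (l+N)) x powr \<beta>) * (\<Sum>i\<in>UNIV. (\<xi> $ i) * Al (e (l+N)) i a x) + (\<beta> * ul (e (l+N)) x powr (\<beta> - 1) * (\<Sum>i\<in>UNIV. \<xi> $ i * Pl (e (l+N)) i x)) * Pl (e (l+N)) a x - g\<phi> x $ a) \<in> borel_measurable borel" for a
          by measurable
        then have gc: "(\<lambda>x. (gql \<xi> (e (l + N)) x - g\<phi> x) $ a) \<in> borel_measurable borel" for a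
          by (simp add: gql_def Av_def Pv_def inner_vec_def)
        have [measurable]: "(\<lambda>x. det2 j k (gql \<xi> (e (l + N)) x - g\<phi> x) (Pv (e (l + N)) x) (\<lambda>i. Av (e (l + N)) x i)) \<in> borel_measurable borel"
          by (rule det2_measurable[OF gc Pc])
        show ?thesis unfolding f_def[abs_def] by measurable
      qed
      have lim: "AE x in lborel. (\<lambda>l. f l x) \<longlonglongrightarrow> f0 x"
        using ae
      proof eventually_elim
        fix x assume a: "x \<in> cube z \<rho> \<longrightarrow> (\<forall>i j. (\<lambda>l. Al (e l) i j x) \<longlonglongrightarrow> H i j x) \<and> (\<forall>l i j. \<bar>Al (e l) i j x\<bar> powr p \<le> G x) \<and> (\<forall>j. RR x j = 0)"
        show "(\<lambda>l. f l x) \<longlonglongrightarrow> f0 x"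
        proof (cases "x \<in> ball z t")
          case True
          then have x: "x \<in> cube z \<rho>" using cb ball_subset_cball[of z t] by blast
          have uc: "(\<lambda>l. ul (e (l + N)) x) \<longlonglongrightarrow> u x" and Pc: "(\<lambda>l. Pv (e (l + N)) x) \<longlonglongrightarrow> Du x"
            using Pconv[OF x] by (auto intro: LIMSEQ_ignore_initial_segment)
          have Ac: "(\<lambda>l. Av (e (l + N)) x i) \<longlonglongrightarrow> Hv x i" for i
          proof -
            have "(\<lambda>l. Al (e (l + N)) i j x) \<longlonglongrightarrow> H i j x" for j using a x by (intro LIMSEQ_ignore_initial_segment) blast
            then show ?thesis unfolding Av_def Hv_def by (intro vec_tendstoI) simp
          qed
          have u0: "u x \<noteq> 0" using upos[OF x] by simp
          have "(\<lambda>l. gql \<xi> (e (l + N)) x - g\<phi> x) \<longlonglongrightarrow> gq \<xi> x - g\<phi> x"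
            unfolding gql_def gq_def using u0 by (intro tendsto_intros uc Pc Ac) auto
          from tendsto_det2[OF this Pc Ac]
          have dc: "(\<lambda>l. det2 j k (gql \<xi> (e (l + N)) x - g\<phi> x) (Pv (e (l + N)) x) (Av (e (l + N)) x)) \<longlonglongrightarrow> det2 j k (gq \<xi> x - g\<phi> x) (Du x) (Hv x)" .
          have mc: "(\<lambda>l. max 0 (ql \<xi> (e (l + N)) x - \<phi> x - \<tau>)) \<longlonglongrightarrow> max 0 (q \<xi> x - \<phi> x - \<tau>)"
            unfolding ql_def q_def using u0 by (intro tendsto_intros uc Pc) auto
          then show ?thesis unfolding f_def f0_def by (intro tendsto_mult tendsto_const dc mc)
        qed (simp add: f_def f0_def)
      qed
      have dom: "AE x in lborel. norm (f l x) \<le> C * (indicator (cube z \<rho>) x * 1 + indicator (cube z \<rho>) x * G x)" for l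
        using ae
      proof eventually_elim
        fix x assume a: "x \<in> cube z \<rho> \<longrightarrow> (\<forall>i j. (\<lambda>l. Al (e l) i j x) \<longlonglongrightarrow> H i j x) \<and> (\<forall>l i j. \<bar>Al (e l) i j x\<bar> powr p \<le> G x) \<and> (\<forall>j. RR x j = 0)"
        show "norm (f l x) \<le> C * (indicator (cube z \<rho>) x * 1 + indicator (cube z \<rho>) x * G x)"
        proof (cases "x \<in> cube z \<rho>")
          case True
          then have hf: "h x \<ge> 1" "h x ^ (CARD('n) - 1) \<le> 1 + G x" "\<forall>l i j. \<bar>Al (e l) i j x\<bar> \<le> h x"
            using hfacts[of x] a by blast+
          have "\<bar>det2 j k (gql \<xi> (e (l + N)) x - g\<phi> x) (Pv (e (l + N)) x) (Av (e (l + N)) x)\<bar> \<le> fact CARD('n) * ((V * h x) * (?n * B) * h x ^ (CARD('n) - 2))"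
            by (rule abs_det2_le[OF jk Vbound[OF le_add2 True hf(1,3)] normP[OF True]]) (use hf in \<open>simp add: Av_def\<close>)
          also have "\<dots> = fact CARD('n) * (V * (?n * B)) * h x ^ (CARD('n) - 1)" unfolding npow[symmetric] by simp
          also have "\<dots> \<le> fact CARD('n) * (V * (?n * B)) * (1 + G x)" using hf V0 Bpos by (intro mult_left_mono) auto
          finally have d: "\<bar>det2 j k (gql \<xi> (e (l + N)) x - g\<phi> x) (Pv (e (l + N)) x) (Av (e (l + N)) x)\<bar> \<le> fact CARD('n) * (V * (?n * B)) * (1 + G x)" .
          have "norm (f l x) \<le> \<bar>max 0 (ql \<xi> (e (l + N)) x - \<phi> x - \<tau>)\<bar> * \<bar>det2 j k (gql \<xi> (e (l + N)) x - g\<phi> x) (Pv (e (l + N)) x) (Av (e (l + N)) x)\<bar>"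
            by (auto simp: f_def indicator_def abs_mult)
          also have "\<dots> \<le> S * (fact CARD('n) * (V * (?n * B)) * (1 + G x))"
            using Sbound[OF le_add2 True, of l] d S0 by (intro mult_mono) auto
          finally show ?thesis using True by (simp add: C_def distrib_left mult.assoc)
        next
          case False
          then have "x \<notin> ball z t" using cb ball_subset_cball[of z t] by blast
          then show ?thesis using False by (simp add: f_def)
        qed
      qed
      show "f0 \<in> borel_measurable lborel" using f0m by simp
      show "(\<lambda>l. \<integral>x. f l x \<partial>lborel) \<longlonglongrightarrow> (\<integral>x. f0 x \<partial>lborel)"
        by (rule integral_dominated_convergence[OF _ _ Ci lim dom]) (use f0m fm in auto)
      show "integrable lborel f0"
        by (rule integrable_dominated_convergence[OF _ _ Ci lim dom]) (use f0m fm in auto)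
    qed
    have f00: "(\<integral>x. f0 x \<partial>lborel) = 0"
      using conv(2) unfolding fint by (simp add: LIMSEQ_const_iff)
    define s where "s x = indicator (ball z t) x * max 0 (q \<xi> x - \<phi> x - \<tau>)" for x
    define T2 where "T2 x = s x * det2 j k (g\<phi> x) (Du x) (Hv x)" for x
    define T1 where "T1 x = s x * (u x powr \<beta> * (\<xi> $ j * x $ k - \<xi> $ k * x $ j) / (\<alpha> - 1) * det (\<chi> i. Hv x i))" for x
    have [measurable]: "s \<in> borel_measurable borel" unfolding s_def[abs_def] by measurable
    have T2m: "T2 \<in> borel_measurable borel"
    proof -
      have a: "(\<lambda>x. Hv x i $ a) \<in> borel_measurable borel" "(\<lambda>x. Du x $ a) \<in> borel_measurable borel" "(\<lambda>x. g\<phi> x $ a) \<in> borel_measurable borel" for i a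
        by (auto simp: Hv_def Du_def intro!: borel_measurable_continuous_countable_exceptions[of "{0}" "\<lambda>x. g\<phi> x $ a"] continuous_intros c\<phi>(2))
      have [measurable]: "(\<lambda>x. det2 j k (g\<phi> x) (Du x) (\<lambda>i. Hv x i)) \<in> borel_measurable borel"
        by (rule det2_measurable[OF a(3) a(2) a(1)])
      show ?thesis unfolding T2_def[abs_def] by measurable
    qed
    have T1m: "T1 \<in> borel_measurable borel"
    proof -
      have [measurable]: "(\<lambda>x. x $ i) \<in> borel_measurable (borel :: (real^'n) measure)" for i
        by (auto intro!: borel_measurable_continuous_onI continuous_intros)
      have [measurable]: "(\<lambda>x. det (\<chi> i. Hv x i)) \<in> borel_measurable borel"
        unfolding det_def Hv_def by simp
      show ?thesis unfolding T1_def[abs_def] by measurable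
    qed
    have sS: "\<bar>s x\<bar> \<le> S" if x: "x \<in> cube z \<rho>" for x
    proof -
      have "\<bar>q \<xi> x\<bar> \<le> B powr \<beta> * (norm \<xi> * (?n * B))"
        unfolding q_def abs_mult
      proof (intro mult_mono)
        show "\<bar>u x powr \<beta>\<bar> \<le> B powr \<beta>" using upos[OF x] B4[OF x] \<beta> by (auto intro!: powr_mono2)
        show "\<bar>\<xi> \<bullet> Du x\<bar> \<le> norm \<xi> * (?n * B)"
          using Cauchy_Schwarz_ineq2[of \<xi> "Du x"] mult_left_mono[OF normD[OF x], of "norm \<xi>"] by simp
      qed auto
      then show ?thesis using M1[OF x] S0 unfolding S_def s_def by (auto simp: max_def abs_le_iff indicator_def)
    qed
    have T2i: "integrable lborel T2"
    proof (rule Bochner_Integration.integrable_bound[OF Ci[of "S * (fact CARD('n) * (M2 * (?n * B)))"]])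
      show "AE x in lborel. norm (T2 x) \<le> norm (S * (fact CARD('n) * (M2 * (?n * B))) * (indicator (cube z \<rho>) x * 1 + indicator (cube z \<rho>) x * G x))"
        using ae
      proof eventually_elim
        fix x assume a: "x \<in> cube z \<rho> \<longrightarrow> (\<forall>i j. (\<lambda>l. Al (e l) i j x) \<longlonglongrightarrow> H i j x) \<and> (\<forall>l i j. \<bar>Al (e l) i j x\<bar> powr p \<le> G x) \<and> (\<forall>j. RR x j = 0)"
        show "norm (T2 x) \<le> norm (S * (fact CARD('n) * (M2 * (?n * B))) * (indicator (cube z \<rho>) x * 1 + indicator (cube z \<rho>) x * G x))"
        proof (cases "x \<in> cube z \<rho>")
          case True
          then have hf: "h x \<ge> 1" "h x ^ (CARD('n) - 2) \<le> 1 + G x" "\<forall>i j. \<bar>H i j x\<bar> \<le> h x"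
            using hfacts[of x] a by blast+
          have "\<bar>det2 j k (g\<phi> x) (Du x) (Hv x)\<bar> \<le> fact CARD('n) * (M2 * (?n * B) * h x ^ (CARD('n) - 2))"
            by (rule abs_det2_le[OF jk M2[OF True] normD[OF True]]) (use hf in \<open>simp add: Hv_def\<close>)
          also have "\<dots> \<le> fact CARD('n) * (M2 * (?n * B) * (1 + G x))" using hf M0 Bpos by (intro mult_left_mono) auto
          finally have "\<bar>s x\<bar> * \<bar>det2 j k (g\<phi> x) (Du x) (Hv x)\<bar> \<le> S * (fact CARD('n) * (M2 * (?n * B) * (1 + G x)))"
            using sS[OF True] S0 by (intro mult_mono) auto
          then show ?thesis using True by (auto simp: T2_def abs_mult[symmetric] distrib_left mult.assoc intro: order_trans[OF _ abs_ge_self])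
        next
          case False
          then have "x \<notin> ball z t" using cb ball_subset_cball[of z t] by blast
          then show ?thesis by (simp add: T2_def s_def)
        qed
      qed
    qed (use T2m in simp)
    \<comment> \<open>Where Euler's relation holds, that is almost everywhere,
      \<open>det2_gq\<close> splits the limit integrand into the two sides of the claimed
      identity.\<close>
    have T1eq: "AE x in lborel. T1 x = f0 x + T2 x"
      using ae
    proof eventually_elim
      fix x assume a: "x \<in> cube z \<rho> \<longrightarrow> (\<forall>i j. (\<lambda>l. Al (e l) i j x) \<longlonglongrightarrow> H i j x) \<and> (\<forall>l i j. \<bar>Al (e l) i j x\<bar> powr p \<le> G x) \<and> (\<forall>j. RR x j = 0)"
      show "T1 x = f0 x + T2 x"
      proof (cases "x \<in> ball z t")
        case True
        then have "x \<in> cube z \<rho>" using cb ball_subset_cball[of z t] by blast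
        then have "\<forall>j. RR x j = 0" using a by blast
        from det2_gq[OF jk this] show ?thesis using True by (simp add: T1_def T2_def f0_def s_def right_diff_distrib)
      qed (simp add: T1_def T2_def f0_def s_def)
    qed
    have i12: "integrable lborel (\<lambda>x. f0 x + T2 x)" using conv(3) T2i by (rule Bochner_Integration.integrable_add)
    have T1i: "integrable lborel T1"
      by (rule integrable_cong_AE_imp[OF i12]) (use T1m T1eq in \<open>auto elim: eventually_mono\<close>)
    have "(\<integral>x. T1 x \<partial>lborel) = (\<integral>x. f0 x + T2 x \<partial>lborel)"
      by (rule integral_cong_AE) (use T1m T1eq i12 in \<open>auto dest: borel_measurable_integrable\<close>)
    also have "\<dots> = (\<integral>x. T2 x \<partial>lborel)" using conv(3) T2i f00 by simp
    finally have "integrable lborel T1 \<and> integrable lborel T2 \<and> (\<integral>x. T1 x \<partial>lborel) = (\<integral>x. T2 x \<partial>lborel)"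
      using T1i T2i by simp
    then show "integrable lborel (\<lambda>x. indicator (ball z t) x * max 0 (q \<xi> x - \<phi> x - \<tau>) *
          (u x powr \<beta> * (\<xi> $ j * x $ k - \<xi> $ k * x $ j) / (\<alpha> - 1) * det (\<chi> i. Hv x i))) \<and>
      integrable lborel (\<lambda>x. indicator (ball z t) x * max 0 (q \<xi> x - \<phi> x - \<tau>) * det2 j k (g\<phi> x) (Du x) (Hv x)) \<and>
      (\<integral>x. indicator (ball z t) x * max 0 (q \<xi> x - \<phi> x - \<tau>) *
          (u x powr \<beta> * (\<xi> $ j * x $ k - \<xi> $ k * x $ j) / (\<alpha> - 1) * det (\<chi> i. Hv x i)) \<partial>lborel) =
      (\<integral>x. indicator (ball z t) x * max 0 (q \<xi> x - \<phi> x - \<tau>) * det2 j k (g\<phi> x) (Du x) (Hv x) \<partial>lborel)"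
      unfolding T1_def[abs_def] T2_def[abs_def] s_def[abs_def] .
  qed
qed

end

subsection \<open>The strong maximum principle\<close>

lemma homogeneous_zero:
  fixes u :: "real^'n \<Rightarrow> real"
  assumes \<alpha>: "\<alpha> > 0" and hom: "\<And>t x. t > 0 \<Longrightarrow> u (t *\<^sub>R x) = t powr \<alpha> * u x"
  shows "u 0 = 0"
proof -
  have "u 0 = 2 powr \<alpha> * u 0" using hom[of 2 0] by simp
  moreover have "2 powr \<alpha> > (1::real)" using \<alpha> by (intro gr_one_powr) auto
  ultimately show ?thesis using \<alpha> by simp
qed

text \<open>A maximum point \<open>z\<close> of \<open>q \<xi>\<close> that is not parallel to \<open>\<xi>\<close>; the assumptions are contradictory
  (\<open>no_transversal_max\<close>).\<close>

locale hessian_max = hessian_setup u H \<alpha> p \<sigma>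
  for u :: "real^'n \<Rightarrow> real" and H :: "'n \<Rightarrow> 'n \<Rightarrow> real^'n \<Rightarrow> real" and \<alpha> p \<sigma> :: real +
  fixes \<xi> z :: "real^'n" and j k :: 'n
  assumes uz: "u z > 0" and max_q: "\<And>x. u x > 0 \<Longrightarrow> q \<xi> x \<le> q \<xi> z"
    and jk: "j \<noteq> k" and transversal: "\<xi> $ j * z $ k \<noteq> \<xi> $ k * z $ j"

context hessian_setup
begin

lemma u_zero: "u 0 = 0" by (rule homogeneous_zero[OF \<alpha>(1) hom])

end

context hessian_max
begin

lemma z0: "z \<noteq> 0" using uz u_zero by auto

abbreviation cut :: "real \<Rightarrow> (real^'n \<Rightarrow> real) \<Rightarrow> real \<Rightarrow> real^'n \<Rightarrow> real" where
  "cut t \<phi> \<tau> x \<equiv> indicator (ball z t) x * max 0 (q \<xi> x - \<phi> x - \<tau>)"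

text \<open>Near z the transversality minor and u powr \<beta> keep their signs, and
  \<open>pos\<close> bounds the Hessian determinant away from 0 with a fixed sign. The left side of
  \<open>comparison_identity\<close> then dominates a positive multiple of the integral of the
  cutoff.\<close>

lemma key_inequality:
  obtains R c where "R > 0" "c > 0" "0 \<notin> cube z R" "\<And>x. x \<in> cube z R \<Longrightarrow> u x > 0"
    "\<And>t \<phi> g\<phi> \<tau>. \<lbrakk>0 < t; t \<le> R; \<And>x. x \<noteq> 0 \<Longrightarrow> (\<phi> has_derivative (\<lambda>h. g\<phi> x \<bullet> h)) (at x);
      \<And>x. x \<noteq> 0 \<Longrightarrow> isCont g\<phi> x; \<And>x. x \<in> sphere z t \<Longrightarrow> q \<xi> x - \<phi> x < \<tau>\<rbrakk> \<Longrightarrow>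
      integrable lborel (cut t \<phi> \<tau>) \<and>
      integrable lborel (\<lambda>x. cut t \<phi> \<tau> x * \<bar>det2 j k (g\<phi> x) (Du x) (Hv x)\<bar>) \<and>
      c * (\<integral>x. cut t \<phi> \<tau> x \<partial>lborel) \<le> (\<integral>x. cut t \<phi> \<tau> x * \<bar>det2 j k (g\<phi> x) (Du x) (Hv x)\<bar> \<partial>lborel)"
proof (rule comparison_identity[OF z0 uz])
  fix \<rho>
  assume \<rho>: "\<rho> > 0" "0 \<notin> cube z \<rho>" and upos: "\<And>x. x \<in> cube z \<rho> \<Longrightarrow> u x > 0"
    and I: "\<And>\<xi> j k t \<phi> g\<phi> \<tau>. \<lbrakk>j \<noteq> k; 0 < t; t \<le> \<rho>; \<And>x. x \<noteq> 0 \<Longrightarrow> (\<phi> has_derivative (\<lambda>h. g\<phi> x \<bullet> h)) (at x);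
      \<And>x. x \<noteq> 0 \<Longrightarrow> isCont g\<phi> x; \<And>x. x \<in> sphere z t \<Longrightarrow> q \<xi> x - \<phi> x < \<tau>\<rbrakk> \<Longrightarrow>
      integrable lborel (\<lambda>x. indicator (ball z t) x * max 0 (q \<xi> x - \<phi> x - \<tau>) *
          (u x powr \<beta> * (\<xi> $ j * x $ k - \<xi> $ k * x $ j) / (\<alpha> - 1) * det (\<chi> i. Hv x i))) \<and>
      integrable lborel (\<lambda>x. indicator (ball z t) x * max 0 (q \<xi> x - \<phi> x - \<tau>) * det2 j k (g\<phi> x) (Du x) (Hv x)) \<and>
      (\<integral>x. indicator (ball z t) x * max 0 (q \<xi> x - \<phi> x - \<tau>) *
          (u x powr \<beta> * (\<xi> $ j * x $ k - \<xi> $ k * x $ j) / (\<alpha> - 1) * det (\<chi> i. Hv x i)) \<partial>lborel) =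
      (\<integral>x. indicator (ball z t) x * max 0 (q \<xi> x - \<phi> x - \<tau>) * det2 j k (g\<phi> x) (Du x) (Hv x) \<partial>lborel)"
  define w where "w x = \<xi> $ j * x $ k - \<xi> $ k * x $ j" for x :: "real^'n"
  define a where "a x = u x powr \<beta> * w x / (\<alpha> - 1)" for x
  have az: "a z \<noteq> 0" using uz transversal \<alpha> by (simp add: a_def w_def)
  have ca: "isCont a z"
  proof -
    have "isCont u z" using cont by (simp add: continuous_on_eq_continuous_at)
    then show ?thesis unfolding a_def[abs_def] w_def using uz \<alpha> by (intro continuous_intros) auto
  qed
  obtain d where d: "d > 0" "\<And>x. dist x z < d \<Longrightarrow> dist (a x) (a z) < \<bar>a z\<bar> / 2"
    using ca az unfolding continuous_at_eps_delta by (metis half_gt_zero zero_less_abs_iff)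
  obtain c0 where c0: "c0 > 0" and pos0: "AE x in lborel. x \<in> cube z \<rho> \<longrightarrow> c0 \<le> \<sigma> * det (\<chi> i j. H i j x)"
    using pos[OF compact_cube \<rho>(2)] by blast
  have detH: "det (\<chi> i. Hv x i) = det (\<chi> i j. H i j x)" for x by (simp add: Hv_def)
  define R where "R = min \<rho> (d / (2 * real CARD('n)))"
  have R: "R > 0" "R \<le> \<rho>" using \<rho> d by (auto simp: R_def)
  have sub: "cube z R \<subseteq> cube z \<rho>" using R by (intro cube_mono)
  have anear: "\<bar>a x - a z\<bar> < \<bar>a z\<bar> / 2" if "x \<in> cube z R" for x
  proof -
    have "real CARD('n) * R \<le> real CARD('n) * (d / (2 * real CARD('n)))" unfolding R_def by (intro mult_left_mono) auto
    then have "norm (x - z) \<le> d / 2" using cube_norm_le[OF that] by simp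
    then show ?thesis using d(1) d(2)[of x] by (auto simp: dist_norm dist_real_def)
  qed
  \<comment> \<open>With \<sigma> = 0 the lower bound from \<open>pos\<close> would fail on a cube
    of positive measure.\<close>
  have sigma: "\<sigma> \<noteq> 0"
  proof
    assume "\<sigma> = 0"
    then have "AE x in lborel. x \<notin> cube z \<rho>" using pos0 c0 by (auto elim: eventually_mono)
    then have "emeasure lborel (cube z \<rho>) = 0" by (subst (asm) AE_iff_measurable[OF _ refl]) auto
    then show False using \<rho> by (simp add: emeasure_cube)
  qed
  define c' where "c' = \<bar>a z\<bar> / 2 * (c0 / \<bar>\<sigma>\<bar>)"
  have c': "c' > 0" using az c0 sigma by (simp add: c'_def)
  have key: "AE x in lborel. x \<in> cube z R \<longrightarrow> c' \<le> sgn (a z) * sgn \<sigma> * (a x * det (\<chi> i. Hv x i))"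
    using pos0
  proof eventually_elim
    fix x assume p: "x \<in> cube z \<rho> \<longrightarrow> c0 \<le> \<sigma> * det (\<chi> i j. H i j x)"
    show "x \<in> cube z R \<longrightarrow> c' \<le> sgn (a z) * sgn \<sigma> * (a x * det (\<chi> i. Hv x i))"
    proof
      assume x: "x \<in> cube z R"
      have 1: "\<bar>a z\<bar> / 2 \<le> sgn (a z) * a x" using anear[OF x] az by (cases "a z > 0") (auto simp: abs_if split: if_splits)
      have "c0 \<le> \<sigma> * det (\<chi> i. Hv x i)" using p x sub unfolding detH by auto
      then have 2: "c0 / \<bar>\<sigma>\<bar> \<le> sgn \<sigma> * det (\<chi> i. Hv x i)"
        using sigma by (cases "\<sigma> > 0") (auto simp: field_simps)
      have "c' \<le> (sgn (a z) * a x) * (sgn \<sigma> * det (\<chi> i. Hv x i))"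
        unfolding c'_def using 1 2 c0 az sigma by (intro mult_mono) auto
      then show "c' \<le> sgn (a z) * sgn \<sigma> * (a x * det (\<chi> i. Hv x i))" by (simp add: mult_ac)
    qed
  qed
  show thesis
  proof (rule that[OF R(1) c'])
    show "0 \<notin> cube z R" using sub \<rho> by auto
    show "u x > 0" if "x \<in> cube z R" for x using upos sub that by auto
    fix t :: real and \<phi> :: "real^'n \<Rightarrow> real" and g\<phi> :: "real^'n \<Rightarrow> real^'n" and \<tau> :: real
    assume t: "0 < t" "t \<le> R" and d\<phi>: "\<And>x. x \<noteq> 0 \<Longrightarrow> (\<phi> has_derivative (\<lambda>h. g\<phi> x \<bullet> h)) (at x)"
      and cg: "\<And>x. x \<noteq> 0 \<Longrightarrow> isCont g\<phi> x" and sph: "\<And>x. x \<in> sphere z t \<Longrightarrow> q \<xi> x - \<phi> x < \<tau>"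
    have tr: "t \<le> \<rho>" using t R by simp
    let ?s = "cut t \<phi> \<tau>"
    let ?D = "\<lambda>x. det2 j k (g\<phi> x) (Du x) (Hv x)"
    define T1 where "T1 x = ?s x * (a x * det (\<chi> i. Hv x i))" for x
    have i: "integrable lborel T1" "integrable lborel (\<lambda>x. ?s x * ?D x)" "(\<integral>x. T1 x \<partial>lborel) = (\<integral>x. ?s x * ?D x \<partial>lborel)"
      using I[OF jk t(1) tr d\<phi> cg sph] unfolding T1_def[abs_def] a_def w_def by simp_all
    have cb: "ball z t \<subseteq> cube z R" using t by (auto simp: dist_norm norm_minus_commute intro!: ball_subset_cube)
    have s0: "?s x \<ge> 0" for x by auto
    have key2: "AE x in lborel. c' * ?s x \<le> sgn (a z) * sgn \<sigma> * T1 x"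
      using key
    proof eventually_elim
      fix x assume K: "x \<in> cube z R \<longrightarrow> c' \<le> sgn (a z) * sgn \<sigma> * (a x * det (\<chi> i. Hv x i))"
      show "c' * ?s x \<le> sgn (a z) * sgn \<sigma> * T1 x"
      proof (cases "x \<in> ball z t")
        case True
        then have "c' * ?s x \<le> (sgn (a z) * sgn \<sigma> * (a x * det (\<chi> i. Hv x i))) * ?s x"
          using K cb s0 by (intro mult_right_mono) auto
        then show ?thesis by (simp add: T1_def mult_ac)
      qed (simp add: T1_def)
    qed
    have c\<phi>: "continuous_on (- {0}) \<phi>"
      by (auto intro!: continuous_at_imp_continuous_on has_derivative_continuous[OF d\<phi>])
    have [measurable]: "\<phi> \<in> borel_measurable borel"
      by (rule borel_measurable_continuous_countable_exceptions[OF _ c\<phi>]) simp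
    have [measurable]: "ball z t \<in> sets borel" by simp
    have si: "integrable lborel ?s"
    proof (rule Bochner_Integration.integrable_bound[of _ "\<lambda>x. (1 / c') * T1 x"])
      show "integrable lborel (\<lambda>x. (1 / c') * T1 x)" using i by simp
      show "?s \<in> borel_measurable lborel" by simp
      show "AE x in lborel. norm (?s x) \<le> norm (1 / c' * T1 x)"
        using key2
      proof eventually_elim
        fix x assume "c' * ?s x \<le> sgn (a z) * sgn \<sigma> * T1 x"
        also have "\<dots> \<le> \<bar>T1 x\<bar>" by (auto simp: sgn_if)
        finally show "norm (?s x) \<le> norm (1 / c' * T1 x)" using c' s0[of x] by (simp add: abs_mult field_simps)
      qed
    qed
    have "c' * (\<integral>x. ?s x \<partial>lborel) = (\<integral>x. c' * ?s x \<partial>lborel)" by simp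
    also have "\<dots> \<le> (\<integral>x. sgn (a z) * sgn \<sigma> * T1 x \<partial>lborel)"
      using key2 si i(1) by (intro integral_mono_AE) auto
    also have "\<dots> = sgn (a z) * sgn \<sigma> * (\<integral>x. ?s x * ?D x \<partial>lborel)" using i(3) by simp
    also have "\<dots> \<le> \<bar>\<integral>x. ?s x * ?D x \<partial>lborel\<bar>" by (auto simp: sgn_if)
    also have "\<dots> \<le> (\<integral>x. \<bar>?s x * ?D x\<bar> \<partial>lborel)" using integral_norm_bound[of lborel "\<lambda>x. ?s x * ?D x"] by simp
    also have "\<dots> = (\<integral>x. ?s x * \<bar>?D x\<bar> \<partial>lborel)" using s0 by (intro Bochner_Integration.integral_cong) (auto simp: abs_mult)
    finally have "c' * (\<integral>x. ?s x \<partial>lborel) \<le> (\<integral>x. ?s x * \<bar>?D x\<bar> \<partial>lborel)" .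
    moreover have "integrable lborel (\<lambda>x. ?s x * \<bar>?D x\<bar>)"
    proof -
      have "(\<lambda>x. ?s x * \<bar>?D x\<bar>) = (\<lambda>x. \<bar>?s x * ?D x\<bar>)" using s0 by (auto simp: abs_mult)
      then show ?thesis using integrable_abs[OF i(2)] by simp
    qed
    ultimately show "integrable lborel ?s \<and> integrable lborel (\<lambda>x. ?s x * \<bar>?D x\<bar>) \<and> c' * (\<integral>x. ?s x \<partial>lborel) \<le> (\<integral>x. ?s x * \<bar>?D x\<bar> \<partial>lborel)"
      using si by simp
  qed
qed

lemma cut_integral_pos:
  assumes t: "t > 0" and \<phi>: "isCont \<phi> z" and gt: "q \<xi> z - \<phi> z > \<tau>" and int: "integrable lborel (cut t \<phi> \<tau>)"
  shows "(\<integral>x. cut t \<phi> \<tau> x \<partial>lborel) > 0"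
proof -
  have "isCont (q \<xi>) z"
  proof -
    have "isCont u z" "isCont Du z" using cont continuous_Du z0 by (simp_all add: continuous_on_eq_continuous_at open_delete)
    then show ?thesis unfolding q_def[abs_def] using uz by (intro continuous_intros) auto
  qed
  then have "isCont (\<lambda>x. q \<xi> x - \<phi> x) z" by (intro continuous_intros \<phi>)
  then obtain d where d: "d > 0" "\<And>x. dist x z < d \<Longrightarrow> dist (q \<xi> x - \<phi> x) (q \<xi> z - \<phi> z) < q \<xi> z - \<phi> z - \<tau>"
    using gt unfolding continuous_at_eps_delta by (metis diff_gt_0_iff_gt)
  define r where "r = min d t / (2 * real CARD('n))"
  have r: "r > 0" using d t by (simp add: r_def)
  have pos: "cut t \<phi> \<tau> x > 0" if x: "x \<in> cube z r" for x
  proof -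
    have "norm (x - z) \<le> min d t / 2" using cube_norm_le[OF x] by (simp add: r_def)
    then have n: "norm (x - z) < d" "norm (x - z) < t" using d t by (auto simp: min_def split: if_splits)
    then have "q \<xi> x - \<phi> x > \<tau>" using d(2)[of x] by (auto simp: dist_norm dist_real_def)
    then show ?thesis using n by (simp add: dist_norm norm_minus_commute)
  qed
  have "(\<integral>x. cut t \<phi> \<tau> x \<partial>lborel) \<noteq> 0"
  proof
    assume "(\<integral>x. cut t \<phi> \<tau> x \<partial>lborel) = 0"
    then have "AE x in lborel. cut t \<phi> \<tau> x = 0"
      using integral_nonneg_eq_0_iff_AE[OF int] by auto
    then have "AE x in lborel. x \<notin> cube z r" by eventually_elim (use pos in force)
    then have "emeasure lborel (cube z r) = 0" by (subst (asm) AE_iff_measurable[OF _ refl]) auto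
    then show False using r by (simp add: emeasure_cube)
  qed
  moreover have "(\<integral>x. cut t \<phi> \<tau> x \<partial>lborel) \<ge> 0" by (intro integral_nonneg_AE) auto
  ultimately show ?thesis by linarith
qed

text \<open>The comparison function \<open>(u x - u z)\<^sup>2\<close> has gradient parallel to \<open>Du x\<close>, so the right-hand side of
  \<open>key_inequality\<close> vanishes: a maximum of \<open>q \<xi>\<close> on the level set of \<open>u\<close> cannot be isolated.\<close>

lemma max_set_meets_spheres:
  obtains R where "R > 0" "\<And>t. 0 < t \<Longrightarrow> t \<le> R \<Longrightarrow> \<exists>y. norm (y - z) = t \<and> u y = u z \<and> q \<xi> y = q \<xi> z"
proof (rule key_inequality)
  fix R c
  assume R: "R > 0" "c > 0" "0 \<notin> cube z R" and upos: "\<And>x. x \<in> cube z R \<Longrightarrow> u x > 0"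
    and KI: "\<And>t \<phi> g\<phi> \<tau>. \<lbrakk>0 < t; t \<le> R; \<And>x. x \<noteq> 0 \<Longrightarrow> (\<phi> has_derivative (\<lambda>h. g\<phi> x \<bullet> h)) (at x);
      \<And>x. x \<noteq> 0 \<Longrightarrow> isCont g\<phi> x; \<And>x. x \<in> sphere z t \<Longrightarrow> q \<xi> x - \<phi> x < \<tau>\<rbrakk> \<Longrightarrow>
      integrable lborel (cut t \<phi> \<tau>) \<and>
      integrable lborel (\<lambda>x. cut t \<phi> \<tau> x * \<bar>det2 j k (g\<phi> x) (Du x) (Hv x)\<bar>) \<and>
      c * (\<integral>x. cut t \<phi> \<tau> x \<partial>lborel) \<le> (\<integral>x. cut t \<phi> \<tau> x * \<bar>det2 j k (g\<phi> x) (Du x) (Hv x)\<bar> \<partial>lborel)"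
  show thesis
  proof (rule that[OF R(1)], rule ccontr)
    fix t assume t: "0 < t" "t \<le> R" and none: "\<nexists>y. norm (y - z) = t \<and> u y = u z \<and> q \<xi> y = q \<xi> z"
    define \<phi> where "\<phi> x = (u x - u z)\<^sup>2" for x
    define g\<phi> where "g\<phi> x = (2 * (u x - u z)) *\<^sub>R Du x" for x
    have cb: "cball z t \<subseteq> cube z R" using t by (auto simp: dist_norm norm_minus_commute intro!: ball_subset_cube)
    have d\<phi>: "(\<phi> has_derivative (\<lambda>h. g\<phi> x \<bullet> h)) (at x)" if "x \<noteq> 0" for x
    proof -
      have "((\<lambda>x. u x - u z) has_derivative (\<lambda>h. Du x \<bullet> h)) (at x)"
        using has_derivative_diff[OF has_derivative_u[OF that] has_derivative_const[of "u z"]] by simp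
      from has_derivative_mult[OF this this]
      show ?thesis unfolding \<phi>_def[abs_def] g\<phi>_def power2_eq_square
        by (rule has_derivative_eq_rhs) (auto simp: algebra_simps)
    qed
    have cg: "isCont g\<phi> x" if "x \<noteq> 0" for x
    proof -
      have "isCont u x" "isCont Du x" using cont continuous_Du that by (simp_all add: continuous_on_eq_continuous_at open_delete)
      then show ?thesis unfolding g\<phi>_def[abs_def] by (intro continuous_intros)
    qed
    have "continuous_on (sphere z t) (\<lambda>x. q \<xi> x - \<phi> x)"
    proof (intro continuous_intros)
      show "continuous_on (sphere z t) (q \<xi>)"
      proof (rule continuous_on_q)
        fix x assume "x \<in> sphere z t"
        then have "x \<in> cube z R" using cb by auto
        then show "x \<noteq> 0 \<and> u x > 0" using upos R by auto
      qed
      show "continuous_on (sphere z t) \<phi>" unfolding \<phi>_def by (intro continuous_intros continuous_on_subset[OF cont]) auto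
    qed
    moreover have "q \<xi> x - \<phi> x < q \<xi> z" if x: "x \<in> sphere z t" for x
    proof -
      have le: "q \<xi> x \<le> q \<xi> z" using x cb by (intro max_q upos) auto
      have "\<phi> x \<ge> 0" by (simp add: \<phi>_def)
      moreover have "\<not> (q \<xi> x = q \<xi> z \<and> \<phi> x = 0)"
        using none x by (auto simp: \<phi>_def dist_norm norm_minus_commute)
      ultimately show ?thesis using le by linarith
    qed
    ultimately obtain \<kappa> where \<kappa>: "\<kappa> > 0" "\<And>x. x \<in> sphere z t \<Longrightarrow> q \<xi> x - \<phi> x \<le> q \<xi> z - \<kappa>"
      using compact_sup_less[of "sphere z t" "\<lambda>x. q \<xi> x - \<phi> x" "q \<xi> z"] by auto
    \<comment> \<open>A level strictly between the values on the sphere and the value at z, where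
      \<open>\<phi>\<close> vanishes.\<close>
    define \<tau> where "\<tau> = q \<xi> z - \<kappa> / 2"
    have sph: "q \<xi> x - \<phi> x < \<tau>" if "x \<in> sphere z t" for x using \<kappa>(1) \<kappa>(2)[OF that] by (simp add: \<tau>_def)
    note K = KI[OF t d\<phi> cg sph]
    have "det2 j k (g\<phi> x) (Du x) (Hv x) = 0" for x
    proof -
      have "det2 j k (g\<phi> x) (Du x) (Hv x) = (2 * (u x - u z)) * det2 j k (Du x) (Du x) (Hv x)"
        unfolding g\<phi>_def using linear_scale[OF linear_det2_left] by simp
      then show ?thesis by (simp add: det2_same[OF jk])
    qed
    then have "c * (\<integral>x. cut t \<phi> \<tau> x \<partial>lborel) \<le> 0" using K by simp
    moreover have "(\<integral>x. cut t \<phi> \<tau> x \<partial>lborel) > 0"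
    proof (rule cut_integral_pos[OF t(1)])
      show "isCont \<phi> z" using d\<phi>[OF z0] by (rule has_derivative_continuous)
      show "\<tau> < q \<xi> z - \<phi> z" using \<kappa> by (simp add: \<tau>_def \<phi>_def)
    qed (use K in simp)
    ultimately show False using R(2) by (simp add: mult_le_0_iff)
  qed
qed

end

section \<open>The measure of nearly maximal sets\<close>

context hessian_setup
begin

text \<open>One function, integrable on compact sets off the origin, whose p-th root bounds every
  Hessian entry; its integral over a set is the energy of that set.\<close>

definition "Hsum x = (\<Sum>i\<in>UNIV. \<Sum>j\<in>UNIV. \<bar>H i j x\<bar> powr p)"

lemma Hsum_measurable [measurable]: "Hsum \<in> borel_measurable borel"
  unfolding Hsum_def[abs_def] by measurable

lemma Hsum_nonneg: "Hsum x \<ge> 0"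
  by (auto simp: Hsum_def intro!: sum_nonneg)

lemma powr_le_Hsum: "\<bar>H i j x\<bar> powr p \<le> Hsum x"
proof -
  have "\<bar>H i j x\<bar> powr p \<le> (\<Sum>j\<in>UNIV. \<bar>H i j x\<bar> powr p)" by (rule member_le_sum) auto
  also have "\<dots> \<le> Hsum x" unfolding Hsum_def by (rule member_le_sum) (auto intro: sum_nonneg)
  finally show ?thesis .
qed

lemma H_le_Hsum: "\<bar>H i j x\<bar> \<le> Hsum x powr (1 / p)"
proof -
  have "\<bar>H i j x\<bar> = (\<bar>H i j x\<bar> powr p) powr (1 / p)" using p1 by (simp add: powr_powr)
  also have "\<dots> \<le> Hsum x powr (1 / p)" using powr_le_Hsum p1 by (intro powr_mono2) auto
  finally show ?thesis .
qed

lemma Hsum_integrable: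
  assumes "compact T" "0 \<notin> T"
  shows "integrable lborel (\<lambda>x. indicator T x * Hsum x)"
proof -
  have "integrable lborel (\<lambda>x. \<Sum>i\<in>UNIV. \<Sum>j\<in>UNIV. indicator T x * \<bar>H i j x\<bar> powr p)"
    using Hp[OF assms] by (intro Bochner_Integration.integrable_sum) (simp add: set_integrable_def)
  then show ?thesis by (simp add: Hsum_def sum_distrib_left)
qed

lemma powr_measure_le:
  "(\<integral>\<^sup>+y. ennreal (\<bar>H i j y\<bar> powr p) * indicator T y \<partial>lborel) \<le> (\<integral>\<^sup>+y. ennreal (Hsum y) * indicator T y \<partial>lborel)"
  using powr_le_Hsum by (intro nn_integral_mono mult_right_mono ennreal_leI) auto

end

context hessian_max
begin

text \<open>The vector in row j is the gradient of the paraboloid \<epsilon> |x - z|^2 / R^2, of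
  norm at most 2 \<epsilon> / R on the ball. The gradient of u in row k is bounded, and n - 2
  Hessian rows remain.\<close>

lemma det2_paraboloid_bound:
  assumes R: "R > 0" "0 \<notin> cube z R"
  obtains K where "K > 0" "\<And>\<epsilon> x. \<epsilon> > 0 \<Longrightarrow> x \<in> ball z R \<Longrightarrow>
    \<bar>det2 j k ((2 * \<epsilon> / R\<^sup>2) *\<^sub>R (x - z)) (Du x) (Hv x)\<bar> \<le> \<epsilon> * K * (Hsum x powr (1 / p)) ^ (CARD('n) - 2)"
proof -
  have "bounded (Du ` cube z R)"
    using R by (intro compact_imp_bounded compact_continuous_image compact_cube continuous_on_subset[OF continuous_Du]) auto
  then obtain L where L: "L > 0" "\<And>x. x \<in> cube z R \<Longrightarrow> norm (Du x) \<le> L" by (auto simp: bounded_pos)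
  define K where "K = fact CARD('n) * (2 / R * L)"
  show thesis
  proof (rule that[of K])
    show "K > 0" using L R by (simp add: K_def)
    fix \<epsilon> :: real and x assume e: "\<epsilon> > 0" and x: "x \<in> ball z R"
    have n: "norm (x - z) \<le> R" using x by (simp add: dist_norm norm_minus_commute)
    have "norm ((2 * \<epsilon> / R\<^sup>2) *\<^sub>R (x - z)) \<le> (2 * \<epsilon> / R\<^sup>2) * R"
      using n e R by (simp add: mult_left_mono divide_right_mono)
    also have "\<dots> = 2 * \<epsilon> / R" using R by (simp add: power2_eq_square)
    finally have v: "norm ((2 * \<epsilon> / R\<^sup>2) *\<^sub>R (x - z)) \<le> 2 * \<epsilon> / R" .
    have w: "norm (Du x) \<le> L" using L(2) ball_subset_cube[OF n] .
    have "\<bar>det2 j k ((2 * \<epsilon> / R\<^sup>2) *\<^sub>R (x - z)) (Du x) (Hv x)\<bar> \<le>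
        fact CARD('n) * (2 * \<epsilon> / R * L * (Hsum x powr (1 / p)) ^ (CARD('n) - 2))"
      by (rule abs_det2_le[OF jk v w]) (simp add: Hv_def H_le_Hsum)
    then show "\<bar>det2 j k ((2 * \<epsilon> / R\<^sup>2) *\<^sub>R (x - z)) (Du x) (Hv x)\<bar> \<le> \<epsilon> * K * (Hsum x powr (1 / p)) ^ (CARD('n) - 2)"
      by (simp add: K_def mult_ac)
  qed
qed

text \<open>\<open>s\<close> is the cutoff of \<open>key_inequality\<close> for a paraboloid of
  height \<epsilon>, truncated at the maximum minus \<epsilon> / 2. The majorant \<open>g\<close> is
  left open because \<open>dim_ge_3\<close> takes a constant and \<open>level_estimate\<close> an
  expression in the energy density.\<close>

lemma paraboloid_inequality:
  obtains R c K where "R > 0" "c > 0" "K > 0" "0 \<notin> cube z R" "\<And>x. x \<in> cube z R \<Longrightarrow> u x > 0"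
    "\<And>\<epsilon>. \<epsilon> > 0 \<Longrightarrow> \<exists>s. integrable lborel s \<and> (\<integral>x. s x \<partial>lborel) > 0 \<and>
      (\<forall>x. 0 \<le> s x \<and> s x \<le> \<epsilon> / 2 * indicator (ball z R) x) \<and>
      (\<forall>x\<in>ball z (R / 2). q \<xi> z - q \<xi> x \<le> \<epsilon> / 8 \<longrightarrow> \<epsilon> / 8 \<le> s x) \<and>
      (\<forall>g. integrable lborel (\<lambda>x. s x * g x) \<longrightarrow>
        (\<forall>x\<in>ball z R. \<epsilon> * K * (Hsum x powr (1 / p)) ^ (CARD('n) - 2) \<le> g x) \<longrightarrow>
        c * (\<integral>x. s x \<partial>lborel) \<le> (\<integral>x. s x * g x \<partial>lborel))"
proof (rule key_inequality)
  fix R c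
  assume R: "R > 0" "c > 0" "0 \<notin> cube z R" and upos: "\<And>x. x \<in> cube z R \<Longrightarrow> u x > 0"
    and KI: "\<And>t \<phi> g\<phi> \<tau>. \<lbrakk>0 < t; t \<le> R; \<And>x. x \<noteq> 0 \<Longrightarrow> (\<phi> has_derivative (\<lambda>h. g\<phi> x \<bullet> h)) (at x);
      \<And>x. x \<noteq> 0 \<Longrightarrow> isCont g\<phi> x; \<And>x. x \<in> sphere z t \<Longrightarrow> q \<xi> x - \<phi> x < \<tau>\<rbrakk> \<Longrightarrow>
      integrable lborel (cut t \<phi> \<tau>) \<and>
      integrable lborel (\<lambda>x. cut t \<phi> \<tau> x * \<bar>det2 j k (g\<phi> x) (Du x) (Hv x)\<bar>) \<and>
      c * (\<integral>x. cut t \<phi> \<tau> x \<partial>lborel) \<le> (\<integral>x. cut t \<phi> \<tau> x * \<bar>det2 j k (g\<phi> x) (Du x) (Hv x)\<bar> \<partial>lborel)"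
  obtain K where K: "K > 0" "\<And>\<epsilon> x. \<epsilon> > 0 \<Longrightarrow> x \<in> ball z R \<Longrightarrow>
    \<bar>det2 j k ((2 * \<epsilon> / R\<^sup>2) *\<^sub>R (x - z)) (Du x) (Hv x)\<bar> \<le> \<epsilon> * K * (Hsum x powr (1 / p)) ^ (CARD('n) - 2)"
    using det2_paraboloid_bound[OF R(1,3)] by blast
  have le: "q \<xi> x \<le> q \<xi> z" if "norm (x - z) \<le> R" for x using max_q upos ball_subset_cube[OF that] by blast
  show thesis
  proof (rule that[OF R(1,2) K(1) R(3)], erule upos)
    fix \<epsilon> :: real assume e: "\<epsilon> > 0"
    define \<phi> where "\<phi> x = \<epsilon> / R\<^sup>2 * ((x - z) \<bullet> (x - z))" for x
    define g\<phi> where "g\<phi> x = (2 * \<epsilon> / R\<^sup>2) *\<^sub>R (x - z)" for x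
    define \<tau> where "\<tau> = q \<xi> z - \<epsilon> / 2"
    have d\<phi>: "(\<phi> has_derivative (\<lambda>h. g\<phi> x \<bullet> h)) (at x)" for x
    proof -
      have "((\<lambda>x. (x - z) \<bullet> (x - z)) has_derivative (\<lambda>h. 2 * ((x - z) \<bullet> h))) (at x)"
        by (auto intro!: derivative_eq_intros simp: inner_commute)
      from has_derivative_mult_right[OF this, of "\<epsilon> / R\<^sup>2"]
      show ?thesis unfolding \<phi>_def[abs_def] g\<phi>_def by (simp add: mult_ac)
    qed
    have cg: "isCont g\<phi> x" for x unfolding g\<phi>_def by (intro continuous_intros)
    have \<phi>n: "\<phi> x = \<epsilon> * (norm (x - z) / R)\<^sup>2" for x by (simp add: \<phi>_def power2_norm_eq_inner power_divide)
    have \<phi>0: "\<phi> x \<ge> 0" for x using e by (simp add: \<phi>n)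
    have sph: "q \<xi> x - \<phi> x < \<tau>" if "x \<in> sphere z R" for x
    proof -
      have "norm (x - z) = R" using that by (simp add: dist_norm norm_minus_commute)
      then show ?thesis using le[of x] e R by (simp add: \<phi>n \<tau>_def)
    qed
    note I = KI[OF R(1) order.refl d\<phi> cg sph]
    let ?s = "cut R \<phi> \<tau>"
    have s0: "?s x \<ge> 0" for x by simp
    have s1: "?s x \<le> \<epsilon> / 2 * indicator (ball z R) x" for x
    proof (cases "x \<in> ball z R")
      case True
      then have "norm (x - z) \<le> R" by (simp add: dist_norm norm_minus_commute)
      from le[OF this] have "max 0 (q \<xi> x - \<phi> x - \<tau>) \<le> \<epsilon> / 2" using \<phi>0[of x] e by (auto simp: \<tau>_def max_def)
      then show ?thesis using True by simp
    qed simp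
    \<comment> \<open>On the half ball the paraboloid is at most \<epsilon> / 4; of the \<epsilon> /
      2 above the level at least \<epsilon> / 2 - \<epsilon> / 4 - \<epsilon> / 8 = \<epsilon> / 8
      remains.\<close>
    have s2: "\<epsilon> / 8 \<le> ?s x" if x: "x \<in> ball z (R / 2)" "q \<xi> z - q \<xi> x \<le> \<epsilon> / 8" for x
    proof -
      have n: "norm (x - z) / R \<le> 1 / 2" using x R by (simp add: dist_norm norm_minus_commute field_simps)
      have "(norm (x - z) / R)\<^sup>2 \<le> (1 / 2)\<^sup>2" using n R by (intro power_mono) auto
      then have "\<phi> x \<le> \<epsilon> * (1 / 2)\<^sup>2" unfolding \<phi>n using e by (intro mult_left_mono) auto
      then have "\<phi> x \<le> \<epsilon> / 4" by (simp add: power2_eq_square)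
      moreover have "x \<in> ball z R" using x R by simp
      ultimately show ?thesis using x by (auto simp: \<tau>_def max_def)
    qed
    have s3: "(\<integral>x. ?s x \<partial>lborel) > 0"
    proof (rule cut_integral_pos[OF R(1)])
      show "isCont \<phi> z" using has_derivative_continuous[OF d\<phi>] .
      show "\<tau> < q \<xi> z - \<phi> z" using e by (simp add: \<tau>_def \<phi>_def)
    qed (use I in simp)
    have s4: "c * (\<integral>x. ?s x \<partial>lborel) \<le> (\<integral>x. ?s x * g x \<partial>lborel)"
      if g: "integrable lborel (\<lambda>x. ?s x * g x)" "\<forall>x\<in>ball z R. \<epsilon> * K * (Hsum x powr (1 / p)) ^ (CARD('n) - 2) \<le> g x" for g
    proof -
      have "c * (\<integral>x. ?s x \<partial>lborel) \<le> (\<integral>x. ?s x * \<bar>det2 j k (g\<phi> x) (Du x) (Hv x)\<bar> \<partial>lborel)" using I by blast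
      also have "\<dots> \<le> (\<integral>x. ?s x * g x \<partial>lborel)"
      proof (rule integral_mono)
        show "integrable lborel (\<lambda>x. ?s x * \<bar>det2 j k (g\<phi> x) (Du x) (Hv x)\<bar>)" using I by blast
        show "integrable lborel (\<lambda>x. ?s x * g x)" by (rule g)
        fix x
        show "?s x * \<bar>det2 j k (g\<phi> x) (Du x) (Hv x)\<bar> \<le> ?s x * g x"
        proof (cases "x \<in> ball z R")
          case True
          then have "\<bar>det2 j k (g\<phi> x) (Du x) (Hv x)\<bar> \<le> g x" using K(2)[OF e True] g(2) unfolding g\<phi>_def by fastforce
          then show ?thesis using s0 by (intro mult_left_mono) auto
        qed simp
      qed
      finally show ?thesis .
    qed
    have si: "integrable lborel ?s" using I by blast
    show "\<exists>s. integrable lborel s \<and> (\<integral>x. s x \<partial>lborel) > 0 \<and>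
      (\<forall>x. 0 \<le> s x \<and> s x \<le> \<epsilon> / 2 * indicator (ball z R) x) \<and>
      (\<forall>x\<in>ball z (R / 2). q \<xi> z - q \<xi> x \<le> \<epsilon> / 8 \<longrightarrow> \<epsilon> / 8 \<le> s x) \<and>
      (\<forall>g. integrable lborel (\<lambda>x. s x * g x) \<longrightarrow>
        (\<forall>x\<in>ball z R. \<epsilon> * K * (Hsum x powr (1 / p)) ^ (CARD('n) - 2) \<le> g x) \<longrightarrow>
        c * (\<integral>x. s x \<partial>lborel) \<le> (\<integral>x. s x * g x \<partial>lborel))"
      using si s3 s0 s1 s2 s4 by (intro exI[of _ ?s] conjI allI impI ballI) blast+
  qed
qed

text \<open>For n = 2 no Hessian row remains in the majorant, which is the constant \<epsilon> K.
  The choice \<epsilon> K = c / 2 contradicts the positivity of the integral of \<open>s\<close>, so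
  the strong maximum principle in the plane is complete at this point.\<close>

lemma dim_ge_3: "CARD('n) \<ge> 3"
proof (rule ccontr)
  assume "\<not> ?thesis"
  then have n: "CARD('n) - 2 = 0" by simp
  show False
  proof (rule paraboloid_inequality)
    fix R c K
    assume R: "R > 0" "c > 0" "K > 0" and S: "\<And>\<epsilon>. \<epsilon> > 0 \<Longrightarrow> \<exists>s. integrable lborel s \<and> (\<integral>x. s x \<partial>lborel) > 0 \<and>
      (\<forall>x. 0 \<le> s x \<and> s x \<le> \<epsilon> / 2 * indicator (ball z R) x) \<and>
      (\<forall>x\<in>ball z (R / 2). q \<xi> z - q \<xi> x \<le> \<epsilon> / 8 \<longrightarrow> \<epsilon> / 8 \<le> s x) \<and>
      (\<forall>g. integrable lborel (\<lambda>x. s x * g x) \<longrightarrow>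
        (\<forall>x\<in>ball z R. \<epsilon> * K * (Hsum x powr (1 / p)) ^ (CARD('n) - 2) \<le> g x) \<longrightarrow>
        c * (\<integral>x. s x \<partial>lborel) \<le> (\<integral>x. s x * g x \<partial>lborel))"
    define \<epsilon> where "\<epsilon> = c / (2 * K)"
    have e: "\<epsilon> > 0" "\<epsilon> * K = c / 2" using R by (auto simp: \<epsilon>_def)
    obtain s where s: "integrable lborel s" "(\<integral>x. s x \<partial>lborel) > 0"
      "\<forall>g. integrable lborel (\<lambda>x. s x * g x) \<longrightarrow> (\<forall>x\<in>ball z R. c / 2 \<le> g x) \<longrightarrow> c * (\<integral>x. s x \<partial>lborel) \<le> (\<integral>x. s x * g x \<partial>lborel)"
      using S[OF e(1)] unfolding e(2) n by auto
    have "c * (\<integral>x. s x \<partial>lborel) \<le> (\<integral>x. s x * (c / 2) \<partial>lborel)" using s(3)[rule_format, of "\<lambda>_. c / 2"] s(1) by simp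
    then have "c * (\<integral>x. s x \<partial>lborel) \<le> c / 2 * (\<integral>x. s x \<partial>lborel)" by simp
    moreover have "c / 2 * (\<integral>x. s x \<partial>lborel) < c * (\<integral>x. s x \<partial>lborel)" using s(2) R by simp
    ultimately show False by linarith
  qed
qed

text \<open>Comparison with paraboloids of height \<open>\<epsilon>\<close>: the determinant on the right is \<open>O(\<epsilon> * h ^ (n - 2))\<close> with
  \<open>h\<close> the \<open>p\<close>-integrable size of the Hessian, and Young's inequality turns this into a power of \<open>\<epsilon>\<close>.\<close>

lemma level_estimate:
  obtains R C where "R > 0" "C > 0" "0 \<notin> cube z R" "\<And>x. x \<in> cube z R \<Longrightarrow> u x > 0"
    "\<And>\<epsilon>. \<epsilon> > 0 \<Longrightarrow> measure lborel {x \<in> ball z R. q \<xi> z - q \<xi> x \<le> \<epsilon>} \<le> C * \<epsilon> powr (p / (real CARD('n) - 2))"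
proof (rule paraboloid_inequality)
  fix R c K
  assume R: "R > 0" "c > 0" "K > 0" "0 \<notin> cube z R" and upos: "\<And>x. x \<in> cube z R \<Longrightarrow> u x > 0"
    and S: "\<And>\<epsilon>. \<epsilon> > 0 \<Longrightarrow> \<exists>s. integrable lborel s \<and> (\<integral>x. s x \<partial>lborel) > 0 \<and>
      (\<forall>x. 0 \<le> s x \<and> s x \<le> \<epsilon> / 2 * indicator (ball z R) x) \<and>
      (\<forall>x\<in>ball z (R / 2). q \<xi> z - q \<xi> x \<le> \<epsilon> / 8 \<longrightarrow> \<epsilon> / 8 \<le> s x) \<and>
      (\<forall>g. integrable lborel (\<lambda>x. s x * g x) \<longrightarrow>
        (\<forall>x\<in>ball z R. \<epsilon> * K * (Hsum x powr (1 / p)) ^ (CARD('n) - 2) \<le> g x) \<longrightarrow>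
        c * (\<integral>x. s x \<partial>lborel) \<le> (\<integral>x. s x * g x \<partial>lborel))"
  have n2': "(real CARD('n) - 2) > 0" "real (CARD('n) - 2) = (real CARD('n) - 2)" using dim_ge_3 by (auto simp: of_nat_diff)
  define b where "b = p / (real CARD('n) - 2)"
  have "b > real CARD('n) - 1" using pn n2' by (simp add: b_def pos_less_divide_eq)
  then have b: "b \<ge> 1" using dim_ge_3 by simp
  define I where "I = (\<integral>x. indicator (cube z R) x * Hsum x \<partial>lborel)"
  have Hi: "integrable lborel (\<lambda>x. indicator (cube z R) x * Hsum x)" using R by (intro Hsum_integrable) auto
  have I0: "I \<ge> 0" unfolding I_def by (intro integral_nonneg_AE) (auto simp: Hsum_nonneg)
  \<comment> \<open>The constant part of Young's inequality takes only half of c and is absorbed on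
    the left.\<close>
  define a where "a = c / 2"
  define A where "A = a powr (1 - b) * K powr b"
  have A: "A > 0" using R by (simp add: A_def a_def)
  have cb: "ball z R \<subseteq> cube z R" by (auto simp: dist_norm norm_minus_commute intro!: ball_subset_cube)
  have est: "measure lborel {x \<in> ball z (R / 2). q \<xi> z - q \<xi> x \<le> \<epsilon> / 8} \<le> (8 / c * A * I) * \<epsilon> powr b" if e: "\<epsilon> > 0" for \<epsilon>
  proof -
    obtain s where s: "integrable lborel s" "(\<integral>x. s x \<partial>lborel) > 0"
      "\<forall>x. 0 \<le> s x \<and> s x \<le> \<epsilon> / 2 * indicator (ball z R) x"
      "\<forall>x\<in>ball z (R / 2). q \<xi> z - q \<xi> x \<le> \<epsilon> / 8 \<longrightarrow> \<epsilon> / 8 \<le> s x"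
      "\<forall>g. integrable lborel (\<lambda>x. s x * g x) \<longrightarrow> (\<forall>x\<in>ball z R. \<epsilon> * K * (Hsum x powr (1 / p)) ^ (CARD('n) - 2) \<le> g x) \<longrightarrow>
        c * (\<integral>x. s x \<partial>lborel) \<le> (\<integral>x. s x * g x \<partial>lborel)"
      using S[OF e] by blast
    have [measurable]: "s \<in> borel_measurable borel" using s(1) by auto
    define g where "g x = a + A * \<epsilon> powr b * Hsum x" for x
    have sH: "s x * Hsum x \<le> \<epsilon> / 2 * (indicator (cube z R) x * Hsum x)" "0 \<le> s x * Hsum x" for x
    proof -
      have "s x \<le> \<epsilon> / 2 * indicator (cube z R) x"
      proof -
        have "indicator (ball z R) x \<le> (indicator (cube z R) x :: real)" using cb by (auto simp: indicator_def)
        then have "\<epsilon> / 2 * indicator (ball z R) x \<le> \<epsilon> / 2 * indicator (cube z R) x" using e by (intro mult_left_mono) auto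
        then show ?thesis using s(3) order_trans by blast
      qed
      then have "s x * Hsum x \<le> (\<epsilon> / 2 * indicator (cube z R) x) * Hsum x" by (intro mult_right_mono Hsum_nonneg) auto
      then show "s x * Hsum x \<le> \<epsilon> / 2 * (indicator (cube z R) x * Hsum x)" by (simp only: mult.assoc)
      show "0 \<le> s x * Hsum x" using s(3) Hsum_nonneg by simp
    qed
    have sHi: "integrable lborel (\<lambda>x. s x * Hsum x)"
    proof (rule Bochner_Integration.integrable_bound)
      show "integrable lborel (\<lambda>x. \<epsilon> / 2 * (indicator (cube z R) x * Hsum x))" using Hi by simp
      show "AE x in lborel. norm (s x * Hsum x) \<le> norm (\<epsilon> / 2 * (indicator (cube z R) x * Hsum x))"
      proof (rule AE_I2)
        fix x show "norm (s x * Hsum x) \<le> norm (\<epsilon> / 2 * (indicator (cube z R) x * Hsum x))"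
          using sH[of x] by (simp only: real_norm_def)
      qed
    qed simp
    have gi: "integrable lborel (\<lambda>x. s x * g x)"
    proof -
      have "integrable lborel (\<lambda>x. a * s x + A * \<epsilon> powr b * (s x * Hsum x))" using s(1) sHi by simp
      then show ?thesis by (simp add: g_def algebra_simps)
    qed
    \<comment> \<open>Young's inequality with exponent b = p / (n - 2), for which the b-th power of
      the n - 2 Hessian factors is exactly \<open>Hsum x\<close>.\<close>
    have gb: "\<epsilon> * K * (Hsum x powr (1 / p)) ^ (CARD('n) - 2) \<le> g x" for x
    proof -
      define y where "y = \<epsilon> * K * (Hsum x powr (1 / p)) ^ (CARD('n) - 2)"
      have y0: "y \<ge> 0" using e R by (simp add: y_def)
      have "((Hsum x powr (1 / p)) ^ (CARD('n) - 2)) powr b = Hsum x"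
      proof (cases "Hsum x = 0")
        case True then show ?thesis using dim_ge_3 b by simp
      next
        case False
        then have h: "Hsum x > 0" using Hsum_nonneg[of x] by simp
        then have "(Hsum x powr (1 / p)) ^ (CARD('n) - 2) = (Hsum x powr (1 / p)) powr (real CARD('n) - 2)"
          using n2'(2) powr_realpow[of "Hsum x powr (1 / p)" "CARD('n) - 2"] by simp
        also have "\<dots> powr b = Hsum x powr (1 / p * (real CARD('n) - 2) * b)" by (simp add: powr_powr)
        also have "1 / p * (real CARD('n) - 2) * b = 1" using p1 n2' by (simp add: b_def)
        finally show ?thesis using h by simp
      qed
      then have "y powr b = \<epsilon> powr b * K powr b * Hsum x" using e R by (simp add: y_def powr_mult)
      moreover have "y \<le> a + a powr (1 - b) * y powr b"
        using y0 R b by (intro le_young_split) (auto simp: a_def)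
      ultimately have "y \<le> g x" by (simp add: g_def A_def mult_ac)
      then show ?thesis by (simp add: y_def)
    qed
    have "c * (\<integral>x. s x \<partial>lborel) \<le> (\<integral>x. s x * g x \<partial>lborel)" using s(5) gi gb by blast
    also have "\<dots> = (\<integral>x. a * s x + A * \<epsilon> powr b * (s x * Hsum x) \<partial>lborel)" by (simp add: g_def algebra_simps)
    also have "\<dots> = a * (\<integral>x. s x \<partial>lborel) + A * \<epsilon> powr b * (\<integral>x. s x * Hsum x \<partial>lborel)" using s(1) sHi by simp
    finally have 0: "c * (\<integral>x. s x \<partial>lborel) \<le> a * (\<integral>x. s x \<partial>lborel) + A * \<epsilon> powr b * (\<integral>x. s x * Hsum x \<partial>lborel)" .
    have "(\<integral>x. s x * Hsum x \<partial>lborel) \<le> (\<integral>x. \<epsilon> / 2 * (indicator (cube z R) x * Hsum x) \<partial>lborel)"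
      using sHi Hi sH by (intro integral_mono) auto
    also have "\<dots> = \<epsilon> / 2 * I" by (simp add: I_def)
    finally have "A * \<epsilon> powr b * (\<integral>x. s x * Hsum x \<partial>lborel) \<le> A * \<epsilon> powr b * (\<epsilon> / 2 * I)"
      using A by (intro mult_left_mono) auto
    then have 1: "a * (\<integral>x. s x \<partial>lborel) \<le> A * \<epsilon> powr b * (\<epsilon> / 2 * I)"
      using 0 unfolding a_def by linarith
    let ?S = "{x \<in> ball z (R / 2). q \<xi> z - q \<xi> x \<le> \<epsilon> / 8}"
    have [measurable]: "?S \<in> sets borel" by measurable
    have fin: "emeasure lborel ?S < \<infinity>"
    proof -
      have "emeasure lborel ?S \<le> emeasure lborel (cube z R)" using cb R by (intro emeasure_mono) auto
      then show ?thesis using R by (simp add: emeasure_cube order_le_less_trans)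
    qed
    have "\<epsilon> / 8 * measure lborel ?S = (\<integral>x. \<epsilon> / 8 * indicator ?S x \<partial>lborel)" using fin by simp
    also have "\<dots> \<le> (\<integral>x. s x \<partial>lborel)"
    proof (rule integral_mono)
      show "integrable lborel (\<lambda>x. \<epsilon> / 8 * indicator ?S x)" using fin by simp
      fix x show "\<epsilon> / 8 * indicator ?S x \<le> s x" using s(3,4) by (auto simp: indicator_def)
    qed (rule s)
    finally have "\<epsilon> / 8 * measure lborel ?S \<le> (\<integral>x. s x \<partial>lborel)" .
    then have "a * (\<epsilon> / 8 * measure lborel ?S) \<le> a * (\<integral>x. s x \<partial>lborel)" using R by (intro mult_left_mono) (auto simp: a_def)
    then have "a * (\<epsilon> / 8 * measure lborel ?S) \<le> A * \<epsilon> powr b * (\<epsilon> / 2 * I)"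
      using 1 by linarith
    \<comment> \<open>One factor \<epsilon> is the height of the cutoff; it occurs in the lower
      bound for the integral of \<open>s\<close> and in the upper bound for its energy, and
      cancels.\<close>
    then have "\<epsilon> * (c * measure lborel ?S) \<le> \<epsilon> * (8 * A * I * \<epsilon> powr b)" by (simp add: a_def mult_ac)
    then have "c * measure lborel ?S \<le> 8 * A * I * \<epsilon> powr b" using e by simp
    then show ?thesis using R by (simp add: field_simps)
  qed
  show thesis
  proof (rule that[of "R / 2" "8 / c * A * (I + 1) * 8 powr b"])
    show "0 < R / 2" using R by simp
    show "0 < 8 / c * A * (I + 1) * 8 powr b" using R A I0 by simp
    have "cube z (R / 2) \<subseteq> cube z R" using R by (intro cube_mono) simp
    then show "0 \<notin> cube z (R / 2)" "\<And>x. x \<in> cube z (R / 2) \<Longrightarrow> u x > 0" using R upos by auto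
    fix \<epsilon> :: real assume e: "\<epsilon> > 0"
    have "measure lborel {x \<in> ball z (R / 2). q \<xi> z - q \<xi> x \<le> \<epsilon>} \<le> (8 / c * A * I) * (8 * \<epsilon>) powr b"
      using est[of "8 * \<epsilon>"] e by simp
    also have "\<dots> = 8 / c * A * I * 8 powr b * \<epsilon> powr b" using e by (simp add: powr_mult)
    also have "\<dots> \<le> 8 / c * A * (I + 1) * 8 powr b * \<epsilon> powr b"
      using R A I0 by (intro mult_right_mono mult_left_mono) auto
    finally show "measure lborel {x \<in> ball z (R / 2). q \<xi> z - q \<xi> x \<le> \<epsilon>} \<le> 8 / c * A * (I + 1) * 8 powr b * \<epsilon> powr (p / (real CARD('n) - 2))"
      by (simp add: b_def)
  qed
qed

end

section \<open>Packing of tubes around maximum points\<close>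

context hessian_setup
begin

lemma q_hom:
  assumes "s > 0" "u x \<ge> 0" "x \<noteq> 0"
  shows "q \<xi> (s *\<^sub>R x) = q \<xi> x"
proof -
  have e: "\<alpha> * \<beta> + (\<alpha> - 1) = 0" using \<alpha> by (simp add: \<beta>_def field_simps)
  have "q \<xi> (s *\<^sub>R x) = (s powr \<alpha> * u x) powr \<beta> * (s powr (\<alpha> - 1) * (\<xi> \<bullet> Du x))"
    using assms by (simp add: q_def hom P_hom)
  also have "\<dots> = (s powr (\<alpha> * \<beta>) * s powr (\<alpha> - 1)) * q \<xi> x"
    using assms by (simp add: q_def powr_mult powr_powr mult_ac)
  also have "s powr (\<alpha> * \<beta>) * s powr (\<alpha> - 1) = 1" using e assms by (simp add: powr_add[symmetric])
  finally show ?thesis by simp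
qed

lemma powr_u_lipschitz:
  assumes "0 \<notin> cube z R" and "\<And>x. x \<in> cube z R \<Longrightarrow> u x > 0"
  obtains L where "L > 0" "\<And>x y. x \<in> cube z R \<Longrightarrow> y \<in> cube z R \<Longrightarrow> \<bar>u x powr a - u y powr a\<bar> \<le> L * norm (x - y)"
proof -
  have nz: "x \<noteq> 0" if "x \<in> cube z R" for x using that assms by auto
  define G where "G x = (a * u x powr (a - 1)) *\<^sub>R Du x" for x
  have "continuous_on (cube z R) G"
    unfolding G_def[abs_def] using assms
    by (intro continuous_intros continuous_on_subset[OF cont] continuous_on_subset[OF continuous_Du]) force+
  then have "bounded (G ` cube z R)" by (intro compact_imp_bounded compact_continuous_image compact_cube)
  then obtain L where L: "L > 0" "\<And>x. x \<in> cube z R \<Longrightarrow> norm (G x) \<le> L" by (auto simp: bounded_pos)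
  show thesis
  proof (rule that[OF L(1)])
    fix x y assume xy: "x \<in> cube z R" "y \<in> cube z R"
    have "norm (u x powr a - u y powr a) \<le> L * norm (x - y)"
    proof (rule differentiable_bound[OF convex_cube _ _ xy])
      fix w assume w: "w \<in> cube z R"
      have "((\<lambda>x. u x powr a) has_derivative (\<lambda>h. G w \<bullet> h)) (at w within cube z R)"
        unfolding G_def
        by (rule has_derivative_eq_rhs, rule has_derivative_powr[OF has_derivative_at_withinI[OF has_derivative_u[OF nz[OF w]]] has_derivative_const])
          (use assms(2)[OF w] w in \<open>auto simp: powr_diff\<close>)
      then show "((\<lambda>x. u x powr a) has_derivative (\<bullet>) (G w)) (at w within cube z R)" by simp
      show "onorm ((\<bullet>) (G w)) \<le> L"
      proof (rule onorm_bound)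
        fix h
        have "norm (G w \<bullet> h) \<le> norm (G w) * norm h" using Cauchy_Schwarz_ineq2 by simp
        also have "\<dots> \<le> L * norm h" using L(2)[OF w] by (intro mult_right_mono) auto
        finally show "norm (G w \<bullet> h) \<le> L * norm h" .
      qed (use L in simp)
    qed
    then show "\<bar>u x powr a - u y powr a\<bar> \<le> L * norm (x - y)" by simp
  qed
qed

text \<open>The map \<open>x \<mapsto> u x powr (-1/\<alpha>) *\<^sub>R x\<close> is constant on rays, so tubes around two points of
  one level set of \<open>u\<close> can only meet if the points are close.\<close>

lemma tubes_disjoint:
  assumes R: "0 \<notin> cube z R" and upos: "\<And>x. x \<in> cube z R \<Longrightarrow> u x > 0"
  obtains \<Lambda> where "\<Lambda> > 0" "\<And>x y \<rho> c. \<lbrakk>c > 0; \<rho> > 0; cube x \<rho> \<subseteq> cube z R; cube y \<rho> \<subseteq> cube z R; u x = u y; \<Lambda> * \<rho> < u x powr (-1/\<alpha>) * norm (x - y)\<rbrakk>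
    \<Longrightarrow> tube c x \<rho> \<inter> tube c y \<rho> = {}"
proof -
  obtain L where L: "L > 0" "\<And>x y. x \<in> cube z R \<Longrightarrow> y \<in> cube z R \<Longrightarrow> \<bar>u x powr (-1/\<alpha>) - u y powr (-1/\<alpha>)\<bar> \<le> L * norm (x - y)"
    using powr_u_lipschitz[OF R upos] by blast
  have "continuous_on (cube z R) (\<lambda>x. u x powr (-1/\<alpha>))"
    by (intro continuous_intros continuous_on_subset[OF cont]) (auto dest!: upos)
  then have "bounded ((\<lambda>x. u x powr (-1/\<alpha>)) ` cube z R)" by (intro compact_imp_bounded compact_continuous_image compact_cube)
  then obtain B where B: "B > 0" "\<And>x. x \<in> cube z R \<Longrightarrow> u x powr (-1/\<alpha>) \<le> B" by (auto simp: bounded_pos)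
  have "bounded (cube z R)" by (intro compact_imp_bounded compact_cube)
  then obtain Z where Z: "Z > 0" "\<And>x. x \<in> cube z R \<Longrightarrow> norm x \<le> Z" by (auto simp: bounded_pos)
  define g where "g x = u x powr (-1/\<alpha>) *\<^sub>R x" for x
  define A where "A = L * Z + B"
  have A: "A > 0" using L B Z by (simp add: A_def add_pos_pos)
  have gl: "norm (g x - g y) \<le> A * norm (x - y)" if "x \<in> cube z R" "y \<in> cube z R" for x y
  proof -
    have "g x - g y = (u x powr (-1/\<alpha>) - u y powr (-1/\<alpha>)) *\<^sub>R x + u y powr (-1/\<alpha>) *\<^sub>R (x - y)"
      by (simp add: g_def algebra_simps)
    then have "norm (g x - g y) \<le> \<bar>u x powr (-1/\<alpha>) - u y powr (-1/\<alpha>)\<bar> * norm x + u y powr (-1/\<alpha>) * norm (x - y)"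
      by (metis abs_of_nonneg norm_scaleR norm_triangle_ineq powr_ge_zero)
    also have "\<dots> \<le> (L * norm (x - y)) * Z + B * norm (x - y)"
      using that L B Z by (intro add_mono mult_mono) auto
    finally show ?thesis by (simp add: A_def algebra_simps)
  qed
  have gh: "g (s *\<^sub>R x) = g x" if "s > 0" "u x > 0" for s x
    using that \<alpha> by (simp add: g_def hom powr_mult powr_powr powr_minus field_simps)
  show thesis
  proof (rule that[of "2 * A * real CARD('n)"])
    show "0 < 2 * A * real CARD('n)" using A by simp
    fix x y :: "real^'n" and \<rho> c :: real
    assume c: "c > 0" "\<rho> > 0" and cu: "cube x \<rho> \<subseteq> cube z R" "cube y \<rho> \<subseteq> cube z R" and eq: "u x = u y"
      and far: "2 * A * real CARD('n) * \<rho> < u x powr (-1/\<alpha>) * norm (x - y)"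
    have ctr: "w \<in> cube w \<rho>" for w :: "real^'n" using c by (auto simp: mem_cube_iff)
    show "tube c x \<rho> \<inter> tube c y \<rho> = {}"
    proof (rule ccontr)
      assume "tube c x \<rho> \<inter> tube c y \<rho> \<noteq> {}"
      then obtain s t a b where st: "s \<in> {1..1+c}" "t \<in> {1..1+c}" "a \<in> cube x \<rho>" "b \<in> cube y \<rho>" "s *\<^sub>R a = t *\<^sub>R b"
        unfolding tube_def by auto
      have "g a = g b"
        using gh[of s a] gh[of t b] st cu upos by fastforce
      then have "g x - g y = (g x - g a) + (g b - g y)" by simp
      then have "norm (g x - g y) \<le> norm (g x - g a) + norm (g b - g y)" by (metis norm_triangle_ineq)
      also have "\<dots> \<le> A * norm (x - a) + A * norm (b - y)" using cu st ctr by (intro add_mono gl) auto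
      also have "\<dots> \<le> A * (real CARD('n) * \<rho>) + A * (real CARD('n) * \<rho>)"
        using cube_norm_le[OF st(3)] cube_norm_le[OF st(4)] A by (intro add_mono mult_left_mono) (auto simp: norm_minus_commute)
      finally have "norm (g x - g y) \<le> 2 * A * real CARD('n) * \<rho>" by (simp add: mult_ac)
      moreover have "g x - g y = u x powr (-1/\<alpha>) *\<^sub>R (x - y)" by (simp add: g_def eq algebra_simps)
      ultimately show False using far by simp
    qed
  qed
qed

text \<open>\<open>packing\<close> for the constant function 1, of degree 0: the volume of the cube,
  of order \<rho>^n, is at most a multiple of \<rho> times the volume of the tube.\<close>

lemma tube_measure_ge:
  fixes x :: "real^'n"
  assumes c: "0 < c" "c \<le> 1" and \<rho>: "0 < \<rho>" and \<eta>: "\<eta> > 0" "\<And>y. y \<in> cube x \<rho> \<Longrightarrow> norm y \<ge> \<eta>"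
  shows "\<eta> * c / (5 * real CARD('n)) * \<rho> ^ (CARD('n) - 1) \<le> measure lborel (tube c x \<rho>)"
proof -
  let ?n = "real CARD('n)"
  have fin: "emeasure lborel (tube c x \<rho>) < \<infinity>" using compact_tube emeasure_compact_finite by blast
  let ?A = "5 * ?n / (\<eta> * c) * 2 powr ?n * \<rho>"
  have A: "?A > 0" using c \<rho> \<eta> by simp
  have "ennreal ((2 * \<rho>) ^ CARD('n)) = (\<integral>\<^sup>+y. 1 * indicator (cube x \<rho>) y \<partial>lborel)"
    using emeasure_cube[of \<rho> x] \<rho> by simp
  also have "\<dots> \<le> ennreal ?A * (\<integral>\<^sup>+y. 1 * indicator (tube c x \<rho>) y \<partial>lborel)"
    using packing[of "\<lambda>_. 1" c \<rho> \<eta> x 0] assms by simp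
  also have "\<dots> = ennreal (?A * measure lborel (tube c x \<rho>))"
    unfolding ennreal_mult[OF less_imp_le[OF A] measure_nonneg] using fin by (simp add: emeasure_eq_ennreal_measure)
  finally have "(2 * \<rho>) ^ CARD('n) \<le> ?A * measure lborel (tube c x \<rho>)"
    by (rule ennreal_le_iff[THEN iffD1, rotated]) (intro mult_nonneg_nonneg less_imp_le[OF A] measure_nonneg)
  also have "\<dots> = (2 powr ?n * \<rho>) * (5 * ?n / (\<eta> * c) * measure lborel (tube c x \<rho>))" by simp
  also have "(2 * \<rho>) ^ CARD('n) = (2 powr ?n * \<rho>) * \<rho> ^ (CARD('n) - 1)"
    by (simp add: power_mult_distrib powr_realpow power_eq_if[of \<rho> "CARD('n)"])
  finally have "\<rho> ^ (CARD('n) - 1) \<le> 5 * ?n / (\<eta> * c) * measure lborel (tube c x \<rho>)"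
    using \<rho> by (subst (asm) mult_le_cancel_left_pos) auto
  then show ?thesis using c \<eta> by (simp add: field_simps)
qed

text \<open>Tube energy at most K r contributes an extra factor r powr (1 / p), which raises the
  Hoelder exponent \<gamma> to 1 - (n - 2) / p. The Lipschitz oscillation of u powr \<beta> fits in
  because r \<le> 1 and the new exponent is at most 1.\<close>

lemma q_osc:
  assumes R: "0 \<notin> cube z R" and upos: "\<And>x. x \<in> cube z R \<Longrightarrow> u x > 0" and \<eta>: "\<eta> > 0" "\<And>x. x \<in> cube z R \<Longrightarrow> norm x \<ge> \<eta>"
    and c: "0 < c" "c \<le> 1" and K: "K > 0"
  obtains C where "C > 0" "\<And>x y r. \<lbrakk>0 < r; r \<le> 1; cube x (4 * r) \<subseteq> cube z R; y \<in> cube x r;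
    \<And>i j. (\<integral>\<^sup>+y. ennreal (\<bar>H i j y\<bar> powr p) * indicator (tube c x (4 * r)) y \<partial>lborel) \<le> ennreal (K * r)\<rbrakk> \<Longrightarrow>
    \<bar>q \<xi> y - q \<xi> x\<bar> \<le> C * r powr (1 - (real CARD('n) - 2) / p)"
proof -
  obtain L where L: "L > 0" "\<And>x y. x \<in> cube z R \<Longrightarrow> y \<in> cube z R \<Longrightarrow> \<bar>u x powr \<beta> - u y powr \<beta>\<bar> \<le> L * norm (x - y)"
    using powr_u_lipschitz[OF R upos] by blast
  have "continuous_on (cube z R) (\<lambda>x. u x powr \<beta>)"
    by (intro continuous_intros continuous_on_subset[OF cont]) (auto dest!: upos)
  then have "bounded ((\<lambda>x. u x powr \<beta>) ` cube z R)" by (intro compact_imp_bounded compact_continuous_image compact_cube)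
  then obtain B where B: "B > 0" "\<And>x. x \<in> cube z R \<Longrightarrow> u x powr \<beta> \<le> B" by (auto simp: bounded_pos)
  have "continuous_on (cube z R) (\<lambda>x. \<xi> \<bullet> Du x)"
    by (intro continuous_intros continuous_on_subset[OF continuous_Du]) (use R in auto)
  then have "bounded ((\<lambda>x. \<xi> \<bullet> Du x) ` cube z R)" by (intro compact_imp_bounded compact_continuous_image compact_cube)
  then obtain Z where Z: "Z > 0" "\<And>x. x \<in> cube z R \<Longrightarrow> \<bar>\<xi> \<bullet> Du x\<bar> \<le> Z" by (auto simp: bounded_pos)
  define \<theta> where "\<theta> = 1 - (real CARD('n) - 2) / p"
  have \<theta>: "\<theta> = 1 / p + \<gamma>" "\<theta> \<le> 1" using p1 n2 by (auto simp: \<theta>_def \<gamma>_def field_simps)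
  define W where "W = holdC * (packC \<eta> c * K) powr (1 / p)"
  have W: "W \<ge> 0" using holdC_pos by (simp add: W_def)
  define S where "S = (\<Sum>i\<in>UNIV. \<bar>\<xi> $ i\<bar>)"
  have S: "S \<ge> 0" by (simp add: S_def sum_nonneg)
  define C where "C = L * real CARD('n) * Z + B * (S * W) + 1"
  show thesis
  proof (rule that[of C])
    show "C > 0" using L Z B S W by (simp add: C_def add_nonneg_pos)
    fix x y r assume r: "0 < r" "r \<le> 1" and cu: "cube x (4 * r) \<subseteq> cube z R" and y: "y \<in> cube x r"
      and E: "\<And>i j. (\<integral>\<^sup>+y. ennreal (\<bar>H i j y\<bar> powr p) * indicator (tube c x (4 * r)) y \<partial>lborel) \<le> ennreal (K * r)"
    have x: "x \<in> cube x r" using r by (simp add: mem_cube_iff)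
    have sub: "cube x r \<subseteq> cube z R" using cu cube_mono[of r "4 * r" x] r by auto
    have Po: "\<bar>P i y - P i x\<bar> \<le> W * r powr \<theta>" for i
    proof -
      have "\<bar>P i y - P i x\<bar> \<le> holdC * (packC \<eta> c * (K * r)) powr (1 / p) * r powr \<gamma>"
        using P_osc[OF c r(1) \<eta>(1) _ _ E y x, of i] cu \<eta>(2) K r by auto
      also have "\<dots> = W * r powr \<theta>"
        using r K packC_pos[OF \<eta>(1) c(1)] by (simp add: W_def \<theta> powr_add powr_mult mult_ac)
      finally show ?thesis .
    qed
    have "\<bar>\<xi> \<bullet> Du y - \<xi> \<bullet> Du x\<bar> = \<bar>\<Sum>i\<in>UNIV. \<xi> $ i * (P i y - P i x)\<bar>"
      by (simp add: Du_def inner_vec_def sum_subtractf right_diff_distrib)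
    also have "\<dots> \<le> (\<Sum>i\<in>UNIV. \<bar>\<xi> $ i\<bar> * (W * r powr \<theta>))"
      using Po by (intro order_trans[OF sum_abs] sum_mono) (auto simp: abs_mult intro!: mult_left_mono)
    also have "\<dots> = S * W * r powr \<theta>" by (simp add: S_def sum_distrib_right mult.assoc)
    finally have D: "\<bar>\<xi> \<bullet> Du y - \<xi> \<bullet> Du x\<bar> \<le> S * W * r powr \<theta>" .
    have "\<bar>u y powr \<beta> - u x powr \<beta>\<bar> \<le> L * norm (y - x)" using x y sub by (intro L) auto
    also have "\<dots> \<le> L * (real CARD('n) * r)" using cube_norm_le[OF y] L by (intro mult_left_mono) auto
    also have "\<dots> \<le> L * (real CARD('n) * r powr \<theta>)"
    proof -
      have "r powr 1 \<le> r powr \<theta>" using r \<theta> by (intro powr_mono') auto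
      then show ?thesis using r L by (intro mult_left_mono) auto
    qed
    finally have U: "\<bar>u y powr \<beta> - u x powr \<beta>\<bar> \<le> L * real CARD('n) * r powr \<theta>" by simp
    have "q \<xi> y - q \<xi> x = (u y powr \<beta> - u x powr \<beta>) * (\<xi> \<bullet> Du y) + u x powr \<beta> * (\<xi> \<bullet> Du y - \<xi> \<bullet> Du x)"
      by (simp add: q_def algebra_simps)
    then have "\<bar>q \<xi> y - q \<xi> x\<bar> \<le> \<bar>u y powr \<beta> - u x powr \<beta>\<bar> * \<bar>\<xi> \<bullet> Du y\<bar> + u x powr \<beta> * \<bar>\<xi> \<bullet> Du y - \<xi> \<bullet> Du x\<bar>"
      by (metis abs_mult abs_of_nonneg abs_triangle_ineq powr_ge_zero)
    also have "\<dots> \<le> (L * real CARD('n) * r powr \<theta>) * Z + B * (S * W * r powr \<theta>)"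
      using U D x y sub B Z L by (intro add_mono mult_mono) auto
    also have "\<dots> \<le> C * r powr \<theta>" by (simp add: C_def algebra_simps)
    finally show "\<bar>q \<xi> y - q \<xi> x\<bar> \<le> C * r powr (1 - (real CARD('n) - 2) / p)" by (simp add: \<theta>_def)
  qed
qed

end

text \<open>Markov's inequality for the counting measure.\<close>

lemma card_le_twice_average:
  fixes E :: "'a \<Rightarrow> real"
  assumes I: "finite I" "I \<noteq> {}" and E: "\<And>i. i \<in> I \<Longrightarrow> E i \<ge> 0" and T: "sum E I \<le> T" "T > 0"
  shows "real (card I) / 2 \<le> card {i \<in> I. E i \<le> 2 * T / card I}"
proof -
  let ?B = "{i \<in> I. \<not> E i \<le> 2 * T / card I}" and ?G = "{i \<in> I. E i \<le> 2 * T / card I}"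
  have n: "real (card I) > 0" using I by (simp add: card_gt_0_iff)
  have "card ?B * (2 * T / card I) \<le> sum E ?B"
    using sum_bounded_below[of ?B "2 * T / card I" E] by auto
  also have "\<dots> \<le> sum E I" using I E by (intro sum_mono2) auto
  finally have "card ?B * (2 * T / card I) \<le> T" using T by simp
  then have "real (card ?B) * 2 * T \<le> card I * T" using n by (simp add: field_simps)
  then have "real (card ?B) * 2 \<le> card I" using T by (subst (asm) mult_le_cancel_right_pos) auto
  moreover have "card I = card ?G + card ?B"
  proof -
    have "?G \<union> ?B = I" by auto
    then show ?thesis using I card_Un_disjoint[of ?G ?B] by auto
  qed
  ultimately show ?thesis by simp
qed

context hessian_setup
begin

lemma tube_energy_sum_le:
  assumes T: "finite I" "disjoint_family_on T I" "\<And>i. i \<in> I \<Longrightarrow> T i \<subseteq> S" "\<And>i. i \<in> I \<Longrightarrow> compact (T i)" and S: "compact S" "0 \<notin> S"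
  shows "(\<Sum>i\<in>I. \<integral>x. indicator (T i) x * Hsum x \<partial>lborel) \<le> (\<integral>x. indicator S x * Hsum x \<partial>lborel)"
proof -
  have i: "integrable lborel (\<lambda>x. indicator (T i) x * Hsum x)" if "i \<in> I" for i
    using T that S by (intro Hsum_integrable) auto
  have "(\<Sum>i\<in>I. \<integral>x. indicator (T i) x * Hsum x \<partial>lborel) = (\<integral>x. (\<Sum>i\<in>I. indicator (T i) x * Hsum x) \<partial>lborel)"
    using i by simp
  also have "\<dots> \<le> (\<integral>x. indicator S x * Hsum x \<partial>lborel)"
  proof (rule integral_mono)
    show "integrable lborel (\<lambda>x. \<Sum>i\<in>I. indicator (T i) x * Hsum x)" using i by simp
    show "integrable lborel (\<lambda>x. indicator S x * Hsum x)" by (rule Hsum_integrable[OF S])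
    fix x
    have "(\<Sum>i\<in>I. indicator (T i) x) = (indicator (\<Union>i\<in>I. T i) x :: real)"
      by (rule indicator_UN_disjoint[OF T(1,2), symmetric])
    also have "\<dots> \<le> indicator S x" using T(3) by (auto simp: indicator_def)
    finally have "(\<Sum>i\<in>I. indicator (T i) x) * Hsum x \<le> indicator S x * Hsum x"
      by (intro mult_right_mono Hsum_nonneg)
    then show "(\<Sum>i\<in>I. indicator (T i) x * Hsum x) \<le> indicator S x * Hsum x" by (simp add: sum_distrib_right)
  qed
  finally show ?thesis .
qed

end

context hessian_max
begin

text \<open>By 0-homogeneity, closeness of \<open>q \<xi>\<close> to its maximum on the cube spreads
  along the rays to the whole tube.\<close>

lemma tube_in_level_set:
  assumes "\<And>w. w \<in> cube y r \<Longrightarrow> \<bar>q \<xi> w - q \<xi> y\<bar> \<le> \<epsilon>" "\<And>w. w \<in> cube y r \<Longrightarrow> u w > 0 \<and> w \<noteq> 0"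
    and "tube c y r \<subseteq> S" "q \<xi> y = q \<xi> z"
  shows "tube c y r \<subseteq> {x \<in> S. q \<xi> z - q \<xi> x \<le> \<epsilon>}"
proof
  fix x assume x: "x \<in> tube c y r"
  then obtain s w where s: "s \<ge> 1" "w \<in> cube y r" "x = s *\<^sub>R w" unfolding tube_def by auto
  have "q \<xi> x = q \<xi> w" using s assms(2)[OF s(2)] by (auto intro!: q_hom)
  then show "x \<in> {x \<in> S. q \<xi> z - q \<xi> x \<le> \<epsilon>}" using assms(1)[OF s(2)] assms(3,4) x by auto
qed

text \<open>On about \<open>1 / r\<close> disjoint tubes of radius \<open>r\<close> around maximum points the energy is on average
  \<open>O(r)\<close>, which keeps \<open>q \<xi>\<close> close to its maximum on at least half of them.\<close>

lemma packing_bound: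
  obtains r0 Q W where "r0 > 0" "Q > 0" "W > 0"
    "\<And>r. 0 < r \<Longrightarrow> r \<le> r0 \<Longrightarrow> Q * r powr (real CARD('n) - 2) \<le> W * r powr ((1 - (real CARD('n) - 2) / p) * (p / (real CARD('n) - 2)))"
proof -
  let ?n = "real CARD('n)"
  obtain R C1 where R: "R > 0" "C1 > 0" "0 \<notin> cube z R" and upos: "\<And>x. x \<in> cube z R \<Longrightarrow> u x > 0"
    and lev: "\<And>\<epsilon>. \<epsilon> > 0 \<Longrightarrow> measure lborel {x \<in> ball z R. q \<xi> z - q \<xi> x \<le> \<epsilon>} \<le> C1 * \<epsilon> powr (p / (?n - 2))"
    using level_estimate by blast
  obtain R2 where R2: "R2 > 0" "\<And>t. 0 < t \<Longrightarrow> t \<le> R2 \<Longrightarrow> \<exists>y. norm (y - z) = t \<and> u y = u z \<and> q \<xi> y = q \<xi> z"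
    using max_set_meets_spheres by blast
  obtain \<eta> where \<eta>: "\<eta> > 0" "\<And>x. x \<in> cube z R \<Longrightarrow> norm x \<ge> \<eta>"
    using separate_point_closed[OF compact_imp_closed[OF compact_cube] R(3)] by (auto simp: dist_norm)
  obtain \<Lambda>0 where \<Lambda>0: "\<Lambda>0 > 0" "\<And>x y \<rho> c. \<lbrakk>c > 0; \<rho> > 0; cube x \<rho> \<subseteq> cube z R; cube y \<rho> \<subseteq> cube z R; u x = u y; \<Lambda>0 * \<rho> < u x powr (-1/\<alpha>) * norm (x - y)\<rbrakk>
    \<Longrightarrow> tube c x \<rho> \<inter> tube c y \<rho> = {}"
    using tubes_disjoint[OF R(3) upos] by blast
  \<comment> \<open>The length of the tubes: dilation moves a point of \<open>cube z R\<close> by at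
    most R / 4, so the tubes stay in the ball.\<close>
  define c where "c = min 1 (R / (4 * (norm z + ?n * R)))"
  have nR: "norm z + ?n * R > 0" using R by (simp add: add_nonneg_pos)
  have c: "0 < c" "c \<le> 1" using nR R by (auto simp: c_def)
  have cR: "c * (norm z + ?n * R) \<le> R / 4"
  proof -
    have "c * (norm z + ?n * R) \<le> R / (4 * (norm z + ?n * R)) * (norm z + ?n * R)" using nR by (intro mult_right_mono) (auto simp: c_def)
    also have "\<dots> = R / 4" using nR by (metis divide_divide_eq_left' nonzero_eq_divide_eq less_irrefl mult.commute)
    finally show ?thesis .
  qed
  define \<kappa> where "\<kappa> = u z powr (-1/\<alpha>)"
  have \<kappa>: "\<kappa> > 0" using uz by (simp add: \<kappa>_def)
  \<comment> \<open>The spacing of the centres relative to r. The 4 accounts for tubes of radius 4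
    r, and the 1 makes the inequality required for disjointness strict.\<close>
  define \<Lambda> where "\<Lambda> = (4 * \<Lambda>0 + 1) / \<kappa>"
  have \<Lambda>: "\<Lambda> > 0" using \<Lambda>0 \<kappa> by (simp add: \<Lambda>_def)
  define R0 where "R0 = min R2 (R / 4)"
  have R0: "R0 > 0" "R0 \<le> R2" "R0 \<le> R / 4" using R R2 by (auto simp: R0_def)
  define E0 where "E0 = (\<integral>x. indicator (cube z R) x * Hsum x \<partial>lborel) + 1"
  have E0: "E0 > 0" unfolding E0_def by (intro add_nonneg_pos integral_nonneg_AE) (auto simp: Hsum_nonneg)
  \<comment> \<open>K r bounds twice the average of the total energy E0 over at least R0 / (2
    \<Lambda> r) tubes.\<close>
  define K where "K = 4 * E0 * \<Lambda> / R0"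
  have K: "K > 0" using E0 \<Lambda> R0 by (simp add: K_def)
  obtain C where C: "C > 0" "\<And>x y r. \<lbrakk>0 < r; r \<le> 1; cube x (4 * r) \<subseteq> cube z R; y \<in> cube x r;
    \<And>i j. (\<integral>\<^sup>+y. ennreal (\<bar>H i j y\<bar> powr p) * indicator (tube c x (4 * r)) y \<partial>lborel) \<le> ennreal (K * r)\<rbrakk> \<Longrightarrow>
    \<bar>q \<xi> y - q \<xi> x\<bar> \<le> C * r powr (1 - (?n - 2) / p)"
    using q_osc[OF R(3) upos \<eta> c K] by blast
  define \<theta> where "\<theta> = 1 - (?n - 2) / p"
  define b where "b = p / (?n - 2)"
  define A where "A = \<eta> * c / (5 * ?n)"
  have A: "A > 0" using \<eta> c by (simp add: A_def)
  \<comment> \<open>The three bounds serve \<open>q_osc\<close>, the existence of at least two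
    spacings within R0, and the confinement of cubes of half-width 4 r.\<close>
  define r0 where "r0 = min 1 (min (R0 / (2 * \<Lambda>)) (R / (16 * ?n)))"
  have r0: "r0 > 0" using R R0 \<Lambda> by (simp add: r0_def)
  show thesis
  proof (rule that[OF r0, of "R0 / (4 * \<Lambda>) * A" "C1 * C powr b"])
    show "0 < R0 / (4 * \<Lambda>) * A" using R0 \<Lambda> A by simp
    show "0 < C1 * C powr b" using R C by simp
    fix r assume r: "0 < r" "r \<le> r0"
    have r1: "r \<le> 1" using r by (simp add: r0_def)
    have "r \<le> R / (16 * ?n)" using r by (simp add: r0_def)
    then have rR: "4 * (?n * r) \<le> R / 4" by (simp add: field_simps)
    define D where "D = \<Lambda> * r"
    have D: "D > 0" using \<Lambda> r by (simp add: D_def)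
    define N where "N = nat \<lfloor>R0 / D\<rfloor>"
    have N: "real N * D \<le> R0" "R0 / (2 * D) \<le> real N" "N > 0"
    proof -
      have "r \<le> R0 / (2 * \<Lambda>)" using r by (simp add: r0_def)
      then have q2: "R0 / D \<ge> 2" using \<Lambda> D r by (simp add: D_def field_simps)
      have "real N \<le> R0 / D" using q2 by (simp add: N_def)
      then show "real N * D \<le> R0" using D by (simp add: field_simps)
      have "real N > R0 / D - 1" using q2 unfolding N_def by linarith
      moreover have "t / 2 \<le> m" if "t - 1 < m" "2 \<le> t" for t m :: real using that by simp
      ultimately have h: "R0 / D / 2 \<le> real N" using q2 by blast
      then show "R0 / (2 * D) \<le> real N" by (simp add: mult.commute)
      show "N > 0" using h q2 by (cases N) auto
    qed
    \<comment> \<open>Maximum points on the level set of u at the distances D, 2 D, ..., N D from z;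
      distinct distances separate them by at least D.\<close>
    have "\<forall>i\<in>{1..N}. \<exists>y. norm (y - z) = real i * D \<and> u y = u z \<and> q \<xi> y = q \<xi> z"
    proof
      fix i assume i: "i \<in> {1..N}"
      have "real i * D \<le> real N * D" using i D by (intro mult_right_mono) auto
      then have "real i * D \<le> R2" using N R0 by linarith
      moreover have "0 < real i * D" using i D by simp
      ultimately show "\<exists>y. norm (y - z) = real i * D \<and> u y = u z \<and> q \<xi> y = q \<xi> z" using R2(2) by blast
    qed
    from bchoice[OF this] obtain y where y: "\<And>i. i \<in> {1..N} \<Longrightarrow> norm (y i - z) = real i * D \<and> u (y i) = u z \<and> q \<xi> (y i) = q \<xi> z"
      by blast
    have near: "norm (w - z) \<le> R / 2" if i: "i \<in> {1..N}" and w: "w \<in> cube (y i) (4 * r)" for i w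
    proof -
      have "real i * D \<le> real N * D" using i D by (intro mult_right_mono) auto
      then have "norm (y i - z) \<le> R / 4" using y[OF i] N(1) R0(3) by linarith
      moreover have "norm (w - y i) \<le> R / 4" using cube_norm_le[OF w] rR by (simp add: mult_ac)
      ultimately show ?thesis using norm_triangle_ineq[of "w - y i" "y i - z"] by simp
    qed
    have cu: "cube (y i) (4 * r) \<subseteq> cube z R" if i: "i \<in> {1..N}" for i
    proof
      fix w assume "w \<in> cube (y i) (4 * r)"
      from near[OF i this] show "w \<in> cube z R" using R by (intro ball_subset_cube) simp
    qed
    have cu1: "cube (y i) r \<subseteq> cube z R" if i: "i \<in> {1..N}" for i
      using cu[OF i] cube_mono[of r "4 * r" "y i"] r by auto
    define T where "T i = tube c (y i) (4 * r)" for i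
    have TR: "T i \<subseteq> ball z R" if i: "i \<in> {1..N}" for i
    proof
      fix x assume "x \<in> T i"
      then obtain s w where s: "1 \<le> s" "s \<le> 1 + c" "w \<in> cube (y i) (4 * r)" "x = s *\<^sub>R w" unfolding T_def tube_def by auto
      have "w \<in> cube z R" using s cu[OF i] by auto
      then have nw: "norm w \<le> norm z + ?n * R" using cube_norm_le[of w z R] norm_triangle_ineq[of z "w - z"] by simp
      have e: "x - z = (s - 1) *\<^sub>R w + (w - z)" using s by (simp add: algebra_simps)
      have "norm (x - z) \<le> (s - 1) * norm w + norm (w - z)"
        unfolding e using norm_triangle_ineq[of "(s - 1) *\<^sub>R w" "w - z"] s(1) by simp
      also have "\<dots> \<le> c * (norm z + ?n * R) + R / 2"
        using s nw near[OF i s(3)] c by (intro add_mono mult_mono) auto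
      also have "\<dots> < R" using cR R by linarith
      finally show "x \<in> ball z R" by (simp add: dist_norm norm_minus_commute)
    qed
    have bc: "ball z R \<subseteq> cube z R" by (auto simp: dist_norm norm_minus_commute intro!: ball_subset_cube)
    have disj: "T i \<inter> T l = {}" if i: "i \<in> {1..N}" and l: "l \<in> {1..N}" and "i \<noteq> l" for i l
      unfolding T_def
    proof (rule \<Lambda>0(2)[OF c(1) _ cu[OF i] cu[OF l]])
      show "0 < 4 * r" "u (y i) = u (y l)" using r y i l by auto
      have "1 * D \<le> \<bar>real i - real l\<bar> * D" using \<open>i \<noteq> l\<close> D by (intro mult_right_mono) auto
      also have "\<dots> = \<bar>norm (y i - z) - norm (y l - z)\<bar>"
        using y[OF i] y[OF l] D by (simp add: left_diff_distrib[symmetric] abs_mult)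
      also have "\<dots> \<le> norm (y i - y l)" using norm_triangle_ineq3[of "y i - z" "y l - z"] by simp
      finally have "\<kappa> * D \<le> \<kappa> * norm (y i - y l)" using \<kappa> by simp
      moreover have "\<kappa> * D = (4 * \<Lambda>0 + 1) * r" using \<kappa> by (simp add: D_def \<Lambda>_def)
      ultimately show "\<Lambda>0 * (4 * r) < u (y i) powr (-1/\<alpha>) * norm (y i - y l)"
        using y[OF i] r by (simp add: \<kappa>_def algebra_simps)
    qed
    define E where "E i = (\<integral>x. indicator (T i) x * Hsum x \<partial>lborel)" for i
    have cT: "compact (T i)" for i unfolding T_def by (rule compact_tube)
    have "sum E {1..N} \<le> (\<integral>x. indicator (cube z R) x * Hsum x \<partial>lborel)"
      unfolding E_def using TR bc disj cT R by (intro tube_energy_sum_le) (auto simp: disjoint_family_on_def)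
    then have sE: "sum E {1..N} \<le> E0" by (simp add: E0_def)
    have Enn: "E i \<ge> 0" for i unfolding E_def by (intro integral_nonneg_AE) (auto simp: Hsum_nonneg)
    \<comment> \<open>The good tubes. The energies are measured at radius 4 r, as the oscillation
      estimate demands; the volumes below are those of the inner tubes of radius r.\<close>
    define G where "G = {i \<in> {1..N}. E i \<le> 2 * E0 / card {1..N}}"
    have G: "finite G" "G \<subseteq> {1..N}" by (auto simp: G_def)
    have cardG: "real N / 2 \<le> card G"
      using card_le_twice_average[OF _ _ Enn sE E0] N(3) unfolding G_def by simp
    have EG: "E i \<le> K * r" if "i \<in> G" for i
    proof -
      have "E i \<le> 2 * E0 / N" using that by (simp add: G_def)
      also have "\<dots> \<le> 2 * E0 / (R0 / (2 * D))" using N E0 R0 D by (intro divide_left_mono) auto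
      also have "\<dots> = K * r" by (simp add: K_def D_def)
      finally show ?thesis .
    qed
    define S where "S = {x \<in> ball z R. q \<xi> z - q \<xi> x \<le> C * r powr \<theta>}"
    have Sm [measurable]: "S \<in> sets borel" unfolding S_def by measurable
    have subS: "tube c (y i) r \<subseteq> S" if "i \<in> G" for i
    proof -
      have i: "i \<in> {1..N}" using that G by auto
      have en: "(\<integral>\<^sup>+x. ennreal (\<bar>H k l x\<bar> powr p) * indicator (tube c (y i) (4 * r)) x \<partial>lborel) \<le> ennreal (K * r)" for k l
      proof -
        have int: "integrable lborel (\<lambda>x. indicator (T i) x * Hsum x)"
          using cT TR[OF i] bc R by (intro Hsum_integrable) auto
        have "(\<integral>\<^sup>+x. ennreal (\<bar>H k l x\<bar> powr p) * indicator (tube c (y i) (4 * r)) x \<partial>lborel) \<le> (\<integral>\<^sup>+x. ennreal (Hsum x) * indicator (T i) x \<partial>lborel)"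
          unfolding T_def by (rule powr_measure_le)
        also have "\<dots> = (\<integral>\<^sup>+x. ennreal (indicator (T i) x * Hsum x) \<partial>lborel)"
          by (rule nn_integral_cong) (auto simp: indicator_def)
        also have "\<dots> = ennreal (E i)"
          unfolding E_def by (rule nn_integral_eq_integral[OF int]) (auto simp: Hsum_nonneg)
        also have "\<dots> \<le> ennreal (K * r)" using EG[OF that] by (rule ennreal_leI)
        finally show ?thesis .
      qed
      show ?thesis unfolding S_def
      proof (rule tube_in_level_set)
        show "\<bar>q \<xi> w - q \<xi> (y i)\<bar> \<le> C * r powr \<theta>" if "w \<in> cube (y i) r" for w
          unfolding \<theta>_def using C(2)[OF r(1) r1 cu[OF i] that en] .
        show "u w > 0 \<and> w \<noteq> 0" if "w \<in> cube (y i) r" for w using cu1[OF i] that upos R(3) by auto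
        have "tube c (y i) r \<subseteq> T i" unfolding T_def using r by (intro tube_mono cube_mono) simp
        then show "tube c (y i) r \<subseteq> ball z R" using TR[OF i] by auto
        show "q \<xi> (y i) = q \<xi> z" using y[OF i] by simp
      qed
    qed
    have Sfin: "emeasure lborel S < \<infinity>"
    proof -
      have "emeasure lborel S \<le> emeasure lborel (cube z R)" using bc by (intro emeasure_mono) (auto simp: S_def)
      then show ?thesis using R by (simp add: emeasure_cube order_le_less_trans)
    qed
    have tsub: "tube c (y i) r \<subseteq> T i" for i unfolding T_def using r by (intro tube_mono cube_mono) simp
    \<comment> \<open>Volume count: at least N / 2 disjoint inner tubes, each of measure at least A
      r^(n - 1), lie in the nearly maximal set \<open>S\<close>. Since N is of order 1 / r, the
      total has order r^(n - 2).\<close>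
    have "R0 / (2 * D) / 2 * (A * r ^ (CARD('n) - 1)) \<le> card G * (A * r ^ (CARD('n) - 1))"
      using cardG N(2) A r by (intro mult_right_mono) auto
    also have "\<dots> \<le> (\<Sum>i\<in>G. measure lborel (tube c (y i) r))"
    proof -
      have "A * r ^ (CARD('n) - 1) \<le> measure lborel (tube c (y i) r)" if "i \<in> G" for i
        unfolding A_def using that G cu1 \<eta> r c by (intro tube_measure_ge) blast+
      then show ?thesis using sum_bounded_below[of G "A * r ^ (CARD('n) - 1)"] by simp
    qed
    also have "\<dots> = measure lborel (\<Union>i\<in>G. tube c (y i) r)"
    proof (rule measure_finite_Union[symmetric, OF G(1)])
      show "(\<lambda>i. tube c (y i) r) ` G \<subseteq> sets lborel" by auto
      show "disjoint_family_on (\<lambda>i. tube c (y i) r) G"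
        unfolding disjoint_family_on_def using disj tsub G(2) by blast
      show "emeasure lborel (tube c (y i) r) \<noteq> \<infinity>" for i using emeasure_compact_finite[OF compact_tube, of c "y i" r] by simp
    qed
    also have "\<dots> \<le> measure lborel S"
      using subS Sfin G(1) by (intro measure_mono_fmeasurable) (auto simp: fmeasurable_def intro!: sets.finite_UN)
    also have "\<dots> \<le> C1 * (C * r powr \<theta>) powr b"
      unfolding S_def b_def using C r by (intro lev) simp
    also have "\<dots> = C1 * C powr b * r powr (\<theta> * b)" using C r by (simp add: powr_mult powr_powr)
    finally have fin: "R0 / (2 * D) / 2 * (A * r ^ (CARD('n) - 1)) \<le> C1 * C powr b * r powr (\<theta> * b)" .
    have "r ^ (CARD('n) - 1) = r * r powr (?n - 2)"
    proof -
      have e: "CARD('n) - 1 = Suc (CARD('n) - 2)" using n2 by simp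
      show ?thesis unfolding e using r n2 by (simp add: powr_realpow[symmetric] of_nat_diff)
    qed
    then have "R0 / (2 * D) / 2 * (A * r ^ (CARD('n) - 1)) = R0 / (4 * \<Lambda>) * A * r powr (?n - 2)"
      using r by (simp add: D_def)
    then show "R0 / (4 * \<Lambda>) * A * r powr (?n - 2) \<le> C1 * C powr b * r powr ((1 - (?n - 2) / p) * (p / (?n - 2)))"
      using fin by (simp add: \<theta>_def b_def)
  qed
qed

text \<open>The exponent on the right of \<open>packing_bound\<close> exceeds n - 2 by p / (n - 2) -
  (n - 1). This is positive precisely for p > (n - 1) (n - 2), and then the inequality fails for
  small r.\<close>

lemma no_transversal_max: False
proof -
  let ?n = "real CARD('n)"
  obtain r0 Q W where *: "r0 > 0" "Q > 0" "W > 0"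
    and le: "\<And>r. 0 < r \<Longrightarrow> r \<le> r0 \<Longrightarrow> Q * r powr (?n - 2) \<le> W * r powr ((1 - (?n - 2) / p) * (p / (?n - 2)))"
    using packing_bound by blast
  define \<delta> where "\<delta> = (1 - (?n - 2) / p) * (p / (?n - 2)) - (?n - 2)"
  have n: "?n - 2 > 0" using dim_ge_3 by simp
  have "\<delta> = p / (?n - 2) - (?n - 1)" using n p1 by (simp add: \<delta>_def field_simps)
  moreover have "p / (?n - 2) > ?n - 1" using pn n by (simp add: pos_less_divide_eq)
  ultimately have \<delta>: "\<delta> > 0" by simp
  \<comment> \<open>At this radius W * r powr \<delta> has dropped to at most Q / 2.\<close>
  define r where "r = min r0 ((Q / (2 * W)) powr (1 / \<delta>))"
  have r: "0 < r" "r \<le> r0" using * by (auto simp: r_def)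
  have "r powr \<delta> \<le> ((Q / (2 * W)) powr (1 / \<delta>)) powr \<delta>" using r \<delta> by (intro powr_mono2) (auto simp: r_def)
  also have "\<dots> = Q / (2 * W)" using \<delta> * by (simp add: powr_powr)
  finally have "W * r powr \<delta> \<le> Q / 2" using * by (simp add: field_simps)
  then have "W * r powr \<delta> * r powr (?n - 2) \<le> Q / 2 * r powr (?n - 2)" by (intro mult_right_mono) auto
  moreover have "W * r powr \<delta> * r powr (?n - 2) = W * r powr ((1 - (?n - 2) / p) * (p / (?n - 2)))"
    by (simp add: \<delta>_def powr_add[symmetric] mult.assoc)
  moreover have "Q / 2 * r powr (?n - 2) < Q * r powr (?n - 2)" using * r by simp
  ultimately show False using le[OF r] by linarith
qed

end

context hessian_setup
begin

lemma max_imp_parallel: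
  assumes "u z > 0" and "\<And>x. u x > 0 \<Longrightarrow> q \<xi> x \<le> q \<xi> z"
  shows "\<xi> $ j * z $ k = \<xi> $ k * z $ j"
proof (rule ccontr)
  assume t: "\<not> ?thesis"
  then have "j \<noteq> k" by auto
  then interpret hessian_max u H \<alpha> p \<sigma> \<xi> z j k using assms t by unfold_locales auto
  show False by (rule no_transversal_max)
qed

end

subsection \<open>Absence of sign changes\<close>

context hessian_setup
begin

text \<open>On the line through \<xi> Euler's relation evaluates the derivative. If z points along
  \<xi>, equality holds by homogeneity; otherwise the left side is nonpositive.\<close>

lemma parallel_max_value:
  assumes z: "u z > 0" and par: "\<And>j k. \<xi> $ j * z $ k = \<xi> $ k * z $ j"
  shows "q \<xi> z \<le> \<alpha> * max 0 (u \<xi>) powr (1 / \<alpha>)"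
proof -
  have z0: "z \<noteq> 0" using z u_zero by auto
  then obtain k where k: "z $ k \<noteq> 0" by (auto simp: vec_eq_iff)
  define \<mu> where "\<mu> = \<xi> $ k / z $ k"
  have \<xi>: "\<xi> = \<mu> *\<^sub>R z" using par[of _ k] k by (simp add: vec_eq_iff \<mu>_def field_simps)
  have "q \<xi> z = \<mu> * (u z powr \<beta> * (\<alpha> * u z))" using euler_u[OF z0] by (simp add: q_def \<xi>)
  also have "u z powr \<beta> * (\<alpha> * u z) = \<alpha> * u z powr (1 / \<alpha>)"
  proof -
    have "u z powr (1 / \<alpha>) = u z powr \<beta> * u z powr 1" by (simp only: \<beta>_def powr_add[symmetric]) simp
    then show ?thesis using z by simp
  qed
  finally have q: "q \<xi> z = \<mu> * (\<alpha> * u z powr (1 / \<alpha>))" .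
  show ?thesis
  proof (cases "\<mu> > 0")
    case True
    then have "max 0 (u \<xi>) powr (1 / \<alpha>) = \<mu> * u z powr (1 / \<alpha>)"
      using z \<alpha> by (simp add: \<xi> hom powr_mult powr_powr)
    then show ?thesis by (simp add: q)
  next
    case False
    then have "q \<xi> z \<le> 0" unfolding q using \<alpha> by (intro mult_nonpos_nonneg) auto
    also have "0 \<le> \<alpha> * max 0 (u \<xi>) powr (1 / \<alpha>)" using \<alpha> by simp
    finally show ?thesis .
  qed
qed

text \<open>The left-hand side is \<open>\<alpha>\<close> times the slope of \<open>max 0 u powr (1 / \<alpha>)\<close> in direction \<open>\<xi>\<close>.\<close>

lemma slope_bound:
  assumes "u x > 0"
  shows "q \<xi> x \<le> \<alpha> * max 0 (u \<xi>) powr (1 / \<alpha>)"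
proof -
  have x0: "x \<noteq> 0" using assms u_zero by auto
  \<comment> \<open>The extension of \<open>q \<xi>\<close> by 0 across the zero set is continuous
    because \<beta> > 0. A maximum over the whole sphere thus exists, and it is either 0 or attained
    where u > 0.\<close>
  define g where "g x = max 0 (u x) powr \<beta> * (\<xi> \<bullet> Du x)" for x
  have "continuous_on (sphere 0 1) g"
    unfolding g_def using \<beta>
    by (intro continuous_intros continuous_on_powr' continuous_on_subset[OF cont] continuous_on_subset[OF continuous_Du]) auto
  moreover have "sgn x \<in> sphere 0 1" using x0 by (simp add: norm_sgn)
  ultimately obtain z where z: "z \<in> sphere 0 1" "\<And>y. y \<in> sphere 0 1 \<Longrightarrow> g y \<le> g z"
    using continuous_attains_sup[OF compact_sphere, of 0 1 g] by blast
  have gq: "g y = q \<xi> y" if "u y > 0" for y using that by (simp add: g_def q_def)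
  have le: "q \<xi> y \<le> g z" if y: "u y > 0" for y
  proof -
    have y0: "y \<noteq> 0" using y u_zero by auto
    have s: "sgn y = inverse (norm y) *\<^sub>R y" by (simp add: sgn_div_norm)
    have "q \<xi> y = q \<xi> (sgn y)" unfolding s using y y0 by (intro q_hom[symmetric]) auto
    also have "\<dots> = g (sgn y)" unfolding s using y y0 by (intro gq[symmetric]) (simp add: hom)
    also have "\<dots> \<le> g z" using y0 by (intro z) (simp add: norm_sgn)
    finally show ?thesis .
  qed
  have "g z \<le> \<alpha> * max 0 (u \<xi>) powr (1 / \<alpha>)"
  proof (cases "u z > 0")
    case True
    have "q \<xi> z \<le> \<alpha> * max 0 (u \<xi>) powr (1 / \<alpha>)"
      using le gq[OF True] by (intro parallel_max_value max_imp_parallel True) auto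
    then show ?thesis by (simp add: gq[OF True])
  next
    case False
    then show ?thesis using \<alpha> by (simp add: g_def max_def)
  qed
  then show ?thesis using le[OF assms] by simp
qed

lemma inner_Du_nonpos:
  assumes "u x > 0" "u \<xi> \<le> 0" shows "\<xi> \<bullet> Du x \<le> 0"
proof -
  have "q \<xi> x \<le> 0" using slope_bound[OF assms(1), of \<xi>] assms(2) by (simp add: max_absorb1)
  then show ?thesis using assms(1) by (simp add: q_def mult_le_0_iff)
qed

lemma inner_Du_pos: "u x > 0 \<Longrightarrow> x \<bullet> Du x > 0"
  using euler_u[of x] u_zero \<alpha> by (cases "x = 0") auto

text \<open>Negation multiplies the Hessian determinant by (-1)^n. A free sign factor \<sigma> lets
  both signs of u be treated in the same locale.\<close>

lemma hessian_setup_uminus: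
  "hessian_setup (\<lambda>x. - u x) (\<lambda>i j x. - H i j x) \<alpha> p (\<sigma> * (-1) ^ CARD('n))"
proof
  have d: "det (\<chi> i j. - H i j x) = (-1) ^ CARD('n) * det (\<chi> i j. H i j x)" for x
  proof -
    have "(\<chi> i j. - H i j x) = (\<chi> i. (-1) *s (\<chi> j. H i j x))" by (simp add: vec_eq_iff)
    then show ?thesis using det_rows_mul[of "\<lambda>_. -1" "\<lambda>i. \<chi> j. H i j x"] by simp
  qed
  show "\<exists>c>0. AE x in lborel. x \<in> C \<longrightarrow> c \<le> \<sigma> * (-1) ^ CARD('n) * det (\<chi> i j. - H i j x)"
    if "compact C" "0 \<notin> C" for C
    using pos[OF that] unfolding d by (simp add: mult.assoc power_mult_distrib[symmetric] flip: mult.assoc[of "(-1) ^ _"])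
qed (use n2 \<alpha> hom cont p1 pn Hp weak in \<open>auto intro!: continuous_intros\<close>)

end

text \<open>The sum of the two unit vectors has inner products with \<open>v\<close> and
  \<open>w\<close> of one and the same sign, that of 1 + sgn v \<bullet> sgn w. If this is not
  positive, the sum has norm 0.\<close>

lemma opposite_if_no_common_positive:
  fixes v w :: "'a :: real_inner"
  assumes "v \<noteq> 0" "w \<noteq> 0" "\<And>\<xi>. \<xi> \<bullet> v \<le> 0 \<or> \<xi> \<bullet> w \<le> 0"
  shows "sgn v = - sgn w"
proof -
  define \<xi> where "\<xi> = sgn v + sgn w"
  have v: "v = norm v *\<^sub>R sgn v" and w: "w = norm w *\<^sub>R sgn w" using assms by (simp_all add: sgn_div_norm)
  have 1: "sgn v \<bullet> sgn v = 1" "sgn w \<bullet> sgn w = 1" using assms by (simp_all add: norm_sgn flip: power2_norm_eq_inner)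
  have "\<xi> \<bullet> v = norm v * (1 + sgn v \<bullet> sgn w)" by (subst v) (simp add: \<xi>_def inner_add_left 1 inner_commute[of "sgn w"])
  moreover have "\<xi> \<bullet> w = norm w * (1 + sgn v \<bullet> sgn w)" by (subst w) (simp add: \<xi>_def inner_add_left 1)
  ultimately have "1 + sgn v \<bullet> sgn w \<le> 0"
    using assms(3)[of \<xi>] assms(1,2) by (auto simp: mult_le_0_iff)
  then have "\<xi> \<bullet> \<xi> \<le> 0" by (simp add: \<xi>_def inner_add_left inner_add_right 1 inner_commute)
  then have "\<xi> = 0" using inner_ge_zero[of \<xi>] by simp
  then show ?thesis by (simp add: \<xi>_def eq_neg_iff_add_eq_0)
qed

lemma exists_nonzero_orthogonal:
  fixes e :: "real^'n"
  assumes "CARD('n) \<ge> 2"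
  obtains y where "y \<noteq> 0" "e \<bullet> y = 0"
proof -
  obtain j k :: 'n where jk: "j \<noteq> k" using assms
    using assms card_le_Suc0_iff_eq[of "UNIV :: 'n set"] by fastforce
  show thesis
  proof (cases "e $ k = 0")
    case True
    then show ?thesis by (intro that[of "axis k 1"]) (auto simp: inner_axis)
  next
    case False
    have "(e $ k *\<^sub>R axis j 1 - e $ j *\<^sub>R axis k 1 :: real^'n) $ j = e $ k" using jk by (simp add: axis_def)
    then have "e $ k *\<^sub>R axis j 1 - e $ j *\<^sub>R axis k 1 \<noteq> (0 :: real^'n)" using False by (metis zero_index)
    then show ?thesis by (rule that) (simp add: inner_diff_right inner_axis)
  qed
qed

context hessian_setup
begin

text \<open>Letting t tend to 0 gives u y = 0. From a zero at which it is differentiable a function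
  grows at most linearly, whereas t powr \<alpha> with \<alpha> < 1 outgrows every linear function
  near 0.\<close>

lemma not_linear_growth:
  assumes y: "y \<noteq> 0" and a: "a > 0" and eq: "\<And>t. t > 0 \<Longrightarrow> u (y + t *\<^sub>R e) = t powr \<alpha> * a"
  shows False
proof -
  have y0: "u y = 0"
  proof -
    have 1: "((\<lambda>t. u (y + t *\<^sub>R e)) \<longlongrightarrow> u (y + 0 *\<^sub>R e)) (at_right 0)"
      using cont by (intro isCont_tendsto_compose[of _ u] tendsto_intros) (auto simp: continuous_on_eq_continuous_at)
    have 2: "((\<lambda>t. t powr \<alpha> * a) \<longlongrightarrow> 0 powr \<alpha> * a) (at_right 0)"
      using \<alpha> by (intro tendsto_intros tendsto_powr') (auto simp: eventually_at_right_field intro: exI[of _ 1])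
    have "\<forall>\<^sub>F t in at_right 0. t powr \<alpha> * a = u (y + t *\<^sub>R e)"
      using eq by (auto simp: eventually_at_right_field intro: exI[of _ 1])
    from tendsto_unique[OF _ Lim_transform_eventually[OF 2 this] 1] show ?thesis by simp
  qed
  obtain d where d: "d > 0" "\<And>w. norm (w - y) < d \<Longrightarrow> norm (u w - u y - Du y \<bullet> (w - y)) \<le> 1 * norm (w - y)"
    using has_derivative_u[OF y] unfolding has_derivative_at_alt by (metis zero_less_one)
  define B where "B = norm (Du y) * norm e + norm e + 1"
  have B: "B > 0" by (simp add: B_def add_nonneg_pos)
  \<comment> \<open>The first entry stays within the range of the linear approximation; the second
    makes t powr (\<alpha> - 1) at least B / a.\<close>
  define t where "t = min (d / (2 * (norm e + 1))) ((B / a) powr (1 / (\<alpha> - 1)))"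
  have t: "t > 0" using d a B by (simp add: t_def add_nonneg_pos)
  have te: "t * norm e < d"
  proof -
    have "t * norm e \<le> d / (2 * (norm e + 1)) * (norm e + 1)" using t by (intro mult_mono) (auto simp: t_def)
    also have "\<dots> = d / 2"
    proof -
      have "norm e + 1 \<noteq> 0" using norm_ge_zero[of e] by linarith
      then show ?thesis by (simp add: divide_simps)
    qed
    finally show ?thesis using d by simp
  qed
  have "t powr \<alpha> * a = u (y + t *\<^sub>R e)" using eq[OF t] by simp
  also have "\<dots> \<le> \<bar>Du y \<bullet> (t *\<^sub>R e)\<bar> + norm (t *\<^sub>R e)" using d(2)[of "y + t *\<^sub>R e"] te t y0 by auto
  also have "\<dots> \<le> norm (Du y) * norm (t *\<^sub>R e) + norm (t *\<^sub>R e)" using Cauchy_Schwarz_ineq2[of "Du y" "t *\<^sub>R e"] by simp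
  also have "\<dots> < t * B" using t by (simp add: B_def algebra_simps)
  finally have "t powr \<alpha> * a < t * B" .
  then have "t powr (\<alpha> - 1) < B / a" using t a by (simp add: powr_diff field_simps)
  moreover have "B / a = ((B / a) powr (1 / (\<alpha> - 1))) powr (\<alpha> - 1)" using \<alpha> B a by (simp add: powr_powr)
  moreover have "\<dots> \<le> t powr (\<alpha> - 1)" using t \<alpha> by (intro powr_mono2') (auto simp: t_def)
  ultimately show False by simp
qed

lemma no_sign_change: "(\<forall>x. u x \<ge> 0) \<or> (\<forall>x. u x \<le> 0)"
proof (rule ccontr)
  assume "\<not> ?thesis"
  then obtain x1 x2 where x1: "u x1 > 0" and x2: "u x2 < 0" by (auto simp: not_le)
  interpret neg: hessian_setup "\<lambda>x. - u x" "\<lambda>i j x. - H i j x" \<alpha> p "\<sigma> * (-1) ^ CARD('n)"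
    by (rule hessian_setup_uminus)
  \<comment> \<open>The gradient of - u at a single negative point fixes the normal direction for
    all positive points.\<close>
  define w where "w = neg.Du x2"
  have w0: "w \<noteq> 0" using neg.inner_Du_pos[of x2] x2 by (auto simp: w_def)
  have wneg: "\<xi> \<bullet> w \<le> 0" if "u \<xi> \<ge> 0" for \<xi> unfolding w_def using neg.inner_Du_nonpos[of x2 \<xi>] x2 that by simp
  define e where "e = - sgn w"
  have e1: "norm e = 1" using w0 by (simp add: e_def norm_sgn)
  \<comment> \<open>Every \<xi> has u \<xi> \<ge> 0 or u \<xi> \<le> 0, so it cannot have positive
    inner product with both \<open>w\<close> and \<open>Du x\<close>. The two are therefore
    opposite.\<close>
  have dir: "Du x = norm (Du x) *\<^sub>R e" if "u x > 0" for x
  proof -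
    have nz: "Du x \<noteq> 0" using inner_Du_pos[OF that] by auto
    have "sgn (Du x) = - sgn w"
      using wneg inner_Du_nonpos[OF that] by (intro opposite_if_no_common_positive nz w0) (metis linear)
    moreover have "Du x = norm (Du x) *\<^sub>R sgn (Du x)" using nz by (simp add: sgn_div_norm)
    ultimately show ?thesis by (simp add: e_def)
  qed
  have upos: "u \<xi> > 0" if "e \<bullet> \<xi> > 0" for \<xi>
  proof (rule ccontr)
    assume "\<not> u \<xi> > 0"
    then have "\<xi> \<bullet> Du x1 \<le> 0" by (intro inner_Du_nonpos x1) simp
    then have "norm (Du x1) * (\<xi> \<bullet> e) \<le> 0" by (subst (asm) dir[OF x1]) simp
    moreover have "norm (Du x1) > 0" using inner_Du_pos[OF x1] by auto
    ultimately show False using that by (simp add: mult_le_0_iff inner_commute)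
  qed
  \<comment> \<open>A nonzero direction in the boundary hyperplane, along which u is constant inside
    the half-space; its existence uses n \<ge> 2.\<close>
  obtain y where y: "y \<noteq> 0" "e \<bullet> y = 0" using exists_nonzero_orthogonal[OF n2] by blast
  show False
  proof (rule not_linear_growth[OF y(1)])
    have ee: "e \<bullet> e = 1" using e1 by (simp flip: power2_norm_eq_inner)
    show "u e > 0" using upos[of e] ee by simp
    fix t :: real assume t: "t > 0"
    have "DERIV (\<lambda>s. u (t *\<^sub>R e + s *\<^sub>R y)) s :> 0" for s
    proof -
      let ?w = "t *\<^sub>R e + s *\<^sub>R y"
      have "e \<bullet> ?w > 0" using t y ee by (simp add: inner_add_right)
      then have w: "u ?w > 0" by (rule upos)
      then have w0: "?w \<noteq> 0" using u_zero by auto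
      have "((\<lambda>s. t *\<^sub>R e + s *\<^sub>R y) has_derivative (\<lambda>h. h *\<^sub>R y)) (at s)" by (auto intro!: derivative_eq_intros)
      from has_derivative_compose[OF this has_derivative_u[OF w0]]
      have "((\<lambda>s. u (t *\<^sub>R e + s *\<^sub>R y)) has_derivative (\<lambda>h. Du ?w \<bullet> (h *\<^sub>R y))) (at s)" .
      moreover have "Du ?w \<bullet> y = 0" by (subst dir[OF w]) (simp add: y)
      ultimately show ?thesis by (simp add: has_field_derivative_def lambda_zero)
    qed
    then have "u (t *\<^sub>R e + 1 *\<^sub>R y) = u (t *\<^sub>R e + 0 *\<^sub>R y)" by (rule DERIV_isconst_all[rule_format])
    then show "u (y + t *\<^sub>R e) = t powr \<alpha> * u e" using t by (simp add: add.commute hom)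
  qed
qed

end

section \<open>From weak derivatives to Borel representatives\<close>

lemma smooth_measurable: "smooth (\<phi> :: real^'n \<Rightarrow> real) \<Longrightarrow> partial_derivs js \<phi> \<in> borel_measurable borel"
  by (intro borel_measurable_continuous_onI differentiable_imp_continuous_on)
    (simp add: differentiable_on_def differentiable_at_withinI smooth_differentiable)

text \<open>The fundamental lemma of the calculus of variations. With reflected mollifiers as test
  functions all small-scale mollifications vanish, and L^1 convergence gives 0 on every cube that
  keeps a margin from the origin.\<close>

lemma weak_zero_imp_AE_zero:
  fixes D :: "real^'n \<Rightarrow> real"
  assumes Dm [measurable]: "D \<in> borel_measurable borel"
    and Di: "\<And>C. compact C \<Longrightarrow> 0 \<notin> C \<Longrightarrow> set_integrable lborel C D"
    and D0: "\<And>\<phi>. test_function_on (UNIV - {0}) \<phi> \<Longrightarrow> (\<integral>x. D x * \<phi> x \<partial>lborel) = 0"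
  shows "AE x in lborel. D x = 0"
proof -
  have loc: "AE x in lborel. x \<in> cube z r \<longrightarrow> D x = 0" if r: "r > 0" "0 \<notin> cube z (r + r)" for z r
  proof -
    have "AE x in lborel. ennreal (\<bar>D x\<bar> powr 1) * indicator (cube z r) x = 0"
    proof (rule nn_integral_le_all_imp_AE_0)
      fix \<eta> :: real assume \<eta>: "\<eta> > 0"
      have "set_integrable lborel (cube z (r + r)) (\<lambda>x. \<bar>D x\<bar> powr 1)"
        using set_integrable_abs[OF Di[OF compact_cube r(2)]] by simp
      then obtain e0 where e0: "e0 > 0" "e0 \<le> r" "\<And>\<epsilon>. \<lbrakk>0 < \<epsilon>; \<epsilon> < e0\<rbrakk> \<Longrightarrow>
        (\<integral>\<^sup>+x. ennreal (\<bar>conv D (mollifier \<epsilon>) x - D x\<bar> powr 1) * indicator (cube z r) x \<partial>lborel) \<le> ennreal \<eta>"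
        using conv_Lp_convergence[OF Dm order.refl less_imp_le[OF r(1)] r(1) _ \<eta>] by blast
      define \<epsilon> where "\<epsilon> = e0 / 2"
      have e: "0 < \<epsilon>" "\<epsilon> < e0" using e0 by (auto simp: \<epsilon>_def)
      have "conv D (mollifier \<epsilon>) x = 0" if x: "x \<in> cube z r" for x
      proof -
        have "cube x \<epsilon> \<subseteq> cube z (r + r)" using e e0 by (intro cube_subset_cube[OF x]) auto
        then have "0 \<notin> cube x \<epsilon>" using r by auto
        from D0[OF test_function_mollifier[OF e(1) this]] show ?thesis by (simp add: conv_def)
      qed
      then have "(\<integral>\<^sup>+x. ennreal (\<bar>D x\<bar> powr 1) * indicator (cube z r) x \<partial>lborel) =
        (\<integral>\<^sup>+x. ennreal (\<bar>conv D (mollifier \<epsilon>) x - D x\<bar> powr 1) * indicator (cube z r) x \<partial>lborel)"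
        by (intro nn_integral_cong) (auto simp: indicator_def)
      then show "(\<integral>\<^sup>+x. ennreal (\<bar>D x\<bar> powr 1) * indicator (cube z r) x \<partial>lborel) \<le> ennreal \<eta>" using e0(3)[OF e] by simp
    qed measurable
    then show ?thesis by eventually_elim (auto simp: indicator_def split: if_splits)
  qed
  \<comment> \<open>By Lindelof's theorem countably many of these open sets cover the punctured
    space, so their null sets can be united.\<close>
  define F where "F = {S. open S \<and> (AE x in lborel. x \<in> S \<longrightarrow> D x = 0)}"
  obtain F' where F': "F' \<subseteq> F" "countable F'" "\<Union>F' = \<Union>F"
    by (rule Lindelof[of F]) (auto simp: F_def)
  have "z \<in> \<Union>F" if z: "z \<noteq> 0" for z
  proof -
    define r where "r = norm z / (4 * real CARD('n))"
    have r: "r > 0" using z by (simp add: r_def)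
    have "0 \<notin> cube z (r + r)"
    proof
      assume "0 \<in> cube z (r + r)"
      from cube_norm_le[OF this] show False using z by (simp add: r_def)
    qed
    note l = loc[OF r this]
    have "ball z r \<subseteq> cube z r" by (auto simp: dist_norm norm_minus_commute intro!: ball_subset_cube)
    then have "AE x in lborel. x \<in> ball z r \<longrightarrow> D x = 0" using l by (auto elim!: eventually_mono)
    then have "ball z r \<in> F" by (simp add: F_def)
    then show ?thesis using r by (intro UnionI[of "ball z r"]) auto
  qed
  then have cover: "\<exists>S\<in>F'. z \<in> S" if "z \<noteq> 0" for z using that F'(3) by auto
  have "AE x in lborel. \<forall>S\<in>F'. x \<in> S \<longrightarrow> D x = 0"
    using F' by (intro AE_ball_countable[THEN iffD2]) (auto simp: F_def)
  then show ?thesis using AE_lborel_singleton[of 0] by eventually_elim (use cover in blast)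
qed

text \<open>Transfers data from Lebesgue measure on the punctured space to Borel functions on the
  whole space, the setting of all preceding estimates; the origin is a null set.\<close>

lemma borel_representative:
  fixes f :: "real^'n \<Rightarrow> real"
  assumes f: "f \<in> borel_measurable (lebesgue_on (UNIV - {0}))"
  obtains f' where "f' \<in> borel_measurable borel" "AE x in lborel. f x = f' x"
    "\<And>q C. Lp_loc q (UNIV - {0}) f \<Longrightarrow> compact C \<Longrightarrow> 0 \<notin> C \<Longrightarrow> set_integrable lborel C (\<lambda>x. \<bar>f' x\<bar> powr q)"
    "\<And>\<psi>. \<psi> \<in> borel_measurable borel \<Longrightarrow> (LINT x:UNIV - {0}|lebesgue. f x * \<psi> x) = (\<integral>x. f' x * \<psi> x \<partial>lborel)"
proof -
  define f0 where "f0 x = indicator (UNIV - {0}) x * f x" for x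
  have f0: "f0 \<in> borel_measurable lebesgue"
    using f borel_measurable_restrict_space_iff[of "UNIV - {0}" lebesgue f] by (simp add: f0_def[abs_def] mult.commute)
  then obtain f' where f'[measurable]: "f' \<in> borel_measurable borel" and ae0: "AE x in lborel. f0 x = f' x"
    using completion_ex_borel_measurable_real[of f0 lborel] by auto
  have ae: "AE x in lborel. f x = f' x"
    using ae0 AE_lborel_singleton[of 0] by eventually_elim (simp add: f0_def)
  then have aeL: "AE x in lebesgue. f x = f' x" by (simp add: AE_completion_iff)
  have f'L: "f' \<in> borel_measurable lebesgue" by (rule measurable_completion) simp
  show thesis
  proof (rule that[OF f' ae])
    fix q C assume q: "Lp_loc q (UNIV - {0}) f" and C: "compact C" "(0 :: real^'n) \<notin> C"
    have [measurable]: "C \<in> sets borel" using C by (simp add: borel_compact)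
    have m: "(\<lambda>x. indicator C x *\<^sub>R \<bar>f' x\<bar> powr q) \<in> borel_measurable lborel" by simp
    have "integrable lebesgue (\<lambda>x. indicator C x *\<^sub>R \<bar>f x\<bar> powr q)"
      using q C unfolding Lp_loc_def set_integrable_def by blast
    then have "integrable lebesgue (\<lambda>x. indicator C x *\<^sub>R \<bar>f' x\<bar> powr q)"
      by (rule integrable_cong_AE_imp) (use m aeL in \<open>auto intro: measurable_completion elim: eventually_mono\<close>)
    then show "set_integrable lborel C (\<lambda>x. \<bar>f' x\<bar> powr q)"
      unfolding set_integrable_def using integrable_completion[OF m] by simp
  next
    fix \<psi> :: "real^'n \<Rightarrow> real" assume [measurable]: "\<psi> \<in> borel_measurable borel"
    have m: "(\<lambda>x. f' x * \<psi> x) \<in> borel_measurable lborel" by simp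
    have \<psi>L: "\<psi> \<in> borel_measurable lebesgue" by (rule measurable_completion) simp
    have "(LINT x:UNIV - {0}|lebesgue. f x * \<psi> x) = (\<integral>x. f0 x * \<psi> x \<partial>lebesgue)"
      unfolding set_lebesgue_integral_def f0_def by (simp add: mult_ac)
    also have "\<dots> = (\<integral>x. f' x * \<psi> x \<partial>lebesgue)"
    proof (rule integral_cong_AE)
      show "(\<lambda>x. f0 x * \<psi> x) \<in> borel_measurable lebesgue" using f0 \<psi>L by simp
      show "(\<lambda>x. f' x * \<psi> x) \<in> borel_measurable lebesgue" using f'L \<psi>L by simp
      have "AE x in lebesgue. f0 x = f' x" using ae0 by (simp add: AE_completion_iff)
      then show "AE x in lebesgue. f0 x * \<psi> x = f' x * \<psi> x" by eventually_elim simp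
    qed
    also have "\<dots> = (\<integral>x. f' x * \<psi> x \<partial>lborel)" by (rule integral_completion[OF m])
    finally show "(LINT x:UNIV - {0}|lebesgue. f x * \<psi> x) = (\<integral>x. f' x * \<psi> x \<partial>lborel)" .
  qed
qed

lemma set_integrable_of_abs:
  fixes f :: "real^'n \<Rightarrow> real"
  assumes [measurable]: "f \<in> borel_measurable borel" and C: "compact C" and f: "set_integrable lborel C (\<lambda>x. \<bar>f x\<bar> powr 1)"
  shows "set_integrable lborel C f"
proof -
  have [measurable]: "C \<in> sets borel" using C by (simp add: borel_compact)
  show ?thesis unfolding set_integrable_def
  proof (rule Bochner_Integration.integrable_bound)
    show "integrable lborel (\<lambda>x. indicator C x *\<^sub>R \<bar>f x\<bar> powr 1)" using f by (simp add: set_integrable_def)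
    show "AE x in lborel. norm (indicator C x *\<^sub>R f x) \<le> norm (indicator C x *\<^sub>R \<bar>f x\<bar> powr 1)"
      by (auto simp: indicator_def)
  qed simp
qed

text \<open>At the origin continuity comes from \<bar>u x\<bar> \<le> B |x|^\<alpha>, with B a bound
  on the unit sphere.\<close>

lemma homogeneous_continuous:
  fixes u :: "real^'n \<Rightarrow> real"
  assumes \<alpha>: "\<alpha> > 0" and hom: "\<And>t x. t > 0 \<Longrightarrow> u (t *\<^sub>R x) = t powr \<alpha> * u x"
    and cont: "continuous_on (UNIV - {0}) u"
  shows "continuous_on UNIV u"
proof -
  have u0: "u 0 = 0" by (rule homogeneous_zero[OF \<alpha> hom])
  have "bounded (u ` sphere 0 1)"
    by (intro compact_imp_bounded compact_continuous_image compact_sphere continuous_on_subset[OF cont]) auto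
  then obtain B where B: "B > 0" "\<And>x. norm x = 1 \<Longrightarrow> \<bar>u x\<bar> \<le> B" by (auto simp: bounded_pos)
  have le: "norm (u x) \<le> B * norm x powr \<alpha>" for x
  proof (cases "x = 0")
    case False
    have "x = norm x *\<^sub>R sgn x" using False by (simp add: sgn_div_norm)
    then have "u x = norm x powr \<alpha> * u (sgn x)" using hom[of "norm x" "sgn x"] False by simp
    moreover have "\<bar>u (sgn x)\<bar> \<le> B" using False by (intro B) (simp add: norm_sgn)
    ultimately show ?thesis by (simp add: abs_mult mult.commute mult_right_mono)
  qed (simp add: u0)
  have "((\<lambda>x :: real^'n. B * norm x powr \<alpha>) \<longlongrightarrow> B * 0 powr \<alpha>) (at 0)"
    using \<alpha> by (intro tendsto_intros tendsto_powr' tendsto_norm_zero) auto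
  then have lim: "((\<lambda>x :: real^'n. B * norm x powr \<alpha>) \<longlongrightarrow> 0) (at 0)" by simp
  have "(u \<longlongrightarrow> 0) (at 0)"
    by (rule Lim_null_comparison[OF always_eventually lim]) (use le in simp)
  then have "isCont u 0" by (simp add: isCont_def u0)
  moreover have "isCont u x" if "x \<noteq> 0" for x
    using cont that by (simp add: continuous_on_eq_continuous_at open_delete)
  ultimately have "isCont u x" for x by (cases "x = 0") auto
  then show ?thesis by (intro continuous_at_imp_continuous_on) blast
qed

text \<open>Two versions of each second derivative are at hand: the one from the Sobolev condition
  is p-integrable, while the entry of \<open>D2u\<close> carries the sign condition and is a priori
  only locally integrable. Uniqueness of weak derivatives identifies them almost everywhere.\<close>

lemma hessian_setup_from_weak_hessian:
  fixes u :: "real^'n \<Rightarrow> real"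
  assumes n: "CARD('n) \<ge> 2" and \<alpha>: "0 < \<alpha>" "\<alpha> < 1" and hom: "homogeneous_of_degree \<alpha> u"
    and p: "p > sobolev_threshold CARD('n)" and sob: "Sobolev_loc 2 p (UNIV - {0}) u"
    and cont: "continuous_on (UNIV - {0}) u" and hess: "has_weak_hessian (UNIV - {0}) u D2u"
    and pos: "locally_strictly_positive (UNIV - {0}) (\<lambda>x. \<sigma> * det (D2u x))"
  obtains H where "hessian_setup u H \<alpha> p \<sigma>"
proof -
  have hom': "u (t *\<^sub>R x) = t powr \<alpha> * u x" if "t > 0" for t x
    using hom that by (simp add: homogeneous_of_degree_def)
  \<comment> \<open>The indices are transposed because \<open>H i j\<close> differentiates first in
    direction i and then in direction j, while \<open>partial_derivs\<close> applies the last index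
    of its list first. The determinant does not see this.\<close>
  define Q where "Q i j g \<longleftrightarrow> g \<in> borel_measurable borel \<and> (AE x in lborel. D2u x $ j $ i = g x) \<and>
    (\<forall>C. compact C \<longrightarrow> 0 \<notin> C \<longrightarrow> set_integrable lborel C (\<lambda>x. \<bar>g x\<bar> powr p)) \<and>
    (\<forall>\<phi>. test_function_on (UNIV - {0}) \<phi> \<longrightarrow> (\<integral>x. u x * partial_derivs [j, i] \<phi> x \<partial>lborel) = (\<integral>x. g x * \<phi> x \<partial>lborel))"
    for i j :: 'n and g :: "real^'n \<Rightarrow> real"
  have ex: "\<exists>g. Q i j g" for i j
  proof -
    have h: "has_weak_deriv (UNIV - {0}) [j, i] u (\<lambda>x. D2u x $ j $ i)"
      using hess by (simp add: has_weak_hessian_def)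
    obtain g where g: "Lp_loc p (UNIV - {0}) g" "has_weak_deriv (UNIV - {0}) [j, i] u g"
      using sob[unfolded Sobolev_loc_def, rule_format, of "[j, i]"] by auto
    have gm: "g \<in> borel_measurable (lebesgue_on (UNIV - {0}))" using g(1) by (simp add: Lp_loc_def)
    have hm: "(\<lambda>x. D2u x $ j $ i) \<in> borel_measurable (lebesgue_on (UNIV - {0}))"
      using h by (simp add: has_weak_deriv_def Lp_loc_def)
    have [measurable]: "u \<in> borel_measurable borel"
      using homogeneous_continuous[OF \<alpha>(1) hom' cont] by (rule borel_measurable_continuous_onI)
    have u1: "(\<integral>x. u x * \<psi> x \<partial>lborel) = (LINT x:UNIV - {0}|lebesgue. u x * \<psi> x)"
      if [measurable]: "\<psi> \<in> borel_measurable borel" for \<psi>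
    proof -
      have "(\<integral>x. u x * \<psi> x \<partial>lborel) = (\<integral>x. indicator (UNIV - {0}) x *\<^sub>R (u x * \<psi> x) \<partial>lborel)"
      proof (rule integral_cong_AE)
        show "AE x in lborel. u x * \<psi> x = indicator (UNIV - {0}) x *\<^sub>R (u x * \<psi> x)"
          using AE_lborel_singleton[of 0] by eventually_elim simp
      qed simp_all
      also have "\<dots> = (LINT x:UNIV - {0}|lebesgue. u x * \<psi> x)"
        unfolding set_lebesgue_integral_def by (rule integral_completion[symmetric]) simp
      finally show ?thesis .
    qed
    show ?thesis
    proof (rule borel_representative[OF gm])
      fix g' :: "real^'n \<Rightarrow> real"
      assume g': "g' \<in> borel_measurable borel" "AE x in lborel. g x = g' x"
        "\<And>q C. Lp_loc q (UNIV - {0}) g \<Longrightarrow> compact C \<Longrightarrow> 0 \<notin> C \<Longrightarrow> set_integrable lborel C (\<lambda>x. \<bar>g' x\<bar> powr q)"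
        "\<And>\<psi>. \<psi> \<in> borel_measurable borel \<Longrightarrow> (LINT x:UNIV - {0}|lebesgue. g x * \<psi> x) = (\<integral>x. g' x * \<psi> x \<partial>lborel)"
      show ?thesis
      proof (rule borel_representative[OF hm])
      fix h' :: "real^'n \<Rightarrow> real"
      assume h': "h' \<in> borel_measurable borel" "AE x in lborel. D2u x $ j $ i = h' x"
        "\<And>q C. Lp_loc q (UNIV - {0}) (\<lambda>x. D2u x $ j $ i) \<Longrightarrow> compact C \<Longrightarrow> 0 \<notin> C \<Longrightarrow> set_integrable lborel C (\<lambda>x. \<bar>h' x\<bar> powr q)"
        "\<And>\<psi>. \<psi> \<in> borel_measurable borel \<Longrightarrow> (LINT x:UNIV - {0}|lebesgue. D2u x $ j $ i * \<psi> x) = (\<integral>x. h' x * \<psi> x \<partial>lborel)"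
      note [measurable] = g'(1) h'(1)
      have g1: "set_integrable lborel C g'" if C: "compact C" "0 \<notin> C" for C
        by (rule set_integrable_of_abs[OF g'(1) C(1) g'(3)[OF _ C]]) (use g(2) in \<open>simp add: has_weak_deriv_def\<close>)
      have h1: "set_integrable lborel C h'" if C: "compact C" "0 \<notin> C" for C
        by (rule set_integrable_of_abs[OF h'(1) C(1) h'(3)[OF _ C]]) (use h in \<open>simp add: has_weak_deriv_def\<close>)
      have wg: "(\<integral>x. u x * partial_derivs [j, i] \<phi> x \<partial>lborel) = (\<integral>x. g' x * \<phi> x \<partial>lborel)"
        and wh: "(\<integral>x. u x * partial_derivs [j, i] \<phi> x \<partial>lborel) = (\<integral>x. h' x * \<phi> x \<partial>lborel)"
        if t: "test_function_on (UNIV - {0}) \<phi>" for \<phi>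
      proof -
        have m: "\<phi> \<in> borel_measurable borel" "partial_derivs [j, i] \<phi> \<in> borel_measurable borel"
          using t smooth_measurable[of \<phi> "[]"] smooth_measurable[of \<phi> "[j, i]"] by (auto simp: test_function_on_def)
        show "(\<integral>x. u x * partial_derivs [j, i] \<phi> x \<partial>lborel) = (\<integral>x. g' x * \<phi> x \<partial>lborel)"
          using g(2)[unfolded has_weak_deriv_def] t u1[OF m(2)] g'(4)[OF m(1)] by (simp del: partial_derivs.simps)
        show "(\<integral>x. u x * partial_derivs [j, i] \<phi> x \<partial>lborel) = (\<integral>x. h' x * \<phi> x \<partial>lborel)"
          using h[unfolded has_weak_deriv_def] t u1[OF m(2)] h'(4)[OF m(1)] by (simp del: partial_derivs.simps)
      qed
      have "AE x in lborel. g' x - h' x = 0"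
      proof (rule weak_zero_imp_AE_zero)
        show "set_integrable lborel C (\<lambda>x. g' x - h' x)" if "compact C" "0 \<notin> C" for C
          using g1[OF that] h1[OF that] by simp
        fix \<phi> :: "real^'n \<Rightarrow> real" assume t: "test_function_on (UNIV - {0}) \<phi>"
        have c: "continuous_on UNIV \<phi>" and s: "compact (closure {x. \<phi> x \<noteq> 0})" "0 \<notin> closure {x. \<phi> x \<noteq> 0}"
          using t smooth_continuous[of \<phi> "[]"] by (auto simp: test_function_on_def)
        let ?S = "closure {x. \<phi> x \<noteq> 0}"
        have [measurable]: "\<phi> \<in> borel_measurable borel" using c by (rule borel_measurable_continuous_onI)
        have "bounded (\<phi> ` ?S)" by (intro compact_imp_bounded compact_continuous_image s continuous_on_subset[OF c]) auto
        then obtain B where B: "\<And>x. x \<in> ?S \<Longrightarrow> \<bar>\<phi> x\<bar> \<le> B" "B > 0" by (auto simp: bounded_pos)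
        have zero: "\<phi> x = 0" if "x \<notin> ?S" for x using that closure_subset[of "{x. \<phi> x \<noteq> 0}"] by blast
        have i: "integrable lborel (\<lambda>x. f x * \<phi> x)" if [measurable]: "f \<in> borel_measurable borel" and f: "set_integrable lborel ?S f" for f
        proof (rule Bochner_Integration.integrable_bound)
          show "integrable lborel (\<lambda>x. B * (indicator ?S x * f x))" using f by (simp add: set_integrable_def)
          show "AE x in lborel. norm (f x * \<phi> x) \<le> norm (B * (indicator ?S x * f x))"
          proof (rule AE_I2)
            fix x show "norm (f x * \<phi> x) \<le> norm (B * (indicator ?S x * f x))"
              using B(1)[of x] B(2) zero[of x] by (cases "x \<in> ?S") (auto simp: abs_mult mult.commute intro!: mult_right_mono)
          qed
        qed simp
        show "(\<integral>x. (g' x - h' x) * \<phi> x \<partial>lborel) = 0"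
          using i[OF g'(1) g1[OF s]] i[OF h'(1) h1[OF s]] wg[OF t] wh[OF t] by (simp add: left_diff_distrib)
      qed simp
      with h'(2) have "AE x in lborel. D2u x $ j $ i = g' x" by eventually_elim simp
      then show ?thesis using g'(1,3) g(1) wg unfolding Q_def by (intro exI[of _ g'] conjI allI impI) auto
      qed
    qed
  qed
  define H where "H i j = (SOME g. Q i j g)" for i j
  have QH: "Q i j (H i j)" for i j unfolding H_def by (rule someI_ex[OF ex])
  note Hm = QH[unfolded Q_def, THEN conjunct1]
    and Hae = QH[unfolded Q_def, THEN conjunct2, THEN conjunct1]
    and Hp = QH[unfolded Q_def, THEN conjunct2, THEN conjunct2, THEN conjunct1, rule_format]
    and weak = QH[unfolded Q_def, THEN conjunct2, THEN conjunct2, THEN conjunct2, rule_format]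
  have "AE x in lborel. \<forall>i\<in>UNIV. \<forall>j\<in>UNIV. D2u x $ j $ i = H i j x"
    by (intro AE_finite_allI Hae) auto
  then have det: "AE x in lborel. det (\<chi> i j. H i j x) = det (D2u x)"
  proof eventually_elim
    fix x assume "\<forall>i\<in>UNIV. \<forall>j\<in>UNIV. D2u x $ j $ i = H i j x"
    then have "(\<chi> i j. H i j x) = transpose (D2u x)" by (simp add: transpose_def)
    then show "det (\<chi> i j. H i j x) = det (D2u x)" by (simp add: det_transpose)
  qed
  have "hessian_setup u H \<alpha> p \<sigma>"
  proof
    show "p > 1" "p > (real CARD('n) - 1) * (real CARD('n) - 2)" using p by (auto simp: sobolev_threshold_def)
    show "continuous_on UNIV u" by (rule homogeneous_continuous[OF \<alpha>(1) hom' cont])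
    fix C :: "(real^'n) set" assume C: "compact C" "0 \<notin> C"
    then obtain c where c: "c > 0" "AE x in lebesgue. x \<in> C \<longrightarrow> c \<le> \<sigma> * det (D2u x)"
      using pos unfolding locally_strictly_positive_def by blast
    from c(2) have "AE x in lborel. x \<in> C \<longrightarrow> c \<le> \<sigma> * det (D2u x)" by (simp add: AE_completion_iff)
    with det have "AE x in lborel. x \<in> C \<longrightarrow> c \<le> \<sigma> * det (\<chi> i j. H i j x)" by eventually_elim simp
    then show "\<exists>c>0. AE x in lborel. x \<in> C \<longrightarrow> c \<le> \<sigma> * det (\<chi> i j. H i j x)" using c(1) by blast
  qed (rule n \<alpha> hom' Hm Hp weak | assumption)+
  then show thesis by (rule that)
qed

theorem theorem1p2:
  fixes u :: "real^'n \<Rightarrow> real"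
    and D2u :: "real^'n \<Rightarrow> real^'n^'n"
    and \<alpha> p :: real
  assumes "CARD('n) \<ge> 2"
    and "0 < \<alpha>" and "\<alpha> < 1"
    and "homogeneous_of_degree \<alpha> u"
    and "p > sobolev_threshold CARD('n)"
    and "Sobolev_loc 2 p (UNIV - {0}) u"
    and "continuous_on (UNIV - {0}) u"
    and "has_weak_hessian (UNIV - {0}) u D2u"
    and "locally_strictly_positive (UNIV - {0}) (\<lambda>x. det (D2u x)) \<or>
         locally_strictly_positive (UNIV - {0}) (\<lambda>x. - det (D2u x))"
  shows "(\<forall>x. u x \<ge> 0) \<or> (\<forall>x. u x \<le> 0)"
proof -
  \<comment> \<open>The two alternatives for the sign of the determinant are merged into the choices
    1 and -1 of \<sigma>.\<close>
  have "\<exists>\<sigma>. locally_strictly_positive (UNIV - {0}) (\<lambda>x. \<sigma> * det (D2u x))"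
    using assms(9)
  proof
    assume "locally_strictly_positive (UNIV - {0}) (\<lambda>x. det (D2u x))"
    then show ?thesis by (intro exI[of _ 1]) simp
  next
    assume "locally_strictly_positive (UNIV - {0}) (\<lambda>x. - det (D2u x))"
    then show ?thesis by (intro exI[of _ "-1"]) simp
  qed
  then obtain \<sigma> where "locally_strictly_positive (UNIV - {0}) (\<lambda>x. \<sigma> * det (D2u x))" ..
  from hessian_setup_from_weak_hessian[OF assms(1-8) this]
  obtain H where "hessian_setup u H \<alpha> p \<sigma>" .
  then show ?thesis by (rule hessian_setup.no_sign_change)
qed

end
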